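(* Let $A>0$, $f\in\operatorname{SLLL}_0[A]$, $g\in\operatorname{SLLL}^0[A]$, $m_0\in\mathcal{P}^p(\mathbb{R}^d)$, $y_0\in\mathbb{R}^{d'}$, and assume that $\sigma_F,\sigma_L:\mathcal{P}^p(\mathbb{R}^d)\times\mathbb{R}^{d'}\to\mathbb{R}$ are continuous. Then there exists a Stackelberg solution of the game with dynamics $f,g$ and payoffs $\sigma_F,\sigma_L$, in which the follower controls the minor agents and the leader controls the major agent; that is, there exist $\zeta^*\in\mathcal{V}$ and $\alpha^*\in\mathcal{A}[m_0]$ such that $\alpha^*\in\mathscr{O}[\zeta^*]$ and, for each $\zeta\in\mathcal{V}$, $$\Sigma_L(\alpha^*,\zeta^* )\ge\max_{\alpha\in\mathscr{O}[\zeta]}\Sigma_L(\alpha,\zeta).$$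
   Context: Fix $T>0$, $p\ge 1$, natural numbers $d,d'$, and compact metric spaces $U,V$ (control spaces of the minor agents and of the major agent). $\mathcal{P}^p(X)$ is the set of Borel probabilities on a Polish space $X$ with finite $p$-th moment, with the $p$-Wasserstein metric $W_p$. For $m\in\mathcal{P}^p(\mathbb{R}^d)$, $\varsigma_p(m)=\big(\int\|x\|^p m(dx)\big)^{1/p}$. $\Gamma=C([0,T];\mathbb{R}^d)$ with the sup norm, $e_t(x(\cdot))=x(t)$, and $h\sharp m$ is the push-forward of $m$ by $h$. For Polish spaces $X,Y$ and a Borel measure $m$ on $X$, $\Lambda(X,m,Y)$ is the set of Borel measures on $X\times Y$ with marginal $m$ on $X$. With $\lambda$ the Lebesgue measure on $[0,T]$, $\mathcal{U}=\Lambda([0,T],\lambda,U)$ and $\mathcal{V}=\Lambda([0,T],\lambda,V)$ are the sets of relaxed controls, with the topology of narrow convergence (they are compact metrizable). $\mathcal{A}[m_0]=\Lambda(\mathbb{R}^d,m_0,\mathcal{U})$. $\operatorname{SLLL}_0[A]$ is the set of continuous $f:[0,T]\times\mathbb{R}^d\times\mathcal{P}^p(\mathbb{R}^d)\times\mathbb{R}^{d'}\times U\times V\to\mathbb{R}^d$ of the form $f(t,x,m,y,u,v)=f_I(t,x,m,y,u)+f_{II}(t,x,m,y,v)$ with $f_I,f_{II}$ continuous, such that: (i) $\|f_I(t,x,m,y,u)\|+\|f_{II}(t,x,m,y,v)\|\le A(1+\|x\|+\varsigma_p(m)+\|y\|)$; (ii) for any $c$ there are constants $B_{I,c},B_{II,c}$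 such that for all $t\in[0,T]$, $x_1,x_2\in\mathbb{R}^d$, $m_1,m_2$ with $\varsigma_p(m_i)\le c$, $y_1,y_2$ with $\|y_i\|\le c$, $u\in U$, $v\in V$: $\|f_I(t,x_1,m_1,y_1,u)-f_I(t,x_2,m_2,y_2,u)\|\le B_{I,c}(\|x_1-x_2\|+W_p(m_1,m_2)+\|y_1-y_2\|)$ and $\|f_{II}(t,x_1,m_1,y_1,v)-f_{II}(t,x_2,m_2,y_2,v)\|\le B_{II,c}(\|x_1-x_2\|+W_p(m_1,m_2)+\|y_1-y_2\|)$. $\operatorname{SLLL}^0[A]$ is the set of continuous $g:[0,T]\times\mathbb{R}^{d'}\times\mathcal{P}^p(\mathbb{R}^d)\times V\to\mathbb{R}^{d'}$ such that: (i) $\|g(t,y,m,v)\|\le A(1+\|y\|+\varsigma_p(m))$; (ii) for any $c$ there is $B'_c$ such that for $t\in[0,T]$, $\|y_i\|\le c$, $\varsigma_p(m_i)\le c$ ($i=1,2$), $v\in V$: $\|g(t,y_1,m_1,v)-g(t,y_2,m_2,v)\|\le B'_c(\|y_1-y_2\|+W_p(m_1,m_2))$. Given $m(\cdot),y(\cdot)$, $x_0\in\mathbb{R}^d$, $\xi\in\mathcal{U}$, $\zeta\in\mathcal{V}$, let $\mathscr{T}_0[f,m(\cdot),y(\cdot),x_0,\xi,\zeta]\in\Gamma$ be the solution $x(\cdot)$ of $x(t)=x_0+\int_{[0,t]\times U}f_I(\tau,x(\tau),m(\tau),y(\tau),u)\,\xi(d(\tau,u))+\int_{[0,t]\times V}f_{II}(\tau,x(\tau),m(\tau),y(\tau),v)\,\zeta(d(\tau,v))$,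 and let $\mathscr{T}^0[g,m(\cdot),y_0,\zeta]$ be the solution $y(\cdot)$ of $y(t)=y_0+\int_{[0,t]\times V}g(\tau,y(\tau),m(\tau),v)\,\zeta(d(\tau,v))$. A pair $(m(\cdot),y(\cdot))$ with $m:[0,T]\to\mathcal{P}^p(\mathbb{R}^d)$, $y:[0,T]\to\mathbb{R}^{d'}$ is a motion generated by $f,g,m_0,y_0,\alpha,\zeta$ if there is $\chi\in\mathcal{P}^p(\Gamma)$ such that $y(\cdot)=\mathscr{T}^0[g,m(\cdot),y_0,\zeta]$; $m(t)=e_t\sharp\chi$ for all $t\in[0,T]$; and $\chi=\mathscr{T}_0[f,m(\cdot),y(\cdot),\cdot,\cdot,\zeta]\sharp\alpha$ (push-forward of $\alpha$ under $(x_0,\xi)\mapsto\mathscr{T}_0[f,m(\cdot),y(\cdot),x_0,\xi,\zeta]$). For such data the motion exists and is unique. Payoffs: for $\alpha\in\mathcal{A}[m_0]$, $\zeta\in\mathcal{V}$, with $(m(\cdot),y(\cdot))$ the motion generated by $f,g,m_0,y_0,\alpha,\zeta$, put $\Sigma_L(\alpha,\zeta)=\sigma_L(m(T),y(T))$ (the leader's payoff, to be maximized) and $\Sigma_F(\alpha,\zeta)=\sigma_F(m(T),y(T))$ (the follower's payoff). For $\zeta\in\mathcal{V}$, $\mathscr{O}[\zeta]=\operatorname{Argmax}\{\Sigma_F(\alpha,\zeta):\alpha\in\mathcal{A}[m_0]\}$. *)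

theory Defs
  imports "HOL-Probability.Probability"
begin

section \<open>Compact metric spaces as types\<close>

class compact_metric_space = metric_space +
  assumes compact_UNIV: "compact (UNIV :: 'a set)"

text \<open>Compact metric spaces are Polish; the instance makes the product algebra
  \<open>borel \<Otimes>\<^sub>M borel\<close> agree with the Borel algebra of the product.\<close>

lemma compact_metric_space_countable_basis:
  "\<exists>B :: 'a::compact_metric_space set set. countable B \<and> open = generate_topology B"
proof -
  have "\<exists>F :: 'a set. finite F \<and> UNIV = (\<Union>x\<in>F. ball x (1 / real (Suc n)))" for n
  proof -
    obtain F where "F \<subseteq> UNIV" "finite F" "(UNIV :: 'a set) \<subseteq> (\<Union>x\<in>F. ball x (1 / real (Suc n)))"
      by (rule compactE_image[OF compact_UNIV, of UNIV "\<lambda>x :: 'a. ball x (1 / real (Suc n))"]) auto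
    then show ?thesis by blast
  qed
  then obtain F :: "nat \<Rightarrow> 'a set" where F: "\<And>n. finite (F n)"
    and cover: "\<And>n. UNIV = (\<Union>x\<in>F n. ball x (1 / real (Suc n)))"
    by metis
  define B where "B = (\<Union>n. (\<lambda>x. ball x (1 / real (Suc n))) ` F n)"
  have "countable B"
    unfolding B_def by (rule countable_UN) (simp_all add: countable_finite F)
  moreover have "topological_basis B"
  proof (rule topological_basisI)
    show "open S" if "S \<in> B" for S
      using that by (auto simp: B_def)
    fix S :: "'a set" and x assume "open S" "x \<in> S"
    then obtain e where e: "e > 0" "ball x e \<subseteq> S"
      by (meson open_contains_ball)
    obtain n where n: "1 / real (Suc n) < e / 2"
      using e(1) nat_approx_posE[of "e / 2"] by auto
    obtain z where z: "z \<in> F n" "x \<in> ball z (1 / real (Suc n))"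
      using cover[of n] by blast
    have "ball z (1 / real (Suc n)) \<subseteq> ball x e"
    proof
      fix w assume "w \<in> ball z (1 / real (Suc n))"
      then have "dist x w < 1 / real (Suc n) + 1 / real (Suc n)"
        using z(2) dist_triangle[of x w z] by (simp add: dist_commute)
      then show "w \<in> ball x e" using n by (simp add: dist_commute)
    qed
    then show "\<exists>B'\<in>B. x \<in> B' \<and> B' \<subseteq> S"
      using z e(2) by (auto simp: B_def intro!: exI[of _ n] bexI[of _ z])
  qed
  ultimately show ?thesis
    using topological_basis_imp_subbasis by blast
qed

instance compact_metric_space \<subseteq> second_countable_topology
  by standard (rule compact_metric_space_countable_basis)

instance compact_metric_space \<subseteq> complete_space
proof
  fix X :: "nat \<Rightarrow> 'a" assume "Cauchy X"
  then show "convergent X"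
    using compact_imp_complete[OF compact_UNIV] unfolding complete_def convergent_def by blast
qed

instance compact_metric_space \<subseteq> polish_space
  by standard


section \<open>Measures with a given marginal, and the narrow topology\<close>

definition borel_of :: "'a topology \<Rightarrow> 'a measure" where
  "borel_of X = sigma (topspace X) {S. openin X S}"

lemma borel_of_euclidean: "borel_of euclidean = borel"
  by (simp add: borel_of_def borel_def)

text \<open>\<open>Lambda m N\<close> is the set of measures on the product of (the space of) \<open>m\<close> and \<open>N\<close> whose
  first marginal is \<open>m\<close>; only the measurable structure of \<open>N\<close> matters.\<close>

definition Lambda :: "'a measure \<Rightarrow> 'b measure \<Rightarrow> ('a \<times> 'b) measure set" where
  "Lambda m N = {\<pi>. sets \<pi> = sets (m \<Otimes>\<^sub>M N) \<and> distr \<pi> m fst = m}"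

text \<open>The coarsest topology on a set \<open>\<M>\<close> of (finite) Borel measures on \<open>\<Omega>\<close> for which
  integration of every bounded continuous function on \<open>\<Omega>\<close> is continuous.\<close>

definition narrow_topology :: "'a::topological_space set \<Rightarrow> 'a measure set \<Rightarrow> 'a measure topology" where
  "narrow_topology \<Omega> \<M> = topology_generated_by
     {{\<mu> \<in> \<M>. (LINT z|\<mu>. \<phi> z) \<in> G} | \<phi> G.
        continuous_on \<Omega> \<phi> \<and> bounded (\<phi> ` \<Omega>) \<and> open (G :: real set)}"

lemma topspace_narrow_topology [simp]: "topspace (narrow_topology \<Omega> \<M>) = \<M>"
proof -
  have "\<M> = {\<mu> \<in> \<M>. (LINT z|\<mu>. (\<lambda>_. 0) z) \<in> (UNIV :: real set)}" by simp
  moreover have "continuous_on \<Omega> (\<lambda>_. 0 :: real)" "bounded ((\<lambda>_. 0 :: real) ` \<Omega>)"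
    by (auto simp: image_constant_conv)
  ultimately have "\<M> \<in> {{\<mu> \<in> \<M>. (LINT z|\<mu>. \<phi> z) \<in> G} | \<phi> G.
        continuous_on \<Omega> \<phi> \<and> bounded (\<phi> ` \<Omega>) \<and> open (G :: real set)}"
    using open_UNIV by blast
  then show ?thesis
    unfolding narrow_topology_def topology_generated_by_topspace by auto
qed


section \<open>Wasserstein spaces\<close>

definition Pp :: "real \<Rightarrow> 'a metric \<Rightarrow> 'a measure set" where
  "Pp p X = {\<mu>. prob_space \<mu> \<and> sets \<mu> = sets (borel_of (mtopology_of X)) \<and>
     (\<exists>x0\<in>mspace X. (\<integral>\<^sup>+x. ennreal (mdist X x x0 powr p) \<partial>\<mu>) < \<infinity>)}"

definition couplings :: "'a measure \<Rightarrow> 'a measure \<Rightarrow> ('a \<times> 'a) measure set" where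
  "couplings \<mu> \<nu> = {\<pi>. sets \<pi> = sets (\<mu> \<Otimes>\<^sub>M \<nu>) \<and> distr \<pi> \<mu> fst = \<mu> \<and> distr \<pi> \<nu> snd = \<nu>}"

text \<open>The infimum is finite on \<open>Pp p X\<close>, which is the only place where \<open>Wp\<close> is used.\<close>

definition Wp :: "real \<Rightarrow> 'a metric \<Rightarrow> 'a measure \<Rightarrow> 'a measure \<Rightarrow> real" where
  "Wp p X \<mu> \<nu> = enn2real (INF \<pi>\<in>couplings \<mu> \<nu>.
     (\<integral>\<^sup>+z. ennreal (mdist X (fst z) (snd z) powr p) \<partial>\<pi>)) powr (1 / p)"

text \<open>The metric topology of \<open>Wp\<close>; it is written out so that it is available without first
  establishing the triangle inequality for \<open>Wp\<close>.\<close>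

definition Wp_topology :: "real \<Rightarrow> 'a metric \<Rightarrow> 'a measure topology" where
  "Wp_topology p X = topology (\<lambda>S. S \<subseteq> Pp p X \<and>
     (\<forall>\<mu>\<in>S. \<exists>r>0. {\<nu> \<in> Pp p X. Wp p X \<mu> \<nu> < r} \<subseteq> S))"

lemma openin_Wp_topology:
  "openin (Wp_topology p X) S \<longleftrightarrow>
     S \<subseteq> Pp p X \<and> (\<forall>\<mu>\<in>S. \<exists>r>0. {\<nu> \<in> Pp p X. Wp p X \<mu> \<nu> < r} \<subseteq> S)"
proof -
  let ?P = "\<lambda>S. S \<subseteq> Pp p X \<and> (\<forall>\<mu>\<in>S. \<exists>r>0. {\<nu> \<in> Pp p X. Wp p X \<mu> \<nu> < r} \<subseteq> S)"
  have "?P (S \<inter> S')" if "?P S" "?P S'" for S S'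
  proof (intro conjI ballI)
    show "S \<inter> S' \<subseteq> Pp p X" using that by blast
    fix \<mu> assume "\<mu> \<in> S \<inter> S'"
    then obtain r r' where "r > 0" "{\<nu> \<in> Pp p X. Wp p X \<mu> \<nu> < r} \<subseteq> S"
      "r' > 0" "{\<nu> \<in> Pp p X. Wp p X \<mu> \<nu> < r'} \<subseteq> S'"
      using \<open>?P S\<close> \<open>?P S'\<close> by blast
    then have "min r r' > 0" "{\<nu> \<in> Pp p X. Wp p X \<mu> \<nu> < min r r'} \<subseteq> S \<inter> S'" by auto
    then show "\<exists>r>0. {\<nu> \<in> Pp p X. Wp p X \<mu> \<nu> < r} \<subseteq> S \<inter> S'" by blast
  qed
  moreover have "?P (\<Union>\<K>)" if K: "\<forall>S\<in>\<K>. ?P S" for \<K>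
  proof (intro conjI ballI)
    show "\<Union>\<K> \<subseteq> Pp p X" using K by blast
    fix \<mu> assume "\<mu> \<in> \<Union>\<K>"
    then obtain S where "S \<in> \<K>" "\<mu> \<in> S" by blast
    moreover from this obtain r where "r > 0" "{\<nu> \<in> Pp p X. Wp p X \<mu> \<nu> < r} \<subseteq> S"
      using K by blast
    ultimately show "\<exists>r>0. {\<nu> \<in> Pp p X. Wp p X \<mu> \<nu> < r} \<subseteq> \<Union>\<K>" by blast
  qed
  ultimately have "istopology ?P"
    unfolding istopology_def by blast
  then show ?thesis
    unfolding Wp_topology_def by (simp add: topology_inverse')
qed

lemma topspace_Wp_topology [simp]: "topspace (Wp_topology p X) = Pp p X"
proof (rule antisym)
  show "topspace (Wp_topology p X) \<subseteq> Pp p X"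
    using openin_Wp_topology[of p X "topspace (Wp_topology p X)"] by simp
  have "openin (Wp_topology p X) (Pp p X)"
    unfolding openin_Wp_topology by (auto intro: exI[of _ 1])
  then show "Pp p X \<subseteq> topspace (Wp_topology p X)"
    by (rule openin_subset)
qed

definition varsigma :: "real \<Rightarrow> 'x::real_normed_vector measure \<Rightarrow> real" where
  "varsigma p m = (LINT x|m. norm x powr p) powr (1 / p)"


section \<open>Relaxed controls and strategies\<close>

definition relaxed_controls :: "real \<Rightarrow> (real \<times> 'u::compact_metric_space) measure set" where
  "relaxed_controls T = Lambda (restrict_space lborel {0..T}) borel"

definition relaxed_control_topology ::
    "real \<Rightarrow> (real \<times> 'u::compact_metric_space) measure topology" where
  "relaxed_control_topology T = narrow_topology ({0..T} \<times> UNIV) (relaxed_controls T)"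

definition minor_strategies ::
    "real \<Rightarrow> 'x measure \<Rightarrow> ('x \<times> (real \<times> 'u::compact_metric_space) measure) measure set" where
  "minor_strategies T m0 = Lambda m0 (borel_of (relaxed_control_topology T))"


section \<open>Classes of right-hand sides\<close>

text \<open>An element \<open>f = f\<^sub>I + f\<^sub>I\<^sub>I\<close> is represented by the pair of its summands, because the dynamics
  is written through them.\<close>

definition SLLL_sub0 ::
    "real \<Rightarrow> real \<Rightarrow> real \<Rightarrow>
     ((real \<Rightarrow> 'x::euclidean_space \<Rightarrow> 'x measure \<Rightarrow> 'y::euclidean_space \<Rightarrow> 'u::compact_metric_space \<Rightarrow> 'x) \<times>
      (real \<Rightarrow> 'x \<Rightarrow> 'x measure \<Rightarrow> 'y \<Rightarrow> 'v::compact_metric_space \<Rightarrow> 'x)) set" where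
  "SLLL_sub0 T p A = {(fI, fII).
     continuous_map
       (prod_topology (top_of_set {0..T}) (prod_topology euclidean
         (prod_topology (Wp_topology p euclidean_metric) (prod_topology euclidean euclidean))))
       euclidean (\<lambda>(t, x, m, y, u). fI t x m y u) \<and>
     continuous_map
       (prod_topology (top_of_set {0..T}) (prod_topology euclidean
         (prod_topology (Wp_topology p euclidean_metric) (prod_topology euclidean euclidean))))
       euclidean (\<lambda>(t, x, m, y, v). fII t x m y v) \<and>
     (\<forall>t\<in>{0..T}. \<forall>x. \<forall>m\<in>Pp p euclidean_metric. \<forall>y u v.
        norm (fI t x m y u) + norm (fII t x m y v) \<le> A * (1 + norm x + varsigma p m + norm y)) \<and>
     (\<forall>c. \<exists>BI BII. \<forall>t\<in>{0..T}. \<forall>x1 x2. \<forall>m1\<in>Pp p euclidean_metric. \<forall>m2\<in>Pp p euclidean_metric.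
        \<forall>y1 y2 u v.
        varsigma p m1 \<le> c \<and> varsigma p m2 \<le> c \<and> norm y1 \<le> c \<and> norm y2 \<le> c \<longrightarrow>
          norm (fI t x1 m1 y1 u - fI t x2 m2 y2 u)
            \<le> BI * (norm (x1 - x2) + Wp p euclidean_metric m1 m2 + norm (y1 - y2)) \<and>
          norm (fII t x1 m1 y1 v - fII t x2 m2 y2 v)
            \<le> BII * (norm (x1 - x2) + Wp p euclidean_metric m1 m2 + norm (y1 - y2)))}"

definition SLLL_sup0 ::
    "real \<Rightarrow> real \<Rightarrow> real \<Rightarrow>
     (real \<Rightarrow> 'y::euclidean_space \<Rightarrow> 'x::euclidean_space measure \<Rightarrow> 'v::compact_metric_space \<Rightarrow> 'y) set" where
  "SLLL_sup0 T p A = {g.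
     continuous_map
       (prod_topology (top_of_set {0..T}) (prod_topology euclidean
         (prod_topology (Wp_topology p euclidean_metric) euclidean)))
       euclidean (\<lambda>(t, y, m, v). g t y m v) \<and>
     (\<forall>t\<in>{0..T}. \<forall>y. \<forall>m\<in>Pp p euclidean_metric. \<forall>v.
        norm (g t y m v) \<le> A * (1 + norm y + varsigma p m)) \<and>
     (\<forall>c. \<exists>B. \<forall>t\<in>{0..T}. \<forall>y1 y2. \<forall>m1\<in>Pp p euclidean_metric. \<forall>m2\<in>Pp p euclidean_metric. \<forall>v.
        norm y1 \<le> c \<and> norm y2 \<le> c \<and> varsigma p m1 \<le> c \<and> varsigma p m2 \<le> c \<longrightarrow>
          norm (g t y1 m1 v - g t y2 m2 v)
            \<le> B * (norm (y1 - y2) + Wp p euclidean_metric m1 m2))}"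


section \<open>Dynamics\<close>

text \<open>Elements are extensional: they take the value \<open>undefined\<close> off \<open>{0..T}\<close>, so equality of paths
  is equality on \<open>{0..T}\<close>.\<close>

definition path_space :: "real \<Rightarrow> (real \<Rightarrow> 'x::euclidean_space) metric" where
  "path_space T = cfunspace (top_of_set {0..T}) euclidean_metric"

lemma mspace_path_space:
  "mspace (path_space T) = {x. x \<in> extensional {0..T} \<and> continuous_on {0..T} x}"
proof -
  have "Metric_space.mbounded (mspace euclidean_metric) (mdist euclidean_metric) (x ` {0..T})"
    if "continuous_on {0..T} x" for x :: "real \<Rightarrow> 'a"
    using compact_imp_bounded[OF compact_continuous_image[OF that compact_Icc]] by simp
  then show ?thesis
    by (auto simp: path_space_def)
qed

text \<open>The integrability clauses exclude the convention that the Bochner integral of a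
  non-integrable function is \<open>0\<close>.\<close>

definition solves_minor where
  "solves_minor T fI fII m y x0 \<xi> \<zeta> x \<longleftrightarrow>
     x \<in> mspace (path_space T) \<and>
     integrable \<xi> (\<lambda>(\<tau>, u). fI \<tau> (x \<tau>) (m \<tau>) (y \<tau>) u) \<and>
     integrable \<zeta> (\<lambda>(\<tau>, v). fII \<tau> (x \<tau>) (m \<tau>) (y \<tau>) v) \<and>
     (\<forall>t\<in>{0..T}. x t = x0
        + (LINT (\<tau>, u):{0..t} \<times> UNIV|\<xi>. fI \<tau> (x \<tau>) (m \<tau>) (y \<tau>) u)
        + (LINT (\<tau>, v):{0..t} \<times> UNIV|\<zeta>. fII \<tau> (x \<tau>) (m \<tau>) (y \<tau>) v))"

definition solves_major where
  "solves_major T g m y0 \<zeta> y \<longleftrightarrow>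
     y \<in> mspace (path_space T) \<and>
     integrable \<zeta> (\<lambda>(\<tau>, v). g \<tau> (y \<tau>) (m \<tau>) v) \<and>
     (\<forall>t\<in>{0..T}. y t = y0 + (LINT (\<tau>, v):{0..t} \<times> UNIV|\<zeta>. g \<tau> (y \<tau>) (m \<tau>) v))"

definition traj_minor where
  "traj_minor T fI fII m y x0 \<xi> \<zeta> = (THE x. solves_minor T fI fII m y x0 \<xi> \<zeta> x)"

definition traj_major where
  "traj_major T g m y0 \<zeta> = (THE y. solves_major T g m y0 \<zeta> y)"

definition is_motion ::
    "real \<Rightarrow> real \<Rightarrow>
     (real \<Rightarrow> 'x::euclidean_space \<Rightarrow> 'x measure \<Rightarrow> 'y::euclidean_space \<Rightarrow> 'u::compact_metric_space \<Rightarrow> 'x) \<Rightarrow>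
     (real \<Rightarrow> 'x \<Rightarrow> 'x measure \<Rightarrow> 'y \<Rightarrow> 'v::compact_metric_space \<Rightarrow> 'x) \<Rightarrow>
     (real \<Rightarrow> 'y \<Rightarrow> 'x measure \<Rightarrow> 'v \<Rightarrow> 'y) \<Rightarrow> 'y \<Rightarrow>
     ('x \<times> (real \<times> 'u) measure) measure \<Rightarrow> (real \<times> 'v) measure \<Rightarrow>
     (real \<Rightarrow> 'x measure) \<Rightarrow> (real \<Rightarrow> 'y) \<Rightarrow> bool" where
  "is_motion T p fI fII g y0 \<alpha> \<zeta> m y \<longleftrightarrow>
     m \<in> {0..T} \<rightarrow>\<^sub>E Pp p euclidean_metric \<and> y \<in> {0..T} \<rightarrow>\<^sub>E UNIV \<and>
     (\<exists>\<mu>\<in>Pp p (path_space T).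
        y = traj_major T g m y0 \<zeta> \<and>
        (\<forall>t\<in>{0..T}. m t = distr \<mu> borel (\<lambda>x. x t)) \<and>
        \<mu> = distr \<alpha> (borel_of (mtopology_of (path_space T)))
              (\<lambda>(x0, \<xi>). traj_minor T fI fII m y x0 \<xi> \<zeta>))"

definition payoff where
  "payoff T p fI fII g y0 \<sigma> \<alpha> \<zeta> =
     (case (THE (m, y). is_motion T p fI fII g y0 \<alpha> \<zeta> m y) of (m, y) \<Rightarrow> \<sigma> (m T, y T))"

definition best_responses where
  "best_responses T p fI fII g m0 y0 \<sigma>F \<zeta> =
     {\<alpha>. is_arg_max (\<lambda>\<alpha>. payoff T p fI fII g y0 \<sigma>F \<alpha> \<zeta>) (\<lambda>\<alpha>. \<alpha> \<in> minor_strategies T m0) \<alpha>}"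

end

(*
  The leader maximises a continuous payoff over the graph of the best response correspondence, and
  this graph is sequentially compact. The key point is the stability of the motion: convergence of
  strategies in law is realised by almost sure convergence of random initial states and controls
  (coding a control by its integrals against countably many functions reduces Skorohod's theorem to
  the real line), and then the trajectories of the agents can be compared pathwise. A Gronwall
  estimate in the norm sup_t exp(-l t) |.| with large l bounds the distance of the motions by the
  errors of the initial states and of the control integrals. The former converge in L^p, and not
  only almost surely, because all strategies have the same first marginal m_0.
*)

theory Submission
  imports Defs
begin

text \<open>\<open>payoff\<close> reads the motion through \<open>THE\<close>, so existence and
  uniqueness of motions have to be proved as well; they run on the same comparison estimates as
  stability. The right-hand sides are Lipschitz only for bounded moments and bounded y. Linear
  growth therefore first yields a number \<open>bound\<close> common to all strategies and controls,
  and one Lipschitz constant B then serves every motion. Wasserstein distances are only ever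
  estimated from above, by the L^p distance of random positions on one probability space; for this
  reason a motion is found as a fixed point for the trajectories of all agents, not for the curve of
  laws. The L^p triangle inequality is used with a factor 2; the loss is absorbed by the rate l,
  whose multiples of B (4, 16, 40) are chosen so that half of the unknown quantity is absorbed each
  time. The narrow topology is entered through an injective code with closed range in a sequence
  space. Closedness of the range is the compactness of the set of controls, and it turns Borel
  measurability into a question about sequences.\<close>

section \<open>Two iteration principles: implicit estimates and a weighted fixed point\<close>

text \<open>The map k |-> r + k / 2 halves the distance to its fixed point 2 * r, so iterating
  \<open>step\<close> forgets the initial constant \<open>K\<close>. A bound with some
  \<open>K\<close> must exist, but its size is irrelevant; this is how implicit estimates become
  explicit ones below.\<close>

lemma le_of_halving_step:
  fixes F w :: "'i \<Rightarrow> real"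
  assumes w: "\<And>i. i \<in> I \<Longrightarrow> 0 \<le> w i" and bnd: "\<And>i. i \<in> I \<Longrightarrow> F i \<le> K * w i" and r: "0 \<le> r"
    and step: "\<And>k i. 0 \<le> k \<Longrightarrow> (\<And>j. j \<in> I \<Longrightarrow> F j \<le> k * w j) \<Longrightarrow> i \<in> I \<Longrightarrow> F i \<le> (r + k / 2) * w i"
    and i: "i \<in> I"
  shows "F i \<le> 2 * r * w i"
proof -
  \<comment> \<open>\<open>max K 0\<close> because \<open>step\<close> applies to nonnegative
    constants only.\<close>
  have *: "\<forall>i\<in>I. F i \<le> (2 * r + max K 0 / 2 ^ n) * w i" for n
  proof (induction n)
    case 0
    have "K * w i \<le> (2 * r + max K 0) * w i" if "i \<in> I" for i
      by (intro mult_right_mono) (use w r that in auto)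
    then show ?case using bnd by fastforce
  next
    case (Suc n)
    have eq: "r + (2 * r + max K 0 / 2 ^ n) / 2 = 2 * r + max K 0 / 2 ^ Suc n"
      by (simp add: field_simps)
    show ?case using step[of "2 * r + max K 0 / 2 ^ n"] Suc r unfolding eq by auto
  qed
  have "(\<lambda>n. (2 * r + max K 0 / 2 ^ n) * w i) \<longlonglongrightarrow> (2 * r + 0) * w i"
    by (intro tendsto_intros LIMSEQ_divide_realpow_zero) auto
  then have "F i \<le> (2 * r + 0) * w i"
    by (rule LIMSEQ_le_const) (use * i in auto)
  then show ?thesis by simp
qed

text \<open>The invariant \<open>W\<close> plays the role of a closed subset in Banach's fixed point theorem; the
  weights \<open>w\<close> turn Volterra operators into contractions.\<close>

lemma weighted_contraction_fixpoint:
  fixes \<Phi> :: "('i \<Rightarrow> 'e::banach) \<Rightarrow> 'i \<Rightarrow> 'e" and w :: "'i \<Rightarrow> real"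
  assumes w: "\<And>i. i \<in> I \<Longrightarrow> 0 \<le> w i"
    and z0: "W z0" and inv: "\<And>z. W z \<Longrightarrow> W (\<Phi> z)"
    and start: "0 \<le> N" "\<And>i. i \<in> I \<Longrightarrow> norm (\<Phi> z0 i - z0 i) \<le> N * w i"
    and contr: "\<And>z z' k i. W z \<Longrightarrow> W z' \<Longrightarrow> 0 \<le> k \<Longrightarrow> (\<And>j. j \<in> I \<Longrightarrow> norm (z j - z' j) \<le> k * w j) \<Longrightarrow>
      i \<in> I \<Longrightarrow> norm (\<Phi> z i - \<Phi> z' i) \<le> k / 2 * w i"
    and closed: "\<And>Z z. (\<And>n::nat. W (Z n)) \<Longrightarrow>
      (\<And>n i. i \<in> I \<Longrightarrow> norm (Z n i - z i) \<le> 2 * N / 2 ^ n * w i) \<Longrightarrow> W z"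
  shows "\<exists>z. W z \<and> (\<forall>i\<in>I. \<Phi> z i = z i)"
proof -
  define Z where "Z n = (\<Phi> ^^ n) z0" for n
  have ZS: "Z (Suc n) = \<Phi> (Z n)" for n by (simp add: Z_def)
  have WZ: "W (Z n)" for n by (induction n) (auto simp: Z_def z0 inv)
  have d: "\<forall>i\<in>I. norm (Z (Suc n) i - Z n i) \<le> N / 2 ^ n * w i" for n
  proof (induction n)
    case 0 then show ?case using start by (simp add: Z_def)
  next
    case (Suc n)
    then show ?case
      using contr[OF WZ WZ, of "N / 2 ^ n" "Suc n" n] start(1) by (simp add: ZS field_simps)
  qed
  \<comment> \<open>The partial geometric sum is kept exactly: the weaker bound
    \<open>2 * N / 2 ^ n\<close> alone would not survive the induction.\<close>
  have tele: "norm (Z (n + k) i - Z n i) \<le> 2 * N / 2 ^ n * (1 - 1 / 2 ^ k) * w i" if "i \<in> I" for n k i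
  proof (induction k)
    case 0 then show ?case by simp
  next
    case (Suc k)
    have "norm (Z (n + Suc k) i - Z n i) \<le> norm (Z (Suc (n + k)) i - Z (n + k) i) + norm (Z (n + k) i - Z n i)"
      by (metis add_Suc_right norm_triangle_sub norm_diff_triangle_le order_refl)
    also have "\<dots> \<le> N / 2 ^ (n + k) * w i + 2 * N / 2 ^ n * (1 - 1 / 2 ^ k) * w i"
      using d[of "n + k"] that Suc by (intro add_mono) auto
    also have "\<dots> = 2 * N / 2 ^ n * (1 - 1 / 2 ^ Suc k) * w i"
      by (simp add: field_simps power_add)
    finally show ?case .
  qed
  have tele': "norm (Z (n + k) i - Z n i) \<le> 2 * N / 2 ^ n * w i" if "i \<in> I" for n k i
  proof -
    have "2 * N / 2 ^ n * (1 - 1 / 2 ^ k) * w i \<le> 2 * N / 2 ^ n * 1 * w i"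
      by (intro mult_right_mono mult_left_mono) (use start w that in auto)
    then show ?thesis using tele[OF that, of n k] by simp
  qed
  have "convergent (\<lambda>n. Z n i)" if i: "i \<in> I" for i
  proof (rule Cauchy_convergent, rule CauchyI)
    fix e :: real assume "e > 0"
    have "(\<lambda>n. 2 * N * w i / 2 ^ n) \<longlonglongrightarrow> 0" by (rule LIMSEQ_divide_realpow_zero) simp
    then obtain n where n: "2 * N * w i / 2 ^ n < e / 2"
      using \<open>e > 0\<close> by (metis (no_types, lifting) eventually_sequentially half_gt_zero order_refl order_tendstoD(2))
    have "norm (Z a i - Z b i) < e" if ge: "a \<ge> n" "b \<ge> n" for a b
    proof -
      obtain k l where kl: "a = n + k" "b = n + l"
        using le_Suc_ex[OF ge(1)] le_Suc_ex[OF ge(2)] by metis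
      have "norm (Z a i - Z b i) \<le> norm (Z a i - Z n i) + norm (Z b i - Z n i)"
        by (metis norm_minus_commute norm_diff_triangle_le order_refl)
      also have "\<dots> \<le> 2 * N / 2 ^ n * w i + 2 * N / 2 ^ n * w i"
        unfolding kl by (intro add_mono tele' i)
      also have "\<dots> < e" using n by simp
      finally show ?thesis .
    qed
    then show "\<exists>M. \<forall>m\<ge>M. \<forall>n\<ge>M. norm (Z m i - Z n i) < e" by blast
  qed
  \<comment> \<open>Off \<open>I\<close> the limit function is arbitrary; accordingly the fixed
    point equation is asserted on \<open>I\<close> only.\<close>
  then obtain z where z: "\<And>i. i \<in> I \<Longrightarrow> (\<lambda>n. Z n i) \<longlonglongrightarrow> z i"
    unfolding convergent_def by metis
  have zb: "norm (Z n i - z i) \<le> 2 * N / 2 ^ n * w i" if "i \<in> I" for n i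
  proof -
    have "(\<lambda>k. norm (Z (k + n) i - Z n i)) \<longlonglongrightarrow> norm (z i - Z n i)"
      by (intro tendsto_intros LIMSEQ_ignore_initial_segment z that)
    then have "norm (z i - Z n i) \<le> 2 * N / 2 ^ n * w i"
      by (rule LIMSEQ_le_const2) (use tele'[OF that, of n] in \<open>auto simp: add.commute\<close>)
    then show ?thesis by (simp add: norm_minus_commute)
  qed
  have Wz: "W z" using closed[OF WZ zb] .
  have "\<Phi> z i = z i" if i: "i \<in> I" for i
  proof -
    have b: "norm (Z (Suc n) i - \<Phi> z i) \<le> N * w i / 2 ^ n" for n
      using contr[OF WZ Wz, of "2 * N / 2 ^ n" n i] zb start(1) i by (simp add: ZS)
    have "(\<lambda>n. N * w i / 2 ^ n) \<longlonglongrightarrow> 0" by (rule LIMSEQ_divide_realpow_zero) simp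
    then have "(\<lambda>n. Z (Suc n) i - \<Phi> z i) \<longlonglongrightarrow> 0"
      by (rule Lim_null_comparison[rotated]) (use b in auto)
    then have "(\<lambda>n. Z (Suc n) i) \<longlonglongrightarrow> \<Phi> z i" by (rule LIM_zero_cancel)
    then show ?thesis by (rule LIMSEQ_unique) (rule LIMSEQ_Suc[OF z[OF i]])
  qed
  with Wz show ?thesis by blast
qed

section \<open>The L^p quasi-norm\<close>

definition Lp_fun :: "real \<Rightarrow> 'a measure \<Rightarrow> ('a \<Rightarrow> 'b::euclidean_space) \<Rightarrow> bool" where
  "Lp_fun p M h \<longleftrightarrow> h \<in> borel_measurable M \<and> integrable M (\<lambda>x. norm (h x) powr p)"

definition Lp_norm :: "real \<Rightarrow> 'a measure \<Rightarrow> ('a \<Rightarrow> 'b::euclidean_space) \<Rightarrow> real" where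
  "Lp_norm p M h = (LINT x|M. norm (h x) powr p) powr (1 / p)"

lemma Lp_fun_measurable: "Lp_fun p M h \<Longrightarrow> h \<in> borel_measurable M"
  by (simp add: Lp_fun_def)

lemma Lp_norm_nonneg: "0 \<le> Lp_norm p M h"
  by (simp add: Lp_norm_def)

lemma Lp_fun_mono:
  fixes h :: "'a \<Rightarrow> 'b::euclidean_space" and k :: "'a \<Rightarrow> 'c::euclidean_space"
  assumes p: "p \<ge> 1" and k: "Lp_fun p M k" and h: "h \<in> borel_measurable M"
    and le: "\<And>x. x \<in> space M \<Longrightarrow> norm (h x) \<le> norm (k x)"
  shows "Lp_fun p M h" "Lp_norm p M h \<le> Lp_norm p M k"
proof -
  have [measurable]: "h \<in> borel_measurable M" by fact
  have le': "norm (h x) powr p \<le> norm (k x) powr p" if "x \<in> space M" for x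
    using le[OF that] p by (intro powr_mono2) auto
  have i: "integrable M (\<lambda>x. norm (h x) powr p)"
    by (rule Bochner_Integration.integrable_bound[of M "\<lambda>x. norm (k x) powr p"])
      (use k le' in \<open>auto simp: Lp_fun_def\<close>)
  then show "Lp_fun p M h" by (simp add: Lp_fun_def h)
  have "(LINT x|M. norm (h x) powr p) \<le> (LINT x|M. norm (k x) powr p)"
    by (rule integral_mono) (use k i le' in \<open>auto simp: Lp_fun_def\<close>)
  then show "Lp_norm p M h \<le> Lp_norm p M k"
    unfolding Lp_norm_def using p by (intro powr_mono2) auto
qed

lemma powr_add_le:
  fixes a b p :: real
  assumes "p \<ge> 1" "0 \<le> a" "0 \<le> b"
  shows "(a + b) powr p \<le> 2 powr p * (a powr p + b powr p)"
proof -
  have "(a + b) powr p \<le> (2 * max a b) powr p" using assms by (intro powr_mono2) auto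
  also have "\<dots> = 2 powr p * max a b powr p" using assms by (simp add: powr_mult)
  also have "\<dots> \<le> 2 powr p * (a powr p + b powr p)" by (intro mult_left_mono) (auto simp: max_def)
  finally show ?thesis .
qed

text \<open>Write a^p = a * a^(p-1) and enlarge the second factor to (a + b)^(p-1); the two terms
  then add up to (a + b)^p.\<close>

lemma powr_add_powr_le:
  fixes a b p :: real
  assumes p: "p \<ge> 1" and a: "0 \<le> a" and b: "0 \<le> b"
  shows "a powr p + b powr p \<le> (a + b) powr p"
proof (cases "a = 0 \<or> b = 0")
  case True then show ?thesis by auto
next
  case False
  with a b have pos: "a > 0" "b > 0" by auto
  have eq: "x powr p = x * x powr (p - 1)" if "x > 0" for x :: real
    using that by (simp add: powr_mult_base)
  have "a * a powr (p - 1) + b * b powr (p - 1) \<le> a * (a + b) powr (p - 1) + b * (a + b) powr (p - 1)"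
    using pos p by (intro add_mono mult_left_mono powr_mono2) auto
  then show ?thesis using eq[of a] eq[of b] eq[of "a + b"] pos by (simp add: algebra_simps)
qed

text \<open>Integrate (a + b)^p \<le> 2^p (a^p + b^p), then apply \<open>powr_add_powr_le\<close> to
  the two norms. Compared with Minkowski's inequality a factor 2 is lost, which later constants
  absorb. Domination by a sum of norms, in place of a sum of functions, also covers differences and
  functions with values in different spaces.\<close>

lemma Lp_fun_add_le:
  fixes h :: "'a \<Rightarrow> 'b::euclidean_space" and h1 :: "'a \<Rightarrow> 'c::euclidean_space" and h2 :: "'a \<Rightarrow> 'd::euclidean_space"
  assumes p: "p \<ge> 1" and h1: "Lp_fun p M h1" and h2: "Lp_fun p M h2" and h: "h \<in> borel_measurable M"
    and le: "\<And>x. x \<in> space M \<Longrightarrow> norm (h x) \<le> norm (h1 x) + norm (h2 x)"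
  shows "Lp_fun p M h" "Lp_norm p M h \<le> 2 * (Lp_norm p M h1 + Lp_norm p M h2)"
proof -
  have [measurable]: "h \<in> borel_measurable M" by fact
  let ?k = "\<lambda>x. 2 powr p * (norm (h1 x) powr p + norm (h2 x) powr p)"
  have le': "norm (h x) powr p \<le> ?k x" if "x \<in> space M" for x
  proof -
    have "norm (h x) powr p \<le> (norm (h1 x) + norm (h2 x)) powr p"
      using le[OF that] p by (intro powr_mono2) auto
    also have "\<dots> \<le> ?k x" using p by (intro powr_add_le) auto
    finally show ?thesis .
  qed
  have ki: "integrable M ?k" using h1 h2 by (auto simp: Lp_fun_def)
  have i: "integrable M (\<lambda>x. norm (h x) powr p)"
    by (rule Bochner_Integration.integrable_bound[OF ki]) (use le' in auto)
  then show "Lp_fun p M h" by (simp add: Lp_fun_def h)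
  let ?a = "LINT x|M. norm (h1 x) powr p" and ?b = "LINT x|M. norm (h2 x) powr p"
  have nn: "?a \<ge> 0" "?b \<ge> 0" by auto
  have "(LINT x|M. norm (h x) powr p) \<le> (LINT x|M. ?k x)"
    by (rule integral_mono) (use ki i le' in auto)
  also have "\<dots> = 2 powr p * (?a + ?b)" using h1 h2 by (simp add: Lp_fun_def)
  also have "?a + ?b = (?a powr (1 / p)) powr p + (?b powr (1 / p)) powr p"
    using p nn by (simp add: powr_powr)
  also have "\<dots> \<le> (?a powr (1 / p) + ?b powr (1 / p)) powr p"
    using p by (intro powr_add_powr_le) auto
  also have "2 powr p * (?a powr (1 / p) + ?b powr (1 / p)) powr p = (2 * (?a powr (1 / p) + ?b powr (1 / p))) powr p"
    by (rule powr_mult[symmetric])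
  finally have "(LINT x|M. norm (h x) powr p) \<le> (2 * (Lp_norm p M h1 + Lp_norm p M h2)) powr p"
    unfolding Lp_norm_def by simp
  then have "Lp_norm p M h \<le> ((2 * (Lp_norm p M h1 + Lp_norm p M h2)) powr p) powr (1 / p)"
    unfolding Lp_norm_def using p by (intro powr_mono2) auto
  also have "\<dots> = 2 * (Lp_norm p M h1 + Lp_norm p M h2)"
    using p Lp_norm_nonneg[of p M h1] Lp_norm_nonneg[of p M h2] by (simp add: powr_powr)
  finally show "Lp_norm p M h \<le> 2 * (Lp_norm p M h1 + Lp_norm p M h2)" .
qed

lemma (in prob_space) Lp_const:
  assumes "p \<ge> 1"
  shows "Lp_fun p M (\<lambda>_. c :: 'b::euclidean_space)" "Lp_norm p M (\<lambda>_. c) = norm c"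
  using assms by (auto simp: Lp_fun_def Lp_norm_def prob_space powr_powr)

lemma Lp_scaleR:
  fixes h :: "'a \<Rightarrow> 'b::euclidean_space"
  assumes p: "p \<ge> 1" and h: "Lp_fun p M h"
  shows "Lp_fun p M (\<lambda>x. c *\<^sub>R h x)" "Lp_norm p M (\<lambda>x. c *\<^sub>R h x) = \<bar>c\<bar> * Lp_norm p M h"
  using assms by (auto simp: Lp_fun_def Lp_norm_def powr_mult powr_powr)

lemma Lp_norm_tendsto_0I:
  assumes p: "p \<ge> 1" and "(\<lambda>n. LINT x|M. norm (h n x) powr p) \<longlonglongrightarrow> 0"
  shows "(\<lambda>n. Lp_norm p M (h n)) \<longlonglongrightarrow> 0"
proof -
  have "(\<lambda>n. Lp_norm p M (h n)) \<longlonglongrightarrow> 0 powr (1 / p)"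
    unfolding Lp_norm_def using assms by (intro tendsto_powr2 tendsto_const) auto
  then show ?thesis by simp
qed

lemma powr_norm_tendsto_0:
  fixes f :: "nat \<Rightarrow> 'b::real_normed_vector"
  assumes "p \<ge> (1::real)" "f \<longlonglongrightarrow> 0"
  shows "(\<lambda>n. norm (f n) powr p) \<longlonglongrightarrow> 0"
proof -
  have "(\<lambda>n. norm (f n) powr p) \<longlonglongrightarrow> 0 powr p"
    using assms by (intro tendsto_powr2 tendsto_const tendsto_norm_zero) auto
  then show ?thesis using assms by simp
qed

lemma Lp_norm_dominated_tendsto_0:
  fixes h :: "nat \<Rightarrow> 'a \<Rightarrow> 'b::euclidean_space" and D :: "'a \<Rightarrow> 'c::euclidean_space"
  assumes p: "p \<ge> 1" and D: "Lp_fun p M D" and [measurable]: "\<And>n. h n \<in> borel_measurable M"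
    and le: "\<And>n x. x \<in> space M \<Longrightarrow> norm (h n x) \<le> norm (D x)"
    and lim: "AE x in M. (\<lambda>n. h n x) \<longlonglongrightarrow> 0"
  shows "(\<lambda>n. Lp_norm p M (h n)) \<longlonglongrightarrow> 0"
proof (rule Lp_norm_tendsto_0I[OF p])
  have "(\<lambda>n. LINT x|M. norm (h n x) powr p) \<longlonglongrightarrow> (LINT x|M. 0)"
  proof (rule integral_dominated_convergence)
    show "integrable M (\<lambda>x. norm (D x) powr p)" using D by (simp add: Lp_fun_def)
    show "AE x in M. (\<lambda>n. norm (h n x) powr p) \<longlonglongrightarrow> 0"
      using lim by eventually_elim (rule powr_norm_tendsto_0[OF p])
    show "AE x in M. norm (norm (h n x) powr p) \<le> norm (D x) powr p" for n
      using le p by (intro AE_I2) (auto intro!: powr_mono2)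
  qed auto
  then show "(\<lambda>n. LINT x|M. norm (h n x) powr p) \<longlonglongrightarrow> 0" by simp
qed

text \<open>By Scheffe's lemma the \<open>p\<close>-th powers of the norms converge in mean, and \<open>norm (X n x - Y x) powr p\<close>
  minus a multiple of their difference is dominated.\<close>

lemma Lp_norm_tendsto_0_of_norms:
  fixes X :: "nat \<Rightarrow> 'a \<Rightarrow> 'b::euclidean_space"
  assumes p: "p \<ge> 1" and X: "\<And>n. Lp_fun p M (X n)" and Y: "Lp_fun p M Y"
    and eq: "\<And>n. (LINT x|M. norm (X n x) powr p) = (LINT x|M. norm (Y x) powr p)"
    and lim: "AE x in M. (\<lambda>n. X n x) \<longlonglongrightarrow> Y x"
  shows "(\<lambda>n. Lp_norm p M (\<lambda>x. X n x - Y x)) \<longlonglongrightarrow> 0"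
proof (rule Lp_norm_tendsto_0I[OF p])
  have [measurable]: "\<And>n. X n \<in> borel_measurable M" "Y \<in> borel_measurable M"
    using X Y by (auto simp: Lp_fun_def)
  have int: "integrable M (\<lambda>x. norm (X n x) powr p)" "integrable M (\<lambda>x. norm (Y x) powr p)" for n
    using X Y by (auto simp: Lp_fun_def)
  define q where "q n x = \<bar>norm (X n x) powr p - norm (Y x) powr p\<bar>" for n x
  have qi: "integrable M (q n)" for n unfolding q_def using int by auto
  have plim: "AE x in M. (\<lambda>n. norm (X n x) powr p) \<longlonglongrightarrow> norm (Y x) powr p"
    using lim by eventually_elim (use p in \<open>auto intro!: tendsto_powr2 tendsto_norm\<close>)
  have "(\<lambda>n. \<integral>\<^sup>+x. norm (norm (X n x) powr p - norm (Y x) powr p) \<partial>M) \<longlonglongrightarrow> 0"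
  proof (rule Scheffe_lemma2)
    show "(\<integral>\<^sup>+ x. norm (norm (X n x) powr p) \<partial>M) \<le> (\<integral>\<^sup>+ x. norm (norm (Y x) powr p) \<partial>M)" for n
      using int eq[of n] by (simp add: nn_integral_eq_integral)
  qed (use int plim in auto)
  then have "(\<lambda>n. ennreal (LINT x|M. q n x)) \<longlonglongrightarrow> 0"
    using qi unfolding q_def by (simp add: nn_integral_eq_integral)
  moreover have "0 \<le> (LINT x|M. q n x)" for n by (simp add: q_def)
  ultimately have ql: "(\<lambda>n. LINT x|M. q n x) \<longlonglongrightarrow> 0"
    using tendsto_ennreal_iff[of "\<lambda>n. LINT x|M. q n x" sequentially 0] by simp
  let ?c = "2 powr p"
  \<comment> \<open>The truncation at 0 supplies the lower bound for dominated convergence; the p-th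
    power is still at most \<open>h n x + ?c * q n x\<close>, and both terms have vanishing
    mean.\<close>
  define h where "h n x = max 0 (norm (X n x - Y x) powr p - ?c * q n x)" for n x
  have ub: "norm (X n x - Y x) powr p \<le> ?c * (2 * norm (Y x) powr p) + ?c * q n x" for n x
  proof -
    have "norm (X n x - Y x) powr p \<le> (norm (X n x) + norm (Y x)) powr p"
      using p by (intro powr_mono2 norm_triangle_ineq4) auto
    also have "\<dots> \<le> ?c * (norm (X n x) powr p + norm (Y x) powr p)"
      using p by (intro powr_add_le) auto
    also have "\<dots> \<le> ?c * (2 * norm (Y x) powr p + q n x)"
      by (intro mult_left_mono) (auto simp: q_def)
    finally show ?thesis by (simp add: algebra_simps)
  qed
  have [measurable]: "\<And>n. h n \<in> borel_measurable M" unfolding h_def q_def by measurable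
  have "(\<lambda>n. LINT x|M. h n x) \<longlonglongrightarrow> (LINT x|M. 0)"
  proof (rule integral_dominated_convergence)
    show "integrable M (\<lambda>x. ?c * (2 * norm (Y x) powr p))" using int by auto
    show "AE x in M. norm (h n x) \<le> ?c * (2 * norm (Y x) powr p)" for n
      using ub[of n] by (intro AE_I2) (auto simp: h_def algebra_simps)
    show "AE x in M. (\<lambda>n. h n x) \<longlonglongrightarrow> 0"
      using lim plim
    proof eventually_elim
      case (elim x)
      have "(\<lambda>n. norm (X n x - Y x) powr p) \<longlonglongrightarrow> 0"
        using elim(1) by (intro powr_norm_tendsto_0 p) (simp add: LIM_zero)
      moreover have "(\<lambda>n. q n x) \<longlonglongrightarrow> 0"
        using elim(2) unfolding q_def by (intro tendsto_rabs_zero) (simp add: LIM_zero)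
      ultimately have "(\<lambda>n. h n x) \<longlonglongrightarrow> max 0 (0 - ?c * 0)"
        unfolding h_def by (intro tendsto_intros)
      then show ?case by simp
    qed
  qed auto
  then have hl: "(\<lambda>n. LINT x|M. h n x) \<longlonglongrightarrow> 0" by simp
  have hi: "integrable M (h n)" for n
  proof (rule Bochner_Integration.integrable_bound)
    show "integrable M (\<lambda>x. ?c * (2 * norm (Y x) powr p))" using int by auto
    show "AE x in M. norm (h n x) \<le> norm (?c * (2 * norm (Y x) powr p))"
      using ub[of n] by (intro AE_I2) (auto simp: h_def algebra_simps)
  qed auto
  have le: "(LINT x|M. norm (X n x - Y x) powr p) \<le> (LINT x|M. h n x) + ?c * (LINT x|M. q n x)" for n
  proof -
    have "(LINT x|M. norm (X n x - Y x) powr p) \<le> (LINT x|M. h n x + ?c * q n x)"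
    proof (rule integral_mono)
      show "integrable M (\<lambda>x. norm (X n x - Y x) powr p)"
        using Lp_fun_add_le(1)[OF p X[of n] Y, of "\<lambda>x. X n x - Y x"]
        by (auto simp: Lp_fun_def norm_triangle_ineq4)
      show "integrable M (\<lambda>x. h n x + ?c * q n x)" using hi qi by auto
      show "norm (X n x - Y x) powr p \<le> h n x + ?c * q n x" for x
        unfolding h_def by linarith
    qed
    then show ?thesis using hi qi by simp
  qed
  have "(\<lambda>n. (LINT x|M. h n x) + ?c * (LINT x|M. q n x)) \<longlonglongrightarrow> 0 + ?c * 0"
    by (intro tendsto_intros hl ql)
  then have "(\<lambda>n. (LINT x|M. h n x) + ?c * (LINT x|M. q n x)) \<longlonglongrightarrow> 0" by simp
  then show "(\<lambda>n. LINT x|M. norm (X n x - Y x) powr p) \<longlonglongrightarrow> 0"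
    by (rule Lim_null_comparison[rotated]) (use le in auto)
qed


section \<open>Convergence in law realised by almost sure convergence\<close>

text \<open>The indicator of a closed set F is the pointwise limit of the continuous functions max 0
  (1 - n * dist(x, F)), so the measures agree on closed sets, which form an intersection-stable
  generator of the Borel algebra.\<close>

lemma finite_measure_eqI_continuous:
  fixes M N :: "'a::metric_space measure"
  assumes M: "finite_measure M" "sets M = sets borel" and N: "finite_measure N" "sets N = sets borel"
    and eq: "\<And>f :: 'a \<Rightarrow> real. continuous_on UNIV f \<Longrightarrow> (\<And>x. 0 \<le> f x \<and> f x \<le> 1) \<Longrightarrow> (LINT x|M. f x) = (LINT x|N. f x)"
  shows "M = N"
proof -
  interpret M: finite_measure M by fact
  interpret N: finite_measure N by fact
  have closed_eq: "measure M F = measure N F" if F: "closed F" for F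
  \<comment> \<open>\<open>infdist\<close> to the empty set is 0 by convention, which would make
    every \<open>f n\<close> constantly 1.\<close>
  proof (cases "F = {}")
    case False
    define f where "f n x = max 0 (1 - real n * infdist x F)" for n x
    have fc: "continuous_on UNIV (f n)" for n
      unfolding f_def by (intro continuous_intros)
    have f01: "0 \<le> f n x \<and> f n x \<le> 1" for n x by (auto simp: f_def infdist_nonneg)
    have flim: "(\<lambda>n. f n x) \<longlonglongrightarrow> indicator F x" for x
    proof (cases "x \<in> F")
      case True then show ?thesis by (simp add: f_def)
    next
      case False
      then have pos: "infdist x F > 0"
        using F \<open>F \<noteq> {}\<close> by (metis in_closed_iff_infdist_zero infdist_nonneg less_eq_real_def)
      obtain n0 :: nat where n0: "1 / infdist x F < real n0" using reals_Archimedean2 by blast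
      have "f n x = 0" if "n \<ge> n0" for n
      proof -
        have "1 < real n0 * infdist x F" using n0 pos by (simp add: field_simps)
        also have "\<dots> \<le> real n * infdist x F" using that pos by (intro mult_right_mono) auto
        finally show ?thesis by (simp add: f_def)
      qed
      then have "eventually (\<lambda>n. f n x = indicator F x) sequentially"
        using False by (auto simp: eventually_sequentially)
      then show ?thesis by (rule tendsto_eventually)
    qed
    have lim: "(\<lambda>n. LINT x|K. f n x) \<longlonglongrightarrow> measure K F"
      if K: "finite_measure K" "sets K = sets borel" for K :: "'a measure"
    proof -
      interpret K: finite_measure K by fact
      have sp: "space K = UNIV" using K(2) sets_eq_imp_space_eq[of K borel] by simp
      have "(\<lambda>n. LINT x|K. f n x) \<longlonglongrightarrow> (LINT x|K. indicator F x)"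
      proof (rule integral_dominated_convergence)
        show "f n \<in> borel_measurable K" for n
          using borel_measurable_continuous_onI[OF fc[of n]] measurable_cong_sets[OF K(2) refl] by blast
        show "(indicator F :: 'a \<Rightarrow> real) \<in> borel_measurable K"
          using F K(2) by (intro borel_measurable_indicator) auto
      qed (use flim f01 in \<open>auto intro!: AE_I2\<close>)
      also have "(LINT x|K. indicator F x :: real) = measure K F"
        using sp by simp
      finally show ?thesis .
    qed
    show ?thesis
      by (rule LIMSEQ_unique[OF lim[OF M]]) (use lim[OF N] eq[OF fc f01] in simp)
  qed simp
  show ?thesis
  proof (rule measure_eqI_generator_eq[where E = "Collect closed" and \<Omega> = UNIV and A = "\<lambda>_. UNIV"])
    show "Int_stable (Collect closed :: 'a set set)" by (auto simp: Int_stable_def)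
    show "emeasure M X = emeasure N X" if "X \<in> Collect closed" for X
      using that closed_eq by (simp add: M.emeasure_eq_measure N.emeasure_eq_measure)
    show "sets M = sigma_sets UNIV (Collect closed)" "sets N = sigma_sets UNIV (Collect closed)"
      unfolding M(2) N(2) borel_eq_closed by (auto simp: sets_measure_of)
  qed (auto simp: M.emeasure_eq_measure)
qed

text \<open>In base 4 (rather than 3) a sum of binary digits determines its digits through the floor
  function, since the tail of the expansion is at most \<open>1/3\<close> of a unit in the last place.\<close>

definition base4 :: "(nat \<Rightarrow> int) \<Rightarrow> real" where
  "base4 B = (\<Sum>k. of_int (B k) / 4 ^ Suc k)"

lemma base4_summable:
  assumes "\<And>k. B k \<in> {0, 1::int}"
  shows "summable (\<lambda>k. of_int (B k) / 4 ^ Suc k :: real)"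
proof (rule summable_comparison_test')
  show "summable (\<lambda>k. (1/4) ^ Suc k :: real)"
    using summable_mult[OF summable_geometric[of "1/4 :: real"], of "1/4"] by simp
  show "norm (of_int (B n) / 4 ^ Suc n :: real) \<le> (1/4) ^ Suc n" if "n \<ge> 0" for n
    using assms[of n] by (auto simp: field_simps power_divide)
qed

lemma base4_bounds:
  assumes "\<And>k. B k \<in> {0, 1::int}"
  shows "0 \<le> base4 B" "base4 B \<le> 1 / 3"
proof -
  show "0 \<le> base4 B"
    unfolding base4_def
  proof (intro suminf_nonneg base4_summable assms)
    show "0 \<le> of_int (B n) / (4 :: real) ^ Suc n" for n using assms[of n] by auto
  qed
  have s: "(\<lambda>k. (1/4) ^ Suc k :: real) sums (1 / 3)"
    using sums_mult[OF geometric_sums[of "1/4 :: real"], of "1/4"] by simp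
  have "base4 B \<le> (\<Sum>k. (1/4) ^ Suc k)"
    unfolding base4_def
  proof (rule suminf_le)
    show "of_int (B n) / 4 ^ Suc n \<le> (1/4 :: real) ^ Suc n" for n
      using assms[of n] by (auto simp: field_simps power_divide)
  qed (use assms base4_summable s sums_summable in blast)+
  then show "base4 B \<le> 1 / 3" using sums_unique[OF s] by simp
qed

lemma base4_shift:
  assumes "\<And>k. B k \<in> {0, 1::int}"
  shows "4 * base4 B = of_int (B 0) + base4 (\<lambda>k. B (Suc k))"
proof -
  let ?f = "\<lambda>k. of_int (B k) / 4 ^ Suc k :: real"
  have "(\<Sum>k. ?f (Suc k)) = base4 B - ?f 0"
    unfolding base4_def by (rule suminf_split_head) (use assms base4_summable in blast)
  moreover have "base4 (\<lambda>k. B (Suc k)) = (\<Sum>k. 4 * ?f (Suc k))"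
    unfolding base4_def by simp
  moreover have "(\<Sum>k. 4 * ?f (Suc k)) = 4 * (\<Sum>k. ?f (Suc k))"
    by (rule suminf_mult, subst summable_Suc_iff) (use assms base4_summable in blast)
  ultimately show ?thesis by simp
qed

text \<open>Moving the point by \<open>Suc k\<close> places turns the leading digits into an
  integer, whose last base 4 digit is \<open>B k\<close>, and leaves a tail that
  \<open>base4_bounds\<close> confines to [0, 1/3].\<close>

lemma base4_scaled:
  assumes "\<And>k. B k \<in> {0, 1::int}"
  shows "\<exists>N f. 4 ^ Suc k * base4 B = of_int N + f \<and> 0 \<le> f \<and> f \<le> 1 / 3 \<and> N mod 4 = B k"
  using assms
proof (induction k arbitrary: B)
  case 0
  have "B 0 mod 4 = B 0" using 0[of 0] by auto
  then show ?case
    using base4_shift[of B] base4_bounds[of "\<lambda>k. B (Suc k)"] 0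
    by (intro exI[of _ "B 0"] exI[of _ "base4 (\<lambda>k. B (Suc k))"]) auto
next
  case (Suc k)
  obtain N f where N: "4 ^ Suc k * base4 (\<lambda>k. B (Suc k)) = of_int N + f" "0 \<le> f" "f \<le> 1 / 3" "N mod 4 = B (Suc k)"
    using Suc.IH[of "\<lambda>k. B (Suc k)"] Suc.prems by auto
  have "4 ^ Suc (Suc k) * base4 B = 4 ^ Suc k * (4 * base4 B)" by simp
  also have "\<dots> = of_int (4 ^ Suc k * B 0 + N) + f"
    using N(1) base4_shift[of B] Suc.prems by (simp add: algebra_simps)
  finally show ?case
    using N by (intro exI[of _ "4 ^ Suc k * B 0 + N"] exI[of _ f]) (auto simp: mod_simps mult.assoc)
qed

lemma base4_digit:
  assumes "\<And>k. B k \<in> {0, 1::int}"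
  shows "\<lfloor>4 ^ Suc k * base4 B\<rfloor> mod 4 = B k"
proof -
  obtain N f where "4 ^ Suc k * base4 B = of_int N + f" "0 \<le> f" "f \<le> 1 / 3" "N mod 4 = B k"
    using base4_scaled[where B = B, OF assms] by blast
  moreover from this have "\<lfloor>4 ^ Suc k * base4 B\<rfloor> = N" by (intro floor_unique) auto
  ultimately show ?thesis by simp
qed

text \<open>The tails lie in [0, 1/3], so scaled values closer than 1/2 have the same integer part.
  Hence decoding is continuous on the set of codes, which fails for ordinary binary
  expansions.\<close>

lemma base4_digit_eq:
  assumes "\<And>k. B k \<in> {0, 1::int}" "\<And>k. C k \<in> {0, 1::int}"
    and close: "\<bar>base4 B - base4 C\<bar> < 1 / (2 * 4 ^ Suc k)"
  shows "B k = C k"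
proof -
  obtain N f where N: "4 ^ Suc k * base4 B = of_int N + f" "0 \<le> f" "f \<le> 1 / 3" "N mod 4 = B k"
    using base4_scaled[where B = B, OF assms(1)] by blast
  obtain N' f' where N': "4 ^ Suc k * base4 C = of_int N' + f'" "0 \<le> f'" "f' \<le> 1 / 3" "N' mod 4 = C k"
    using base4_scaled[where B = C, OF assms(2)] by blast
  have "\<bar>4 ^ Suc k * base4 B - 4 ^ Suc k * base4 C\<bar> = 4 ^ Suc k * \<bar>base4 B - base4 C\<bar>"
    by (simp add: abs_mult flip: right_diff_distrib)
  also have "\<dots> < 1 / 2" using close by (simp add: field_simps)
  finally have "\<bar>real_of_int N - real_of_int N'\<bar> < 1" using N N' by linarith
  then have "N = N'" by linarith
  then show ?thesis using N N' by simp
qed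

section \<open>Coding a sequence of numbers in [0,1) by one real number\<close>

text \<open>Each digit is the remainder of one halving of floors, so the n-th partial sum telescopes
  to floor(2^n x) / 2^n.\<close>

lemma binary_expansion:
  fixes x :: real
  assumes "0 \<le> x" "x < 1"
  shows "(\<lambda>j. of_int (\<lfloor>2 ^ Suc j * x\<rfloor> mod 2) / 2 ^ Suc j) sums x"
proof -
  have fl: "\<lfloor>2 ^ Suc n * x\<rfloor> = 2 * \<lfloor>2 ^ n * x\<rfloor> + \<lfloor>2 ^ Suc n * x\<rfloor> mod 2" for n
  proof -
    have "\<lfloor>2 ^ Suc n * x\<rfloor> div 2 = \<lfloor>2 ^ n * x\<rfloor>"
      using floor_divide_real_eq_div[of 2 "2 ^ Suc n * x"] by simp
    then show ?thesis by presburger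
  qed
  have part: "(\<Sum>j<n. of_int (\<lfloor>2 ^ Suc j * x\<rfloor> mod 2) / 2 ^ Suc j) = (of_int \<lfloor>2 ^ n * x\<rfloor> / 2 ^ n :: real)" for n
  proof (induction n)
    case 0
    have "\<lfloor>x\<rfloor> = 0" using assms by (simp add: floor_eq_iff)
    then show ?case by simp
  next
    case (Suc n)
    have "of_int \<lfloor>2 ^ Suc n * x\<rfloor> = 2 * of_int \<lfloor>2 ^ n * x\<rfloor> + (of_int (\<lfloor>2 ^ Suc n * x\<rfloor> mod 2) :: real)"
      by (subst fl) simp
    then show ?case using Suc by (simp add: field_simps)
  qed
  have "(\<lambda>n. of_int \<lfloor>2 ^ n * x\<rfloor> / 2 ^ n) \<longlonglongrightarrow> x"
  proof (rule tendsto_sandwich)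
    show "\<forall>\<^sub>F n in sequentially. x - 1 / 2 ^ n \<le> of_int \<lfloor>2 ^ n * x\<rfloor> / 2 ^ n"
    proof (intro always_eventually allI)
      fix n
      have "2 ^ n * x - 1 \<le> of_int \<lfloor>2 ^ n * x\<rfloor>" by linarith
      then have "(2 ^ n * x - 1) / 2 ^ n \<le> of_int \<lfloor>2 ^ n * x\<rfloor> / 2 ^ n"
        by (rule divide_right_mono) simp
      then show "x - 1 / 2 ^ n \<le> of_int \<lfloor>2 ^ n * x\<rfloor> / 2 ^ n" by (simp add: diff_divide_distrib)
    qed
    show "\<forall>\<^sub>F n in sequentially. of_int \<lfloor>2 ^ n * x\<rfloor> / 2 ^ n \<le> x"
      by (intro always_eventually allI) (simp add: field_simps)
    have "(\<lambda>n. x - 1 / 2 ^ n) \<longlonglongrightarrow> x - 0"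
      by (intro tendsto_intros LIMSEQ_divide_realpow_zero) auto
    then show "(\<lambda>n. x - 1 / 2 ^ n) \<longlonglongrightarrow> x" by simp
  qed auto
  then show ?thesis unfolding sums_def part .
qed

text \<open>The binary digits of all coordinates \<open>z i\<close> are interleaved by the pairing
  function into one 0-1 sequence, which \<open>base4\<close> then reads as a point of a Cantor
  set.\<close>

definition digit :: "(nat \<Rightarrow> real) \<Rightarrow> nat \<Rightarrow> int" where
  "digit z k = (case prod_decode k of (i, j) \<Rightarrow> \<lfloor>2 ^ Suc j * z i\<rfloor> mod 2)"

text \<open>Inverse to the code on sequences in [0,1). The formula makes sense for every real
  \<open>y\<close>, which gives a Borel function without describing the range of the code.\<close>

definition undigit :: "real \<Rightarrow> nat \<Rightarrow> real" where
  "undigit y i = (\<Sum>j. of_int (\<lfloor>4 ^ Suc (prod_encode (i, j)) * y\<rfloor> mod 4) / 2 ^ Suc j)"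

lemma digit_01: "digit z k \<in> {0, 1}"
  unfolding digit_def by (auto split: prod.split)

lemma undigit_base4:
  assumes "\<And>i. 0 \<le> z i \<and> z i < 1"
  shows "undigit (base4 (digit z)) = z"
proof
  fix i
  have "undigit (base4 (digit z)) i = (\<Sum>j. of_int (digit z (prod_encode (i, j))) / 2 ^ Suc j)"
    unfolding undigit_def by (simp only: base4_digit[OF digit_01])
  also have "\<dots> = (\<Sum>j. of_int (\<lfloor>2 ^ Suc j * z i\<rfloor> mod 2) / 2 ^ Suc j)"
    by (simp add: digit_def)
  also have "\<dots> = z i" using binary_expansion[of "z i"] assms[of i] by (simp add: sums_iff)
  finally show "undigit (base4 (digit z)) i = z i" .
qed

text \<open>Convergence of the codes makes every digit eventually constant by
  \<open>base4_digit_eq\<close>, hence also the floor of 2^m * z for every m, so each coordinate is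
  Cauchy. Nothing is said about the code of the limit: a coordinate may converge to 1, which has no
  code.\<close>

lemma convergent_of_base4_convergent:
  fixes z :: "nat \<Rightarrow> nat \<Rightarrow> real"
  assumes z: "\<And>n i. 0 \<le> z n i \<and> z n i < 1" and conv: "convergent (\<lambda>n. base4 (digit (z n)))"
  shows "convergent (\<lambda>n. z n i)"
proof -
  have C: "Cauchy (\<lambda>n. base4 (digit (z n)))" using conv by (rule convergent_Cauchy)
  have dig: "\<exists>M. \<forall>a\<ge>M. \<forall>b\<ge>M. digit (z a) k = digit (z b) k" for k
  proof -
    obtain M where M: "\<And>a b. a \<ge> M \<Longrightarrow> b \<ge> M \<Longrightarrow> norm (base4 (digit (z a)) - base4 (digit (z b))) < 1 / (2 * 4 ^ Suc k)"
      using CauchyD[OF C, of "1 / (2 * 4 ^ Suc k)"] by auto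
    have "digit (z a) k = digit (z b) k" if "a \<ge> M" "b \<ge> M" for a b
      by (rule base4_digit_eq[OF digit_01 digit_01]) (use M[OF that] in simp)
    then show ?thesis by blast
  qed
  have fl: "\<exists>M. \<forall>a\<ge>M. \<forall>b\<ge>M. \<lfloor>2 ^ m * z a i\<rfloor> = \<lfloor>2 ^ m * z b i\<rfloor>" for m
  proof (induction m)
    case 0
    have "\<lfloor>z a i\<rfloor> = 0" for a using z[of a i] by linarith
    then show ?case by simp
  next
    case (Suc m)
    obtain M where M: "\<And>a b. a \<ge> M \<Longrightarrow> b \<ge> M \<Longrightarrow> \<lfloor>2 ^ m * z a i\<rfloor> = \<lfloor>2 ^ m * z b i\<rfloor>"
      using Suc by blast
    obtain K where K: "\<And>a b. a \<ge> K \<Longrightarrow> b \<ge> K \<Longrightarrow> digit (z a) (prod_encode (i, m)) = digit (z b) (prod_encode (i, m))"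
      using dig by blast
    have eq: "\<lfloor>2 ^ Suc m * z a i\<rfloor> = 2 * \<lfloor>2 ^ m * z a i\<rfloor> + digit (z a) (prod_encode (i, m))" for a
    proof -
      have "\<lfloor>2 ^ Suc m * z a i\<rfloor> div 2 = \<lfloor>2 ^ m * z a i\<rfloor>"
        using floor_divide_real_eq_div[of 2 "2 ^ Suc m * z a i"] by simp
      moreover have "digit (z a) (prod_encode (i, m)) = \<lfloor>2 ^ Suc m * z a i\<rfloor> mod 2"
        by (simp add: digit_def)
      ultimately show ?thesis by presburger
    qed
    have "\<lfloor>2 ^ Suc m * z a i\<rfloor> = \<lfloor>2 ^ Suc m * z b i\<rfloor>" if "a \<ge> max M K" "b \<ge> max M K" for a b
      unfolding eq using M[of a b] K[of a b] that by simp
    then show ?case by blast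
  qed
  show ?thesis
  proof (rule Cauchy_convergent, rule CauchyI)
    fix e :: real assume e: "e > 0"
    obtain m where m: "(1/2 :: real) ^ m < e" using real_arch_pow_inv[OF e, of "1/2"] by auto
    obtain M where M: "\<And>a b. a \<ge> M \<Longrightarrow> b \<ge> M \<Longrightarrow> \<lfloor>2 ^ m * z a i\<rfloor> = \<lfloor>2 ^ m * z b i\<rfloor>"
      using fl by blast
    have "norm (z a i - z b i) < e" if "a \<ge> M" "b \<ge> M" for a b
    proof -
      have "\<bar>2 ^ m * z a i - 2 ^ m * z b i\<bar> < 1" using M[OF that] by linarith
      then have "2 ^ m * \<bar>z a i - z b i\<bar> < 1"
        by (simp add: abs_mult flip: right_diff_distrib)
      then have "\<bar>z a i - z b i\<bar> < (1/2) ^ m" by (simp add: field_simps power_divide)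
      then show ?thesis using m by simp
    qed
    then show "\<exists>M. \<forall>m\<ge>M. \<forall>n\<ge>M. norm (z m i - z n i) < e" by blast
  qed
qed

lemma measurable_base4_digit:
  assumes [measurable]: "\<And>i. (\<lambda>x. z x i) \<in> borel_measurable M"
  shows "(\<lambda>x. base4 (digit (z x))) \<in> borel_measurable M"
proof -
  have [measurable]: "(\<lambda>x. real_of_int (digit (z x) k)) \<in> borel_measurable M" for k
    unfolding digit_def by (cases "prod_decode k") simp
  show ?thesis unfolding base4_def by measurable
qed

lemma measurable_undigit: "(\<lambda>y. undigit y i) \<in> borel_measurable borel"
  unfolding undigit_def by measurable

text \<open>Helly's selection theorem and Skorohod's representation theorem on the real line, transported
  through the code \<open>base4 \<circ> digit\<close>.\<close>

theorem Skorohod_subsequence: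
  fixes \<mu> :: "nat \<Rightarrow> 'm measure" and e :: "'m \<Rightarrow> nat \<Rightarrow> real" and \<psi> :: "(nat \<Rightarrow> real) \<Rightarrow> 'm"
  assumes prob: "\<And>n. prob_space (\<mu> n)" and sets: "\<And>n. sets (\<mu> n) = sets M"
    and e: "\<And>i. (\<lambda>x. e x i) \<in> borel_measurable M"
    and e01: "\<And>x i. x \<in> space M \<Longrightarrow> 0 \<le> e x i \<and> e x i < 1"
    and \<psi>: "\<psi> \<in> measurable borel M" and inv: "\<And>x. x \<in> space M \<Longrightarrow> \<psi> (e x) = x"
  shows "\<exists>r (\<Omega> :: real measure) X. strict_mono (r :: nat \<Rightarrow> nat) \<and> prob_space \<Omega> \<and>
    (\<forall>n. X n \<in> measurable \<Omega> M \<and> distr \<Omega> M (X n) = \<mu> (r n)) \<and>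
    (AE \<omega> in \<Omega>. \<forall>i. convergent (\<lambda>n. e (X n \<omega>) i))"
proof -
  have [measurable]: "\<And>i. (\<lambda>x. e x i) \<in> borel_measurable (\<mu> n)" "\<psi> \<in> measurable borel (\<mu> n)" for n
    using e \<psi> measurable_cong_sets[OF sets refl] measurable_cong_sets[OF refl sets] by blast+
  have sp: "space (\<mu> n) = space M" for n using sets sets_eq_imp_space_eq by blast
  define c where "c x = base4 (digit (e x))" for x
  have [measurable]: "c \<in> borel_measurable M" "c \<in> borel_measurable (\<mu> n)" for n
    unfolding c_def by (rule measurable_base4_digit; use e in simp)+
  define d where "d y = \<psi> (undigit y)" for y
  have "undigit \<in> borel_measurable borel"
    by (rule measurable_coordinatewise_then_product) (rule measurable_undigit)
  then have dm: "d \<in> measurable borel M"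
    unfolding d_def using \<psi> by (rule measurable_compose)
  have dc: "d (c x) = x" if "x \<in> space M" for x
    unfolding d_def c_def using that by (subst undigit_base4) (auto simp: e01 inv)
  define \<rho> where "\<rho> n = distr (\<mu> n) borel c" for n
  have real: "real_distribution (\<rho> n)" for n
  proof -
    interpret prob_space "\<mu> n" by (rule prob)
    show ?thesis unfolding \<rho>_def by (rule real_distribution_distr) measurable
  qed
  \<comment> \<open>All codes lie in [0, 1/3], so tightness is automatic; escape of mass has to be
    excluded where the code is undone.\<close>
  have "tight \<rho>"
    unfolding tight_def
  proof (intro conjI allI impI real)
    fix \<epsilon> :: real assume "\<epsilon> > 0"
    have "measure (\<rho> n) {-1<..1} = 1" for n
    proof -
      interpret prob_space "\<mu> n" by (rule prob)
      have "c x \<in> {-1<..1}" for x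
        using base4_bounds[of "digit (e x)"] digit_01 unfolding c_def by fastforce
      then have "c -` {-1<..1} \<inter> space (\<mu> n) = space (\<mu> n)" by auto
      then show ?thesis unfolding \<rho>_def by (simp add: measure_distr prob_space)
    qed
    then show "\<exists>a b. a < b \<and> (\<forall>n. 1 - \<epsilon> < measure (\<rho> n) {a<..b})"
      using \<open>\<epsilon> > 0\<close> by (intro exI[of _ "-1"] exI[of _ 1]) auto
  qed
  then obtain r N where r: "strict_mono (r :: nat \<Rightarrow> nat)" and N: "real_distribution N"
    and wc: "weak_conv_m (\<rho> \<circ> id \<circ> r) N"
    using tight_imp_convergent_subsubsequence[of \<rho> id] by (auto simp: strict_mono_def)
  have wc': "weak_conv_m (\<lambda>n. \<rho> (r n)) N" using wc by (simp add: comp_def)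
  obtain \<Omega> :: "real measure" and Ys Y where \<Omega>: "prob_space \<Omega>"
    and Ys: "\<And>n. Ys n \<in> borel_measurable \<Omega>" "\<And>n. distr \<Omega> borel (Ys n) = \<rho> (r n)"
    and lim: "\<And>x. x \<in> space \<Omega> \<Longrightarrow> (\<lambda>n. Ys n x) \<longlonglongrightarrow> Y x"
    using Skorohod[OF real N wc'] by blast
  define X where "X n \<omega> = d (Ys n \<omega>)" for n \<omega>
  have Xm: "X n \<in> measurable \<Omega> M" for n
    unfolding X_def using Ys(1) dm by (rule measurable_compose)
  have Xd: "distr \<Omega> M (X n) = \<mu> (r n)" for n
  proof -
    have "distr \<Omega> M (X n) = distr (distr \<Omega> borel (Ys n)) M d"
      unfolding X_def using Ys(1) dm by (subst distr_distr) (auto simp: comp_def)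
    also have "\<dots> = distr (\<mu> (r n)) M (d \<circ> c)"
      unfolding Ys(2) \<rho>_def using dm by (subst distr_distr) auto
    also have "\<dots> = distr (\<mu> (r n)) (\<mu> (r n)) (\<lambda>x. x)"
      using dc sets sp by (intro distr_cong) auto
    finally show ?thesis by simp
  qed
  \<comment> \<open>The representing variables \<open>Ys n\<close> need not be codes at every point,
    but they have the law of \<open>c\<close>, so almost surely they are. Only there does their
    convergence say something about the decoded values.\<close>
  have "AE \<omega> in \<Omega>. \<forall>n. c (d (Ys n \<omega>)) = Ys n \<omega>"
    unfolding AE_all_countable
  proof
    fix n
    have m[measurable]: "{y \<in> space borel. c (d y) = y} \<in> sets borel"
      using dm by measurable
    have "AE x in \<mu> (r n). c (d (c x)) = c x" using dc sp by (intro AE_I2) auto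
    then have "AE y in \<rho> (r n). c (d y) = y"
      unfolding \<rho>_def using m by (subst AE_distr_iff) auto
    then show "AE \<omega> in \<Omega>. c (d (Ys n \<omega>)) = Ys n \<omega>"
      unfolding Ys(2)[symmetric] using m Ys(1) by (subst (asm) AE_distr_iff) auto
  qed
  then have conv: "AE \<omega> in \<Omega>. \<forall>i. convergent (\<lambda>n. e (X n \<omega>) i)"
    using AE_space
  proof eventually_elim
    case (elim \<omega>)
    have "X n \<omega> \<in> space M" for n using measurable_space[OF Xm elim(2)] .
    moreover have "convergent (\<lambda>n. base4 (digit (e (X n \<omega>))))"
      using lim[OF elim(2)] elim(1) unfolding X_def c_def convergent_def by auto
    ultimately show ?case
      using convergent_of_base4_convergent[of "\<lambda>n. e (X n \<omega>)"] e01 by blast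
  qed
  show ?thesis
    using r \<Omega> Xm Xd conv by blast
qed


section \<open>Integration against relaxed controls\<close>

abbreviation control_domain :: "real \<Rightarrow> (real \<times> 'u::compact_metric_space) set" where
  "control_domain T \<equiv> {0..T} \<times> UNIV"

abbreviation time_measure :: "real \<Rightarrow> real measure" where
  "time_measure T \<equiv> restrict_space lborel {0..T}"

lemma compact_control_domain: "compact (control_domain T :: (real \<times> 'u::compact_metric_space) set)"
  by (intro compact_Times compact_Icc compact_UNIV)

lemma continuous_on_control_domain_bound:
  fixes h :: "real \<times> 'u::compact_metric_space \<Rightarrow> 'b::real_normed_vector"
  assumes "continuous_on (control_domain T) h"
  obtains C where "0 \<le> C" "\<And>z. z \<in> control_domain T \<Longrightarrow> norm (h z) \<le> C"
proof -
  have "bounded (h ` control_domain T)"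
    using compact_imp_bounded[OF compact_continuous_image[OF assms compact_control_domain]] .
  then obtain C where "C > 0" "\<And>z. z \<in> control_domain T \<Longrightarrow> norm (h z) \<le> C"
    unfolding bounded_pos by auto
  then show ?thesis using that[of C] by auto
qed

lemma measurable_control_domainI:
  fixes f :: "'m \<Rightarrow> real \<times> 'u::compact_metric_space"
  assumes f: "f \<in> borel_measurable M" and K: "\<And>x. x \<in> space M \<Longrightarrow> f x \<in> control_domain T"
  shows "f \<in> measurable M (time_measure T \<Otimes>\<^sub>M borel)"
proof -
  have "(\<lambda>x. fst (f x)) \<in> borel_measurable M" "(\<lambda>x. snd (f x)) \<in> borel_measurable M"
    using f by (auto simp: borel_prod[symmetric])
  moreover have "fst (f x) \<in> {0..T}" if "x \<in> space M" for x
    using K[OF that] by (auto simp: mem_Times_iff)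
  ultimately have "(\<lambda>x. (fst (f x), snd (f x))) \<in> measurable M (time_measure T \<Otimes>\<^sub>M borel)"
    by (intro measurable_Pair measurable_restrict_space2) auto
  then show ?thesis by simp
qed

lemma measurable_control_domain_id:
  "(\<lambda>z. z) \<in> borel_measurable (time_measure T \<Otimes>\<^sub>M (borel :: 'u::compact_metric_space measure))"
proof -
  have fst: "fst \<in> borel_measurable (time_measure T \<Otimes>\<^sub>M (borel :: 'u measure))"
    by (rule measurable_compose[OF measurable_fst]) (simp add: measurable_restrict_space1)
  show ?thesis using borel_measurable_Pair[OF fst measurable_snd] by simp
qed

lemma space_control_domain: "space (time_measure T \<Otimes>\<^sub>M borel) = control_domain T"
  by (simp add: space_pair_measure space_restrict_space)

lemma continuous_on_control_domain_measurable:
  assumes "continuous_on (control_domain T) h"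
  shows "h \<in> borel_measurable (time_measure T \<Otimes>\<^sub>M (borel :: 'u::compact_metric_space measure))"
proof -
  have "(\<lambda>z. z) \<in> measurable (time_measure T \<Otimes>\<^sub>M (borel :: 'u measure)) (restrict_space borel (control_domain T))"
    by (rule measurable_restrict_space2[OF _ measurable_control_domain_id]) (auto simp: space_pair_measure space_restrict_space)
  then show ?thesis
    using measurable_compose[OF _ borel_measurable_continuous_on_restrict[OF assms]] by auto
qed

lemma relaxed_controls_sets:
  "\<xi> \<in> relaxed_controls T \<Longrightarrow> sets \<xi> = sets (time_measure T \<Otimes>\<^sub>M borel)"
  by (simp add: relaxed_controls_def Lambda_def)

lemma relaxed_controls_space:
  "\<xi> \<in> relaxed_controls T \<Longrightarrow> space \<xi> = control_domain T"
  using relaxed_controls_sets[THEN sets_eq_imp_space_eq] by (simp add: space_control_domain)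

lemma relaxed_controls_distr:
  "\<xi> \<in> relaxed_controls T \<Longrightarrow> distr \<xi> (time_measure T) fst = time_measure T"
  by (simp add: relaxed_controls_def Lambda_def)

lemma relaxed_controls_measurable:
  "\<xi> \<in> relaxed_controls T \<Longrightarrow> measurable \<xi> N = measurable (time_measure T \<Otimes>\<^sub>M borel) N"
  by (rule measurable_cong_sets[OF relaxed_controls_sets refl])

lemma relaxed_controls_fst_measurable:
  assumes "\<xi> \<in> relaxed_controls T"
  shows "fst \<in> measurable \<xi> (time_measure T)"
  unfolding relaxed_controls_measurable[OF assms] by (rule measurable_fst)

lemma relaxed_controls_emeasure_space:
  assumes "\<xi> \<in> relaxed_controls T" "0 \<le> T"
  shows "emeasure \<xi> (space \<xi>) = ennreal T"
proof -
  have "emeasure \<xi> (space \<xi>) = emeasure (distr \<xi> (time_measure T) fst) (space (time_measure T))"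
    using relaxed_controls_fst_measurable[OF assms(1)] relaxed_controls_space[OF assms(1)]
    by (subst emeasure_distr) (auto simp: space_restrict_space sets_restrict_space_iff intro!: arg_cong[where f = "emeasure \<xi>"])
  also have "\<dots> = ennreal T"
    unfolding relaxed_controls_distr[OF assms(1)] using assms(2)
    by (simp add: space_restrict_space emeasure_restrict_space)
  finally show ?thesis .
qed

lemma relaxed_controls_finite:
  assumes "\<xi> \<in> relaxed_controls T" "0 \<le> T"
  shows "finite_measure \<xi>"
  by (rule finite_measureI) (simp add: relaxed_controls_emeasure_space[OF assms])

lemma relaxed_controls_integral_time:
  fixes k :: "real \<Rightarrow> real"
  assumes \<xi>: "\<xi> \<in> relaxed_controls T" and k: "k \<in> borel_measurable borel"
  shows "(LINT z|\<xi>. k (fst z)) = (LINT \<tau>|lborel. indicator {0..T} \<tau> *\<^sub>R k \<tau>)"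
proof -
  have k': "k \<in> borel_measurable (time_measure T)" using k by (simp add: measurable_restrict_space1)
  have "(LINT z|\<xi>. k (fst z)) = (LINT \<tau>|distr \<xi> (time_measure T) fst. k \<tau>)"
    using integral_distr[OF relaxed_controls_fst_measurable[OF \<xi>] k'] by simp
  then show ?thesis
    unfolding relaxed_controls_distr[OF \<xi>] by (simp add: integral_restrict_space)
qed

lemma relaxed_controls_integrable_bounded:
  fixes h :: "real \<times> 'u::compact_metric_space \<Rightarrow> 'b::{banach, second_countable_topology}"
  assumes \<xi>: "\<xi> \<in> relaxed_controls T" and T: "0 \<le> T"
    and h: "h \<in> borel_measurable (time_measure T \<Otimes>\<^sub>M borel)"
    and C: "\<And>z. z \<in> control_domain T \<Longrightarrow> norm (h z) \<le> C"
  shows "integrable \<xi> h"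
proof -
  interpret finite_measure \<xi> by (rule relaxed_controls_finite[OF \<xi> T])
  show ?thesis
    by (rule integrable_const_bound[of _ C])
      (use assms relaxed_controls_space[OF \<xi>] in \<open>auto simp: relaxed_controls_measurable[OF \<xi>] intro!: AE_I2\<close>)
qed

lemma relaxed_controls_integrable:
  fixes h :: "real \<times> 'u::compact_metric_space \<Rightarrow> 'b::{banach, second_countable_topology}"
  assumes \<xi>: "\<xi> \<in> relaxed_controls T" and T: "0 \<le> T" and h: "continuous_on (control_domain T) h"
  shows "integrable \<xi> h"
  using continuous_on_control_domain_bound[OF h]
    relaxed_controls_integrable_bounded[OF \<xi> T continuous_on_control_domain_measurable[OF h]] by metis

abbreviation control_integral ::
    "(real \<times> 'u) measure \<Rightarrow> real \<Rightarrow> (real \<times> 'u \<Rightarrow> 'b::{banach, second_countable_topology}) \<Rightarrow> 'b" where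
  "control_integral \<xi> t h \<equiv> (LINT z:{0..t} \<times> UNIV|\<xi>. h z)"

lemma time_slab_measurable:
  assumes "\<xi> \<in> relaxed_controls T" "S \<in> sets borel"
  shows "(\<lambda>z. indicator (S \<times> UNIV) z :: real) \<in> borel_measurable \<xi>"
proof -
  have "(\<lambda>z. indicator S (fst z) :: real) \<in> borel_measurable \<xi>"
    by (rule measurable_compose[OF relaxed_controls_fst_measurable[OF assms(1)]])
      (use assms(2) in \<open>simp add: measurable_restrict_space1\<close>)
  then show ?thesis by (simp add: indicator_def mem_Times_iff)
qed

lemma relaxed_controls_integrable_slab:
  fixes h :: "real \<times> 'u::compact_metric_space \<Rightarrow> 'b::{banach, second_countable_topology}"
  assumes \<xi>: "\<xi> \<in> relaxed_controls T" and T: "0 \<le> T" and h: "continuous_on (control_domain T) h"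
    and S: "S \<in> sets borel"
  shows "integrable \<xi> (\<lambda>z. indicator (S \<times> UNIV) z *\<^sub>R h z)"
proof -
  obtain C where C: "0 \<le> C" "\<And>z. z \<in> control_domain T \<Longrightarrow> norm (h z) \<le> C"
    using continuous_on_control_domain_bound[OF h] by blast
  have "(\<lambda>z. indicator (S \<times> UNIV) z *\<^sub>R h z) \<in> borel_measurable (time_measure T \<Otimes>\<^sub>M borel)"
    using time_slab_measurable[OF \<xi> S] continuous_on_control_domain_measurable[OF h]
    by (intro borel_measurable_scaleR) (simp_all add: relaxed_controls_measurable[OF \<xi>])
  then show ?thesis
    by (rule relaxed_controls_integrable_bounded[OF \<xi> T, where C = C]) (use C in \<open>auto simp: indicator_def\<close>)
qed

text \<open>The majorant depends on time only, so it is integrated against the prescribed marginal,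
  Lebesgue measure, and the control disappears from the estimate.\<close>

lemma norm_control_integral_le:
  fixes h :: "real \<times> 'u::compact_metric_space \<Rightarrow> 'b::{banach, second_countable_topology}"
  assumes \<xi>: "\<xi> \<in> relaxed_controls T" and T: "0 \<le> T" and h: "continuous_on (control_domain T) h"
    and S: "S \<in> sets borel" and k: "continuous_on UNIV k"
    and le: "\<And>z. z \<in> control_domain T \<Longrightarrow> norm (h z) \<le> k (fst z)"
  shows "norm (LINT z:S \<times> UNIV|\<xi>. h z) \<le> (LINT \<tau>|lborel. indicator {0..T} \<tau> *\<^sub>R (indicator S \<tau> *\<^sub>R k \<tau>))"
proof -
  have kc: "continuous_on (control_domain T) (\<lambda>z :: real \<times> 'u. k (fst z))"
    by (rule continuous_on_subset[OF continuous_on_compose2[OF k continuous_on_fst[OF continuous_on_id]]]) auto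
  have "norm (LINT z:S \<times> UNIV|\<xi>. h z) \<le> (LINT z|\<xi>. norm (indicator (S \<times> UNIV) z *\<^sub>R h z))"
    unfolding set_lebesgue_integral_def by (rule integral_norm_bound)
  also have "\<dots> \<le> (LINT z|\<xi>. indicator S (fst z) *\<^sub>R k (fst z))"
  proof (rule integral_mono)
    show "integrable \<xi> (\<lambda>z. norm (indicator (S \<times> UNIV) z *\<^sub>R h z))"
      by (rule integrable_norm[OF relaxed_controls_integrable_slab[OF \<xi> T h S]])
    have "integrable \<xi> (\<lambda>z. indicator (S \<times> UNIV) z *\<^sub>R k (fst z))"
      by (rule relaxed_controls_integrable_slab[OF \<xi> T kc S])
    then show "integrable \<xi> (\<lambda>z. indicator S (fst z) *\<^sub>R k (fst z))"
      by (simp add: indicator_def mem_Times_iff)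
    show "norm (indicator (S \<times> UNIV) z *\<^sub>R h z) \<le> indicator S (fst z) *\<^sub>R k (fst z)" if "z \<in> space \<xi>" for z
      using le[of z] that relaxed_controls_space[OF \<xi>] by (auto simp: indicator_def mem_Times_iff)
  qed
  also have "\<dots> = (LINT \<tau>|lborel. indicator {0..T} \<tau> *\<^sub>R (indicator S \<tau> *\<^sub>R k \<tau>))"
    by (rule relaxed_controls_integral_time[OF \<xi>])
      (intro borel_measurable_scaleR borel_measurable_indicator borel_measurable_continuous_onI S k)
  finally show ?thesis .
qed

text \<open>Integration of exp(l * \<tau>) gains the factor 1 / l. This makes integral operators
  contractions in the weight exp(l * t) for large l, however long the horizon \<open>T\<close>
  is.\<close>

lemma norm_control_integral_le_exp:
  fixes h :: "real \<times> 'u::compact_metric_space \<Rightarrow> 'b::{banach, second_countable_topology}"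
  assumes \<xi>: "\<xi> \<in> relaxed_controls T" and h: "continuous_on (control_domain T) h"
    and t: "0 \<le> t" "t \<le> T" and C: "0 \<le> C" and l: "0 < l"
    and le: "\<And>z. z \<in> control_domain T \<Longrightarrow> norm (h z) \<le> C * exp (l * fst z)"
  shows "norm (control_integral \<xi> t h) \<le> C / l * exp (l * t)"
proof -
  have T: "0 \<le> T" using t by simp
  have k: "continuous_on UNIV (\<lambda>\<tau>::real. C * exp (l * \<tau>))" by (intro continuous_intros)
  have "norm (control_integral \<xi> t h) \<le> (LINT \<tau>|lborel. indicator {0..T} \<tau> *\<^sub>R (indicator {0..t} \<tau> *\<^sub>R (C * exp (l * \<tau>))))"
    using norm_control_integral_le[OF \<xi> T h _ k le, of "{0..t}"] by simp
  also have "\<dots> = (LINT \<tau>|lborel. indicator {0..t} \<tau> *\<^sub>R (C * exp (l * \<tau>)))"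
    using t by (intro Bochner_Integration.integral_cong) (auto simp: indicator_def)
  also have "\<dots> = C / l * exp (l * t) - C / l * exp (l * 0)"
    by (rule integral_FTC_atLeastAtMost) (use t l in \<open>auto intro!: derivative_eq_intros continuous_intros
      simp: has_real_derivative_iff_has_vector_derivative[symmetric]\<close>)
  also have "\<dots> \<le> C / l * exp (l * t)" using C l by simp
  finally show ?thesis .
qed

lemma norm_control_integral_slab_le:
  fixes h :: "real \<times> 'u::compact_metric_space \<Rightarrow> 'b::{banach, second_countable_topology}"
  assumes \<xi>: "\<xi> \<in> relaxed_controls T" and h: "continuous_on (control_domain T) h"
    and st: "0 \<le> T" "s \<le> t"
    and le: "\<And>z. z \<in> control_domain T \<Longrightarrow> norm (h z) \<le> C"
  shows "norm (LINT z:{s<..t} \<times> UNIV|\<xi>. h z) \<le> C * (t - s)"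
proof -
  have C: "0 \<le> C" by (rule order_trans[OF norm_ge_zero le[of "(0, undefined)"]]) (use st in auto)
  have "norm (LINT z:{s<..t} \<times> UNIV|\<xi>. h z) \<le> (LINT \<tau>|lborel. indicator {0..T} \<tau> *\<^sub>R (indicator {s<..t} \<tau> *\<^sub>R C))"
    using norm_control_integral_le[OF \<xi> st(1) h _ _ le, of "{s<..t}"] by (simp add: continuous_on_const)
  also have "\<dots> \<le> (LINT \<tau>|lborel. indicator {s<..t} \<tau> *\<^sub>R C)"
  proof (rule integral_mono)
    show "integrable lborel (\<lambda>x. indicat_real {s<..t} x *\<^sub>R C)"
      using st by (intro integrable_scaleR_left) simp
    have "emeasure lborel ({0..T} \<inter> {s<..t}) \<le> emeasure lborel {0..T}"
      by (intro emeasure_mono) auto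
    then have "emeasure lborel ({0..T} \<inter> {s<..t}) < \<infinity>"
      using st(1) by (simp add: le_less_trans)
    then have "integrable lborel (\<lambda>x. indicat_real ({0..T} \<inter> {s<..t}) x *\<^sub>R C)"
      by (intro integrable_scaleR_left integrable_real_indicator) auto
    then show "integrable lborel (\<lambda>x. indicat_real {0..T} x *\<^sub>R indicat_real {s<..t} x *\<^sub>R C)"
      by (simp add: indicator_inter_arith mult.assoc)
  qed (use C in \<open>auto simp: indicator_def\<close>)
  also have "\<dots> = C * (t - s)" using st by simp
  finally show ?thesis .
qed

lemma control_integral_split:
  fixes h :: "real \<times> 'u::compact_metric_space \<Rightarrow> 'b::{banach, second_countable_topology}"
  assumes \<xi>: "\<xi> \<in> relaxed_controls T" and h: "continuous_on (control_domain T) h"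
    and st: "0 \<le> s" "s \<le> t" "0 \<le> T"
  shows "control_integral \<xi> t h - control_integral \<xi> s h = (LINT z:{s<..t} \<times> UNIV|\<xi>. h z)"
proof -
  note i = relaxed_controls_integrable_slab[OF \<xi> st(3) h]
  have "(LINT z:{0..t} \<times> UNIV|\<xi>. h z) = (LINT z|\<xi>. indicator ({0..s} \<times> UNIV) z *\<^sub>R h z + indicator ({s<..t} \<times> UNIV) z *\<^sub>R h z)"
    unfolding set_lebesgue_integral_def using st
    by (intro Bochner_Integration.integral_cong) (auto simp: indicator_def mem_Times_iff)
  then show ?thesis
    unfolding set_lebesgue_integral_def using i by simp
qed

lemma control_integral_lipschitz:
  fixes h :: "real \<times> 'u::compact_metric_space \<Rightarrow> 'b::{banach, second_countable_topology}"
  assumes \<xi>: "\<xi> \<in> relaxed_controls T" and h: "continuous_on (control_domain T) h"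
    and st: "0 \<le> s" "0 \<le> t" "0 \<le> T"
    and le: "\<And>z. z \<in> control_domain T \<Longrightarrow> norm (h z) \<le> C"
  shows "norm (control_integral \<xi> t h - control_integral \<xi> s h) \<le> C * \<bar>t - s\<bar>"
proof (cases "s \<le> t")
  case True
  then show ?thesis
    using control_integral_split[OF \<xi> h st(1) True st(3)] norm_control_integral_slab_le[OF \<xi> h st(3) True le] by simp
next
  case False
  then have "t \<le> s" by simp
  then show ?thesis
    using control_integral_split[OF \<xi> h st(2) \<open>t \<le> s\<close> st(3)] norm_control_integral_slab_le[OF \<xi> h st(3) \<open>t \<le> s\<close> le]
    by (simp add: norm_minus_commute)
qed

text \<open>The slab over time 0 is null for every control because its time projection is Lebesgue
  null.\<close>

lemma control_integral_0:
  fixes h :: "real \<times> 'u::compact_metric_space \<Rightarrow> 'b::{banach, second_countable_topology}"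
  assumes \<xi>: "\<xi> \<in> relaxed_controls T" and T: "0 \<le> T" and h: "continuous_on (control_domain T) h"
  shows "control_integral \<xi> 0 h = 0"
proof -
  obtain C where C: "0 \<le> C" "\<And>z. z \<in> control_domain T \<Longrightarrow> norm (h z) \<le> C"
    using continuous_on_control_domain_bound[OF h] by blast
  have "norm (control_integral \<xi> 0 h) \<le> (LINT \<tau>|lborel. indicator {0..T} \<tau> *\<^sub>R (indicator {0..0} \<tau> *\<^sub>R C))"
    using norm_control_integral_le[OF \<xi> T h _ _ C(2), of "{0..0}"] by (simp add: continuous_on_const)
  also have "(\<lambda>\<tau>. indicator {0..T} \<tau> *\<^sub>R (indicator {0..0} \<tau> *\<^sub>R C)) = (\<lambda>\<tau>. indicator {0} \<tau> *\<^sub>R C)"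
    using T by (auto simp: indicator_def fun_eq_iff)
  also have "(LINT \<tau>|lborel. indicator {0} \<tau> *\<^sub>R C) = 0" by simp
  finally show ?thesis by simp
qed

lemma norm_control_integral_le_const:
  fixes h :: "real \<times> 'u::compact_metric_space \<Rightarrow> 'b::{banach, second_countable_topology}"
  assumes \<xi>: "\<xi> \<in> relaxed_controls T" and h: "continuous_on (control_domain T) h"
    and t: "0 \<le> t" "t \<le> T" 
    and le: "\<And>z. z \<in> control_domain T \<Longrightarrow> norm (h z) \<le> C"
  shows "norm (control_integral \<xi> t h) \<le> C * t"
  using control_integral_lipschitz[OF \<xi> h order_refl t(1) _ le] control_integral_0[OF \<xi> _ h] t by simp

lemma continuous_on_control_integral:
  fixes h :: "real \<times> 'u::compact_metric_space \<Rightarrow> 'b::{banach, second_countable_topology}"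
  assumes \<xi>: "\<xi> \<in> relaxed_controls T" and h: "continuous_on (control_domain T) h"
  shows "continuous_on {0..T} (\<lambda>t. control_integral \<xi> t h)"
proof (cases "0 \<le> T")
  case True
  obtain C where C: "0 \<le> C" "\<And>z. z \<in> control_domain T \<Longrightarrow> norm (h z) \<le> C"
    using continuous_on_control_domain_bound[OF h] by blast
  have "C-lipschitz_on {0..T} (\<lambda>t. control_integral \<xi> t h)"
    using control_integral_lipschitz[OF \<xi> h _ _ True C(2)] C(1)
    by (intro lipschitz_onI) (auto simp: dist_norm)
  then show ?thesis by (rule lipschitz_on_continuous_on)
qed simp

lemma control_integral_diff:
  fixes h k :: "real \<times> 'u::compact_metric_space \<Rightarrow> 'b::{banach, second_countable_topology}"
  assumes \<xi>: "\<xi> \<in> relaxed_controls T" and T: "0 \<le> T"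
    and h: "continuous_on (control_domain T) h" and k: "continuous_on (control_domain T) k"
  shows "control_integral \<xi> t h - control_integral \<xi> t k = control_integral \<xi> t (\<lambda>z. h z - k z)"
  unfolding set_lebesgue_integral_def
  using relaxed_controls_integrable_slab[OF \<xi> T h, of "{0..t}"] relaxed_controls_integrable_slab[OF \<xi> T k, of "{0..t}"]
  by (simp add: scaleR_diff_right)

subsection \<open>Narrow convergence\<close>

text \<open>Narrow convergence of sequences; on the compact domain continuous test functions are
  bounded. The argument is sequential throughout, and the topology itself is needed only for Borel
  sets of controls.\<close>

definition control_conv ::
    "real \<Rightarrow> (nat \<Rightarrow> (real \<times> 'u::compact_metric_space) measure) \<Rightarrow> (real \<times> 'u) measure \<Rightarrow> bool" where
  "control_conv T \<xi>n \<xi> \<longleftrightarrow> (\<forall>\<phi>::real \<times> 'u \<Rightarrow> real. continuous_on (control_domain T) \<phi> \<longrightarrow>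
     (\<lambda>n. LINT z|\<xi>n n. \<phi> z) \<longlonglongrightarrow> (LINT z|\<xi>. \<phi> z))"

lemma control_conv_const: "control_conv T (\<lambda>_. \<xi>) \<xi>"
  by (simp add: control_conv_def)

lemma control_conv_vector:
  fixes h :: "real \<times> 'u::compact_metric_space \<Rightarrow> 'b::euclidean_space"
  assumes conv: "control_conv T \<xi>n \<xi>" and \<xi>n: "\<And>n. \<xi>n n \<in> relaxed_controls T" and \<xi>: "\<xi> \<in> relaxed_controls T"
    and T: "0 \<le> T" and h: "continuous_on (control_domain T) h"
  shows "(\<lambda>n. LINT z|\<xi>n n. h z) \<longlonglongrightarrow> (LINT z|\<xi>. h z)"
proof (subst tendsto_componentwise_iff, intro ballI)
  fix b :: 'b assume "b \<in> Basis"
  have "continuous_on (control_domain T) (\<lambda>z. h z \<bullet> b)" using h by (intro continuous_intros)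
  then have "(\<lambda>n. LINT z|\<xi>n n. h z \<bullet> b) \<longlonglongrightarrow> (LINT z|\<xi>. h z \<bullet> b)"
    using conv by (simp add: control_conv_def)
  then show "(\<lambda>n. (LINT z|\<xi>n n. h z) \<bullet> b) \<longlonglongrightarrow> (LINT z|\<xi>. h z) \<bullet> b"
    using relaxed_controls_integrable[OF \<xi>n T h] relaxed_controls_integrable[OF \<xi> T h]
    by (simp add: integral_inner_left)
qed

text \<open>The indicator of [0,t] is no test function. It is replaced by a cutoff that falls
  linearly to 0 on [t, t + d]; every control gives the slab over (t, t + d] mass at most d, so the
  error \<open>C * d\<close> is uniform in n.\<close>

lemma control_conv_control_integral:
  fixes h :: "real \<times> 'u::compact_metric_space \<Rightarrow> 'b::euclidean_space"
  assumes conv: "control_conv T \<xi>n \<xi>" and \<xi>n: "\<And>n. \<xi>n n \<in> relaxed_controls T" and \<xi>: "\<xi> \<in> relaxed_controls T"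
    and T: "0 \<le> T" and h: "continuous_on (control_domain T) h" and t: "0 \<le> t"
  shows "(\<lambda>n. control_integral (\<xi>n n) t h) \<longlonglongrightarrow> control_integral \<xi> t h"
proof (rule LIMSEQ_I)
  fix e :: real assume e: "e > 0"
  obtain C where C: "0 \<le> C" "\<And>z. z \<in> control_domain T \<Longrightarrow> norm (h z) \<le> C"
    using continuous_on_control_domain_bound[OF h] by blast
  define d where "d = e / (3 * (C + 1))"
  have d: "d > 0" using e C by (simp add: d_def)
  have Cd: "C * d < e / 3" using e C by (simp add: d_def field_simps)
  define k where "k z = max 0 (min 1 (1 - (fst z - t) / d)) *\<^sub>R h z" for z
  have kc: "continuous_on (control_domain T) k"
    unfolding k_def using h d by (intro continuous_intros) auto
  have kb: "norm (k z) \<le> C" if "z \<in> control_domain T" for z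
  proof -
    have "norm (k z) \<le> 1 * norm (h z)"
      unfolding k_def norm_scaleR by (intro mult_right_mono) auto
    then show ?thesis using C(2)[OF that] by simp
  qed
  have close: "norm ((LINT z|\<eta>. k z) - control_integral \<eta> t h) \<le> C * d" if \<eta>: "\<eta> \<in> relaxed_controls T" for \<eta>
  proof -
    have "(LINT z|\<eta>. k z) = (LINT z|\<eta>. indicator ({0..t} \<times> UNIV) z *\<^sub>R h z + indicator ({t<..t + d} \<times> UNIV) z *\<^sub>R k z)"
      using d t relaxed_controls_space[OF \<eta>]
      by (intro Bochner_Integration.integral_cong)
        (auto simp: indicator_def k_def max_def min_def field_simps)
    also have "\<dots> = control_integral \<eta> t h + (LINT z:{t<..t + d} \<times> UNIV|\<eta>. k z)"
      unfolding set_lebesgue_integral_def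
      using relaxed_controls_integrable_slab[OF \<eta> T h] relaxed_controls_integrable_slab[OF \<eta> T kc] by simp
    finally show ?thesis
      using norm_control_integral_slab_le[OF \<eta> kc T, of t "t + d" C] kb d by simp
  qed
  obtain N where N: "\<And>n. n \<ge> N \<Longrightarrow> norm ((LINT z|\<xi>n n. k z) - (LINT z|\<xi>. k z)) < e / 3"
    using LIMSEQ_D[OF control_conv_vector[OF conv \<xi>n \<xi> T kc], of "e / 3"] e by auto
  have "norm (control_integral (\<xi>n n) t h - control_integral \<xi> t h) < e" if "n \<ge> N" for n
  proof -
    let ?a = "control_integral (\<xi>n n) t h" and ?b = "control_integral \<xi> t h"
      and ?a' = "LINT z|\<xi>n n. k z" and ?b' = "LINT z|\<xi>. k z"
    have "norm (?a - ?b) = norm ((?a' - ?b') - (?a' - ?a) + (?b' - ?b))" by simp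
    also have "\<dots> \<le> norm (?a' - ?b') + norm (?a' - ?a) + norm (?b' - ?b)"
      by (meson norm_triangle_ineq norm_triangle_ineq4 add_right_mono order_trans)
    also have "\<dots> < e" using N[OF that] close[OF \<xi>n[of n]] close[OF \<xi>] Cd by linarith
    finally show ?thesis .
  qed
  then show "\<exists>N. \<forall>n\<ge>N. norm (control_integral (\<xi>n n) t h - control_integral \<xi> t h) < e" by blast
qed

text \<open>The primitives are equi-Lipschitz in \<open>t\<close>, so pointwise convergence is uniform.\<close>

lemma control_conv_uniform:
  fixes h :: "real \<times> 'u::compact_metric_space \<Rightarrow> 'b::euclidean_space"
  assumes conv: "control_conv T \<xi>n \<xi>" and \<xi>n: "\<And>n. \<xi>n n \<in> relaxed_controls T" and \<xi>: "\<xi> \<in> relaxed_controls T"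
    and T: "0 \<le> T" and h: "continuous_on (control_domain T) h"
    and C: "\<And>z. z \<in> control_domain T \<Longrightarrow> norm (h z) \<le> C"
  shows "\<exists>\<rho>. \<rho> \<longlonglongrightarrow> 0 \<and> (\<forall>n. 0 \<le> \<rho> n \<and> \<rho> n \<le> 2 * C * T \<and>
    (\<forall>t\<in>{0..T}. norm (control_integral (\<xi>n n) t h - control_integral \<xi> t h) \<le> \<rho> n))"
proof -
  let ?d = "\<lambda>n t. norm (control_integral (\<xi>n n) t h - control_integral \<xi> t h)"
  have C0: "0 \<le> C" by (rule order_trans[OF norm_ge_zero C[of "(0, undefined)"]]) (use T in auto)
  define \<rho> where "\<rho> n = (SUP t\<in>{0..T}. ?d n t)" for n
  have b: "?d n t \<le> 2 * C * T" if "t \<in> {0..T}" for n t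
  proof -
    have "?d n t \<le> norm (control_integral (\<xi>n n) t h) + norm (control_integral \<xi> t h)"
      by (rule norm_triangle_ineq4)
    also have "\<dots> \<le> C * t + C * t"
      using norm_control_integral_le_const[OF \<xi>n[of n] h _ _ C] norm_control_integral_le_const[OF \<xi> h _ _ C] that
      by (intro add_mono) auto
    also have "\<dots> \<le> 2 * C * T" using that C0 by (simp add: mult_left_mono)
    finally show ?thesis .
  qed
  have ne: "{0..T} \<noteq> {}" using T by simp
  have bdd: "bdd_above (?d n ` {0..T})" for n using b by (intro bdd_aboveI2[where M = "2 * C * T"])
  have up: "?d n t \<le> \<rho> n" if "t \<in> {0..T}" for n t
    unfolding \<rho>_def by (rule cSUP_upper[OF that bdd])
  have nn: "0 \<le> \<rho> n" for n by (rule order_trans[OF norm_ge_zero up[of 0 n]]) (use T in auto)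
  have le: "\<rho> n \<le> 2 * C * T" for n unfolding \<rho>_def by (rule cSUP_least[OF ne b])
  have "\<rho> \<longlonglongrightarrow> 0"
  proof (rule LIMSEQ_I)
    fix e :: real assume e: "e > 0"
    \<comment> \<open>On a finite d-net of [0,T] the error is eventually below e / 4. Moving from t
      to the net costs at most \<open>C * d\<close> for each of the two primitives, together less
      than e / 2.\<close>
    define d where "d = e / (8 * (C + 1))"
    have d: "d > 0" using e C0 by (simp add: d_def)
    have Cd: "2 * C * d < e / 2" using e C0 by (simp add: d_def field_simps add_pos_nonneg)
    obtain F where F: "F \<subseteq> {0..T}" "finite F" "{0..T} \<subseteq> (\<Union>s\<in>F. ball s d)"
      using compactE_image[OF compact_Icc[of 0 T], of "{0..T}" "\<lambda>s. ball s d"] d by (metis UN_I centre_in_ball open_ball subsetI)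
    have "\<forall>s\<in>F. eventually (\<lambda>n. ?d n s < e / 4) sequentially"
    proof
      fix s assume "s \<in> F"
      then have "(\<lambda>n. ?d n s) \<longlonglongrightarrow> 0"
        using control_conv_control_integral[OF conv \<xi>n \<xi> T h, of s] F(1)
        by (intro tendsto_norm_zero) (auto simp: LIM_zero)
      then show "eventually (\<lambda>n. ?d n s < e / 4) sequentially"
        using e by (intro order_tendstoD) auto
    qed
    then have "eventually (\<lambda>n. \<forall>s\<in>F. ?d n s < e / 4) sequentially"
      using F(2) by (simp add: eventually_ball_finite)
    then obtain N where N: "\<And>n s. n \<ge> N \<Longrightarrow> s \<in> F \<Longrightarrow> ?d n s < e / 4"
      by (auto simp: eventually_sequentially)
    have "norm (\<rho> n - 0) < e" if n: "n \<ge> N" for n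
    proof -
      have "?d n t \<le> 3 * e / 4" if t: "t \<in> {0..T}" for t
      proof -
        obtain s where s: "s \<in> F" "\<bar>t - s\<bar> < d" using F(3) t by (auto simp: dist_real_def abs_minus_commute)
        have s0: "0 \<le> s" "0 \<le> t" using s(1) F(1) t by auto
        let ?a = "\<lambda>t. control_integral (\<xi>n n) t h" and ?b = "\<lambda>t. control_integral \<xi> t h"
        have "?d n t = norm ((?a s - ?b s) + (?a t - ?a s) - (?b t - ?b s))" by simp
        also have "\<dots> \<le> ?d n s + norm (?a t - ?a s) + norm (?b t - ?b s)"
          by (meson norm_triangle_ineq norm_triangle_ineq4 add_right_mono order_trans)
        also have "\<dots> \<le> e / 4 + C * \<bar>t - s\<bar> + C * \<bar>t - s\<bar>"
          using N[OF n s(1)] control_integral_lipschitz[OF \<xi>n[of n] h s0 T C] control_integral_lipschitz[OF \<xi> h s0 T C]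
          by (intro add_mono) auto
        also have "\<dots> \<le> e / 4 + C * d + C * d"
          using s(2) C0 by (intro add_mono mult_left_mono) auto
        finally show ?thesis using Cd by linarith
      qed
      then have "\<rho> n \<le> 3 * e / 4" unfolding \<rho>_def by (rule cSUP_least[OF ne])
      then show ?thesis using nn[of n] e by simp
    qed
    then show "\<exists>N. \<forall>n\<ge>N. norm (\<rho> n - 0) < e" by blast
  qed
  then show ?thesis using up nn le by blast
qed


section \<open>Sequential compactness of the relaxed controls\<close>

lemma tendsto_coordinatewise:
  fixes f :: "'b \<Rightarrow> 'i \<Rightarrow> 'c::topological_space"
  assumes "\<And>i. ((\<lambda>n. f n i) \<longlongrightarrow> l i) F"
  shows "(f \<longlongrightarrow> l) F"
proof -
  have "limitin (product_topology (\<lambda>_. euclidean) UNIV) f l F"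
    using assms by (simp add: limitin_componentwise)
  then show ?thesis by (simp add: euclidean_product_topology)
qed

lemma LIMSEQ_eq_const:
  fixes f :: "nat \<Rightarrow> 'a::t2_space"
  assumes "f \<longlonglongrightarrow> l" "\<And>n. f n = c"
  shows "l = c"
proof -
  have "f = (\<lambda>_. c)" using assms(2) by blast
  then show ?thesis using assms(1) by (simp add: LIMSEQ_const_iff)
qed

section \<open>A countable family of test functions on the control domain\<close>

definition dense_seq :: "nat \<Rightarrow> 'a::second_countable_topology" where
  "dense_seq = (SOME q. \<forall>X. open X \<longrightarrow> X \<noteq> {} \<longrightarrow> (\<exists>n. q n \<in> X))"

lemma dense_seq:
  fixes X :: "'a::second_countable_topology set"
  assumes "open X" "X \<noteq> {}"
  shows "\<exists>n. dense_seq n \<in> X"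
proof -
  obtain D :: "'a set" where D: "countable D" "\<And>X. open X \<Longrightarrow> X \<noteq> {} \<Longrightarrow> \<exists>d\<in>D. d \<in> X"
    using countable_dense_setE by blast
  then have "D \<noteq> {}" using D(2)[of UNIV] by auto
  then have "\<forall>X. open X \<longrightarrow> X \<noteq> {} \<longrightarrow> (\<exists>n. from_nat_into D n \<in> X)"
    using D by (metis from_nat_into_surj)
  then show ?thesis unfolding dense_seq_def using someI_ex[of "\<lambda>q. \<forall>X. open X \<longrightarrow> X \<noteq> {} \<longrightarrow> (\<exists>n. q n \<in> X)"] assms by blast
qed

text \<open>Time and the distances to a dense sequence separate points, so together they embed the
  compact control domain into a sequence space. The normalisations t / (2T) and d / (1 + d) keep the
  values strictly below 1, as the digit code requires.\<close>

definition coord :: "real \<Rightarrow> nat \<Rightarrow> real \<times> 'u::compact_metric_space \<Rightarrow> real" where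
  "coord T i z = (case i of 0 \<Rightarrow> fst z / (2 * T)
     | Suc j \<Rightarrow> dist (snd z) (dense_seq j) / (1 + dist (snd z) (dense_seq j)))"

lemma continuous_on_coord:
  "T > 0 \<Longrightarrow> continuous_on UNIV (coord T i :: real \<times> 'u::compact_metric_space \<Rightarrow> real)"
proof (cases i)
  case (Suc j)
  have "1 + dist u v \<noteq> 0" for u v :: 'u using zero_le_dist[of u v] by linarith
  then show ?thesis unfolding coord_def Suc by (auto intro!: continuous_intros)
qed (auto simp: coord_def intro!: continuous_intros)

lemma coord_01:
  assumes "T > 0" "z \<in> control_domain T"
  shows "0 \<le> coord T i z \<and> coord T i z < 1"
proof (cases i)
  case 0 then show ?thesis using assms by (auto simp: coord_def field_simps)
next
  case (Suc j)
  have "0 < 1 + dist (snd z) (dense_seq j)" using zero_le_dist[of "snd z" "dense_seq j"] by linarith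
  then show ?thesis by (simp add: coord_def Suc divide_simps)
qed

text \<open>A point of the dense sequence within half the distance of the two control values from
  the first would, by equality of distances, be equally close to the second, against the triangle
  inequality.\<close>

lemma coord_inj:
  fixes z z' :: "real \<times> 'u::compact_metric_space"
  assumes T: "T > 0" and eq: "\<And>i. coord T i z = coord T i z'"
  shows "z = z'"
proof -
  have 1: "fst z = fst z'" using eq[of 0] T by (simp add: coord_def)
  have d: "dist (snd z) (dense_seq j) = dist (snd z') (dense_seq j)" for j
  proof -
    have "0 < 1 + dist u (dense_seq j)" for u :: 'u using zero_le_dist[of u "dense_seq j"] by linarith
    then have p: "1 + dist u (dense_seq j) \<noteq> 0" for u :: 'u by (metis less_irrefl)
    show ?thesis using eq[of "Suc j"] p[of "snd z"] p[of "snd z'"] by (simp add: coord_def frac_eq_eq algebra_simps)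
  qed
  have "snd z = snd z'"
  proof (rule ccontr)
    assume "snd z \<noteq> snd z'"
    then have pos: "dist (snd z) (snd z') / 2 > 0" by simp
    obtain j where "dense_seq j \<in> ball (snd z) (dist (snd z) (snd z') / 2)"
      using dense_seq[of "ball (snd z) (dist (snd z) (snd z') / 2)"] pos by (metis centre_in_ball empty_iff open_ball)
    then show False using d[of j] dist_triangle2[of "snd z" "snd z'" "dense_seq j"] by simp
  qed
  with 1 show ?thesis by (rule prod_eqI)
qed

text \<open>Indexed by finite lists, hence countably many; their integrals will serve as coordinates
  of a control.\<close>

definition monomial :: "real \<Rightarrow> nat list \<Rightarrow> real \<times> 'u::compact_metric_space \<Rightarrow> real" where
  "monomial T l z = (\<Prod>i\<leftarrow>l. coord T i z)"

lemma continuous_on_monomial: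
  "T > 0 \<Longrightarrow> continuous_on S (monomial T l)"
proof (induction l)
  case (Cons i l)
  then show ?case
    using continuous_on_subset[OF continuous_on_coord[of T i], of S] unfolding monomial_def
    by (auto intro!: continuous_intros)
qed (simp add: monomial_def continuous_on_const)

lemma monomial_01:
  assumes "T > 0" "z \<in> control_domain T"
  shows "0 \<le> monomial T l z \<and> monomial T l z \<le> 1"
proof (induction l)
  case (Cons i l)
  then show ?case using coord_01[OF assms, of i] unfolding monomial_def
    by (auto intro!: mult_le_one)
qed (simp add: monomial_def)

text \<open>The algebra generated by the coordinates: concatenation of lists multiplies monomials,
  the empty list gives the constants, and scalar factors are placed in the base case.\<close>

inductive_set monomial_span :: "real \<Rightarrow> (real \<times> 'u::compact_metric_space \<Rightarrow> real) set" for T where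
  monomial: "(\<lambda>z. a * monomial T l z) \<in> monomial_span T"
| add: "f \<in> monomial_span T \<Longrightarrow> g \<in> monomial_span T \<Longrightarrow> (\<lambda>z. f z + g z) \<in> monomial_span T"

lemma monomial_span_mult:
  assumes "f \<in> monomial_span T" "g \<in> monomial_span T"
  shows "(\<lambda>z. f z * g z) \<in> monomial_span T"
  using assms(1)
proof induction
  case (monomial a l)
  from assms(2) show ?case
  proof induction
    case (monomial b l')
    have *: "(\<lambda>z. a * monomial T l z * (b * monomial T l' z)) = (\<lambda>z. (a * b) * monomial T (l @ l') z)"
      by (auto simp: monomial_def)
    show ?case unfolding * by (rule monomial_span.monomial)
  next
    case (add f g)
    then show ?case using monomial_span.add[OF add.IH] by (simp add: distrib_left)
  qed
next
  case (add f1 f2)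
  then show ?case using monomial_span.add[OF add.IH] by (simp add: distrib_right)
qed

lemma continuous_on_monomial_span:
  "f \<in> monomial_span T \<Longrightarrow> T > 0 \<Longrightarrow> continuous_on S f"
  by (induction rule: monomial_span.induct) (auto intro!: continuous_intros continuous_on_monomial)

text \<open>Stone-Weierstrass: the single coordinates belong to the span and separate points by
  \<open>coord_inj\<close>.\<close>

lemma monomial_span_dense:
  assumes T: "T > 0" and f: "continuous_on (control_domain T) f" and e: "e > 0"
  shows "\<exists>g\<in>monomial_span T. \<forall>z\<in>control_domain T. \<bar>f z - g z\<bar> < e"
proof -
  interpret function_ring_on "monomial_span T" "control_domain T"
  proof
    show "(\<lambda>_. c) \<in> monomial_span T" for c
      using monomial_span.monomial[of c T "[]"] by (simp add: monomial_def)
    show "\<exists>f\<in>monomial_span T. f x \<noteq> f y" if "x \<noteq> y" for x y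
    proof -
      obtain i where "coord T i x \<noteq> coord T i y" using coord_inj[OF T, of x y] \<open>x \<noteq> y\<close> by metis
      moreover have "coord T i \<in> monomial_span T"
        using monomial_span.monomial[of 1 T "[i]"] by (simp add: monomial_def)
      ultimately show ?thesis by blast
    qed
  qed (auto intro: compact_control_domain continuous_on_monomial_span monomial_span_mult monomial_span.add T)
  show ?thesis by (rule Stone_Weierstrass_basic[OF f e])
qed

lemma control_integral_full:
  assumes "\<xi> \<in> relaxed_controls T"
  shows "control_integral \<xi> T h = (LINT z|\<xi>. h z)"
  unfolding set_lebesgue_integral_def
  by (intro Bochner_Integration.integral_cong) (auto simp: relaxed_controls_space[OF assms] indicator_def)

lemma norm_integral_control_le:
  fixes h :: "real \<times> 'u::compact_metric_space \<Rightarrow> 'b::{banach, second_countable_topology}"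
  assumes \<xi>: "\<xi> \<in> relaxed_controls T" and h: "continuous_on (control_domain T) h" and T: "0 \<le> T"
    and le: "\<And>z. z \<in> control_domain T \<Longrightarrow> norm (h z) \<le> C"
  shows "norm (LINT z|\<xi>. h z) \<le> C * T"
  using norm_control_integral_le_const[OF \<xi> h T order_refl le] control_integral_full[OF \<xi>, of h] by simp

text \<open>All controls have total mass T, so a test function approximated within d by the span
  changes its integral by at most \<open>d * T\<close>, uniformly in n.\<close>

lemma control_conv_monomial:
  assumes T: "T > 0" and \<xi>n: "\<And>n. \<xi>n n \<in> relaxed_controls T" and \<xi>: "\<xi> \<in> relaxed_controls T"
    and conv: "\<And>l. (\<lambda>n. LINT z|\<xi>n n. monomial T l z) \<longlonglongrightarrow> (LINT z|\<xi>. monomial T l z)"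
  shows "control_conv T \<xi>n \<xi>"
  unfolding control_conv_def
proof (intro allI impI)
  fix \<phi> :: "real \<times> 'a \<Rightarrow> real" assume \<phi>: "continuous_on (control_domain T) \<phi>"
  note int = relaxed_controls_integrable[OF _ less_imp_le[OF T]]
  have span: "(\<lambda>n. LINT z|\<xi>n n. g z) \<longlonglongrightarrow> (LINT z|\<xi>. g z)" if "g \<in> monomial_span T" for g
    using that
  proof induction
    case (monomial a l)
    show ?case using tendsto_mult_left[OF conv[of l], of a] by simp
  next
    case (add f g)
    have "integrable \<eta> f" "integrable \<eta> g" if "\<eta> \<in> relaxed_controls T" for \<eta>
      using int[OF that] continuous_on_monomial_span[OF _ T] add.hyps by auto
    then show ?case using tendsto_add[OF add.IH] \<xi>n \<xi> by simp
  qed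
  show "(\<lambda>n. LINT z|\<xi>n n. \<phi> z) \<longlonglongrightarrow> (LINT z|\<xi>. \<phi> z)"
  proof (rule LIMSEQ_I)
    fix e :: real assume e: "e > 0"
    define d where "d = e / (4 * T)"
    have d: "d > 0" "d * T = e / 4" using e T by (auto simp: d_def)
    obtain g where g: "g \<in> monomial_span T" "\<And>z. z \<in> control_domain T \<Longrightarrow> \<bar>\<phi> z - g z\<bar> < d"
      using monomial_span_dense[OF T \<phi> d(1)] by blast
    have gc: "continuous_on (control_domain T) g" using continuous_on_monomial_span[OF g(1) T] .
    have close: "\<bar>(LINT z|\<eta>. \<phi> z) - (LINT z|\<eta>. g z)\<bar> \<le> e / 4" if \<eta>: "\<eta> \<in> relaxed_controls T" for \<eta>
    proof -
      have "norm (LINT z|\<eta>. \<phi> z - g z) \<le> d * T"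
        using g(2) T by (intro norm_integral_control_le[OF \<eta>]) (auto intro!: continuous_intros \<phi> gc less_imp_le)
      then show ?thesis using int[OF \<eta> \<phi>] int[OF \<eta> gc] d by simp
    qed
    obtain N where N: "\<And>n. n \<ge> N \<Longrightarrow> \<bar>(LINT z|\<xi>n n. g z) - (LINT z|\<xi>. g z)\<bar> < e / 4"
      using LIMSEQ_D[OF span[OF g(1)], of "e / 4"] e by auto
    have "norm ((LINT z|\<xi>n n. \<phi> z) - (LINT z|\<xi>. \<phi> z)) < e" if "n \<ge> N" for n
      using N[OF that] close[OF \<xi>n[of n]] close[OF \<xi>] e unfolding real_norm_def by linarith
    then show "\<exists>N. \<forall>n\<ge>N. norm ((LINT z|\<xi>n n. \<phi> z) - (LINT z|\<xi>. \<phi> z)) < e" by blast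
  qed
qed

lemma sets_control_domain_subset_borel:
  "sets (time_measure T \<Otimes>\<^sub>M (borel :: 'u::compact_metric_space measure)) \<subseteq> sets borel"
proof (rule sets_pair_in_sets)
  fix a and b :: "'u set" assume "a \<in> sets (time_measure T)" "b \<in> sets borel"
  then have "a \<times> b \<in> sets (borel \<Otimes>\<^sub>M borel)" by (auto simp: sets_restrict_space_iff)
  then show "a \<times> b \<in> sets borel" unfolding borel_prod .
qed

section \<open>Identification, existence and compactness of controls\<close>

text \<open>Controls live on the trace of the product algebra on the control domain. The identity
  pushes them to the full Borel algebra, where continuous functions determine a measure; nothing is
  lost, since all sets of the trace algebra are Borel.\<close>

lemma relaxed_controls_eqI:
  fixes \<xi> \<eta> :: "(real \<times> 'u::compact_metric_space) measure"
  assumes T: "0 \<le> T" and \<xi>: "\<xi> \<in> relaxed_controls T" and \<eta>: "\<eta> \<in> relaxed_controls T"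
    and eq: "\<And>\<phi> :: _ \<Rightarrow> real. continuous_on (control_domain T) \<phi> \<Longrightarrow> (LINT z|\<xi>. \<phi> z) = (LINT z|\<eta>. \<phi> z)"
  shows "\<xi> = \<eta>"
proof -
  have id: "(\<lambda>z. z) \<in> borel_measurable \<theta>" if "\<theta> \<in> relaxed_controls T" for \<theta> :: "(real \<times> 'u) measure"
    using measurable_control_domain_id relaxed_controls_measurable[OF that] by blast
  have "distr \<xi> borel (\<lambda>z. z) = distr \<eta> borel (\<lambda>z. z)"
  proof (rule finite_measure_eqI_continuous)
    show "finite_measure (distr \<xi> borel (\<lambda>z. z))"
      by (rule finite_measure.finite_measure_distr[OF relaxed_controls_finite[OF \<xi> T] id[OF \<xi>]])
    show "finite_measure (distr \<eta> borel (\<lambda>z. z))"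
      by (rule finite_measure.finite_measure_distr[OF relaxed_controls_finite[OF \<eta> T] id[OF \<eta>]])
    fix f :: "real \<times> 'u \<Rightarrow> real" assume f: "continuous_on UNIV f"
    show "(LINT z|distr \<xi> borel (\<lambda>z. z). f z) = (LINT z|distr \<eta> borel (\<lambda>z. z). f z)"
      using eq[OF continuous_on_subset[OF f]] id[OF \<xi>] id[OF \<eta>] borel_measurable_continuous_onI[OF f]
      by (simp add: integral_distr)
  qed auto
  moreover have "emeasure \<theta> A = emeasure (distr \<theta> borel (\<lambda>z. z)) A"
    if \<theta>: "\<theta> \<in> relaxed_controls T" and A: "A \<in> sets \<theta>" for \<theta> :: "(real \<times> 'u) measure" and A
  proof -
    have "A \<in> sets borel"
      using A relaxed_controls_sets[OF \<theta>] sets_control_domain_subset_borel by blast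
    moreover have "(\<lambda>z. z) -` A \<inter> space \<theta> = A" using sets.sets_into_space[OF A] by auto
    ultimately show ?thesis using id[OF \<theta>] by (simp add: emeasure_distr)
  qed
  ultimately show ?thesis
    using relaxed_controls_sets[OF \<xi>] relaxed_controls_sets[OF \<eta>] \<xi> \<eta> by (intro measure_eqI) metis+
qed

lemma relaxed_controls_nonempty: "relaxed_controls T \<noteq> {}"
proof -
  let ?N = "time_measure T \<Otimes>\<^sub>M borel"
  \<comment> \<open>The classical control with the constant value \<open>undefined\<close>, which is
    some point of the control space.\<close>
  have m: "(\<lambda>\<tau>. (\<tau>, undefined)) \<in> measurable (time_measure T) ?N" by measurable
  have "distr (distr (time_measure T) ?N (\<lambda>\<tau>. (\<tau>, undefined))) (time_measure T) fst = time_measure T"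
    by (subst distr_distr[OF measurable_fst m]) (simp add: comp_def)
  then have "distr (time_measure T) ?N (\<lambda>\<tau>. (\<tau>, undefined)) \<in> relaxed_controls T"
    by (simp add: relaxed_controls_def Lambda_def)
  then show ?thesis by blast
qed

lemma prob_space_scale_relaxed_control:
  assumes "\<xi> \<in> relaxed_controls T" "T > 0"
  shows "prob_space (scale_measure (ennreal (1 / T)) \<xi>)"
proof
  show "emeasure (scale_measure (ennreal (1 / T)) \<xi>) (space (scale_measure (ennreal (1 / T)) \<xi>)) = 1"
    using relaxed_controls_emeasure_space[OF assms(1)] assms(2)
    by (simp add: space_scale_measure flip: ennreal_mult)
qed

lemma integral_scale_measure_real:
  fixes f :: "'a \<Rightarrow> real"
  assumes r: "0 \<le> r" and f: "integrable M f"
  shows "integral\<^sup>L (scale_measure (ennreal r) M) f = r * integral\<^sup>L M f"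
proof -
  have fm: "f \<in> borel_measurable M" using f by simp
  have nn: "(\<integral>\<^sup>+ x. g x \<partial>scale_measure (ennreal r) M) = ennreal r * (\<integral>\<^sup>+ x. g x \<partial>M)" if "g \<in> borel_measurable M" for g
    using that by (rule nn_integral_scale_measure)
  have fin: "(\<integral>\<^sup>+ x. ennreal (f x) \<partial>M) < \<infinity>" "(\<integral>\<^sup>+ x. ennreal (- f x) \<partial>M) < \<infinity>"
    using f by (auto simp: real_integrable_def less_top)
  have f': "integrable (scale_measure (ennreal r) M) f"
    using fin fm by (auto simp: real_integrable_def nn ennreal_mult_eq_top_iff)
  have "enn2real (ennreal r * x) = r * enn2real x" for x using r by (simp add: enn2real_mult)
  then show ?thesis
    unfolding real_lebesgue_integral_def[OF f] real_lebesgue_integral_def[OF f'] using fm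
    by (simp add: nn right_diff_distrib)
qed

text \<open>Divided by T, controls are laws on the compact domain, embedded in a sequence space by
  \<open>coord\<close>. After passing to a subsequence they are laws of almost surely convergent
  variables, and T times the law of the limit variable is the limit control.\<close>

theorem relaxed_controls_seq_compact:
  fixes \<xi>n :: "nat \<Rightarrow> (real \<times> 'u::compact_metric_space) measure"
  assumes T: "T > 0" and \<xi>n: "\<And>n. \<xi>n n \<in> relaxed_controls T"
  shows "\<exists>r \<xi>. strict_mono (r :: nat \<Rightarrow> nat) \<and> \<xi> \<in> relaxed_controls T \<and> control_conv T (\<lambda>n. \<xi>n (r n)) \<xi>"
proof -
  let ?N = "time_measure T \<Otimes>\<^sub>M (borel :: 'u measure)"
  let ?K = "control_domain T :: (real \<times> 'u) set"
  define e where "e z = (\<lambda>i. coord T i z)" for z :: "real \<times> 'u"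
  have ec: "continuous_on UNIV e"
    unfolding e_def by (intro continuous_on_coordinatewise_then_product continuous_on_coord T)
  have inj: "inj_on e ?K"
    by (rule inj_onI) (auto simp: e_def fun_eq_iff intro!: coord_inj[OF T])
  have eK: "compact (e ` ?K)"
    by (rule compact_continuous_image[OF continuous_on_subset[OF ec] compact_control_domain]) simp
  \<comment> \<open>The image of the domain is compact, hence closed, so the inverse extended by a
    constant is Borel on all sequences.\<close>
  define \<psi> where "\<psi> x = (if x \<in> e ` ?K then inv_into ?K e x else (0, undefined))" for x
  have \<psi>c: "continuous_on (e ` ?K) (inv_into ?K e)"
    by (rule continuous_on_inv[OF continuous_on_subset[OF ec] compact_control_domain])
      (use inj in \<open>auto simp: inv_into_f_f\<close>)
  have \<psi>b: "\<psi> \<in> borel_measurable borel"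
    unfolding \<psi>_def
    by (rule borel_measurable_continuous_on_if[OF _ \<psi>c]) (use compact_imp_closed[OF eK] in auto)
  have \<psi>K: "\<psi> x \<in> ?K" for x
    using T unfolding \<psi>_def by (auto intro!: inv_into_into)
  have \<psi>m: "\<psi> \<in> measurable borel ?N"
    by (rule measurable_control_domainI[OF \<psi>b \<psi>K])
  have \<psi>e: "\<psi> (e z) = z" if "z \<in> ?K" for z
    using that inj by (simp add: \<psi>_def inv_into_f_f)
  have spN: "space ?N = ?K" by (rule space_control_domain)
  define \<mu> where "\<mu> n = scale_measure (ennreal (1 / T)) (\<xi>n n)" for n
  have "\<exists>r (\<Omega> :: real measure) X. strict_mono (r :: nat \<Rightarrow> nat) \<and> prob_space \<Omega> \<and>
    (\<forall>n. X n \<in> measurable \<Omega> ?N \<and> distr \<Omega> ?N (X n) = \<mu> (r n)) \<and>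
    (AE \<omega> in \<Omega>. \<forall>i. convergent (\<lambda>n. e (X n \<omega>) i))"
  proof (rule Skorohod_subsequence)
    show "prob_space (\<mu> n)" for n unfolding \<mu>_def by (rule prob_space_scale_relaxed_control[OF \<xi>n T])
    show "sets (\<mu> n) = sets ?N" for n unfolding \<mu>_def using relaxed_controls_sets[OF \<xi>n] by simp
    show "(\<lambda>z. e z i) \<in> borel_measurable ?N" for i
      unfolding e_def
      by (rule continuous_on_control_domain_measurable) (rule continuous_on_subset[OF continuous_on_coord[OF T]], simp)
    show "0 \<le> e z i \<and> e z i < 1" if "z \<in> space ?N" for z i
      using coord_01[OF T] that spN by (auto simp: e_def)
  qed (use \<psi>m \<psi>e spN in auto)
  then obtain r and \<Omega> :: "real measure" and X where r: "strict_mono r" and \<Omega>: "prob_space \<Omega>"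
    and X: "\<And>n. X n \<in> measurable \<Omega> ?N" "\<And>n. distr \<Omega> ?N (X n) = \<mu> (r n)"
    and conv: "AE \<omega> in \<Omega>. \<forall>i. convergent (\<lambda>n. e (X n \<omega>) i)"
    by blast
  interpret \<Omega>: prob_space \<Omega> by fact
  have XK: "X n \<omega> \<in> ?K" if "\<omega> \<in> space \<Omega>" for n \<omega>
    using measurable_space[OF X(1) that] spN by simp
  \<comment> \<open>Off the convergence set \<open>lim\<close> has some default value;
    \<open>\<psi>\<close> maps it into the domain anyway, so \<open>Y\<close> takes its values there
    everywhere.\<close>
  define Z where "Z \<omega> i = lim (\<lambda>n. e (X n \<omega>) i)" for \<omega> i
  have eXm: "(\<lambda>\<omega>. e (X n \<omega>) i) \<in> borel_measurable \<Omega>" for n i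
    unfolding e_def
    by (rule measurable_compose[OF X(1) continuous_on_control_domain_measurable])
      (rule continuous_on_subset[OF continuous_on_coord[OF T]], simp)
  have "Z \<in> borel_measurable \<Omega>"
    by (rule measurable_coordinatewise_then_product)
      (unfold Z_def, rule borel_measurable_lim_metric, rule eXm)
  then have Ym: "(\<lambda>\<omega>. \<psi> (Z \<omega>)) \<in> measurable \<Omega> ?N" using \<psi>m by (rule measurable_compose)
  define Y where "Y \<omega> = \<psi> (Z \<omega>)" for \<omega>
  have Ym: "Y \<in> measurable \<Omega> ?N" using Ym by (simp add: Y_def[abs_def])
  have YK: "Y \<omega> \<in> ?K" for \<omega> by (simp add: Y_def \<psi>K)
  have lim: "AE \<omega> in \<Omega>. (\<lambda>n. X n \<omega>) \<longlonglongrightarrow> Y \<omega>"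
    using conv AE_space
  proof eventually_elim
    case (elim \<omega>)
    have l: "(\<lambda>n. e (X n \<omega>)) \<longlonglongrightarrow> Z \<omega>"
      by (rule tendsto_coordinatewise) (use elim(1) in \<open>simp add: Z_def convergent_LIMSEQ_iff\<close>)
    have inK: "e (X n \<omega>) \<in> e ` ?K" for n using XK[OF elim(2)] by simp
    have ZK: "Z \<omega> \<in> e ` ?K"
      by (rule closed_sequentially[OF compact_imp_closed[OF eK] inK l])
    have "(\<lambda>n. inv_into ?K e (e (X n \<omega>))) \<longlonglongrightarrow> inv_into ?K e (Z \<omega>)"
      by (rule continuous_on_tendsto_compose[OF \<psi>c l ZK]) (use inK in auto)
    then show ?case using inv_into_f_f[OF inj XK[OF elim(2)]] ZK by (simp add: Y_def \<psi>_def)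
  qed
  have int: "(LINT z|\<xi>n (r n). \<phi> z) = T * \<Omega>.expectation (\<lambda>\<omega>. \<phi> (X n \<omega>))"
    if \<phi>: "continuous_on ?K \<phi>" for \<phi> :: "_ \<Rightarrow> real" and n
  proof -
    have "(LINT z|\<mu> (r n). \<phi> z) = (1 / T) * (LINT z|\<xi>n (r n). \<phi> z)"
      unfolding \<mu>_def using relaxed_controls_integrable[OF \<xi>n _ \<phi>] T by (intro integral_scale_measure_real) auto
    moreover have "(LINT z|\<mu> (r n). \<phi> z) = \<Omega>.expectation (\<lambda>\<omega>. \<phi> (X n \<omega>))"
      unfolding X(2)[symmetric] using continuous_on_control_domain_measurable[OF \<phi>] by (rule integral_distr[OF X(1)])
    ultimately show ?thesis using T by simp
  qed
  have explim: "(\<lambda>n. \<Omega>.expectation (\<lambda>\<omega>. \<phi> (X n \<omega>))) \<longlonglongrightarrow> \<Omega>.expectation (\<lambda>\<omega>. \<phi> (Y \<omega>))"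
    if \<phi>: "continuous_on ?K \<phi>" for \<phi> :: "_ \<Rightarrow> real"
  proof -
    obtain C where C: "0 \<le> C" "\<And>z. z \<in> ?K \<Longrightarrow> norm (\<phi> z) \<le> C"
      using continuous_on_control_domain_bound[OF \<phi>] by blast
    show ?thesis
    proof (rule integral_dominated_convergence)
      show "(\<lambda>\<omega>. \<phi> (Y \<omega>)) \<in> borel_measurable \<Omega>" "(\<lambda>\<omega>. \<phi> (X n \<omega>)) \<in> borel_measurable \<Omega>" for n
        using measurable_compose[OF Ym] measurable_compose[OF X(1)] continuous_on_control_domain_measurable[OF \<phi>] by auto
      show "AE \<omega> in \<Omega>. (\<lambda>n. \<phi> (X n \<omega>)) \<longlonglongrightarrow> \<phi> (Y \<omega>)"
        using lim AE_space
      proof eventually_elim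
        case (elim \<omega>)
        show ?case by (rule continuous_on_tendsto_compose[OF \<phi> elim(1) YK]) (use XK[OF elim(2)] in auto)
      qed
      show "AE \<omega> in \<Omega>. norm (\<phi> (X n \<omega>)) \<le> C" for n using C XK by (intro AE_I2) auto
    qed simp
  qed
  have fstm: "(\<lambda>\<omega>. fst (W \<omega>)) \<in> borel_measurable \<Omega>" if "W \<in> measurable \<Omega> ?N" for W
    by (rule measurable_compose[OF that], rule measurable_compose[OF measurable_fst]) (simp add: measurable_restrict_space1)
  \<comment> \<open>The time coordinates of all \<open>X n\<close> have the same law because the
    marginal of a control is prescribed. The limit inherits it, and this puts the limit measure into
    \<open>relaxed_controls T\<close>.\<close>
  have law: "distr \<Omega> borel (\<lambda>\<omega>. fst (Y \<omega>)) = distr \<Omega> borel (\<lambda>\<omega>. fst (X 0 \<omega>))"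
  proof (rule finite_measure_eqI_continuous)
    show "finite_measure (distr \<Omega> borel (\<lambda>\<omega>. fst (Y \<omega>)))" "finite_measure (distr \<Omega> borel (\<lambda>\<omega>. fst (X 0 \<omega>)))"
      using \<Omega>.finite_measure_distr fstm Ym X(1) by blast+
    fix f :: "real \<Rightarrow> real" assume f: "continuous_on UNIV f"
    have fc: "continuous_on ?K (\<lambda>z. f (fst z))"
      by (rule continuous_on_subset[OF continuous_on_compose2[OF f continuous_on_fst[OF continuous_on_id]]]) auto
    have "T * \<Omega>.expectation (\<lambda>\<omega>. f (fst (X n \<omega>))) = T * \<Omega>.expectation (\<lambda>\<omega>. f (fst (X 0 \<omega>)))" for n
      unfolding int[OF fc, symmetric]
      by (simp add: relaxed_controls_integral_time[OF \<xi>n borel_measurable_continuous_onI[OF f]])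
    then have eq: "\<Omega>.expectation (\<lambda>\<omega>. f (fst (X n \<omega>))) = \<Omega>.expectation (\<lambda>\<omega>. f (fst (X 0 \<omega>)))" for n
      using T by simp
    then have "\<Omega>.expectation (\<lambda>\<omega>. f (fst (Y \<omega>))) = \<Omega>.expectation (\<lambda>\<omega>. f (fst (X 0 \<omega>)))"
      by (rule LIMSEQ_eq_const[OF explim[OF fc]])
    then show "(LINT x|distr \<Omega> borel (\<lambda>\<omega>. fst (Y \<omega>)). f x) = (LINT x|distr \<Omega> borel (\<lambda>\<omega>. fst (X 0 \<omega>)). f x)"
      using fstm[OF Ym] fstm[OF X(1)] borel_measurable_continuous_onI[OF f] by (simp add: integral_distr)
  qed auto
  define \<xi> where "\<xi> = scale_measure (ennreal T) (distr \<Omega> ?N Y)"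
  have \<xi>s: "sets \<xi> = sets ?N" by (simp add: \<xi>_def)
  have \<xi>sp: "space \<xi> = ?K" using sets_eq_imp_space_eq[OF \<xi>s] spN by simp
  have \<xi>fst: "fst \<in> measurable \<xi> (time_measure T)"
    unfolding measurable_cong_sets[OF \<xi>s refl] by (rule measurable_fst)
  have "distr \<xi> (time_measure T) fst = time_measure T"
  proof (rule measure_eqI)
    fix A assume "A \<in> sets (distr \<xi> (time_measure T) fst)"
    then have A: "A \<in> sets (time_measure T)" by simp
    then have Ab: "A \<in> sets borel" by (auto simp: sets_restrict_space_iff)
    have P: "emeasure (distr \<Omega> ?N W) (fst -` A \<inter> ?K) = emeasure (distr \<Omega> borel (\<lambda>\<omega>. fst (W \<omega>))) A"
      if W: "W \<in> measurable \<Omega> ?N" for W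
    proof -
      have "fst -` A \<inter> ?K \<in> sets ?N" using measurable_sets[OF measurable_fst A, of "borel :: 'u measure"] spN by auto
      then have "emeasure (distr \<Omega> ?N W) (fst -` A \<inter> ?K) = emeasure \<Omega> (W -` (fst -` A \<inter> ?K) \<inter> space \<Omega>)"
        using W by (rule emeasure_distr[rotated])
      also have "W -` (fst -` A \<inter> ?K) \<inter> space \<Omega> = (\<lambda>\<omega>. fst (W \<omega>)) -` A \<inter> space \<Omega>"
        using measurable_space[OF W] spN by auto
      finally show ?thesis using fstm[OF W] Ab by (simp add: emeasure_distr)
    qed
    have "emeasure (distr \<xi> (time_measure T) fst) A = emeasure \<xi> (fst -` A \<inter> ?K)"
      using emeasure_distr[OF \<xi>fst A] by (simp add: \<xi>sp)
    also have "\<dots> = ennreal T * emeasure (distr \<Omega> ?N (X 0)) (fst -` A \<inter> ?K)"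
      unfolding \<xi>_def emeasure_scale_measure P[OF Ym] P[OF X(1)[of 0]] law ..
    also have "\<dots> = ennreal T * (ennreal (1 / T) * emeasure (\<xi>n (r 0)) (fst -` A \<inter> ?K))"
      unfolding X(2) \<mu>_def by simp
    also have "\<dots> = emeasure (\<xi>n (r 0)) (fst -` A \<inter> ?K)"
      using T by (simp add: mult.assoc[symmetric] flip: ennreal_mult)
    also have "\<dots> = emeasure (distr (\<xi>n (r 0)) (time_measure T) fst) A"
      using A relaxed_controls_fst_measurable[OF \<xi>n] relaxed_controls_space[OF \<xi>n] by (simp add: emeasure_distr)
    finally show "emeasure (distr \<xi> (time_measure T) fst) A = emeasure (time_measure T) A"
      unfolding relaxed_controls_distr[OF \<xi>n] .
  qed simp
  then have \<xi>: "\<xi> \<in> relaxed_controls T" by (simp add: relaxed_controls_def Lambda_def \<xi>_def)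
  have "control_conv T (\<lambda>n. \<xi>n (r n)) \<xi>"
    unfolding control_conv_def
  proof (intro allI impI)
    fix \<phi> :: "real \<times> 'u \<Rightarrow> real" assume \<phi>: "continuous_on ?K \<phi>"
    have \<phi>m: "\<phi> \<in> borel_measurable ?N" by (rule continuous_on_control_domain_measurable[OF \<phi>])
    obtain C where C: "\<And>z. z \<in> ?K \<Longrightarrow> norm (\<phi> z) \<le> C"
      using continuous_on_control_domain_bound[OF \<phi>] by blast
    have "integrable \<Omega> (\<lambda>\<omega>. \<phi> (Y \<omega>))"
      by (rule \<Omega>.integrable_const_bound[of _ C]) (use C YK measurable_compose[OF Ym \<phi>m] in auto)
    then have "integrable (distr \<Omega> ?N Y) \<phi>" using Ym \<phi>m by (simp add: integrable_distr_eq)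
    then have "(LINT z|\<xi>. \<phi> z) = T * \<Omega>.expectation (\<lambda>\<omega>. \<phi> (Y \<omega>))"
      unfolding \<xi>_def using T Ym \<phi>m by (simp add: integral_scale_measure_real integral_distr)
    then show "(\<lambda>n. LINT z|\<xi>n (r n). \<phi> z) \<longlonglongrightarrow> (LINT z|\<xi>. \<phi> z)"
      unfolding int[OF \<phi>] using explim[OF \<phi>] by (simp add: tendsto_mult_left)
  qed
  then show ?thesis using r \<xi> by blast
qed


section \<open>Sequential compactness of the strategies\<close>

lemma space_borel_of: "space (borel_of X) = topspace X"
  by (simp add: borel_of_def space_measure_of_conv)

lemma openin_subset_Pow: "{S. openin X S} \<subseteq> Pow (topspace X)"
  using openin_subset by blast

lemma sets_borel_of_openin: "openin X S \<Longrightarrow> S \<in> sets (borel_of X)"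
  unfolding borel_of_def by (simp add: sets_measure_of[OF openin_subset_Pow] sigma_sets.Basic)

lemma measurable_borel_ofI:
  assumes "\<And>x. x \<in> space M \<Longrightarrow> f x \<in> topspace X"
    and "\<And>S. openin X S \<Longrightarrow> f -` S \<inter> space M \<in> sets M"
  shows "f \<in> measurable M (borel_of X)"
  unfolding borel_of_def using assms by (intro measurable_measure_of openin_subset_Pow) auto

text \<open>The expectations of a bounded continuous function form a constant sequence, which
  dominated convergence carries to the limit; such functions determine the law.\<close>

lemma distr_eq_of_AE_tendsto:
  fixes f :: "nat \<Rightarrow> 'a \<Rightarrow> 'b::metric_space"
  assumes \<Omega>: "prob_space \<Omega>" and f: "\<And>n. f n \<in> borel_measurable \<Omega>" and g: "g \<in> borel_measurable \<Omega>"
    and lim: "AE \<omega> in \<Omega>. (\<lambda>n. f n \<omega>) \<longlonglongrightarrow> g \<omega>" and L: "\<And>n. distr \<Omega> borel (f n) = L"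
  shows "distr \<Omega> borel g = L"
proof -
  interpret prob_space \<Omega> by fact
  show ?thesis
  proof (rule finite_measure_eqI_continuous)
    show "finite_measure (distr \<Omega> borel g)" by (rule finite_measure_distr[OF g])
    show "finite_measure L" using finite_measure_distr[OF f[of 0]] L[of 0] by simp
    show "sets L = sets borel" using L[of 0] by auto
    fix h :: "'b \<Rightarrow> real" assume h: "continuous_on UNIV h" and h01: "\<And>x. 0 \<le> h x \<and> h x \<le> 1"
    note hm = borel_measurable_continuous_onI[OF h]
    have "(\<lambda>n. expectation (\<lambda>\<omega>. h (f n \<omega>))) \<longlonglongrightarrow> expectation (\<lambda>\<omega>. h (g \<omega>))"
    proof (rule integral_dominated_convergence)
      show "(\<lambda>\<omega>. h (g \<omega>)) \<in> borel_measurable \<Omega>" "(\<lambda>\<omega>. h (f n \<omega>)) \<in> borel_measurable \<Omega>" for n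
        using measurable_compose[OF f hm] measurable_compose[OF g hm] by auto
      show "AE \<omega> in \<Omega>. (\<lambda>n. h (f n \<omega>)) \<longlonglongrightarrow> h (g \<omega>)"
        using lim by eventually_elim (rule continuous_on_tendsto_compose[OF h], auto)
      show "AE \<omega> in \<Omega>. norm (h (f n \<omega>)) \<le> 1" for n using h01 by auto
    qed simp
    moreover have "expectation (\<lambda>\<omega>. h (f n \<omega>)) = (LINT x|L. h x)" for n
      unfolding L[of n, symmetric] using integral_distr[OF f hm] by simp
    ultimately have "expectation (\<lambda>\<omega>. h (g \<omega>)) = (LINT x|L. h x)" by (rule LIMSEQ_eq_const)
    then show "(LINT x|distr \<Omega> borel g. h x) = (LINT x|L. h x)"
      using integral_distr[OF g hm] by simp
  qed simp
qed

subsection \<open>Coding relaxed controls by sequences of reals\<close>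

text \<open>Integrals of monomials lie in [0,T]; division by \<open>2 * T\<close> brings them
  strictly below 1, and \<open>from_nat\<close> enumerates the lists.\<close>

definition control_code :: "real \<Rightarrow> (real \<times> 'u::compact_metric_space) measure \<Rightarrow> nat \<Rightarrow> real" where
  "control_code T \<xi> j = (LINT z|\<xi>. monomial T (from_nat j) z) / (2 * T)"

lemma control_code_01:
  assumes T: "T > 0" and \<xi>: "\<xi> \<in> relaxed_controls T"
  shows "0 \<le> control_code T \<xi> j \<and> control_code T \<xi> j < 1"
proof -
  let ?m = "monomial T (from_nat j) :: real \<times> 'a \<Rightarrow> real"
  have m1: "norm (?m z) \<le> 1" if "z \<in> control_domain T" for z
    using monomial_01[OF T that, of "from_nat j"] by simp
  have "norm (LINT z|\<xi>. ?m z) \<le> 1 * T"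
    using T by (intro norm_integral_control_le[OF \<xi> continuous_on_monomial[OF T]] m1) auto
  moreover have "0 \<le> (LINT z|\<xi>. ?m z)"
    using monomial_01[OF T] relaxed_controls_space[OF \<xi>] by (intro integral_nonneg_AE AE_I2) auto
  ultimately have "0 \<le> (LINT z|\<xi>. ?m z)" "(LINT z|\<xi>. ?m z) < 2 * T" using T by auto
  then show ?thesis using T by (simp add: control_code_def divide_simps)
qed

lemma control_conv_iff_code:
  assumes T: "T > 0" and \<xi>n: "\<And>n. \<xi>n n \<in> relaxed_controls T" and \<xi>: "\<xi> \<in> relaxed_controls T"
  shows "control_conv T \<xi>n \<xi> \<longleftrightarrow> (\<forall>j. (\<lambda>n. control_code T (\<xi>n n) j) \<longlonglongrightarrow> control_code T \<xi> j)"
proof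
  assume "control_conv T \<xi>n \<xi>"
  then show "\<forall>j. (\<lambda>n. control_code T (\<xi>n n) j) \<longlonglongrightarrow> control_code T \<xi> j"
    unfolding control_conv_def control_code_def using T continuous_on_monomial[OF T]
    by (auto intro!: tendsto_divide)
next
  assume *: "\<forall>j. (\<lambda>n. control_code T (\<xi>n n) j) \<longlonglongrightarrow> control_code T \<xi> j"
  show "control_conv T \<xi>n \<xi>"
  proof (rule control_conv_monomial[OF T \<xi>n \<xi>])
    fix l :: "nat list"
    have "(\<lambda>n. 2 * T * control_code T (\<xi>n n) (to_nat l)) \<longlonglongrightarrow> 2 * T * control_code T \<xi> (to_nat l)"
      using * by (intro tendsto_mult_left) auto
    then show "(\<lambda>n. LINT z|\<xi>n n. monomial T l z) \<longlonglongrightarrow> (LINT z|\<xi>. monomial T l z)"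
      using T by (simp add: control_code_def)
  qed
qed

lemma inj_on_control_code:
  assumes T: "T > 0"
  shows "inj_on (control_code T) (relaxed_controls T)"
proof (rule inj_onI)
  fix \<xi> \<eta> :: "(real \<times> 'a) measure"
  assume \<xi>: "\<xi> \<in> relaxed_controls T" and \<eta>: "\<eta> \<in> relaxed_controls T" and eq: "control_code T \<xi> = control_code T \<eta>"
  have "control_conv T (\<lambda>_. \<xi>) \<eta>" using eq by (simp add: control_conv_iff_code[OF T \<xi> \<eta>])
  then show "\<xi> = \<eta>"
    using T by (intro relaxed_controls_eqI[OF _ \<xi> \<eta>]) (auto simp: control_conv_def LIMSEQ_const_iff)
qed

text \<open>Compactness of the controls in disguise: a subsequence of preimages converges narrowly,
  and its limit is coded by the limit of the codes. It makes the decoder Borel and ensures that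
  limits of codes are codes.\<close>

lemma closed_range_control_code:
  assumes T: "T > 0"
  shows "closed (control_code T ` (relaxed_controls T :: (real \<times> 'u::compact_metric_space) measure set))"
  unfolding closed_sequential_limits
proof (intro allI impI, elim conjE)
  fix z :: "nat \<Rightarrow> nat \<Rightarrow> real" and l
  assume "\<forall>n. z n \<in> control_code T ` (relaxed_controls T :: (real \<times> 'u) measure set)" and l: "z \<longlonglongrightarrow> l"
  then have "\<forall>n. \<exists>\<xi>. \<xi> \<in> (relaxed_controls T :: (real \<times> 'u) measure set) \<and> z n = control_code T \<xi>" by blast
  then obtain \<xi>n :: "nat \<Rightarrow> (real \<times> 'u) measure" where \<xi>n: "\<And>n. \<xi>n n \<in> relaxed_controls T" "\<And>n. z n = control_code T (\<xi>n n)"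
    by metis
  obtain r \<xi> where r: "strict_mono (r :: nat \<Rightarrow> nat)" and \<xi>: "\<xi> \<in> relaxed_controls T" "control_conv T (\<lambda>n. \<xi>n (r n)) \<xi>"
    using relaxed_controls_seq_compact[OF T, of \<xi>n, OF \<xi>n(1)] by blast
  have "(\<lambda>n. z (r n)) \<longlonglongrightarrow> control_code T \<xi>"
    unfolding \<xi>n(2) using \<xi> control_conv_iff_code[OF T \<xi>n(1) \<xi>(1), of r] by (intro tendsto_coordinatewise) auto
  moreover have "(\<lambda>n. z (r n)) \<longlonglongrightarrow> l" using LIMSEQ_subseq_LIMSEQ[OF l r] by (simp add: comp_def)
  ultimately have "l = control_code T \<xi>" using LIMSEQ_unique by blast
  then show "l \<in> control_code T ` (relaxed_controls T :: (real \<times> 'u) measure set)" using \<xi>(1) by blast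
qed

lemma topspace_relaxed_control_topology: "topspace (relaxed_control_topology T) = relaxed_controls T"
  by (simp add: relaxed_control_topology_def)

lemma measurable_control_code:
  assumes T: "T > 0"
  shows "(\<lambda>\<xi>. control_code T \<xi> j) \<in> borel_measurable (borel_of (relaxed_control_topology T :: (real \<times> 'u::compact_metric_space) measure topology))"
proof -
  let ?m = "monomial T (from_nat j) :: real \<times> 'u \<Rightarrow> real"
  have "(\<lambda>\<xi>. LINT z|\<xi>. ?m z) \<in> borel_measurable (borel_of (relaxed_control_topology T))"
  proof (rule borel_measurableI)
    fix G :: "real set" assume G: "open G"
    have mc: "continuous_on (control_domain T) ?m" by (rule continuous_on_monomial[OF T])
    have "bounded (?m ` control_domain T)"
      using compact_imp_bounded[OF compact_continuous_image[OF mc compact_control_domain]] .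
    then have "openin (relaxed_control_topology T) {\<xi> \<in> relaxed_controls T. (LINT z|\<xi>. ?m z) \<in> G}"
      unfolding relaxed_control_topology_def narrow_topology_def
      using mc G by (intro topology_generated_by_Basis) blast
    moreover have "(\<lambda>\<xi>. LINT z|\<xi>. ?m z) -` G \<inter> space (borel_of (relaxed_control_topology T)) =
        {\<xi> \<in> relaxed_controls T. (LINT z|\<xi>. ?m z) \<in> G}"
      by (auto simp: space_borel_of topspace_relaxed_control_topology)
    ultimately show "(\<lambda>\<xi>. LINT z|\<xi>. ?m z) -` G \<inter> space (borel_of (relaxed_control_topology T)) \<in> sets (borel_of (relaxed_control_topology T))"
      using sets_borel_of_openin by auto
  qed
  then show ?thesis unfolding control_code_def by simp
qed

text \<open>By induction over the generation of open sets from the subbasis, where the claim is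
  convergence of one integral.\<close>

lemma openin_relaxed_control_eventually:
  assumes "openin (relaxed_control_topology T) S" and "\<xi> \<in> S"
    and \<xi>n: "\<And>n. \<xi>n n \<in> relaxed_controls T" and conv: "control_conv T \<xi>n \<xi>"
  shows "eventually (\<lambda>n. \<xi>n n \<in> S) sequentially"
  using assms(1,2) unfolding relaxed_control_topology_def narrow_topology_def openin_topology_generated_by_iff
proof (induction rule: generate_topology_on.induct)
  case (Int a b)
  then have "eventually (\<lambda>n. \<xi>n n \<in> a) sequentially" "eventually (\<lambda>n. \<xi>n n \<in> b) sequentially" by auto
  then show ?case by eventually_elim simp
next
  case (UN K)
  then obtain k where "k \<in> K" "\<xi> \<in> k" by blast
  then have "eventually (\<lambda>n. \<xi>n n \<in> k) sequentially" using UN by blast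
  then show ?case by eventually_elim (use \<open>k \<in> K\<close> in auto)
next
  case (Basis s)
  then obtain \<phi> G where s: "s = {\<mu> \<in> relaxed_controls T. (LINT z|\<mu>. \<phi> z) \<in> G}"
    and \<phi>: "continuous_on (control_domain T) \<phi>" and G: "open (G :: real set)" by blast
  have "(\<lambda>n. LINT z|\<xi>n n. \<phi> z) \<longlonglongrightarrow> (LINT z|\<xi>. \<phi> z)"
    using conv \<phi> by (simp add: control_conv_def)
  then have "eventually (\<lambda>n. (LINT z|\<xi>n n. \<phi> z) \<in> G) sequentially"
    using G Basis(2) s by (intro topological_tendstoD) auto
  then show ?case by eventually_elim (simp add: s \<xi>n)
qed auto

text \<open>In a metric space sequences decide closedness. Knowledge about convergent sequences of
  controls is thus transferred to sets of codes, without a metric on the controls.\<close>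

lemma closed_Diff_seq_open:
  fixes D Q :: "'a::metric_space set"
  assumes D: "closed D"
    and seq: "\<And>z l. (\<And>n. z n \<in> D) \<Longrightarrow> z \<longlonglongrightarrow> l \<Longrightarrow> l \<in> Q \<Longrightarrow> eventually (\<lambda>n. z n \<in> Q) sequentially"
  shows "closed (D - Q)"
  unfolding closed_sequential_limits
proof (intro allI impI, elim conjE)
  fix z l assume z: "\<forall>n. z n \<in> D - Q" and l: "z \<longlonglongrightarrow> l"
  have "l \<in> D" using closed_sequentially[OF D _ l] z by blast
  moreover have "l \<notin> Q"
  proof
    assume "l \<in> Q"
    then have "eventually (\<lambda>n. z n \<in> Q) sequentially" using seq[OF _ l] z by blast
    then have "eventually (\<lambda>n::nat. False) sequentially" by eventually_elim (use z in blast)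
    then show False by simp
  qed
  ultimately show "l \<in> D - Q" by blast
qed

definition control_decode :: "real \<Rightarrow> (nat \<Rightarrow> real) \<Rightarrow> (real \<times> 'u::compact_metric_space) measure" where
  "control_decode T z = (if z \<in> control_code T ` (relaxed_controls T :: (real \<times> 'u) measure set) then inv_into (relaxed_controls T) (control_code T) z
     else (SOME \<xi>. \<xi> \<in> relaxed_controls T))"

lemma control_decode_in: "control_decode T z \<in> relaxed_controls T"
  unfolding control_decode_def using relaxed_controls_nonempty[of T]
  by (auto intro: inv_into_into someI_ex simp: ex_in_conv)

lemma control_decode_code:
  assumes "T > 0" "\<xi> \<in> relaxed_controls T"
  shows "control_decode T (control_code T \<xi>) = \<xi>"
  using inv_into_f_f[OF inj_on_control_code[OF assms(1)] assms(2)] assms(2) by (simp add: control_decode_def)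

text \<open>The preimage of an open S is the set of codes of S, together with the complement of the
  range if the default control lies in S. The codes of S are the closed range minus a closed set,
  hence Borel.\<close>

lemma measurable_control_decode:
  assumes T: "T > 0"
  shows "control_decode T \<in> measurable borel (borel_of (relaxed_control_topology T :: (real \<times> 'u::compact_metric_space) measure topology))"
proof (rule measurable_borel_ofI)
  let ?U = "relaxed_controls T :: (real \<times> 'u) measure set"
  let ?D = "control_code T ` ?U"
  show "control_decode T z \<in> topspace (relaxed_control_topology T)" for z
    by (simp add: control_decode_in topspace_relaxed_control_topology)
  fix S :: "(real \<times> 'u) measure set" assume S: "openin (relaxed_control_topology T) S"
  then have SU: "S \<subseteq> ?U" using openin_subset topspace_relaxed_control_topology by blast
  have D: "closed ?D" by (rule closed_range_control_code[OF T])
  have "closed (?D - control_code T ` S)"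
  proof (rule closed_Diff_seq_open[OF D])
    fix z l assume z: "\<And>n. z n \<in> ?D" and l: "z \<longlonglongrightarrow> l" "l \<in> control_code T ` S"
    have "\<forall>n. \<exists>\<xi>. \<xi> \<in> ?U \<and> z n = control_code T \<xi>" using z by blast
    then obtain \<xi>n where \<xi>n: "\<And>n. \<xi>n n \<in> ?U" "\<And>n. z n = control_code T (\<xi>n n)" by metis
    obtain \<xi> where \<xi>: "\<xi> \<in> S" "l = control_code T \<xi>" using l(2) by blast
    have "control_conv T \<xi>n \<xi>"
    proof (subst control_conv_iff_code[OF T \<xi>n(1)])
      show "\<xi> \<in> ?U" using \<xi> SU by blast
      have "(\<lambda>n. z n j) \<longlonglongrightarrow> l j" for j
        using continuous_on_tendsto_compose[OF continuous_on_product_coordinates[of j] l(1)] by simp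
      then show "\<forall>j. (\<lambda>n. control_code T (\<xi>n n) j) \<longlonglongrightarrow> control_code T \<xi> j"
        by (simp add: \<xi>n(2) \<xi>(2))
    qed
    then have "eventually (\<lambda>n. \<xi>n n \<in> S) sequentially"
      by (rule openin_relaxed_control_eventually[OF S \<xi>(1) \<xi>n(1)])
    then show "eventually (\<lambda>n. z n \<in> control_code T ` S) sequentially"
      by eventually_elim (simp add: \<xi>n(2))
  qed
  moreover have "control_code T ` S = ?D - (?D - control_code T ` S)" using SU by blast
  ultimately have CS: "control_code T ` S \<in> sets borel"
    using D by (metis borel_closed sets.Diff)
  let ?c = "SOME \<xi>. \<xi> \<in> ?U"
  have "control_decode T -` S \<inter> space borel = control_code T ` S \<union> (if ?c \<in> S then - ?D else {})"
  proof (intro set_eqI)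
    fix z
    show "z \<in> control_decode T -` S \<inter> space borel \<longleftrightarrow> z \<in> control_code T ` S \<union> (if ?c \<in> S then - ?D else {})"
    proof (cases "z \<in> ?D")
      case True
      then obtain \<xi> where \<xi>: "\<xi> \<in> ?U" "z = control_code T \<xi>" by blast
      have "z \<in> control_code T ` S \<longleftrightarrow> \<xi> \<in> S"
        unfolding \<xi>(2) using inj_on_image_mem_iff[OF inj_on_control_code[OF T] \<xi>(1) SU] .
      then show ?thesis using True \<xi> by (simp add: control_decode_code[OF T])
    next
      case False
      then have "z \<notin> control_code T ` S" using SU by blast
      then show ?thesis using False by (simp add: control_decode_def)
    qed
  qed
  then show "control_decode T -` S \<inter> space borel \<in> sets borel" using CS D by auto
qed

text \<open>The target is the product algebra, whereas the hypothesis concerns joint convergence.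
  The map \<open>F\<close>, which codes the control, is measurable from the product algebra to the
  Borel algebra of a second countable space; there the complement of the image of Q within the
  closed range is closed, and injectivity of \<open>F\<close> brings the set back.\<close>

lemma seq_open_measurable:
  fixes Q :: "('x::euclidean_space \<times> (real \<times> 'u::compact_metric_space) measure) set"
  assumes T: "T > 0" and Q: "Q \<subseteq> UNIV \<times> relaxed_controls T"
    and seq: "\<And>xn \<xi>n x \<xi>. (\<And>n. \<xi>n n \<in> relaxed_controls T) \<Longrightarrow> xn \<longlonglongrightarrow> x \<Longrightarrow> control_conv T \<xi>n \<xi> \<Longrightarrow> (x, \<xi>) \<in> Q \<Longrightarrow>
      eventually (\<lambda>n. (xn n, \<xi>n n) \<in> Q) sequentially"
  shows "Q \<in> sets (borel \<Otimes>\<^sub>M borel_of (relaxed_control_topology T))"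
proof -
  let ?U = "relaxed_controls T :: (real \<times> 'u) measure set"
  let ?M = "borel \<Otimes>\<^sub>M borel_of (relaxed_control_topology T) :: ('x \<times> (real \<times> 'u) measure) measure"
  define F where "F w = (fst w, control_code T (snd w))" for w :: "'x \<times> (real \<times> 'u) measure"
  let ?D = "UNIV \<times> control_code T ` ?U :: ('x \<times> (nat \<Rightarrow> real)) set"
  have spM: "space ?M = UNIV \<times> ?U"
    by (simp add: space_pair_measure space_borel_of topspace_relaxed_control_topology)
  have cm: "control_code T \<in> borel_measurable (borel_of (relaxed_control_topology T :: (real \<times> 'u) measure topology))"
    by (rule measurable_coordinatewise_then_product) (rule measurable_control_code[OF T])
  have Fm: "F \<in> borel_measurable ?M"
    unfolding F_def by (intro borel_measurable_Pair measurable_fst measurable_compose[OF measurable_snd cm])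
  have injF: "inj_on F (UNIV \<times> ?U)"
    using inj_on_control_code[OF T, where 'a = 'u] by (auto simp: inj_on_def F_def)
  have "closed (?D - F ` Q)"
  proof (rule closed_Diff_seq_open)
    show "closed ?D" by (intro closed_Times closed_range_control_code T closed_UNIV)
    fix z l assume z: "\<And>n. z n \<in> ?D" and l: "z \<longlonglongrightarrow> l" "l \<in> F ` Q"
    have "\<forall>n. \<exists>\<xi>. \<xi> \<in> ?U \<and> snd (z n) = control_code T \<xi>" using z by (force simp: mem_Times_iff)
    then obtain \<xi>n where \<xi>n: "\<And>n. \<xi>n n \<in> ?U" "\<And>n. snd (z n) = control_code T (\<xi>n n)" by metis
    obtain x \<xi> where \<xi>: "(x, \<xi>) \<in> Q" "l = (x, control_code T \<xi>)" using l(2) by (auto simp: F_def)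
    have "control_conv T \<xi>n \<xi>"
    proof (subst control_conv_iff_code[OF T \<xi>n(1)])
      show "\<xi> \<in> ?U" using \<xi> Q by blast
      have "(\<lambda>n. snd (z n)) \<longlonglongrightarrow> control_code T \<xi>" using tendsto_snd[OF l(1)] \<xi>(2) by simp
      then have "(\<lambda>n. snd (z n) j) \<longlonglongrightarrow> control_code T \<xi> j" for j
        using continuous_on_tendsto_compose[OF continuous_on_product_coordinates[of j]] by fastforce
      then show "\<forall>j. (\<lambda>n. control_code T (\<xi>n n) j) \<longlonglongrightarrow> control_code T \<xi> j" by (simp add: \<xi>n(2))
    qed
    moreover have "(\<lambda>n. fst (z n)) \<longlonglongrightarrow> x" using tendsto_fst[OF l(1)] \<xi>(2) by simp
    ultimately have "eventually (\<lambda>n. (fst (z n), \<xi>n n) \<in> Q) sequentially"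
      using seq[of \<xi>n "\<lambda>n. fst (z n)" x \<xi>] \<xi>n(1) \<xi>(1) by blast
    then show "eventually (\<lambda>n. z n \<in> F ` Q) sequentially"
    proof eventually_elim
      case (elim n)
      have "z n = F (fst (z n), \<xi>n n)" by (simp add: F_def prod_eq_iff \<xi>n(2))
      then show ?case using elim by blast
    qed
  qed
  then have "F -` (?D - F ` Q) \<inter> space ?M \<in> sets ?M"
    by (intro measurable_sets[OF Fm]) simp
  then have c: "space ?M - (F -` (?D - F ` Q) \<inter> space ?M) \<in> sets ?M" by (rule sets.compl_sets)
  have eq: "Q = space ?M - (F -` (?D - F ` Q) \<inter> space ?M)"
  proof (intro set_eqI iffI)
    fix w assume "w \<in> Q" then show "w \<in> space ?M - (F -` (?D - F ` Q) \<inter> space ?M)" using Q spM by blast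
  next
    fix w assume w: "w \<in> space ?M - (F -` (?D - F ` Q) \<inter> space ?M)"
    have ws: "w \<in> space ?M" by (rule DiffD1[OF w])
    then have FD: "F w \<in> ?D" unfolding spM F_def by auto
    have "F w \<in> F ` Q"
    proof (rule ccontr)
      assume "F w \<notin> F ` Q"
      with FD have "F w \<in> ?D - F ` Q" by (rule DiffI)
      then have "w \<in> F -` (?D - F ` Q)" by (rule vimageI2)
      then have "w \<in> F -` (?D - F ` Q) \<inter> space ?M" using ws by (rule IntI)
      then show False by (rule DiffD2[OF w])
    qed
    then show "w \<in> Q" using inj_on_image_mem_iff[OF injF _ Q] ws unfolding spM by blast
  qed
  show ?thesis by (rule back_subst[where P = "\<lambda>S. S \<in> sets ?M", OF c eq[symmetric]])
qed

subsection \<open>Almost surely convergent strategies\<close>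

text \<open>A homeomorphism of the real line onto (0,1), so that coordinates of initial states fit
  into a code with values in [0,1).\<close>

definition squash :: "real \<Rightarrow> real" where "squash s = (1 + s / (1 + \<bar>s\<bar>)) / 2"
definition unsquash :: "real \<Rightarrow> real" where "unsquash y = (2 * y - 1) / (1 - \<bar>2 * y - 1\<bar>)"

lemma squash_bounds: "0 < squash s" "squash s < 1"
proof -
  have "\<bar>s / (1 + \<bar>s\<bar>)\<bar> < 1" by (simp add: abs_divide divide_simps)
  then have "-1 < s / (1 + \<bar>s\<bar>)" "s / (1 + \<bar>s\<bar>) < 1" unfolding abs_less_iff by linarith+
  then show "0 < squash s" "squash s < 1" by (simp_all add: squash_def)
qed

lemma unsquash_squash: "unsquash (squash s) = s"
proof -
  have p: "1 + \<bar>s\<bar> \<noteq> 0" by linarith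
  have "2 * ((1 + w) / 2) - 1 = w" for w :: real by (simp add: field_simps)
  then have "2 * squash s - 1 = s / (1 + \<bar>s\<bar>)" unfolding squash_def by blast
  moreover have "1 - \<bar>s / (1 + \<bar>s\<bar>)\<bar> = 1 / (1 + \<bar>s\<bar>)" using p by (simp add: abs_divide field_simps)
  ultimately show ?thesis using p by (simp add: unsquash_def)
qed

text \<open>Continuity holds only inside (0,1): at 0 and 1 the denominator vanishes, and such limits
  correspond to escape to infinity.\<close>

lemma tendsto_unsquash:
  assumes "f \<longlonglongrightarrow> y" "0 < y" "y < 1"
  shows "(\<lambda>n. unsquash (f n)) \<longlonglongrightarrow> unsquash y"
proof -
  have "1 - \<bar>2 * y - 1\<bar> \<noteq> 0" using assms by linarith
  then show ?thesis unfolding unsquash_def by (intro tendsto_intros assms) 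
qed

lemma measurable_squash [measurable]: "squash \<in> borel_measurable borel"
  unfolding squash_def by measurable

lemma measurable_unsquash [measurable]: "unsquash \<in> borel_measurable borel"
  unfolding unsquash_def by measurable

lemma minor_strategies_sets:
  assumes "\<alpha> \<in> minor_strategies T m0"
  shows "sets \<alpha> = sets (m0 \<Otimes>\<^sub>M borel_of (relaxed_control_topology T))"
  using assms by (simp add: minor_strategies_def Lambda_def)

lemma minor_strategies_prob:
  assumes m0: "prob_space m0" and \<alpha>: "\<alpha> \<in> minor_strategies T m0"
  shows "prob_space \<alpha>"
proof -
  have f: "fst \<in> measurable \<alpha> m0"
    unfolding measurable_cong_sets[OF minor_strategies_sets[OF \<alpha>] refl] by (rule measurable_fst)
  have "distr \<alpha> m0 fst = m0" using \<alpha> by (simp add: minor_strategies_def Lambda_def)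
  then show ?thesis using prob_space_distrD[OF f] m0 by simp
qed

lemma minor_strategies_nonempty:
  "(minor_strategies T m0 :: ('x \<times> (real \<times> 'u::compact_metric_space) measure) measure set) \<noteq> {}"
proof -
  obtain \<xi> :: "(real \<times> 'u) measure" where \<xi>: "\<xi> \<in> relaxed_controls T"
    using relaxed_controls_nonempty by blast
  let ?N = "m0 \<Otimes>\<^sub>M borel_of (relaxed_control_topology T) :: ('x \<times> (real \<times> 'u) measure) measure"
  have m: "(\<lambda>x. (x, \<xi>)) \<in> measurable m0 ?N"
    by (rule measurable_Pair2') (simp add: space_borel_of topspace_relaxed_control_topology \<xi>)
  have "distr (distr m0 ?N (\<lambda>x. (x, \<xi>))) m0 fst = m0"
    by (subst distr_distr[OF measurable_fst m]) (simp add: comp_def)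
  then have "distr m0 ?N (\<lambda>x. (x, \<xi>)) \<in> minor_strategies T m0"
    by (simp add: minor_strategies_def Lambda_def)
  then show ?thesis by blast
qed

text \<open>The codes of initial state and control converge almost surely along a subsequence. To
  decode the limit, the control part uses the closed range of \<open>control_code\<close>, and the
  state part uses the common marginal m0, which prevents mass from escaping to infinity.\<close>

theorem minor_strategies_Skorohod:
  fixes m0 :: "'x::euclidean_space measure" and \<alpha>n :: "nat \<Rightarrow> ('x \<times> (real \<times> 'u::compact_metric_space) measure) measure"
  assumes T: "T > 0" and m0: "prob_space m0" "sets m0 = sets borel"
    and \<alpha>n: "\<And>n. \<alpha>n n \<in> minor_strategies T m0"
  defines "M \<equiv> m0 \<Otimes>\<^sub>M borel_of (relaxed_control_topology T)"
  shows "\<exists>r (\<Omega> :: real measure) Xn X \<alpha>. strict_mono (r :: nat \<Rightarrow> nat) \<and> prob_space \<Omega> \<and>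
    (\<forall>n. Xn n \<in> measurable \<Omega> M \<and> distr \<Omega> M (Xn n) = \<alpha>n (r n)) \<and>
    X \<in> measurable \<Omega> M \<and> distr \<Omega> M X = \<alpha> \<and> \<alpha> \<in> minor_strategies T m0 \<and>
    (AE \<omega> in \<Omega>. (\<lambda>n. fst (Xn n \<omega>)) \<longlonglongrightarrow> fst (X \<omega>) \<and> control_conv T (\<lambda>n. snd (Xn n \<omega>)) (snd (X \<omega>)))"
proof -
  let ?N = "borel_of (relaxed_control_topology T) :: (real \<times> 'u) measure measure"
  let ?b = "\<lambda>i. from_nat_into Basis i :: 'x"
  have bB: "?b i \<in> Basis" for i by (simp add: from_nat_into)
  have spM: "space M = UNIV \<times> relaxed_controls T"
    using sets_eq_imp_space_eq[OF m0(2)]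
    by (simp add: M_def space_pair_measure space_borel_of topspace_relaxed_control_topology)
  have fstM: "fst \<in> borel_measurable M"
    unfolding M_def using measurable_fst[of m0 ?N] measurable_cong_sets[OF refl m0(2)] by blast
  have sndM: "snd \<in> measurable M ?N" unfolding M_def by (rule measurable_snd)
  \<comment> \<open>Even entries hold the squashed coordinates of the state, odd ones the code of
    the control. Beyond the dimension \<open>from_nat_into\<close> returns some basis vector again,
    so a few even entries are repetitions.\<close>
  define e where "e w i = (if even i then squash (fst w \<bullet> ?b (i div 2)) else control_code T (snd w) (i div 2))"
    for w :: "'x \<times> (real \<times> 'u) measure" and i
  define \<psi> :: "(nat \<Rightarrow> real) \<Rightarrow> 'x \<times> (real \<times> 'u) measure" where
    "\<psi> z = (\<Sum>b\<in>Basis. unsquash (z (2 * to_nat_on Basis b)) *\<^sub>R b, control_decode T (\<lambda>j. z (2 * j + 1)))" for z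
  have em: "(\<lambda>w. e w i) \<in> borel_measurable M" for i
  proof (cases "even i")
    case True then show ?thesis using fstM by (simp add: e_def)
  next
    case False then show ?thesis
      using measurable_compose[OF sndM measurable_control_code[OF T]] by (simp add: e_def)
  qed
  have \<psi>m: "\<psi> \<in> measurable borel M"
    unfolding \<psi>_def M_def
  proof (rule measurable_Pair)
    show "(\<lambda>z. \<Sum>b\<in>Basis. unsquash (z (2 * to_nat_on Basis b)) *\<^sub>R b) \<in> measurable borel m0"
      unfolding measurable_cong_sets[OF refl m0(2)] by measurable
    have "(\<lambda>z j. z (2 * j + 1)) \<in> borel_measurable (borel :: (nat \<Rightarrow> real) measure)"
      by (rule measurable_coordinatewise_then_product) measurable
    then show "(\<lambda>z. control_decode T (\<lambda>j. z (2 * j + 1))) \<in> measurable borel ?N"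
      by (rule measurable_compose[OF _ measurable_control_decode[OF T]])
  qed
  have \<psi>e: "\<psi> (e w) = w" if "w \<in> space M" for w
  proof -
    have "(\<Sum>b\<in>Basis. unsquash (e w (2 * to_nat_on Basis b)) *\<^sub>R b) = (\<Sum>b\<in>Basis. (fst w \<bullet> b) *\<^sub>R b)"
      by (intro sum.cong) (auto simp: e_def unsquash_squash countable_finite)
    moreover have "(\<lambda>j. e w (2 * j + 1)) = control_code T (snd w)" by (simp add: e_def)
    moreover have "control_decode T (control_code T (snd w)) = snd w"
      using that spM by (intro control_decode_code[OF T]) (simp add: mem_Times_iff)
    ultimately show ?thesis by (simp add: \<psi>_def euclidean_representation)
  qed
  have "\<exists>r (\<Omega> :: real measure) X. strict_mono (r :: nat \<Rightarrow> nat) \<and> prob_space \<Omega> \<and>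
    (\<forall>n. X n \<in> measurable \<Omega> M \<and> distr \<Omega> M (X n) = \<alpha>n (r n)) \<and>
    (AE \<omega> in \<Omega>. \<forall>i. convergent (\<lambda>n. e (X n \<omega>) i))"
  proof (rule Skorohod_subsequence)
    show "prob_space (\<alpha>n n)" for n by (rule minor_strategies_prob[OF m0(1) \<alpha>n])
    show "sets (\<alpha>n n) = sets M" for n using minor_strategies_sets[OF \<alpha>n] by (simp add: M_def)
    show "0 \<le> e w i \<and> e w i < 1" if "w \<in> space M" for w i
    proof (cases "even i")
      case True
      then show ?thesis using squash_bounds[of "fst w \<bullet> ?b (i div 2)"] by (simp add: e_def)
    next
      case False
      have "snd w \<in> relaxed_controls T" using that spM by (simp add: mem_Times_iff)
      then show ?thesis using False control_code_01[OF T] by (simp add: e_def)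
    qed
  qed (use em \<psi>m \<psi>e in auto)
  then obtain r and \<Omega> :: "real measure" and Xn where r: "strict_mono r" and \<Omega>: "prob_space \<Omega>"
    and Xn: "\<And>n. Xn n \<in> measurable \<Omega> M" "\<And>n. distr \<Omega> M (Xn n) = \<alpha>n (r n)"
    and conv: "AE \<omega> in \<Omega>. \<forall>i. convergent (\<lambda>n. e (Xn n \<omega>) i)"
    by blast
  interpret \<Omega>: prob_space \<Omega> by fact
  define Z where "Z \<omega> i = lim (\<lambda>n. e (Xn n \<omega>) i)" for \<omega> i
  have eXm: "(\<lambda>\<omega>. e (Xn n \<omega>) i) \<in> borel_measurable \<Omega>" for n i
    by (rule measurable_compose[OF Xn(1) em])
  have Zi: "(\<lambda>\<omega>. Z \<omega> i) \<in> borel_measurable \<Omega>" for i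
    unfolding Z_def by (rule borel_measurable_lim_metric) (rule eXm)
  have Zm: "Z \<in> borel_measurable \<Omega>" by (rule measurable_coordinatewise_then_product) (rule Zi)
  define X where "X \<omega> = \<psi> (Z \<omega>)" for \<omega>
  have Xm: "X \<in> measurable \<Omega> M" unfolding X_def using Zm \<psi>m by (rule measurable_compose)
  have fstX: "(\<lambda>\<omega>. fst (W \<omega>)) \<in> borel_measurable \<Omega>" if "W \<in> measurable \<Omega> M" for W
    by (rule measurable_compose[OF that fstM])
  have fstm0: "fst \<in> measurable M m0" unfolding M_def by (rule measurable_fst)
  have law: "distr \<Omega> borel (\<lambda>\<omega>. fst (Xn n \<omega>)) = m0" for n
  proof -
    have "m0 = distr (distr \<Omega> M (Xn n)) m0 fst"
      using \<alpha>n[of "r n"] by (simp add: Xn(2) minor_strategies_def Lambda_def)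
    also have "\<dots> = distr \<Omega> m0 (\<lambda>\<omega>. fst (Xn n \<omega>))"
      using distr_distr[OF fstm0 Xn(1)] by (simp add: comp_def)
    also have "\<dots> = distr \<Omega> borel (\<lambda>\<omega>. fst (Xn n \<omega>))"
      by (rule distr_cong) (auto simp: m0)
    finally show ?thesis by simp
  qed
  have elim: "AE \<omega> in \<Omega>. \<forall>i. (\<lambda>n. e (Xn n \<omega>) i) \<longlonglongrightarrow> Z \<omega> i"
    using conv by eventually_elim (simp add: Z_def convergent_LIMSEQ_iff)
  \<comment> \<open>The values 0 and 1 would mean an infinite coordinate. The limit has the law of
    the squashed coordinate under m0, which is carried by (0,1).\<close>
  have Z01: "AE \<omega> in \<Omega>. 0 < Z \<omega> (2 * k) \<and> Z \<omega> (2 * k) < 1" for k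
  proof -
    have eX: "(\<lambda>\<omega>. e (Xn n \<omega>) (2 * k)) = (\<lambda>\<omega>. squash (fst (Xn n \<omega>) \<bullet> ?b k))" for n
      by (simp add: e_def)
    have sq: "(\<lambda>x. squash (x \<bullet> ?b k)) \<in> borel_measurable borel" by measurable
    have d: "distr \<Omega> borel (\<lambda>\<omega>. Z \<omega> (2 * k)) = distr m0 borel (\<lambda>x. squash (x \<bullet> ?b k))"
    proof (rule distr_eq_of_AE_tendsto[OF \<Omega> eXm Zi])
      show "AE \<omega> in \<Omega>. (\<lambda>n. e (Xn n \<omega>) (2 * k)) \<longlonglongrightarrow> Z \<omega> (2 * k)"
        using elim by eventually_elim blast
      show "distr \<Omega> borel (\<lambda>\<omega>. e (Xn n \<omega>) (2 * k)) = distr m0 borel (\<lambda>x. squash (x \<bullet> ?b k))" for n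
        unfolding law[of n, symmetric] eX using distr_distr[OF sq fstX[OF Xn(1)]] by (simp add: comp_def)
    qed
    have a: "AE y in distr m0 borel (\<lambda>x. squash (x \<bullet> ?b k)). 0 < y \<and> y < 1"
    proof (subst AE_distr_iff)
      show "(\<lambda>x. squash (x \<bullet> ?b k)) \<in> borel_measurable m0"
        unfolding measurable_cong_sets[OF m0(2) refl] by (rule sq)
    qed (use squash_bounds in auto)
    have ms: "{y \<in> space borel. 0 < y \<and> y < (1 :: real)} \<in> sets borel" by measurable
    show ?thesis
      using a unfolding d[symmetric] AE_distr_iff[OF Zi ms] .
  qed
  have "AE \<omega> in \<Omega>. \<forall>k. 0 < Z \<omega> (2 * k) \<and> Z \<omega> (2 * k) < 1"
    using Z01 by (simp add: AE_all_countable)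
  then have lim: "AE \<omega> in \<Omega>. (\<lambda>n. fst (Xn n \<omega>)) \<longlonglongrightarrow> fst (X \<omega>) \<and> control_conv T (\<lambda>n. snd (Xn n \<omega>)) (snd (X \<omega>))"
    using elim AE_space
  proof eventually_elim
    case (elim \<omega>)
    have inM: "Xn n \<omega> \<in> space M" for n using measurable_space[OF Xn(1) elim(3)] .
    have "fst (Xn n \<omega>) = fst (\<psi> (e (Xn n \<omega>)))" for n using \<psi>e[OF inM] by simp
    moreover have "(\<lambda>n. fst (\<psi> (e (Xn n \<omega>)))) \<longlonglongrightarrow> fst (X \<omega>)"
      unfolding X_def \<psi>_def fst_conv
      by (intro tendsto_sum tendsto_scaleR tendsto_const tendsto_unsquash) (use elim in auto)
    ultimately have 1: "(\<lambda>n. fst (Xn n \<omega>)) \<longlonglongrightarrow> fst (X \<omega>)" by simp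
    have U: "snd (Xn n \<omega>) \<in> relaxed_controls T" for n using inM[of n] spM by (simp add: mem_Times_iff)
    have l: "(\<lambda>n. control_code T (snd (Xn n \<omega>))) \<longlonglongrightarrow> (\<lambda>j. Z \<omega> (2 * j + 1))"
    proof (rule tendsto_coordinatewise)
      fix j
      show "(\<lambda>n. control_code T (snd (Xn n \<omega>)) j) \<longlonglongrightarrow> Z \<omega> (2 * j + 1)"
        using elim(2)[rule_format, of "2 * j + 1"] by (simp add: e_def)
    qed
    then have "(\<lambda>j. Z \<omega> (2 * j + 1)) \<in> control_code T ` (relaxed_controls T :: (real \<times> 'u) measure set)"
      by (rule closed_sequentially[OF closed_range_control_code[OF T], rotated]) (use U in auto)
    then have c: "control_code T (snd (X \<omega>)) = (\<lambda>j. Z \<omega> (2 * j + 1))"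
      by (auto simp: X_def \<psi>_def control_decode_code[OF T])
    have UX: "snd (X \<omega>) \<in> relaxed_controls T" by (simp add: X_def \<psi>_def control_decode_in)
    have "control_conv T (\<lambda>n. snd (Xn n \<omega>)) (snd (X \<omega>))"
      unfolding control_conv_iff_code[OF T U UX] c
    proof
      fix j
      show "(\<lambda>n. control_code T (snd (Xn n \<omega>)) j) \<longlonglongrightarrow> Z \<omega> (2 * j + 1)"
        using elim(2)[rule_format, of "2 * j + 1"] by (simp add: e_def)
    qed
    with 1 show ?case by blast
  qed
  have "distr \<Omega> borel (\<lambda>\<omega>. fst (X \<omega>)) = m0"
  proof (rule distr_eq_of_AE_tendsto[OF \<Omega> _ fstX[OF Xm] _ law])
    show "(\<lambda>\<omega>. fst (Xn n \<omega>)) \<in> borel_measurable \<Omega>" for n by (rule fstX[OF Xn(1)])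
    show "AE \<omega> in \<Omega>. (\<lambda>n. fst (Xn n \<omega>)) \<longlonglongrightarrow> fst (X \<omega>)" using lim by eventually_elim blast
  qed
  then have "distr \<Omega> m0 (\<lambda>\<omega>. fst (X \<omega>)) = m0"
    using distr_cong[OF refl m0(2), of \<Omega> "\<lambda>\<omega>. fst (X \<omega>)"] by simp
  then have "distr (distr \<Omega> M X) m0 fst = m0"
    using distr_distr[OF fstm0 Xm] by (simp add: comp_def)
  then have "distr \<Omega> M X \<in> minor_strategies T m0"
    by (simp add: minor_strategies_def Lambda_def M_def)
  then show ?thesis
    using r \<Omega> Xn Xm lim
    by (intro exI[of _ r] exI[of _ \<Omega>] exI[of _ Xn] exI[of _ X] exI[of _ "distr \<Omega> M X"] conjI allI refl)
qed


section \<open>Controlled integral equations\<close>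

text \<open>Continuity along continuous paths is just what makes every integrand continuous on the
  compact control domain: integrable against all controls and admissible as a test function for
  narrow convergence. The dependence on laws and on the major agent is hidden in
  \<open>a\<close>.\<close>

definition drift :: "real \<Rightarrow> (real \<Rightarrow> 'e::euclidean_space \<Rightarrow> 'u::compact_metric_space \<Rightarrow> 'e) \<Rightarrow> bool" where
  "drift T a \<longleftrightarrow> (\<forall>x. continuous_on {0..T} x \<longrightarrow>
     continuous_on (control_domain T) (\<lambda>z. a (fst z) (x (fst z)) (snd z)))"

text \<open>One format for both kinds of agents: the equation of the major agent is the case in
  which the first drift vanishes.\<close>

definition integral_curve where
  "integral_curve T a b x0 \<xi> \<zeta> x \<longleftrightarrow> continuous_on {0..T} x \<and>
     (\<forall>t\<in>{0..T}. x t = x0 + control_integral \<xi> t (\<lambda>z. a (fst z) (x (fst z)) (snd z))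
        + control_integral \<zeta> t (\<lambda>z. b (fst z) (x (fst z)) (snd z)))"

lemma norm_add3:
  fixes a b c :: "'e::real_normed_vector"
  shows "norm (a + b + c) \<le> norm a + norm b + norm c"
  using norm_triangle_ineq[of "a + b" c] norm_triangle_ineq[of a b] by linarith

lemma drift_zero: "drift T (\<lambda>_ _ _. 0)"
  by (simp add: drift_def)

lemma integral_curve_continuous: "integral_curve T a b x0 \<xi> \<zeta> x \<Longrightarrow> continuous_on {0..T} x"
  by (simp add: integral_curve_def)

lemma continuous_on_Icc_bound:
  fixes x :: "real \<Rightarrow> 'e::real_normed_vector"
  assumes "continuous_on {0..T} x"
  obtains c where "0 \<le> c" "\<And>t. t \<in> {0..T} \<Longrightarrow> norm (x t) \<le> c"
proof -
  have "bounded (x ` {0..T})"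
    using compact_imp_bounded[OF compact_continuous_image[OF assms compact_Icc]] .
  then obtain c where "c > 0" "\<And>t. t \<in> {0..T} \<Longrightarrow> norm (x t) \<le> c" unfolding bounded_pos by auto
  then show ?thesis using that[of c] by auto
qed

text \<open>All pathwise estimates are instances of this Gronwall-type comparison in the weight \<open>exp (l * t)\<close>.\<close>

lemma integral_curve_compare:
  fixes x x' :: "real \<Rightarrow> 'e::euclidean_space"
    and a a' :: "real \<Rightarrow> 'e \<Rightarrow> 'u::compact_metric_space \<Rightarrow> 'e" and b b' :: "real \<Rightarrow> 'e \<Rightarrow> 'v::compact_metric_space \<Rightarrow> 'e"
  assumes T: "0 \<le> T" and \<xi>: "\<xi> \<in> relaxed_controls T" "\<xi>' \<in> relaxed_controls T"
    and \<zeta>: "\<zeta> \<in> relaxed_controls T" "\<zeta>' \<in> relaxed_controls T"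
    and dr: "drift T a" "drift T a'" "drift T b" "drift T b'"
    and x: "integral_curve T a b x0 \<xi> \<zeta> x" and x': "integral_curve T a' b' x0' \<xi>' \<zeta>' x'"
    and B: "0 \<le> B" and l: "0 < l" "4 * B \<le> l" and k: "0 \<le> k" and \<rho>: "0 \<le> \<rho>"
    and a: "\<And>t u. t \<in> {0..T} \<Longrightarrow> norm (a t (x t) u - a' t (x' t) u) \<le> B * (norm (x t - x' t) + k * exp (l * t))"
    and b: "\<And>t u. t \<in> {0..T} \<Longrightarrow> norm (b t (x t) u - b' t (x' t) u) \<le> B * (norm (x t - x' t) + k * exp (l * t))"
    and err: "\<And>t. t \<in> {0..T} \<Longrightarrow> norm (x0 - x0')
      + norm (control_integral \<xi> t (\<lambda>z. a' (fst z) (x' (fst z)) (snd z)) - control_integral \<xi>' t (\<lambda>z. a' (fst z) (x' (fst z)) (snd z)))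
      + norm (control_integral \<zeta> t (\<lambda>z. b' (fst z) (x' (fst z)) (snd z)) - control_integral \<zeta>' t (\<lambda>z. b' (fst z) (x' (fst z)) (snd z))) \<le> \<rho>"
    and t: "t \<in> {0..T}"
  shows "norm (x t - x' t) \<le> (2 * \<rho> + 4 * B * k / l) * exp (l * t)"
proof -
  have xc: "continuous_on {0..T} x" "continuous_on {0..T} x'" using x x' by (auto simp: integral_curve_def)
  let ?a = "\<lambda>z. a (fst z) (x (fst z)) (snd z)" and ?a' = "\<lambda>z. a' (fst z) (x' (fst z)) (snd z)"
  let ?b = "\<lambda>z. b (fst z) (x (fst z)) (snd z)" and ?b' = "\<lambda>z. b' (fst z) (x' (fst z)) (snd z)"
  have c: "continuous_on (control_domain T) ?a" "continuous_on (control_domain T) ?a'"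
    "continuous_on (control_domain T) ?b" "continuous_on (control_domain T) ?b'"
    using dr xc by (auto simp: drift_def)
  \<comment> \<open>Continuity supplies the crude bound from which the halving starts; it does not
    enter the result.\<close>
  obtain c1 where c1: "0 \<le> c1" "\<And>t. t \<in> {0..T} \<Longrightarrow> norm (x t - x' t) \<le> c1"
    using continuous_on_Icc_bound[OF continuous_on_diff[OF xc]] by blast
  have "norm (x t - x' t) \<le> 2 * (\<rho> + 2 * B * k / l) * exp (l * t)"
  proof (rule le_of_halving_step[where I = "{0..T}" and K = c1 and F = "\<lambda>t. norm (x t - x' t)" and w = "\<lambda>t. exp (l * t)"])
    show "norm (x s - x' s) \<le> c1 * exp (l * s)" if "s \<in> {0..T}" for s
    proof -
      have "norm (x s - x' s) \<le> c1 * 1" using c1(2)[OF that] by simp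
      also have "\<dots> \<le> c1 * exp (l * s)" using c1(1) that l by (intro mult_left_mono) auto
      finally show ?thesis .
    qed
    show "0 \<le> \<rho> + 2 * B * k / l" using B k l \<rho> by simp
    fix \<kappa> s assume \<kappa>: "0 \<le> \<kappa>" and ih: "\<And>j. j \<in> {0..T} \<Longrightarrow> norm (x j - x' j) \<le> \<kappa> * exp (l * j)" and s: "s \<in> {0..T}"
    have st: "0 \<le> s" "s \<le> T" using s by auto
    have bnd: "B * (norm (x j - x' j) + k * exp (l * j)) \<le> B * (\<kappa> + k) * exp (l * j)" if "j \<in> {0..T}" for j
    proof -
      have "norm (x j - x' j) + k * exp (l * j) \<le> (\<kappa> + k) * exp (l * j)"
        using ih[OF that] by (simp add: distrib_right)
      then show ?thesis using mult_left_mono[OF _ B] by (simp add: mult.assoc)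
    qed
    have C: "0 \<le> B * (\<kappa> + k)" using B \<kappa> k by simp
    have 1: "norm (control_integral \<xi> s (\<lambda>z. ?a z - ?a' z)) \<le> B * (\<kappa> + k) / l * exp (l * s)"
    proof (rule norm_control_integral_le_exp[OF \<xi>(1) _ st C l(1)])
      show "norm (?a z - ?a' z) \<le> B * (\<kappa> + k) * exp (l * fst z)" if "z \<in> control_domain T" for z
        using order_trans[OF a[of "fst z" "snd z"] bnd[of "fst z"]] that by (auto simp: mem_Times_iff)
    qed (intro continuous_intros c)
    have 2: "norm (control_integral \<zeta> s (\<lambda>z. ?b z - ?b' z)) \<le> B * (\<kappa> + k) / l * exp (l * s)"
    proof (rule norm_control_integral_le_exp[OF \<zeta>(1) _ st C l(1)])
      show "norm (?b z - ?b' z) \<le> B * (\<kappa> + k) * exp (l * fst z)" if "z \<in> control_domain T" for z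
        using order_trans[OF b[of "fst z" "snd z"] bnd[of "fst z"]] that by (auto simp: mem_Times_iff)
    qed (intro continuous_intros c)
    have d1: "control_integral \<xi> s (\<lambda>z. ?a z - ?a' z) = control_integral \<xi> s ?a - control_integral \<xi> s ?a'"
      by (rule control_integral_diff[OF \<xi>(1) T c(1,2), symmetric])
    have d2: "control_integral \<zeta> s (\<lambda>z. ?b z - ?b' z) = control_integral \<zeta> s ?b - control_integral \<zeta> s ?b'"
      by (rule control_integral_diff[OF \<zeta>(1) T c(3,4), symmetric])
    \<comment> \<open>The change of controls is isolated along the reference curve
      \<open>x'\<close>, so that narrow convergence meets a fixed integrand; the change of the
      drifts is integrated against the controls of \<open>x\<close>.\<close>
    have "x s - x' s = ((x0 - x0') + (control_integral \<xi> s ?a' - control_integral \<xi>' s ?a')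
        + (control_integral \<zeta> s ?b' - control_integral \<zeta>' s ?b'))
        + control_integral \<xi> s (\<lambda>z. ?a z - ?a' z) + control_integral \<zeta> s (\<lambda>z. ?b z - ?b' z)"
      using x x' s unfolding integral_curve_def d1 d2 by (auto simp: algebra_simps)
    then have "norm (x s - x' s) \<le> (norm (x0 - x0') + norm (control_integral \<xi> s ?a' - control_integral \<xi>' s ?a')
        + norm (control_integral \<zeta> s ?b' - control_integral \<zeta>' s ?b'))
        + norm (control_integral \<xi> s (\<lambda>z. ?a z - ?a' z)) + norm (control_integral \<zeta> s (\<lambda>z. ?b z - ?b' z))"
      by (simp only:) (rule order_trans[OF norm_add3 add_right_mono[OF add_right_mono[OF norm_add3]]])
    also have "\<dots> \<le> \<rho> + B * (\<kappa> + k) / l * exp (l * s) + B * (\<kappa> + k) / l * exp (l * s)"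
      by (intro add_mono err[OF s] 1 2)
    also have "\<dots> \<le> \<rho> * exp (l * s) + B * (\<kappa> + k) / l * exp (l * s) + B * (\<kappa> + k) / l * exp (l * s)"
    proof -
      have "\<rho> * 1 \<le> \<rho> * exp (l * s)" using \<rho> st l by (intro mult_left_mono) auto
      then show ?thesis by simp
    qed
    also have "\<dots> = (\<rho> + 2 * B * k / l + 2 * B * \<kappa> / l) * exp (l * s)"
      using l by (simp add: field_simps)
    \<comment> \<open>Each of the two drifts contributes \<open>B * \<kappa> / l\<close>; the
      condition \<open>4 * B \<le> l\<close> makes their sum at most half of \<kappa>.\<close>
    also have "\<dots> \<le> (\<rho> + 2 * B * k / l + \<kappa> / 2) * exp (l * s)"
    proof -
      have "4 * B * \<kappa> \<le> l * \<kappa>" using l \<kappa> by (intro mult_right_mono) auto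
      then have "2 * B * \<kappa> / l \<le> \<kappa> / 2" using l by (simp add: field_simps)
      then show ?thesis by (intro mult_right_mono) auto
    qed
    finally show "norm (x s - x' s) \<le> (\<rho> + 2 * B * k / l + \<kappa> / 2) * exp (l * s)" .
  qed (use t in auto)
  then show ?thesis by (simp add: algebra_simps)
qed

text \<open>Comparison with the zero curve of vanishing drifts; \<open>k\<close> carries the part of
  the growth bound that does not depend on x.\<close>

lemma integral_curve_growth:
  fixes x :: "real \<Rightarrow> 'e::euclidean_space"
    and a :: "real \<Rightarrow> 'e \<Rightarrow> 'u::compact_metric_space \<Rightarrow> 'e" and b :: "real \<Rightarrow> 'e \<Rightarrow> 'v::compact_metric_space \<Rightarrow> 'e"
  assumes T: "0 \<le> T" and \<xi>: "\<xi> \<in> relaxed_controls T" and \<zeta>: "\<zeta> \<in> relaxed_controls T"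
    and dr: "drift T a" "drift T b" and x: "integral_curve T a b x0 \<xi> \<zeta> x"
    and G: "0 \<le> G" and l: "0 < l" "4 * G \<le> l" and k: "0 \<le> k"
    and a: "\<And>t u. t \<in> {0..T} \<Longrightarrow> norm (a t (x t) u) \<le> G * (norm (x t) + k * exp (l * t))"
    and b: "\<And>t u. t \<in> {0..T} \<Longrightarrow> norm (b t (x t) u) \<le> G * (norm (x t) + k * exp (l * t))"
    and t: "t \<in> {0..T}"
  shows "norm (x t) \<le> (2 * norm x0 + 4 * G * k / l) * exp (l * t)"
proof -
  have z: "control_integral \<eta> t (\<lambda>z. 0 :: 'e) = 0" for \<eta> :: "(real \<times> 'w) measure" and t
    by (simp add: set_lebesgue_integral_def)
  have 0: "integral_curve T (\<lambda>_ _ _. 0) (\<lambda>_ _ _. 0) 0 \<xi> \<zeta> (\<lambda>_. 0 :: 'e)"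
    by (simp add: integral_curve_def z)
  show ?thesis
    using integral_curve_compare[OF T \<xi> \<xi> \<zeta> \<zeta> dr(1) drift_zero dr(2) drift_zero x 0 G l k norm_ge_zero, of x0 t]
      a b t by simp
qed

text \<open>The Lipschitz constant is local, so Picard iteration must stay in a bounded set. Linear
  growth makes the paths below M * exp(l1 * t) invariant. This fixes a radius \<open>c\<close>, the
  radius fixes \<open>B\<close>, and a second, larger rate \<open>l\<close> yields the
  contraction.\<close>

lemma integral_curve_exists:
  fixes a :: "real \<Rightarrow> 'e::euclidean_space \<Rightarrow> 'u::compact_metric_space \<Rightarrow> 'e" and b :: "real \<Rightarrow> 'e \<Rightarrow> 'v::compact_metric_space \<Rightarrow> 'e"
  assumes T: "0 \<le> T" and \<xi>: "\<xi> \<in> relaxed_controls T" and \<zeta>: "\<zeta> \<in> relaxed_controls T"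
    and dr: "drift T a" "drift T b" and G: "0 \<le> G"
    and a: "\<And>t x u. t \<in> {0..T} \<Longrightarrow> norm (a t x u) \<le> G * (1 + norm x)"
    and b: "\<And>t x u. t \<in> {0..T} \<Longrightarrow> norm (b t x u) \<le> G * (1 + norm x)"
    and lip: "\<And>c. \<exists>B\<ge>0. \<forall>t\<in>{0..T}. \<forall>x x' u v. norm x \<le> c \<longrightarrow> norm x' \<le> c \<longrightarrow>
      norm (a t x u - a t x' u) \<le> B * norm (x - x') \<and> norm (b t x v - b t x' v) \<le> B * norm (x - x')"
  shows "\<exists>x. integral_curve T a b x0 \<xi> \<zeta> x"
proof -
  \<comment> \<open>The initial value takes M / 2 of the invariant bound, and
    \<open>8 * G \<le> l1\<close> leaves M / 4 for each integral; \<open>1 \<le> M\<close> absorbs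
    the constant in the growth condition.\<close>
  define l1 where "l1 = 8 * G + 1"
  define M where "M = 2 * norm x0 + 1"
  have l1: "l1 > 0" "8 * G \<le> l1" using G by (auto simp: l1_def)
  have M: "1 \<le> M" "norm x0 \<le> M / 2" by (auto simp: M_def)
  define c where "c = M * exp (l1 * T)"
  obtain B where B: "0 \<le> B"
    and lipa: "\<And>t x x' u. t \<in> {0..T} \<Longrightarrow> norm x \<le> c \<Longrightarrow> norm x' \<le> c \<Longrightarrow> norm (a t x u - a t x' u) \<le> B * norm (x - x')"
    and lipb: "\<And>t x x' v. t \<in> {0..T} \<Longrightarrow> norm x \<le> c \<Longrightarrow> norm x' \<le> c \<Longrightarrow> norm (b t x v - b t x' v) \<le> B * norm (x - x')"
    using lip[of c] by metis
  define l where "l = 4 * B + 1"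
  have l: "l > 0" "4 * B \<le> l" using B by (auto simp: l_def)
  let ?a = "\<lambda>x z. a (fst z) (x (fst z)) (snd z)" and ?b = "\<lambda>x z. b (fst z) (x (fst z)) (snd z)"
  define \<Phi> where "\<Phi> x t = x0 + control_integral \<xi> t (?a x) + control_integral \<zeta> t (?b x)" for x t
  define W where "W x \<longleftrightarrow> continuous_on {0..T} x \<and> (\<forall>t\<in>{0..T}. norm (x t) \<le> M * exp (l1 * t))" for x :: "real \<Rightarrow> 'e"
  have cont: "continuous_on (control_domain T) (?a x)" "continuous_on (control_domain T) (?b x)" if "W x" for x
    using dr that by (auto simp: drift_def W_def)
  have Wc: "norm (x t) \<le> c" if "W x" "t \<in> {0..T}" for x t
  proof -
    have "norm (x t) \<le> M * exp (l1 * t)" using that by (simp add: W_def)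
    also have "\<dots> \<le> c" unfolding c_def using that l1 M by (intro mult_left_mono) auto
    finally show ?thesis .
  qed
  have "\<exists>x. W x \<and> (\<forall>t\<in>{0..T}. \<Phi> x t = x t)"
  proof (rule weighted_contraction_fixpoint[where ?z0.0 = "\<lambda>_. 0" and N = c and w = "\<lambda>t. exp (l * t)"])
    show W0: "W (\<lambda>_. 0)" using M by (simp add: W_def)
    show inv: "W (\<Phi> x)" if W: "W x" for x
      unfolding W_def
    proof (intro conjI ballI)
      show "continuous_on {0..T} (\<Phi> x)"
        unfolding \<Phi>_def using cont[OF W] by (intro continuous_intros continuous_on_control_integral \<xi> \<zeta>)
      fix t assume t: "t \<in> {0..T}"
      then have tt: "0 \<le> t" "t \<le> T" by auto
      have gr: "G * (1 + norm (x s)) \<le> G * (2 * M) * exp (l1 * s)" if "s \<in> {0..T}" for s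
      proof -
        have "1 + norm (x s) \<le> M * exp (l1 * s) + M * exp (l1 * s)"
        proof (rule add_mono)
          have "1 * 1 \<le> M * exp (l1 * s)" using M l1 that by (intro mult_mono) auto
          then show "1 \<le> M * exp (l1 * s)" by simp
          show "norm (x s) \<le> M * exp (l1 * s)" using W that by (simp add: W_def)
        qed
        then have "1 + norm (x s) \<le> 2 * M * exp (l1 * s)" by simp
        then show ?thesis using mult_left_mono[OF _ G] by (simp add: mult.assoc)
      qed
      have C: "0 \<le> G * (2 * M)" using G M by simp
      have 1: "norm (control_integral \<xi> t (?a x)) \<le> G * (2 * M) / l1 * exp (l1 * t)"
        by (rule norm_control_integral_le_exp[OF \<xi> cont(1)[OF W] tt C l1(1)])
          (use order_trans[OF a gr] in \<open>auto simp: mem_Times_iff\<close>)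
      have 2: "norm (control_integral \<zeta> t (?b x)) \<le> G * (2 * M) / l1 * exp (l1 * t)"
        by (rule norm_control_integral_le_exp[OF \<zeta> cont(2)[OF W] tt C l1(1)])
          (use order_trans[OF b gr] in \<open>auto simp: mem_Times_iff\<close>)
      have 3: "G * (2 * M) / l1 \<le> M / 4" using mult_right_mono[OF l1(2), of M] M l1 by (simp add: field_simps)
      have "norm (\<Phi> x t) \<le> norm x0 + norm (control_integral \<xi> t (?a x)) + norm (control_integral \<zeta> t (?b x))"
        unfolding \<Phi>_def by (rule norm_add3)
      also have "\<dots> \<le> M / 2 * exp (l1 * t) + M / 4 * exp (l1 * t) + M / 4 * exp (l1 * t)"
      proof (intro add_mono)
        have "M / 2 * 1 \<le> M / 2 * exp (l1 * t)" using M l1 tt by (intro mult_left_mono) auto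
        then show "norm x0 \<le> M / 2 * exp (l1 * t)" using M(2) by linarith
        show "norm (control_integral \<xi> t (?a x)) \<le> M / 4 * exp (l1 * t)"
          by (rule order_trans[OF 1 mult_right_mono[OF 3]]) simp
        show "norm (control_integral \<zeta> t (?b x)) \<le> M / 4 * exp (l1 * t)"
          by (rule order_trans[OF 2 mult_right_mono[OF 3]]) simp
      qed
      finally show "norm (\<Phi> x t) \<le> M * exp (l1 * t)" by simp
    qed
    show c0: "0 \<le> c" using M by (simp add: c_def)
    show "norm (\<Phi> (\<lambda>_. 0) t - 0) \<le> c * exp (l * t)" if "t \<in> {0..T}" for t
    proof -
      have "norm (\<Phi> (\<lambda>_. 0) t) \<le> c * 1" using Wc[OF inv[OF W0] that] by simp
      also have "\<dots> \<le> c * exp (l * t)" using c0 l that by (intro mult_left_mono) auto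
      finally show ?thesis by simp
    qed
    show "norm (\<Phi> x t - \<Phi> x' t) \<le> k / 2 * exp (l * t)"
      if W: "W x" "W x'" and k: "0 \<le> k" and le: "\<And>j. j \<in> {0..T} \<Longrightarrow> norm (x j - x' j) \<le> k * exp (l * j)" and t: "t \<in> {0..T}"
      for x x' k t
    proof -
      have tt: "0 \<le> t" "t \<le> T" using t by auto
      have C: "0 \<le> B * k" using B k by simp
      have bnd: "B * norm (x s - x' s) \<le> B * k * exp (l * s)" if "s \<in> {0..T}" for s
        using mult_left_mono[OF le[OF that] B] by (simp add: mult.assoc)
      have 1: "norm (control_integral \<xi> t (\<lambda>z. ?a x z - ?a x' z)) \<le> B * k / l * exp (l * t)"
      proof (rule norm_control_integral_le_exp[OF \<xi> _ tt C l(1)])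
        show "norm (?a x z - ?a x' z) \<le> B * k * exp (l * fst z)" if "z \<in> control_domain T" for z
          using order_trans[OF lipa[OF _ Wc[OF W(1)] Wc[OF W(2)]] bnd, of "fst z"] that by (auto simp: mem_Times_iff)
      qed (intro continuous_intros cont W)
      have 2: "norm (control_integral \<zeta> t (\<lambda>z. ?b x z - ?b x' z)) \<le> B * k / l * exp (l * t)"
      proof (rule norm_control_integral_le_exp[OF \<zeta> _ tt C l(1)])
        show "norm (?b x z - ?b x' z) \<le> B * k * exp (l * fst z)" if "z \<in> control_domain T" for z
          using order_trans[OF lipb[OF _ Wc[OF W(1)] Wc[OF W(2)]] bnd, of "fst z"] that by (auto simp: mem_Times_iff)
      qed (intro continuous_intros cont W)
      have "\<Phi> x t - \<Phi> x' t = control_integral \<xi> t (\<lambda>z. ?a x z - ?a x' z) + control_integral \<zeta> t (\<lambda>z. ?b x z - ?b x' z)"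
        unfolding \<Phi>_def using control_integral_diff[OF \<xi> T cont(1)[OF W(1)] cont(1)[OF W(2)], of t]
          control_integral_diff[OF \<zeta> T cont(2)[OF W(1)] cont(2)[OF W(2)], of t]
        by (simp add: algebra_simps)
      then have "norm (\<Phi> x t - \<Phi> x' t) \<le> B * k / l * exp (l * t) + B * k / l * exp (l * t)"
        using norm_triangle_mono[OF 1 2] by simp
      also have "\<dots> = 2 * B * k / l * exp (l * t)" by simp
      also have "\<dots> \<le> k / 2 * exp (l * t)"
      proof -
        have "4 * B * k \<le> l * k" using l k by (intro mult_right_mono) auto
        then have "2 * B * k / l \<le> k / 2" using l by (simp add: field_simps)
        then show ?thesis by (rule mult_right_mono) simp
      qed
      finally show ?thesis .
    qed
    show "W z" if W: "\<And>n::nat. W (Z n)" and cl: "\<And>n t. t \<in> {0..T} \<Longrightarrow> norm (Z n t - z t) \<le> 2 * c / 2 ^ n * exp (l * t)" for Z z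
    proof -
      have "uniform_limit {0..T} Z z sequentially"
      proof (rule uniform_limitI)
        fix e :: real assume e: "e > 0"
        have "(\<lambda>n. 2 * c * exp (l * T) / 2 ^ n) \<longlonglongrightarrow> 0" by (rule LIMSEQ_divide_realpow_zero) simp
        then have "eventually (\<lambda>n. 2 * c * exp (l * T) / 2 ^ n < e) sequentially"
          using e by (rule order_tendstoD(2))
        then show "eventually (\<lambda>n. \<forall>t\<in>{0..T}. dist (Z n t) (z t) < e) sequentially"
        proof eventually_elim
          case (elim n)
          show ?case
          proof
            fix t assume t: "t \<in> {0..T}"
            have "norm (Z n t - z t) \<le> 2 * c / 2 ^ n * exp (l * t)" by (rule cl[OF t])
            also have "\<dots> \<le> 2 * c / 2 ^ n * exp (l * T)" using t l c0 by (intro mult_left_mono) auto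
            also have "\<dots> < e" using elim by simp
            finally show "dist (Z n t) (z t) < e" by (simp add: dist_norm)
          qed
        qed
      qed
      note ul = this
      have "continuous_on {0..T} z"
        by (rule uniform_limit_theorem[OF _ ul]) (use W in \<open>auto simp: W_def\<close>)
      moreover have "norm (z t) \<le> M * exp (l1 * t)" if t: "t \<in> {0..T}" for t
      proof (rule LIMSEQ_le_const2)
        show "(\<lambda>n. norm (Z n t)) \<longlonglongrightarrow> norm (z t)"
          by (intro tendsto_norm tendsto_uniform_limitI[OF ul t])
        show "\<exists>N. \<forall>n\<ge>N. norm (Z n t) \<le> M * exp (l1 * t)" using W t by (auto simp: W_def)
      qed
      ultimately show ?thesis by (simp add: W_def)
    qed
  qed auto
  then obtain x where W: "W x" and fp: "\<And>t. t \<in> {0..T} \<Longrightarrow> \<Phi> x t = x t" by blast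
  have "integral_curve T a b x0 \<xi> \<zeta> x"
    unfolding integral_curve_def
  proof (intro conjI ballI)
    show "continuous_on {0..T} x" using W by (simp add: W_def)
    show "x t = x0 + control_integral \<xi> t (?a x) + control_integral \<zeta> t (?b x)" if "t \<in> {0..T}" for t
      using fp[OF that] unfolding \<Phi>_def by (rule sym)
  qed
  then show ?thesis by blast
qed

text \<open>\<open>integral_curve_compare\<close> without perturbation, with the Lipschitz constant
  of a ball that contains both curves.\<close>

lemma integral_curve_unique:
  fixes a :: "real \<Rightarrow> 'e::euclidean_space \<Rightarrow> 'u::compact_metric_space \<Rightarrow> 'e" and b :: "real \<Rightarrow> 'e \<Rightarrow> 'v::compact_metric_space \<Rightarrow> 'e"
  assumes T: "0 \<le> T" and \<xi>: "\<xi> \<in> relaxed_controls T" and \<zeta>: "\<zeta> \<in> relaxed_controls T"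
    and dr: "drift T a" "drift T b"
    and lip: "\<And>c. \<exists>B\<ge>0. \<forall>t\<in>{0..T}. \<forall>x x' u v. norm x \<le> c \<longrightarrow> norm x' \<le> c \<longrightarrow>
      norm (a t x u - a t x' u) \<le> B * norm (x - x') \<and> norm (b t x v - b t x' v) \<le> B * norm (x - x')"
    and x: "integral_curve T a b x0 \<xi> \<zeta> x" and x': "integral_curve T a b x0 \<xi> \<zeta> x'" and t: "t \<in> {0..T}"
  shows "x t = x' t"
proof -
  obtain c1 where c1: "\<And>t. t \<in> {0..T} \<Longrightarrow> norm (x t) \<le> c1"
    using continuous_on_Icc_bound[OF integral_curve_continuous[OF x]] by blast
  obtain c2 where c2: "\<And>t. t \<in> {0..T} \<Longrightarrow> norm (x' t) \<le> c2"
    using continuous_on_Icc_bound[OF integral_curve_continuous[OF x']] by blast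
  obtain B where B: "0 \<le> B"
    and lipa: "\<And>t x x' u. t \<in> {0..T} \<Longrightarrow> norm x \<le> max c1 c2 \<Longrightarrow> norm x' \<le> max c1 c2 \<Longrightarrow> norm (a t x u - a t x' u) \<le> B * norm (x - x')"
    and lipb: "\<And>t x x' v. t \<in> {0..T} \<Longrightarrow> norm x \<le> max c1 c2 \<Longrightarrow> norm x' \<le> max c1 c2 \<Longrightarrow> norm (b t x v - b t x' v) \<le> B * norm (x - x')"
    using lip[of "max c1 c2"] by metis
  have "norm (x t - x' t) \<le> (2 * 0 + 4 * B * 0 / (4 * B + 1)) * exp ((4 * B + 1) * t)"
  proof (rule integral_curve_compare[OF T \<xi> \<xi> \<zeta> \<zeta> dr(1) dr(1) dr(2) dr(2) x x' B])
    show "norm (a s (x s) u - a s (x' s) u) \<le> B * (norm (x s - x' s) + 0 * exp ((4 * B + 1) * s))" if "s \<in> {0..T}" for s u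
      using lipa[OF that, of "x s" "x' s" u] c1[OF that] c2[OF that] by simp
    show "norm (b s (x s) u - b s (x' s) u) \<le> B * (norm (x s - x' s) + 0 * exp ((4 * B + 1) * s))" if "s \<in> {0..T}" for s u
      using lipb[OF that, of "x s" "x' s" u] c1[OF that] c2[OF that] by simp
  qed (use B t in auto)
  then show ?thesis by simp
qed


section \<open>Estimates in the Wasserstein metric\<close>

lemma Pp_euclidean_iff:
  "\<mu> \<in> Pp p (euclidean_metric :: 'x::euclidean_space metric) \<longleftrightarrow> prob_space \<mu> \<and> sets \<mu> = sets borel \<and>
     (\<exists>x0. (\<integral>\<^sup>+x. ennreal (dist x x0 powr p) \<partial>\<mu>) < \<infinity>)"
  by (simp add: Pp_def borel_of_euclidean)

lemma Pp_Lp_fun: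
  fixes \<mu> :: "'x::euclidean_space measure"
  assumes p: "p \<ge> 1" and \<mu>: "\<mu> \<in> Pp p euclidean_metric"
  shows "Lp_fun p \<mu> (\<lambda>x. x)"
proof -
  obtain x0 where x0: "(\<integral>\<^sup>+x. ennreal (dist x x0 powr p) \<partial>\<mu>) < \<infinity>" and s: "sets \<mu> = sets borel" and pr: "prob_space \<mu>"
    using \<mu> by (auto simp: Pp_euclidean_iff)
  interpret prob_space \<mu> by fact
  have m: "(\<lambda>x. x) \<in> borel_measurable \<mu>" using measurable_ident_sets[OF s] by simp
  have m': "(\<lambda>x. x - x0) \<in> borel_measurable \<mu>" using m by simp
  have "(\<lambda>x. norm (x - x0) powr p) \<in> borel_measurable \<mu>" using m' by measurable
  then have "Lp_fun p \<mu> (\<lambda>x. x - x0)"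
    using x0 m' by (simp add: Lp_fun_def integrable_iff_bounded dist_norm)
  then show ?thesis
  proof (rule Lp_fun_add_le(1)[OF p _ Lp_const(1)[OF p, of x0] m])
    show "norm x \<le> norm (x - x0) + norm x0" for x using norm_triangle_sub[of x x0] by simp
  qed
qed

lemma varsigma_distr:
  fixes h :: "'a \<Rightarrow> 'x::euclidean_space"
  assumes "h \<in> borel_measurable \<Omega>"
  shows "varsigma p (distr \<Omega> borel h) = Lp_norm p \<Omega> h"
  using assms by (simp add: varsigma_def Lp_norm_def integral_distr)

lemma distr_in_Pp:
  fixes h :: "'a \<Rightarrow> 'x::euclidean_space"
  assumes "prob_space \<Omega>" "Lp_fun p \<Omega> h"
  shows "distr \<Omega> borel h \<in> Pp p euclidean_metric"
proof -
  have h: "h \<in> borel_measurable \<Omega>" using assms(2) by (rule Lp_fun_measurable)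
  have "(\<integral>\<^sup>+x. ennreal (dist x 0 powr p) \<partial>distr \<Omega> borel h) = (\<integral>\<^sup>+\<omega>. ennreal (norm (h \<omega>) powr p) \<partial>\<Omega>)"
    using h by (simp add: nn_integral_distr)
  also have "\<dots> < \<infinity>" using assms(2) by (simp add: Lp_fun_def integrable_iff_bounded)
  finally show ?thesis
    using prob_space.prob_space_distr[OF assms(1) h] unfolding Pp_euclidean_iff
    by (intro conjI exI[of _ 0]) simp_all
qed

text \<open>Random variables on a common space provide a coupling of their laws.\<close>

lemma Wp_distr_le:
  fixes h k :: "'a \<Rightarrow> 'x::euclidean_space"
  assumes p: "p \<ge> 1" and h: "h \<in> borel_measurable \<Omega>" and k: "k \<in> borel_measurable \<Omega>"
    and hk: "Lp_fun p \<Omega> (\<lambda>\<omega>. h \<omega> - k \<omega>)"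
  shows "Wp p euclidean_metric (distr \<Omega> borel h) (distr \<Omega> borel k) \<le> Lp_norm p \<Omega> (\<lambda>\<omega>. h \<omega> - k \<omega>)"
proof -
  let ?P = "borel \<Otimes>\<^sub>M borel :: ('x \<times> 'x) measure"
  define \<pi> where "\<pi> = distr \<Omega> ?P (\<lambda>\<omega>. (h \<omega>, k \<omega>))"
  have m: "(\<lambda>\<omega>. (h \<omega>, k \<omega>)) \<in> measurable \<Omega> ?P" using h k by measurable
  have 1: "distr \<pi> (distr \<Omega> borel h) fst = distr \<Omega> borel h"
  proof -
    have "distr \<pi> (distr \<Omega> borel h) fst = distr \<pi> borel fst" by (rule distr_cong) auto
    also have "\<dots> = distr \<Omega> borel h"
      unfolding \<pi>_def using distr_distr[OF measurable_fst m] by (simp add: comp_def)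
    finally show ?thesis .
  qed
  have 2: "distr \<pi> (distr \<Omega> borel k) snd = distr \<Omega> borel k"
  proof -
    have "distr \<pi> (distr \<Omega> borel k) snd = distr \<pi> borel snd" by (rule distr_cong) auto
    also have "\<dots> = distr \<Omega> borel k"
      unfolding \<pi>_def using distr_distr[OF measurable_snd m] by (simp add: comp_def)
    finally show ?thesis .
  qed
  have "sets \<pi> = sets (distr \<Omega> borel h \<Otimes>\<^sub>M distr \<Omega> borel k)"
    unfolding \<pi>_def sets_distr by (rule sets_pair_measure_cong) simp_all
  then have mem: "\<pi> \<in> couplings (distr \<Omega> borel h) (distr \<Omega> borel k)"
    unfolding couplings_def using 1 2 by simp
  let ?I = "\<lambda>\<pi> :: ('x \<times> 'x) measure. (\<integral>\<^sup>+z. ennreal (mdist euclidean_metric (fst z) (snd z) powr p) \<partial>\<pi>)"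
  have "(INF \<pi>\<in>couplings (distr \<Omega> borel h) (distr \<Omega> borel k). ?I \<pi>) \<le> ?I \<pi>"
    by (rule INF_lower[OF mem])
  also have "?I \<pi> = (\<integral>\<^sup>+\<omega>. ennreal (norm (h \<omega> - k \<omega>) powr p) \<partial>\<Omega>)"
    unfolding \<pi>_def using m by (subst nn_integral_distr) (auto simp: dist_norm)
  also have "\<dots> = ennreal (LINT \<omega>|\<Omega>. norm (h \<omega> - k \<omega>) powr p)"
    using hk by (intro nn_integral_eq_integral) (auto simp: Lp_fun_def)
  finally have "enn2real (INF \<pi>\<in>couplings (distr \<Omega> borel h) (distr \<Omega> borel k). ?I \<pi>) \<le> (LINT \<omega>|\<Omega>. norm (h \<omega> - k \<omega>) powr p)"
    by (intro enn2real_leI) auto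
  then show ?thesis unfolding Wp_def Lp_norm_def using p by (intro powr_mono2) auto
qed

lemma limitin_Wp_topology:
  assumes "\<mu> \<in> Pp p X" "\<And>n. \<nu> n \<in> Pp p X" "(\<lambda>n. Wp p X \<mu> (\<nu> n)) \<longlonglongrightarrow> 0"
  shows "limitin (Wp_topology p X) \<nu> \<mu> sequentially"
  unfolding limitin_def
proof (intro conjI allI impI)
  show "\<mu> \<in> topspace (Wp_topology p X)" using assms(1) by simp
  fix U assume U: "openin (Wp_topology p X) U \<and> \<mu> \<in> U"
  then obtain r where r: "r > 0" "{\<nu> \<in> Pp p X. Wp p X \<mu> \<nu> < r} \<subseteq> U"
    unfolding openin_Wp_topology by blast
  have "eventually (\<lambda>n. Wp p X \<mu> (\<nu> n) < r) sequentially" using assms(3) r(1) by (rule order_tendstoD(2))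
  then show "eventually (\<lambda>n. \<nu> n \<in> U) sequentially"
    by eventually_elim (use r(2) assms(2) in auto)
qed

text \<open>Sequences decide closedness in the metric domain; in the target it is used that an open
  set contains a ball about each of its points. The limit point is the centre, hence the first
  argument of \<open>Wp\<close>.\<close>

lemma continuous_map_WpI:
  fixes m :: "real \<Rightarrow> 'a measure"
  assumes m: "\<And>t. t \<in> {0..T} \<Longrightarrow> m t \<in> Pp p X"
    and lim: "\<And>s t. (\<And>n::nat. s n \<in> {0..T}) \<Longrightarrow> s \<longlonglongrightarrow> t \<Longrightarrow> t \<in> {0..T} \<Longrightarrow> (\<lambda>n. Wp p X (m t) (m (s n))) \<longlonglongrightarrow> 0"
  shows "continuous_map (top_of_set {0..T}) (Wp_topology p X) m"
  unfolding continuous_map_def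
proof (intro conjI allI impI)
  show "m \<in> topspace (top_of_set {0..T}) \<rightarrow> topspace (Wp_topology p X)" using m by auto
  fix U assume U: "openin (Wp_topology p X) U"
  let ?Q = "{t \<in> {0..T}. m t \<in> U}"
  have "closed ({0..T} - ?Q)"
  proof (rule closed_Diff_seq_open)
    fix s t assume s: "\<And>n. s n \<in> {0..T}" "s \<longlonglongrightarrow> t" "t \<in> ?Q"
    have "limitin (Wp_topology p X) (\<lambda>n. m (s n)) (m t) sequentially"
      using s m by (intro limitin_Wp_topology lim) auto
    then have "eventually (\<lambda>n. m (s n) \<in> U) sequentially"
      using U s(3) unfolding limitin_def by blast
    then show "eventually (\<lambda>n. s n \<in> ?Q) sequentially" by eventually_elim (use s in auto)
  qed simp
  then have "openin (top_of_set {0..T}) ({0..T} \<inter> - ({0..T} - ?Q))"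
    by (intro openin_open_Int open_Compl)
  moreover have "{0..T} \<inter> - ({0..T} - ?Q) = ?Q" by blast
  ultimately show "openin (top_of_set {0..T}) {x \<in> topspace (top_of_set {0..T}). m x \<in> U}" by simp
qed

text \<open>The positions at two times are coupled by the random path itself, so \<open>Wp\<close>
  is at most their L^p distance, which vanishes by continuity of the paths and domination by
  \<open>D\<close>.\<close>

lemma continuous_map_Wp_path_law:
  fixes x :: "real \<Rightarrow> 'a \<Rightarrow> 'x::euclidean_space" and D :: "'a \<Rightarrow> real"
  assumes p: "p \<ge> 1" and \<Omega>: "prob_space \<Omega>"
    and xm: "\<And>t. t \<in> {0..T} \<Longrightarrow> x t \<in> borel_measurable \<Omega>"
    and xc: "\<And>\<omega>. \<omega> \<in> space \<Omega> \<Longrightarrow> continuous_on {0..T} (\<lambda>t. x t \<omega>)"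
    and D: "Lp_fun p \<Omega> D" and le: "\<And>t \<omega>. t \<in> {0..T} \<Longrightarrow> \<omega> \<in> space \<Omega> \<Longrightarrow> norm (x t \<omega>) \<le> norm (D \<omega>)"
    and m: "\<And>t. t \<in> {0..T} \<Longrightarrow> m t = distr \<Omega> borel (x t)"
  shows "continuous_map (top_of_set {0..T}) (Wp_topology p euclidean_metric) m"
proof -
  have xL: "Lp_fun p \<Omega> (x t)" if "t \<in> {0..T}" for t
    by (rule Lp_fun_mono(1)[OF p D xm[OF that] le[OF that]])
  have mP: "m t \<in> Pp p euclidean_metric" if "t \<in> {0..T}" for t
    unfolding m[OF that] by (rule distr_in_Pp[OF \<Omega> xL[OF that]])
  show "continuous_map (top_of_set {0..T}) (Wp_topology p euclidean_metric) m"
  proof (rule continuous_map_WpI[OF mP])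
    fix s t assume s: "\<And>n::nat. s n \<in> {0..T}" "s \<longlonglongrightarrow> t" and t: "t \<in> {0..T}"
    have dm: "(\<lambda>\<omega>. x t \<omega> - x (s n) \<omega>) \<in> borel_measurable \<Omega>" for n
      using xm[OF t] xm[OF s(1)] by simp
    have 2: "Lp_fun p \<Omega> (\<lambda>\<omega>. 2 *\<^sub>R D \<omega>)" by (rule Lp_scaleR(1)[OF p D])
    have dle: "norm (x t \<omega> - x (s n) \<omega>) \<le> norm (2 *\<^sub>R D \<omega>)" if "\<omega> \<in> space \<Omega>" for n \<omega>
      using norm_triangle_ineq4[of "x t \<omega>" "x (s n) \<omega>"] le[OF t that] le[OF s(1)[of n] that] by simp
    have "(\<lambda>n. Lp_norm p \<Omega> (\<lambda>\<omega>. x t \<omega> - x (s n) \<omega>)) \<longlonglongrightarrow> 0"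
    proof (rule Lp_norm_dominated_tendsto_0[OF p 2 dm dle])
      show "AE \<omega> in \<Omega>. (\<lambda>n. x t \<omega> - x (s n) \<omega>) \<longlonglongrightarrow> 0"
      proof (rule AE_I2)
        fix \<omega> assume "\<omega> \<in> space \<Omega>"
        then have "(\<lambda>n. x (s n) \<omega>) \<longlonglongrightarrow> x t \<omega>"
          using continuous_on_tendsto_compose[OF xc s(2) t] s(1) by auto
        from tendsto_diff[OF tendsto_const this, of "x t \<omega>"] show "(\<lambda>n. x t \<omega> - x (s n) \<omega>) \<longlonglongrightarrow> 0" by simp
      qed
    qed
    then show "(\<lambda>n. Wp p euclidean_metric (m t) (m (s n))) \<longlonglongrightarrow> 0"
    proof (rule Lim_null_comparison[rotated], intro always_eventually allI)
      fix n
      have "Wp p euclidean_metric (m t) (m (s n)) \<le> Lp_norm p \<Omega> (\<lambda>\<omega>. x t \<omega> - x (s n) \<omega>)"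
        unfolding m[OF t] m[OF s(1)]
        by (rule Wp_distr_le[OF p xm[OF t] xm[OF s(1)] Lp_fun_mono(1)[OF p 2 dm dle]])
      then show "norm (Wp p euclidean_metric (m t) (m (s n))) \<le> Lp_norm p \<Omega> (\<lambda>\<omega>. x t \<omega> - x (s n) \<omega>)"
        by (simp add: Wp_def)
    qed
  qed
qed

lemma tendsto_payoff:
  fixes \<sigma> :: "'x::euclidean_space measure \<times> 'y::euclidean_space \<Rightarrow> real"
  assumes \<sigma>: "continuous_map (prod_topology (Wp_topology p euclidean_metric) euclidean) euclidean \<sigma>"
    and \<mu>: "\<mu> \<in> Pp p euclidean_metric" "\<And>n. \<nu> n \<in> Pp p euclidean_metric"
    and W: "(\<lambda>n. Wp p euclidean_metric \<mu> (\<nu> n)) \<longlonglongrightarrow> 0" and y: "yn \<longlonglongrightarrow> y"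
  shows "(\<lambda>n. \<sigma> (\<nu> n, yn n)) \<longlonglongrightarrow> \<sigma> (\<mu>, y)"
proof -
  have "limitin (prod_topology (Wp_topology p euclidean_metric) euclidean) (\<lambda>n. (\<nu> n, yn n)) (\<mu>, y) sequentially"
    using limitin_Wp_topology[OF \<mu> W] y by (simp add: limitin_pairwise comp_def)
  from continuous_map_limit[OF \<sigma> this] show ?thesis by (simp add: comp_def)
qed

lemma drift_minor:
  fixes f :: "real \<Rightarrow> 'x::euclidean_space \<Rightarrow> 'x measure \<Rightarrow> 'y::euclidean_space \<Rightarrow> 'u::compact_metric_space \<Rightarrow> 'x"
  assumes f: "continuous_map (prod_topology (top_of_set {0..T}) (prod_topology euclidean
         (prod_topology (Wp_topology p euclidean_metric) (prod_topology euclidean euclidean))))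
       euclidean (\<lambda>(t, x, m, y, u). f t x m y u)"
    and m: "continuous_map (top_of_set {0..T}) (Wp_topology p euclidean_metric) m"
    and y: "continuous_on {0..T} y"
  shows "drift T (\<lambda>t x u. f t x (m t) (y t) u)"
  unfolding drift_def
proof (intro allI impI)
  fix x :: "real \<Rightarrow> 'x" assume x: "continuous_on {0..T} x"
  let ?K = "top_of_set (control_domain T :: (real \<times> 'u) set)"
  have 1: "continuous_map ?K (top_of_set {0..T}) fst"
    by (auto simp: continuous_map_in_subtopology intro: continuous_intros)
  have 2: "continuous_map ?K euclidean snd" by (auto intro: continuous_intros)
  have "continuous_map ?K euclidean (\<lambda>z. x (fst z))" "continuous_map ?K euclidean (\<lambda>z. y (fst z))"
    using continuous_map_compose[OF 1, of euclidean x] continuous_map_compose[OF 1, of euclidean y] x y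
    by (auto simp: comp_def)
  moreover have "continuous_map ?K (Wp_topology p euclidean_metric) (\<lambda>z. m (fst z))"
    using continuous_map_compose[OF 1 m] by (simp add: comp_def)
  ultimately have "continuous_map ?K (prod_topology (top_of_set {0..T}) (prod_topology euclidean
         (prod_topology (Wp_topology p euclidean_metric) (prod_topology euclidean euclidean))))
     (\<lambda>z. (fst z, x (fst z), m (fst z), y (fst z), snd z))"
    using 1 2 by (intro continuous_map_pairedI) auto
  from continuous_map_compose[OF this f]
  show "continuous_on (control_domain T) (\<lambda>z. f (fst z) (x (fst z)) (m (fst z)) (y (fst z)) (snd z))"
    by (simp add: comp_def)
qed

lemma drift_major:
  fixes g :: "real \<Rightarrow> 'y::euclidean_space \<Rightarrow> 'x::euclidean_space measure \<Rightarrow> 'v::compact_metric_space \<Rightarrow> 'y"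
  assumes g: "continuous_map (prod_topology (top_of_set {0..T}) (prod_topology euclidean
         (prod_topology (Wp_topology p euclidean_metric) euclidean)))
       euclidean (\<lambda>(t, y, m, v). g t y m v)"
    and m: "continuous_map (top_of_set {0..T}) (Wp_topology p euclidean_metric) m"
  shows "drift T (\<lambda>t y v. g t y (m t) v)"
  unfolding drift_def
proof (intro allI impI)
  fix y :: "real \<Rightarrow> 'y" assume y: "continuous_on {0..T} y"
  let ?K = "top_of_set (control_domain T :: (real \<times> 'v) set)"
  have 1: "continuous_map ?K (top_of_set {0..T}) fst"
    by (auto simp: continuous_map_in_subtopology intro: continuous_intros)
  have 2: "continuous_map ?K euclidean snd" by (auto intro: continuous_intros)
  have "continuous_map ?K euclidean (\<lambda>z. y (fst z))"
    using continuous_map_compose[OF 1, of euclidean y] y by (auto simp: comp_def)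
  moreover have "continuous_map ?K (Wp_topology p euclidean_metric) (\<lambda>z. m (fst z))"
    using continuous_map_compose[OF 1 m] by (simp add: comp_def)
  ultimately have "continuous_map ?K (prod_topology (top_of_set {0..T}) (prod_topology euclidean
         (prod_topology (Wp_topology p euclidean_metric) euclidean)))
     (\<lambda>z. (fst z, y (fst z), m (fst z), snd z))"
    using 1 2 by (intro continuous_map_pairedI) auto
  from continuous_map_compose[OF this g]
  show "continuous_on (control_domain T) (\<lambda>z. g (fst z) (y (fst z)) (m (fst z)) (snd z))"
    by (simp add: comp_def)
qed


section \<open>Trajectories of the agents\<close>

text \<open>The integrability clauses hold automatically for continuous integrands on the compact
  domain.\<close>

lemma solves_minor_iff:
  fixes fI :: "real \<Rightarrow> 'x::euclidean_space \<Rightarrow> 'x measure \<Rightarrow> 'y::euclidean_space \<Rightarrow> 'u::compact_metric_space \<Rightarrow> 'x"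
    and fII :: "real \<Rightarrow> 'x \<Rightarrow> 'x measure \<Rightarrow> 'y \<Rightarrow> 'v::compact_metric_space \<Rightarrow> 'x"
  assumes T: "0 \<le> T" and \<xi>: "\<xi> \<in> relaxed_controls T" and \<zeta>: "\<zeta> \<in> relaxed_controls T"
    and dI: "drift T (\<lambda>t x u. fI t x (m t) (y t) u)" and dII: "drift T (\<lambda>t x v. fII t x (m t) (y t) v)"
  shows "solves_minor T fI fII m y x0 \<xi> \<zeta> x \<longleftrightarrow> x \<in> extensional {0..T} \<and>
    integral_curve T (\<lambda>t x u. fI t x (m t) (y t) u) (\<lambda>t x v. fII t x (m t) (y t) v) x0 \<xi> \<zeta> x"
proof -
  have "integrable \<xi> (\<lambda>z. fI (fst z) (x (fst z)) (m (fst z)) (y (fst z)) (snd z)) \<and>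
    integrable \<zeta> (\<lambda>z. fII (fst z) (x (fst z)) (m (fst z)) (y (fst z)) (snd z))" if "continuous_on {0..T} x"
    using relaxed_controls_integrable[OF \<xi> T dI[unfolded drift_def, rule_format, OF that]]
      relaxed_controls_integrable[OF \<zeta> T dII[unfolded drift_def, rule_format, OF that]] by blast
  then show ?thesis
    unfolding solves_minor_def integral_curve_def mspace_path_space case_prod_unfold by auto
qed

lemma solves_major_iff:
  fixes g :: "real \<Rightarrow> 'y::euclidean_space \<Rightarrow> 'x::euclidean_space measure \<Rightarrow> 'v::compact_metric_space \<Rightarrow> 'y"
  assumes T: "0 \<le> T" and \<zeta>: "\<zeta> \<in> relaxed_controls T"
    and d: "drift T (\<lambda>t y v. g t y (m t) v)"
  shows "solves_major T g m y0 \<zeta> y \<longleftrightarrow> y \<in> extensional {0..T} \<and>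
    integral_curve T (\<lambda>_ _ (_::'v). 0) (\<lambda>t y v. g t y (m t) v) y0 \<zeta> \<zeta> y"
proof -
  have "integrable \<zeta> (\<lambda>z. g (fst z) (y (fst z)) (m (fst z)) (snd z))" if "continuous_on {0..T} y"
    by (rule relaxed_controls_integrable[OF \<zeta> T d[unfolded drift_def, rule_format, OF that]])
  moreover have "control_integral \<zeta> t (\<lambda>z. 0 :: 'y) = 0" for t by (simp add: set_lebesgue_integral_def)
  ultimately show ?thesis
    unfolding solves_major_def integral_curve_def mspace_path_space case_prod_unfold by auto
qed

section \<open>Topology and Borel structure of the path space\<close>

lemma mspace_path_space_iff: "w \<in> mspace (path_space T) \<longleftrightarrow> w \<in> extensional {0..T} \<and> continuous_on {0..T} w"
  by (simp add: mspace_path_space)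

lemma path_space_dist_le:
  assumes "w \<in> mspace (path_space T)" "w' \<in> mspace (path_space T)" "t \<in> {0..T}"
  shows "dist (w t) (w' t) \<le> mdist (path_space T) w w'"
  using mdist_cfunspace_imp_mdist_le[of w "top_of_set {0..T}" euclidean_metric w' _ t] assms
  unfolding path_space_def by auto

lemma path_space_mdist_le:
  assumes "0 \<le> c" "\<And>t. t \<in> {0..T} \<Longrightarrow> dist (w t) (w' t) \<le> c"
  shows "mdist (path_space T) w w' \<le> c"
  unfolding path_space_def using assms by (intro mdist_cfunspace_le) auto

lemma openin_mtopology_of:
  "openin (mtopology_of X) S \<longleftrightarrow> S \<subseteq> mspace X \<and> (\<forall>x\<in>S. \<exists>r>0. \<forall>y\<in>mspace X. mdist X x y < r \<longrightarrow> y \<in> S)"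
proof -
  interpret Metric_space "mspace X" "mdist X" by (rule Metric_space_mspace_mdist)
  show ?thesis unfolding mtopology_of_def openin_mtopology by (fastforce simp: subset_iff mball_def)
qed

lemma borel_measurable_path_eval:
  assumes "t \<in> {0..T}"
  shows "(\<lambda>w. w t) \<in> borel_measurable (borel_of (mtopology_of (path_space T :: (real \<Rightarrow> 'x::euclidean_space) metric)))"
proof (rule borel_measurableI)
  fix G :: "'x set" assume G: "open G"
  let ?X = "path_space T :: (real \<Rightarrow> 'x) metric"
  have "openin (mtopology_of ?X) {w \<in> mspace ?X. w t \<in> G}"
    unfolding openin_mtopology_of
  proof (intro conjI ballI)
    fix w assume w: "w \<in> {w \<in> mspace ?X. w t \<in> G}"
    then obtain r where r: "r > 0" "\<And>x. dist x (w t) < r \<Longrightarrow> x \<in> G"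
      using G unfolding open_dist by blast
    show "\<exists>r>0. \<forall>y\<in>mspace ?X. mdist ?X w y < r \<longrightarrow> y \<in> {w \<in> mspace ?X. w t \<in> G}"
    proof (intro exI[of _ r] conjI ballI impI r(1))
      fix v assume v: "v \<in> mspace ?X" "mdist ?X w v < r"
      then have "dist (v t) (w t) < r"
        using path_space_dist_le[of w T v t] w assms by (simp add: dist_commute)
      then show "v \<in> {w \<in> mspace ?X. w t \<in> G}" using v r by blast
    qed
  qed blast
  then have "{w \<in> mspace ?X. w t \<in> G} \<in> sets (borel_of (mtopology_of ?X))" by (rule sets_borel_of_openin)
  moreover have "(\<lambda>w. w t) -` G \<inter> space (borel_of (mtopology_of ?X)) = {w \<in> mspace ?X. w t \<in> G}"
    by (auto simp: space_borel_of)
  ultimately show "(\<lambda>w. w t) -` G \<inter> space (borel_of (mtopology_of ?X)) \<in> sets (borel_of (mtopology_of ?X))" by simp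
qed

lemma borel_measurable_mdist:
  assumes "w0 \<in> mspace X"
  shows "(\<lambda>w. mdist X w w0) \<in> borel_measurable (borel_of (mtopology_of X))"
  unfolding borel_measurable_iff_less
proof
  fix a
  have "openin (mtopology_of X) {w \<in> mspace X. mdist X w w0 < a}"
    unfolding openin_mtopology_of
  proof (intro conjI ballI)
    fix w assume w: "w \<in> {w \<in> mspace X. mdist X w w0 < a}"
    show "\<exists>r>0. \<forall>y\<in>mspace X. mdist X w y < r \<longrightarrow> y \<in> {w \<in> mspace X. mdist X w w0 < a}"
    proof (intro exI[of _ "a - mdist X w w0"] conjI ballI impI)
      fix v assume v: "v \<in> mspace X" "mdist X w v < a - mdist X w w0"
      have "mdist X v w0 \<le> mdist X v w + mdist X w w0"
        using mdist_triangle[of v X w w0] v w assms by simp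
      then show "v \<in> {w \<in> mspace X. mdist X w w0 < a}" using v by (simp add: mdist_commute)
    qed (use w in simp)
  qed blast
  then show "{w \<in> space (borel_of (mtopology_of X)). mdist X w w0 < a} \<in> sets (borel_of (mtopology_of X))"
    using sets_borel_of_openin by (simp add: space_borel_of)
qed

section \<open>The equations of the agents for a given curve of laws\<close>

locale mean_field_game =
  fixes T p A :: real
    and fI :: "real \<Rightarrow> 'x::euclidean_space \<Rightarrow> 'x measure \<Rightarrow> 'y::euclidean_space \<Rightarrow> 'u::compact_metric_space \<Rightarrow> 'x"
    and fII :: "real \<Rightarrow> 'x \<Rightarrow> 'x measure \<Rightarrow> 'y \<Rightarrow> 'v::compact_metric_space \<Rightarrow> 'x"
    and g :: "real \<Rightarrow> 'y \<Rightarrow> 'x measure \<Rightarrow> 'v \<Rightarrow> 'y"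
    and m0 :: "'x measure" and y0 :: 'y
  assumes T: "T > 0" and p: "p \<ge> 1" and A: "A > 0"
    and f_SLLL: "(fI, fII) \<in> SLLL_sub0 T p A" and g_SLLL: "g \<in> SLLL_sup0 T p A"
    and m0: "m0 \<in> Pp p euclidean_metric"
begin

abbreviation "state_law_space \<equiv> Pp p (euclidean_metric :: 'x metric)"
abbreviation "W \<equiv> Wp p (euclidean_metric :: 'x metric)"

lemma T0: "0 \<le> T" using T by simp

lemma W_nonneg: "0 \<le> W \<mu> \<nu>" by (simp add: Wp_def)

lemma f_growth:
  assumes "t \<in> {0..T}" "\<mu> \<in> state_law_space"
  shows "norm (fI t x \<mu> y u) \<le> A * (norm x + (1 + varsigma p \<mu> + norm y))"
    and "norm (fII t x \<mu> y v) \<le> A * (norm x + (1 + varsigma p \<mu> + norm y))"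
proof -
  have *: "norm (fI t x \<mu> y u) + norm (fII t x \<mu> y v) \<le> A * (1 + norm x + varsigma p \<mu> + norm y)" for u v
    using f_SLLL assms by (auto simp: SLLL_sub0_def)
  have e: "A * (norm x + (1 + varsigma p \<mu> + norm y)) = A * (1 + norm x + varsigma p \<mu> + norm y)"
    by (simp add: algebra_simps)
  show "norm (fI t x \<mu> y u) \<le> A * (norm x + (1 + varsigma p \<mu> + norm y))"
    unfolding e using *[of u undefined] norm_ge_zero[of "fII t x \<mu> y undefined"] by linarith
  show "norm (fII t x \<mu> y v) \<le> A * (norm x + (1 + varsigma p \<mu> + norm y))"
    unfolding e using *[of undefined v] norm_ge_zero[of "fI t x \<mu> y undefined"] by linarith
qed

lemma g_growth:
  assumes "t \<in> {0..T}" "\<mu> \<in> state_law_space"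
  shows "norm (g t y \<mu> v) \<le> A * (norm y + (1 + varsigma p \<mu>))"
proof -
  have "norm (g t y \<mu> v) \<le> A * (1 + norm y + varsigma p \<mu>)"
    using g_SLLL assms by (auto simp: SLLL_sup0_def)
  then show ?thesis by (simp add: algebra_simps)
qed

text \<open>One nonnegative constant for both parts of f and for g. The Wasserstein and y terms are
  bracketed together because they enter the comparison of trajectories as one perturbation.\<close>

definition lipschitz_const :: "real \<Rightarrow> real \<Rightarrow> bool" where
  "lipschitz_const c B \<longleftrightarrow> 0 \<le> B \<and> (\<forall>t\<in>{0..T}. \<forall>\<mu>\<in>state_law_space. \<forall>\<nu>\<in>state_law_space. \<forall>y y'.
     varsigma p \<mu> \<le> c \<longrightarrow> varsigma p \<nu> \<le> c \<longrightarrow> norm y \<le> c \<longrightarrow> norm y' \<le> c \<longrightarrow>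
     (\<forall>x x' u. norm (fI t x \<mu> y u - fI t x' \<nu> y' u) \<le> B * (norm (x - x') + (W \<mu> \<nu> + norm (y - y')))) \<and>
     (\<forall>x x' v. norm (fII t x \<mu> y v - fII t x' \<nu> y' v) \<le> B * (norm (x - x') + (W \<mu> \<nu> + norm (y - y')))) \<and>
     (\<forall>v. norm (g t y \<mu> v - g t y' \<nu> v) \<le> B * (norm (y - y') + W \<mu> \<nu>)))"

lemma lipschitz_const_exists: "\<exists>B. lipschitz_const c B"
proof -
  obtain BI BII where f: "\<And>t x1 x2 m1 m2 y1 y2 u v. t \<in> {0..T} \<Longrightarrow> m1 \<in> state_law_space \<Longrightarrow> m2 \<in> state_law_space \<Longrightarrow>
    varsigma p m1 \<le> c \<and> varsigma p m2 \<le> c \<and> norm y1 \<le> c \<and> norm y2 \<le> c \<Longrightarrow>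
          norm (fI t x1 m1 y1 u - fI t x2 m2 y2 u) \<le> BI * (norm (x1 - x2) + W m1 m2 + norm (y1 - y2)) \<and>
          norm (fII t x1 m1 y1 v - fII t x2 m2 y2 v) \<le> BII * (norm (x1 - x2) + W m1 m2 + norm (y1 - y2))"
  proof -
    have "\<exists>BI BII. \<forall>t\<in>{0..T}. \<forall>x1 x2. \<forall>m1\<in>state_law_space. \<forall>m2\<in>state_law_space. \<forall>y1 y2 u v.
        varsigma p m1 \<le> c \<and> varsigma p m2 \<le> c \<and> norm y1 \<le> c \<and> norm y2 \<le> c \<longrightarrow>
          norm (fI t x1 m1 y1 u - fI t x2 m2 y2 u) \<le> BI * (norm (x1 - x2) + W m1 m2 + norm (y1 - y2)) \<and>
          norm (fII t x1 m1 y1 v - fII t x2 m2 y2 v) \<le> BII * (norm (x1 - x2) + W m1 m2 + norm (y1 - y2))"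
      using f_SLLL unfolding SLLL_sub0_def by blast
    then show ?thesis using that by blast
  qed
  obtain B where g: "\<And>t y1 y2 m1 m2 v. t \<in> {0..T} \<Longrightarrow> m1 \<in> state_law_space \<Longrightarrow> m2 \<in> state_law_space \<Longrightarrow>
        norm y1 \<le> c \<and> norm y2 \<le> c \<and> varsigma p m1 \<le> c \<and> varsigma p m2 \<le> c \<Longrightarrow>
          norm (g t y1 m1 v - g t y2 m2 v) \<le> B * (norm (y1 - y2) + W m1 m2)"
  proof -
    have "\<exists>B. \<forall>t\<in>{0..T}. \<forall>y1 y2. \<forall>m1\<in>state_law_space. \<forall>m2\<in>state_law_space. \<forall>v.
        norm y1 \<le> c \<and> norm y2 \<le> c \<and> varsigma p m1 \<le> c \<and> varsigma p m2 \<le> c \<longrightarrow>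
          norm (g t y1 m1 v - g t y2 m2 v) \<le> B * (norm (y1 - y2) + W m1 m2)"
      using g_SLLL unfolding SLLL_sup0_def by blast
    then show ?thesis using that by blast
  qed
  define C where "C = max 0 (max BI (max BII B))"
  have C: "BI \<le> C" "BII \<le> C" "B \<le> C" "0 \<le> C" by (auto simp: C_def)
  have le: "K * S \<le> C * S" if "K \<le> C" "0 \<le> S" for K S using that by (rule mult_right_mono)
  have "lipschitz_const c C"
    unfolding lipschitz_const_def
  proof (intro conjI ballI allI impI C(4))
    fix t \<mu> \<nu> y y'
    assume h: "t \<in> {0..T}" "\<mu> \<in> state_law_space" "\<nu> \<in> state_law_space" "varsigma p \<mu> \<le> c" "varsigma p \<nu> \<le> c"
      "norm (y :: 'y) \<le> c" "norm (y' :: 'y) \<le> c"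
    note F = f[OF h(1-3), of y y'] and G = g[OF h(1-3), of y y']
    show "norm (fI t x \<mu> y u - fI t x' \<nu> y' u) \<le> C * (norm (x - x') + (W \<mu> \<nu> + norm (y - y')))" for x x' u
      using F[of x u x' undefined] h le[OF C(1), of "norm (x - x') + W \<mu> \<nu> + norm (y - y')"] W_nonneg[of \<mu> \<nu>]
      by (auto simp: add.assoc intro: order_trans)
    show "norm (fII t x \<mu> y v - fII t x' \<nu> y' v) \<le> C * (norm (x - x') + (W \<mu> \<nu> + norm (y - y')))" for x x' v
      using F[of x undefined x' v] h le[OF C(2), of "norm (x - x') + W \<mu> \<nu> + norm (y - y')"] W_nonneg[of \<mu> \<nu>]
      by (auto simp: add.assoc intro: order_trans)
    show "norm (g t y \<mu> v - g t y' \<nu> v) \<le> C * (norm (y - y') + W \<mu> \<nu>)" for v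
      using G[of v] h le[OF C(3), of "norm (y - y') + W \<mu> \<nu>"] W_nonneg[of \<mu> \<nu>]
      by (auto intro: order_trans)
  qed
  then show ?thesis by blast
qed

text \<open>Continuity of the laws makes the integrands continuous, and bounded moments give access
  to the local Lipschitz constants. The moment bound is recorded instead of being derived from
  continuity.\<close>

definition flow :: "(real \<Rightarrow> 'x measure) \<Rightarrow> bool" where
  "flow m \<longleftrightarrow> continuous_map (top_of_set {0..T}) (Wp_topology p euclidean_metric) m \<and>
     (\<exists>c. \<forall>t\<in>{0..T}. varsigma p (m t) \<le> c)"

lemma flow_in: "flow m \<Longrightarrow> t \<in> {0..T} \<Longrightarrow> m t \<in> state_law_space"
  using continuous_map_image_subset_topspace[of "top_of_set {0..T}" "Wp_topology p (euclidean_metric :: 'x metric)" m]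
  by (auto simp: flow_def)

abbreviation "driftI m y \<equiv> \<lambda>t x u. fI t x (m t) (y t) u"
abbreviation "driftII m y \<equiv> \<lambda>t x v. fII t x (m t) (y t) v"
abbreviation "driftG m \<equiv> \<lambda>t y v. g t y (m t) v"
abbreviation "drift0 \<equiv> \<lambda>(_::real) (_::'y) (_::'v). (0 :: 'y)"

lemma drifts:
  assumes "flow m" "continuous_on {0..T} y"
  shows "drift T (driftI m y)" "drift T (driftII m y)"
  using assms f_SLLL by (auto simp: SLLL_sub0_def flow_def intro!: drift_minor)

lemma drift_g:
  assumes "flow m"
  shows "drift T (driftG m)"
  using assms g_SLLL by (auto simp: SLLL_sup0_def flow_def intro!: drift_major)

lemma flow_bounds:
  assumes m: "flow m" and y: "continuous_on {0..T} y"
  obtains c where "0 \<le> c" "\<And>t. t \<in> {0..T} \<Longrightarrow> varsigma p (m t) \<le> c" "\<And>t. t \<in> {0..T} \<Longrightarrow> norm (y t) \<le> c"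
proof -
  obtain c1 where c1: "\<And>t. t \<in> {0..T} \<Longrightarrow> varsigma p (m t) \<le> c1" using m unfolding flow_def by blast
  obtain c2 where c2: "0 \<le> c2" "\<And>t. t \<in> {0..T} \<Longrightarrow> norm (y t) \<le> c2" using continuous_on_Icc_bound[OF y] by blast
  show ?thesis by (rule that[of "max c1 c2"]) (use c1 c2 in fastforce)+
qed

text \<open>The coupling used is the identity with itself.\<close>

lemma W_self:
  assumes "\<mu> \<in> state_law_space"
  shows "W \<mu> \<mu> = 0"
proof -
  have s: "sets \<mu> = sets borel" using assms by (simp add: Pp_euclidean_iff)
  have m: "(\<lambda>x. x) \<in> borel_measurable \<mu>" using measurable_ident_sets[OF s] by simp
  have "distr \<mu> borel (\<lambda>x. x) = distr \<mu> \<mu> (\<lambda>x. x)" by (rule distr_cong) (auto simp: s)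
  then have "distr \<mu> borel (\<lambda>x. x) = \<mu>" by simp
  moreover have "Lp_fun p \<mu> (\<lambda>x. x - x :: 'x)" "Lp_norm p \<mu> (\<lambda>x. x - x :: 'x) = 0"
    using p by (auto simp: Lp_fun_def Lp_norm_def)
  ultimately show ?thesis
    using Wp_distr_le[OF p m m] W_nonneg[of \<mu> \<mu>] by simp
qed

abbreviation "minor m y x0 \<xi> \<zeta> \<equiv> traj_minor T fI fII m y x0 \<xi> \<zeta>"
abbreviation "major m \<zeta> \<equiv> traj_major T g m y0 \<zeta>"

text \<open>Only existence and uniqueness together give \<open>traj_minor\<close> a meaning, since
  it is defined by \<open>THE\<close>.\<close>

lemma minor_curve:
  assumes m: "flow m" and y: "continuous_on {0..T} y" and \<xi>: "\<xi> \<in> relaxed_controls T" and \<zeta>: "\<zeta> \<in> relaxed_controls T"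
  shows "integral_curve T (driftI m y) (driftII m y) x0 \<xi> \<zeta> (minor m y x0 \<xi> \<zeta>)"
    and "minor m y x0 \<xi> \<zeta> \<in> extensional {0..T}"
proof -
  obtain c where c: "0 \<le> c" "\<And>t. t \<in> {0..T} \<Longrightarrow> varsigma p (m t) \<le> c" "\<And>t. t \<in> {0..T} \<Longrightarrow> norm (y t) \<le> c"
    using flow_bounds[OF m y] by blast
  obtain B where B: "lipschitz_const c B" using lipschitz_const_exists by blast
  have gr: "A * (norm x + (1 + varsigma p (m t) + norm (y t))) \<le> A * (1 + 2 * c) * (1 + norm x)" if "t \<in> {0..T}" for t and x :: 'x
  proof -
    have "norm x + (1 + varsigma p (m t) + norm (y t)) \<le> (1 + 2 * c) * (1 + norm x)"
      using c(2,3)[OF that] mult_nonneg_nonneg[OF c(1) norm_ge_zero[of x]] by (simp add: algebra_simps)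
    then show ?thesis using A by (simp add: mult.assoc)
  qed
  have lip: "\<exists>B\<ge>0. \<forall>t\<in>{0..T}. \<forall>x x' u v. norm x \<le> c' \<longrightarrow> norm x' \<le> c' \<longrightarrow>
      norm (driftI m y t x u - driftI m y t x' u) \<le> B * norm (x - x') \<and> norm (driftII m y t x v - driftII m y t x' v) \<le> B * norm (x - x')" for c'
  proof (intro exI[of _ B] conjI ballI allI impI)
    show "0 \<le> B" using B by (simp add: lipschitz_const_def)
    fix t x x' u v assume t: "t \<in> {0..T}"
    note h = t flow_in[OF m t] c(2)[OF t] c(3)[OF t] W_self[OF flow_in[OF m t]]
    show "norm (driftI m y t x u - driftI m y t x' u) \<le> B * norm (x - x')"
      "norm (driftII m y t x v - driftII m y t x' v) \<le> B * norm (x - x')"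
      using B[unfolded lipschitz_const_def, THEN conjunct2, rule_format, OF h(1,2,2,3,3,4,4)] h(5) by auto
  qed
  have "\<exists>x. integral_curve T (driftI m y) (driftII m y) x0 \<xi> \<zeta> x"
  proof (rule integral_curve_exists[OF T0 \<xi> \<zeta> drifts[OF m y] _ _ _ lip])
    show "0 \<le> A * (1 + 2 * c)" using A c by simp
    show "norm (driftI m y t x u) \<le> A * (1 + 2 * c) * (1 + norm x)" if "t \<in> {0..T}" for t x u
      using f_growth(1)[OF that flow_in[OF m that]] gr[OF that] by (rule order_trans)
    show "norm (driftII m y t x u) \<le> A * (1 + 2 * c) * (1 + norm x)" if "t \<in> {0..T}" for t x u
      using f_growth(2)[OF that flow_in[OF m that]] gr[OF that] by (rule order_trans)
  qed
  then obtain x where x: "integral_curve T (driftI m y) (driftII m y) x0 \<xi> \<zeta> x" by blast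
  note iff = solves_minor_iff[where fI = fI and fII = fII and m = m and y = y, OF T0 \<xi> \<zeta> drifts[OF m y]]
  \<comment> \<open>Uniqueness holds among extensional paths; the integrals do not notice the
    change, as controls live over [0,T].\<close>
  define x' where "x' = restrict x {0..T}"
  have eq: "x' t = x t" if "t \<in> {0..T}" for t using that by (simp add: x'_def)
  have "integral_curve T (driftI m y) (driftII m y) x0 \<xi> \<zeta> x'"
    unfolding integral_curve_def
  proof (intro conjI ballI)
    show "continuous_on {0..T} x'"
      by (rule continuous_on_eq[OF integral_curve_continuous[OF x]]) (simp add: eq)
    fix t assume t: "t \<in> {0..T}"
    have "control_integral \<xi> t (\<lambda>z. driftI m y (fst z) (x' (fst z)) (snd z)) = control_integral \<xi> t (\<lambda>z. driftI m y (fst z) (x (fst z)) (snd z))"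
      "control_integral \<zeta> t (\<lambda>z. driftII m y (fst z) (x' (fst z)) (snd z)) = control_integral \<zeta> t (\<lambda>z. driftII m y (fst z) (x (fst z)) (snd z))"
      unfolding set_lebesgue_integral_def using relaxed_controls_space[OF \<xi>] relaxed_controls_space[OF \<zeta>] eq
      by (auto intro!: Bochner_Integration.integral_cong)
    then show "x' t = x0 + control_integral \<xi> t (\<lambda>z. driftI m y (fst z) (x' (fst z)) (snd z)) +
        control_integral \<zeta> t (\<lambda>z. driftII m y (fst z) (x' (fst z)) (snd z))"
      using x t eq[OF t] by (simp add: integral_curve_def)
  qed
  then have s: "solves_minor T fI fII m y x0 \<xi> \<zeta> x'"
    unfolding iff by (simp add: x'_def)
  have "solves_minor T fI fII m y x0 \<xi> \<zeta> (minor m y x0 \<xi> \<zeta>)"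
    unfolding traj_minor_def
  proof (rule theI[where P = "solves_minor T fI fII m y x0 \<xi> \<zeta>", OF s])
    fix z assume z: "solves_minor T fI fII m y x0 \<xi> \<zeta> z"
    show "z = x'"
    proof (rule extensionalityI[of _ "{0..T}"])
      show "z \<in> extensional {0..T}" "x' \<in> extensional {0..T}" using z s by (simp_all add: iff)
      show "z t = x' t" if "t \<in> {0..T}" for t
        using integral_curve_unique[OF T0 \<xi> \<zeta> drifts[OF m y] lip _ _ that, of x0 z x'] z s by (simp add: iff)
    qed
  qed
  then show "integral_curve T (driftI m y) (driftII m y) x0 \<xi> \<zeta> (minor m y x0 \<xi> \<zeta>)"
    and "minor m y x0 \<xi> \<zeta> \<in> extensional {0..T}" by (simp_all add: iff)
qed

lemma major_curve:
  assumes m: "flow m" and \<zeta>: "\<zeta> \<in> relaxed_controls T"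
  shows "integral_curve T drift0 (driftG m) y0 \<zeta> \<zeta> (major m \<zeta>)"
    and "major m \<zeta> \<in> extensional {0..T}"
proof -
  obtain c where c: "0 \<le> c" "\<And>t. t \<in> {0..T} \<Longrightarrow> varsigma p (m t) \<le> c"
    using flow_bounds[OF m, of "\<lambda>_. 0"] by (metis continuous_on_const)
  have lip: "\<exists>B\<ge>0. \<forall>t\<in>{0..T}. \<forall>x x' u v. norm x \<le> c' \<longrightarrow> norm x' \<le> c' \<longrightarrow>
      norm (drift0 t x u - drift0 t x' u) \<le> B * norm (x - x') \<and> norm (driftG m t x v - driftG m t x' v) \<le> B * norm (x - x')" for c'
  proof -
    obtain B where B: "lipschitz_const (max c c') B" using lipschitz_const_exists by blast
    show ?thesis
    proof (intro exI[of _ B] conjI ballI allI impI)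
      show B0: "0 \<le> B" using B by (simp add: lipschitz_const_def)
      fix t and x x' :: 'y and u v assume t: "t \<in> {0..T}" and x: "norm x \<le> c'" "norm x' \<le> c'"
      have h: "varsigma p (m t) \<le> max c c'" "norm x \<le> max c c'" "norm x' \<le> max c c'" using c(2)[OF t] x by auto
      show "norm (drift0 t x u - drift0 t x' u) \<le> B * norm (x - x')" using B0 by simp
      show "norm (driftG m t x v - driftG m t x' v) \<le> B * norm (x - x')"
        using B[unfolded lipschitz_const_def, THEN conjunct2, rule_format, OF t flow_in[OF m t] flow_in[OF m t] h(1,1,2,3)]
          W_self[OF flow_in[OF m t]] by auto
    qed
  qed
  have "\<exists>x. integral_curve T drift0 (driftG m) y0 \<zeta> \<zeta> x"
  proof (rule integral_curve_exists[OF T0 \<zeta> \<zeta> drift_zero drift_g[OF m] _ _ _ lip])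
    show "0 \<le> A * (1 + c)" using A c by simp
    then show "norm (drift0 t x u) \<le> A * (1 + c) * (1 + norm x)" if "t \<in> {0..T}" for t x u by simp
    show "norm (driftG m t x u) \<le> A * (1 + c) * (1 + norm x)" if t: "t \<in> {0..T}" for t x u
    proof (rule order_trans[OF g_growth[OF t flow_in[OF m t]]])
      have "norm x + (1 + varsigma p (m t)) \<le> (1 + c) * (1 + norm x)"
        using c(2)[OF t] mult_nonneg_nonneg[OF c(1) norm_ge_zero[of x]] by (simp add: algebra_simps)
      then show "A * (norm x + (1 + varsigma p (m t))) \<le> A * (1 + c) * (1 + norm x)"
        using A by (simp add: mult.assoc)
    qed
  qed
  then obtain x where x: "integral_curve T drift0 (driftG m) y0 \<zeta> \<zeta> x" by blast
  note iff = solves_major_iff[where g = g and m = m, OF T0 \<zeta> drift_g[OF m]]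
  define x' where "x' = restrict x {0..T}"
  have eq: "x' t = x t" if "t \<in> {0..T}" for t using that by (simp add: x'_def)
  have "integral_curve T drift0 (driftG m) y0 \<zeta> \<zeta> x'"
    unfolding integral_curve_def
  proof (intro conjI ballI)
    show "continuous_on {0..T} x'"
      by (rule continuous_on_eq[OF integral_curve_continuous[OF x]]) (simp add: eq)
    fix t assume t: "t \<in> {0..T}"
    have "control_integral \<zeta> t (\<lambda>z. driftG m (fst z) (x' (fst z)) (snd z)) = control_integral \<zeta> t (\<lambda>z. driftG m (fst z) (x (fst z)) (snd z))"
      unfolding set_lebesgue_integral_def using relaxed_controls_space[OF \<zeta>] eq
      by (auto intro!: Bochner_Integration.integral_cong)
    then show "x' t = y0 + control_integral \<zeta> t (\<lambda>z. drift0 (fst z) (x' (fst z)) (snd z)) +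
        control_integral \<zeta> t (\<lambda>z. driftG m (fst z) (x' (fst z)) (snd z))"
      using x t eq[OF t] by (simp add: integral_curve_def)
  qed
  then have s: "solves_major T g m y0 \<zeta> x'"
    unfolding iff by (simp add: x'_def)
  have "solves_major T g m y0 \<zeta> (major m \<zeta>)"
    unfolding traj_major_def
  proof (rule theI[where P = "solves_major T g m y0 \<zeta>", OF s])
    fix z assume z: "solves_major T g m y0 \<zeta> z"
    show "z = x'"
    proof (rule extensionalityI[of _ "{0..T}"])
      show "z \<in> extensional {0..T}" "x' \<in> extensional {0..T}" using z s by (simp_all add: iff)
      show "z t = x' t" if "t \<in> {0..T}" for t
        using integral_curve_unique[OF T0 \<zeta> \<zeta> drift_zero drift_g[OF m] lip _ _ that, of y0 z x'] z s by (simp add: iff)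
    qed
  qed
  then show "integral_curve T drift0 (driftG m) y0 \<zeta> \<zeta> (major m \<zeta>)"
    and "major m \<zeta> \<in> extensional {0..T}" by (simp_all add: iff)
qed

end


section \<open>Comparison of trajectories\<close>

context mean_field_game
begin

lemma minor_continuous:
  assumes "flow m" "continuous_on {0..T} y" "\<xi> \<in> relaxed_controls T" "\<zeta> \<in> relaxed_controls T"
  shows "continuous_on {0..T} (minor m y x0 \<xi> \<zeta>)"
  by (rule integral_curve_continuous[OF minor_curve(1)[OF assms]])

lemma major_continuous:
  assumes "flow m" "\<zeta> \<in> relaxed_controls T"
  shows "continuous_on {0..T} (major m \<zeta>)"
  by (rule integral_curve_continuous[OF major_curve(1)[OF assms]])

lemma minor_compare:
  assumes m: "flow m" "flow m'" and y: "continuous_on {0..T} y" "continuous_on {0..T} y'"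
    and \<xi>: "\<xi> \<in> relaxed_controls T" "\<xi>' \<in> relaxed_controls T" and \<zeta>: "\<zeta> \<in> relaxed_controls T" "\<zeta>' \<in> relaxed_controls T"
    and c: "\<And>t. t \<in> {0..T} \<Longrightarrow> varsigma p (m t) \<le> c" "\<And>t. t \<in> {0..T} \<Longrightarrow> varsigma p (m' t) \<le> c"
      "\<And>t. t \<in> {0..T} \<Longrightarrow> norm (y t) \<le> c" "\<And>t. t \<in> {0..T} \<Longrightarrow> norm (y' t) \<le> c"
    and B: "lipschitz_const c B" and l: "0 < l" "4 * B \<le> l" and k: "0 \<le> k" and \<rho>: "0 \<le> \<rho>"
    and d: "\<And>t. t \<in> {0..T} \<Longrightarrow> W (m t) (m' t) + norm (y t - y' t) \<le> k * exp (l * t)"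
    and err: "\<And>t. t \<in> {0..T} \<Longrightarrow> norm (x0 - x0')
      + norm (control_integral \<xi> t (\<lambda>z. driftI m' y' (fst z) (minor m' y' x0' \<xi>' \<zeta>' (fst z)) (snd z))
          - control_integral \<xi>' t (\<lambda>z. driftI m' y' (fst z) (minor m' y' x0' \<xi>' \<zeta>' (fst z)) (snd z)))
      + norm (control_integral \<zeta> t (\<lambda>z. driftII m' y' (fst z) (minor m' y' x0' \<xi>' \<zeta>' (fst z)) (snd z))
          - control_integral \<zeta>' t (\<lambda>z. driftII m' y' (fst z) (minor m' y' x0' \<xi>' \<zeta>' (fst z)) (snd z))) \<le> \<rho>"
    and t: "t \<in> {0..T}"
  shows "norm (minor m y x0 \<xi> \<zeta> t - minor m' y' x0' \<xi>' \<zeta>' t) \<le> (2 * \<rho> + 4 * B * k / l) * exp (l * t)"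
proof (rule integral_curve_compare[OF T0 \<xi> \<zeta> drifts(1)[OF m(1) y(1)] drifts(1)[OF m(2) y(2)] drifts(2)[OF m(1) y(1)]
      drifts(2)[OF m(2) y(2)] minor_curve(1)[OF m(1) y(1) \<xi>(1) \<zeta>(1)] minor_curve(1)[OF m(2) y(2) \<xi>(2) \<zeta>(2)] _ l k \<rho> _ _ err t])
  show B0: "0 \<le> B" using B by (simp add: lipschitz_const_def)
  fix s u v assume s: "s \<in> {0..T}"
  note L = B[unfolded lipschitz_const_def, THEN conjunct2, rule_format, OF s flow_in[OF m(1) s] flow_in[OF m(2) s] c[OF s]]
  have le: "B * (n + (W (m s) (m' s) + norm (y s - y' s))) \<le> B * (n + k * exp (l * s))" for n
    using d[OF s] by (intro mult_left_mono B0) simp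
  show "norm (driftI m y s (minor m y x0 \<xi> \<zeta> s) u - driftI m' y' s (minor m' y' x0' \<xi>' \<zeta>' s) u)
     \<le> B * (norm (minor m y x0 \<xi> \<zeta> s - minor m' y' x0' \<xi>' \<zeta>' s) + k * exp (l * s))"
    using L le order_trans by blast
  show "norm (driftII m y s (minor m y x0 \<xi> \<zeta> s) v - driftII m' y' s (minor m' y' x0' \<xi>' \<zeta>' s) v)
     \<le> B * (norm (minor m y x0 \<xi> \<zeta> s - minor m' y' x0' \<xi>' \<zeta>' s) + k * exp (l * s))"
    using L le order_trans by blast
qed

lemma minor_compare_same:
  assumes m: "flow m" "flow m'" and y: "continuous_on {0..T} y" "continuous_on {0..T} y'"
    and \<xi>: "\<xi> \<in> relaxed_controls T" and \<zeta>: "\<zeta> \<in> relaxed_controls T"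
    and c: "\<And>t. t \<in> {0..T} \<Longrightarrow> varsigma p (m t) \<le> c" "\<And>t. t \<in> {0..T} \<Longrightarrow> varsigma p (m' t) \<le> c"
      "\<And>t. t \<in> {0..T} \<Longrightarrow> norm (y t) \<le> c" "\<And>t. t \<in> {0..T} \<Longrightarrow> norm (y' t) \<le> c"
    and B: "lipschitz_const c B" and l: "0 < l" "4 * B \<le> l" and k: "0 \<le> k"
    and d: "\<And>t. t \<in> {0..T} \<Longrightarrow> W (m t) (m' t) + norm (y t - y' t) \<le> k * exp (l * t)"
    and t: "t \<in> {0..T}"
  shows "norm (minor m y x0 \<xi> \<zeta> t - minor m' y' x0 \<xi> \<zeta> t) \<le> (4 * B * k / l) * exp (l * t)"
  using minor_compare[OF m y \<xi> \<xi> \<zeta> \<zeta> c B l k order_refl d _ t, of x0 x0] by simp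

lemma major_compare:
  assumes m: "flow m" "flow m'" and \<zeta>: "\<zeta> \<in> relaxed_controls T" "\<zeta>' \<in> relaxed_controls T"
    and c: "\<And>t. t \<in> {0..T} \<Longrightarrow> varsigma p (m t) \<le> c" "\<And>t. t \<in> {0..T} \<Longrightarrow> varsigma p (m' t) \<le> c"
      "\<And>t. t \<in> {0..T} \<Longrightarrow> norm (major m \<zeta> t) \<le> c" "\<And>t. t \<in> {0..T} \<Longrightarrow> norm (major m' \<zeta>' t) \<le> c"
    and B: "lipschitz_const c B" and l: "0 < l" "4 * B \<le> l" and k: "0 \<le> k" and \<rho>: "0 \<le> \<rho>"
    and d: "\<And>t. t \<in> {0..T} \<Longrightarrow> W (m t) (m' t) \<le> k * exp (l * t)"
    and err: "\<And>t. t \<in> {0..T} \<Longrightarrow>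
      norm (control_integral \<zeta> t (\<lambda>z. driftG m' (fst z) (major m' \<zeta>' (fst z)) (snd z))
          - control_integral \<zeta>' t (\<lambda>z. driftG m' (fst z) (major m' \<zeta>' (fst z)) (snd z))) \<le> \<rho>"
    and t: "t \<in> {0..T}"
  shows "norm (major m \<zeta> t - major m' \<zeta>' t) \<le> (2 * \<rho> + 4 * B * k / l) * exp (l * t)"
proof (rule integral_curve_compare[OF T0 \<zeta> \<zeta> drift_zero drift_zero drift_g[OF m(1)] drift_g[OF m(2)]
      major_curve(1)[OF m(1) \<zeta>(1)] major_curve(1)[OF m(2) \<zeta>(2)] _ l k \<rho> _ _ _ t])
  show B0: "0 \<le> B" using B by (simp add: lipschitz_const_def)
  have z: "control_integral \<eta> s (\<lambda>z. 0 :: 'y) = 0" for \<eta> :: "(real \<times> 'v) measure" and s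
    by (simp add: set_lebesgue_integral_def)
  fix s v assume s: "s \<in> {0..T}"
  note L = B[unfolded lipschitz_const_def, THEN conjunct2, rule_format, OF s flow_in[OF m(1) s] flow_in[OF m(2) s] c[OF s]]
  have le: "B * (n + W (m s) (m' s)) \<le> B * (n + k * exp (l * s))" for n
    using d[OF s] by (intro mult_left_mono B0) simp
  show "norm ((0 :: 'y) - 0) \<le> B * (norm (major m \<zeta> s - major m' \<zeta>' s) + k * exp (l * s))"
    using B0 k by simp
  show "norm (driftG m s (major m \<zeta> s) v - driftG m' s (major m' \<zeta>' s) v)
     \<le> B * (norm (major m \<zeta> s - major m' \<zeta>' s) + k * exp (l * s))"
    using L le order_trans by blast
  show "norm (y0 - y0) + norm (control_integral \<zeta> s (\<lambda>z. 0 :: 'y) - control_integral \<zeta>' s (\<lambda>z. 0 :: 'y)) +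
     norm (control_integral \<zeta> s (\<lambda>z. driftG m' (fst z) (major m' \<zeta>' (fst z)) (snd z))
          - control_integral \<zeta>' s (\<lambda>z. driftG m' (fst z) (major m' \<zeta>' (fst z)) (snd z))) \<le> \<rho>"
    using err[OF s] by (simp add: z)
qed

lemma minor_growth:
  assumes m: "flow m" and y: "continuous_on {0..T} y" and \<xi>: "\<xi> \<in> relaxed_controls T" and \<zeta>: "\<zeta> \<in> relaxed_controls T"
    and l: "4 * A \<le> l" and k: "0 \<le> k"
    and le: "\<And>t. t \<in> {0..T} \<Longrightarrow> 1 + varsigma p (m t) + norm (y t) \<le> k * exp (l * t)" and t: "t \<in> {0..T}"
  shows "norm (minor m y x0 \<xi> \<zeta> t) \<le> (2 * norm x0 + 4 * A * k / l) * exp (l * t)"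
proof (rule integral_curve_growth[OF T0 \<xi> \<zeta> drifts[OF m y] minor_curve(1)[OF m y \<xi> \<zeta>] _ _ l k _ _ t])
  show "0 \<le> A" "0 < l" using A l by auto
  have mono: "A * (n + (1 + varsigma p (m s) + norm (y s))) \<le> A * (n + k * exp (l * s))" if "s \<in> {0..T}" for n s
    using le[OF that] A by simp
  show "norm (driftI m y s (minor m y x0 \<xi> \<zeta> s) u) \<le> A * (norm (minor m y x0 \<xi> \<zeta> s) + k * exp (l * s))" if "s \<in> {0..T}" for s u
    by (rule order_trans[OF f_growth(1)[OF that flow_in[OF m that]] mono[OF that]])
  show "norm (driftII m y s (minor m y x0 \<xi> \<zeta> s) u) \<le> A * (norm (minor m y x0 \<xi> \<zeta> s) + k * exp (l * s))" if "s \<in> {0..T}" for s u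
    by (rule order_trans[OF f_growth(2)[OF that flow_in[OF m that]] mono[OF that]])
qed

lemma major_growth:
  assumes m: "flow m" and \<zeta>: "\<zeta> \<in> relaxed_controls T"
    and l: "4 * A \<le> l" and k: "0 \<le> k"
    and le: "\<And>t. t \<in> {0..T} \<Longrightarrow> 1 + varsigma p (m t) \<le> k * exp (l * t)" and t: "t \<in> {0..T}"
  shows "norm (major m \<zeta> t) \<le> (2 * norm y0 + 4 * A * k / l) * exp (l * t)"
proof (rule integral_curve_growth[OF T0 \<zeta> \<zeta> drift_zero drift_g[OF m] major_curve(1)[OF m \<zeta>] _ _ l k _ _ t])
  show "0 \<le> A" "0 < l" using A l by auto
  show "norm (0 :: 'y) \<le> A * (norm (major m \<zeta> s) + k * exp (l * s))" for s using A k by simp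
  show "norm (driftG m s (major m \<zeta> s) u) \<le> A * (norm (major m \<zeta> s) + k * exp (l * s))" if "s \<in> {0..T}" for s u
    using le[OF that] A by (intro order_trans[OF g_growth[OF that flow_in[OF m that]]]) simp
qed

section \<open>Trajectories as random variables under a strategy\<close>

abbreviation "input_space \<equiv> m0 \<Otimes>\<^sub>M borel_of (relaxed_control_topology T :: (real \<times> 'u) measure topology)"
abbreviation "path_borel \<equiv> borel_of (mtopology_of (path_space T :: (real \<Rightarrow> 'x) metric))"

lemma m0_prob: "prob_space m0" and m0_sets: "sets m0 = sets borel"
  using m0 by (auto simp: Pp_euclidean_iff)

lemma space_input: "space input_space = UNIV \<times> relaxed_controls T"
  using sets_eq_imp_space_eq[OF m0_sets]
  by (simp add: space_pair_measure space_borel_of topspace_relaxed_control_topology)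

lemma minor_in_path_space:
  assumes "flow m" "continuous_on {0..T} y" "\<xi> \<in> relaxed_controls T" "\<zeta> \<in> relaxed_controls T"
  shows "minor m y x0 \<xi> \<zeta> \<in> mspace (path_space T)"
  using minor_continuous[OF assms] minor_curve(2)[OF assms] by (simp add: mspace_path_space_iff)

text \<open>The trajectory depends sequentially continuously, in the sup norm, on initial state and
  control. Preimages of open sets of paths are therefore sequentially open, and
  \<open>seq_open_measurable\<close> applies. Without measurability the push-forward in
  \<open>is_motion\<close> would be meaningless.\<close>

lemma minor_measurable:
  assumes m: "flow m" and y: "continuous_on {0..T} y" and \<zeta>: "\<zeta> \<in> relaxed_controls T"
  shows "(\<lambda>\<omega>. minor m y (fst \<omega>) (snd \<omega>) \<zeta>) \<in> measurable input_space path_borel"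
proof (rule measurable_borel_ofI)
  let ?F = "\<lambda>\<omega>. minor m y (fst \<omega>) (snd \<omega>) \<zeta>"
  show "?F \<omega> \<in> topspace (mtopology_of (path_space T))" if "\<omega> \<in> space input_space" for \<omega>
    using minor_in_path_space[OF m y _ \<zeta>] that by (auto simp: space_input mem_Times_iff)
  fix S assume S: "openin (mtopology_of (path_space T :: (real \<Rightarrow> 'x) metric)) S"
  obtain c where c: "0 \<le> c" "\<And>t. t \<in> {0..T} \<Longrightarrow> varsigma p (m t) \<le> c" "\<And>t. t \<in> {0..T} \<Longrightarrow> norm (y t) \<le> c"
    using flow_bounds[OF m y] by blast
  obtain B where B: "lipschitz_const c B" using lipschitz_const_exists by blast
  have B0: "0 \<le> B" using B by (simp add: lipschitz_const_def)
  define l where "l = 4 * B + 1"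
  have l: "0 < l" "4 * B \<le> l" using B0 by (auto simp: l_def)
  define Q where "Q = {\<omega> \<in> UNIV \<times> relaxed_controls T. ?F \<omega> \<in> S}"
  have "Q \<in> sets (borel \<Otimes>\<^sub>M borel_of (relaxed_control_topology T))"
  proof (rule seq_open_measurable[OF T])
    show "Q \<subseteq> UNIV \<times> relaxed_controls T" by (auto simp: Q_def)
    fix xn \<xi>n x \<xi>
    assume \<xi>n: "\<And>n::nat. \<xi>n n \<in> relaxed_controls T" and x: "xn \<longlonglongrightarrow> x" and conv: "control_conv T \<xi>n \<xi>" and Q: "(x, \<xi>) \<in> Q"
    have \<xi>: "\<xi> \<in> relaxed_controls T" and wS: "minor m y x \<xi> \<zeta> \<in> S" using Q by (auto simp: Q_def)
    let ?w = "minor m y x \<xi> \<zeta>"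
    obtain r where r: "r > 0" "\<And>v. v \<in> mspace (path_space T) \<Longrightarrow> mdist (path_space T) ?w v < r \<Longrightarrow> v \<in> S"
      using S wS unfolding openin_mtopology_of by blast
    let ?h = "\<lambda>z. driftI m y (fst z) (?w (fst z)) (snd z)"
    have hc: "continuous_on (control_domain T) ?h"
      using drifts(1)[OF m y] minor_continuous[OF m y \<xi> \<zeta>] by (simp add: drift_def)
    obtain C where C: "\<And>z. z \<in> control_domain T \<Longrightarrow> norm (?h z) \<le> C"
      using continuous_on_control_domain_bound[OF hc] by blast
    obtain \<rho> where \<rho>: "\<rho> \<longlonglongrightarrow> 0" "\<And>n. 0 \<le> \<rho> n"
      "\<And>n t. t \<in> {0..T} \<Longrightarrow> norm (control_integral (\<xi>n n) t ?h - control_integral \<xi> t ?h) \<le> \<rho> n"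
      using control_conv_uniform[OF conv \<xi>n \<xi> T0 hc C] by blast
    \<comment> \<open>\<open>minor_compare\<close> with equal flows, hence k = 0; the weight is
      estimated by its value at T to obtain a bound in the sup norm.\<close>
    define e where "e n = 2 * (norm (xn n - x) + \<rho> n) * exp (l * T)" for n
    have e0: "0 \<le> e n" for n using \<rho>(2)[of n] by (simp add: e_def)
    have "(\<lambda>n. norm (xn n - x)) \<longlonglongrightarrow> 0" using x by (intro tendsto_norm_zero) (simp add: LIM_zero)
    then have "e \<longlonglongrightarrow> 2 * (0 + 0) * exp (l * T)"
      unfolding e_def by (intro tendsto_intros \<rho>(1))
    then have "eventually (\<lambda>n. e n < r) sequentially" using r(1) by (intro order_tendstoD(2)) auto
    then show "eventually (\<lambda>n. (xn n, \<xi>n n) \<in> Q) sequentially"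
    proof eventually_elim
      case (elim n)
      have "norm (minor m y (xn n) (\<xi>n n) \<zeta> t - ?w t) \<le> e n" if t: "t \<in> {0..T}" for t
      proof -
        have "norm (minor m y (xn n) (\<xi>n n) \<zeta> t - ?w t) \<le> (2 * (norm (xn n - x) + \<rho> n) + 4 * B * 0 / l) * exp (l * t)"
        proof (rule minor_compare[OF m m y y \<xi>n \<xi> \<zeta> \<zeta> c(2,2,3,3) B l order_refl _ _ _ t])
          show "0 \<le> norm (xn n - x) + \<rho> n" using \<rho>(2) by simp
          show "W (m s) (m s) + norm (y s - y s) \<le> 0 * exp (l * s)" if "s \<in> {0..T}" for s
            using W_self[OF flow_in[OF m that]] by simp
          show "norm (xn n - x) + norm (control_integral (\<xi>n n) s ?h - control_integral \<xi> s ?h)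
             + norm (control_integral \<zeta> s (\<lambda>z. driftII m y (fst z) (?w (fst z)) (snd z)) - control_integral \<zeta> s (\<lambda>z. driftII m y (fst z) (?w (fst z)) (snd z)))
             \<le> norm (xn n - x) + \<rho> n" if "s \<in> {0..T}" for s
            using \<rho>(3)[OF that] by simp
        qed
        also have "\<dots> \<le> e n"
          unfolding e_def using t l \<rho>(2) by (auto intro!: mult_left_mono)
        finally show ?thesis .
      qed
      then have "mdist (path_space T) ?w (minor m y (xn n) (\<xi>n n) \<zeta>) \<le> e n"
        by (intro path_space_mdist_le e0) (simp add: dist_norm norm_minus_commute)
      then show ?case
        using r(2)[OF minor_in_path_space[OF m y \<xi>n \<zeta>]] elim \<xi>n by (simp add: Q_def)
    qed
  qed
  also have "sets (borel \<Otimes>\<^sub>M borel_of (relaxed_control_topology T)) = sets input_space"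
    by (rule sets_pair_measure_cong) (simp_all add: m0_sets)
  also have "Q = ?F -` S \<inter> space input_space" unfolding Q_def space_input by auto
  finally show "?F -` S \<inter> space input_space \<in> sets input_space" .
qed

lemma minor_eval_measurable:
  assumes "flow m" "continuous_on {0..T} y" "\<zeta> \<in> relaxed_controls T" "t \<in> {0..T}"
  shows "(\<lambda>\<omega>. minor m y (fst \<omega>) (snd \<omega>) \<zeta> t) \<in> borel_measurable input_space"
  by (rule measurable_compose[OF minor_measurable[OF assms(1-3)] borel_measurable_path_eval[OF assms(4)]])

abbreviation "strategies \<equiv> minor_strategies T m0 :: ('x \<times> (real \<times> 'u) measure) measure set"

lemma strategies_measurable:
  assumes "\<alpha> \<in> strategies"
  shows "measurable \<alpha> M = measurable input_space M"
  by (rule measurable_cong_sets[OF minor_strategies_sets[OF assms] refl])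

lemma strategies_space: "\<alpha> \<in> strategies \<Longrightarrow> space \<alpha> = UNIV \<times> relaxed_controls T"
  using sets_eq_imp_space_eq[OF minor_strategies_sets] space_input by blast

lemma strategies_prob: "\<alpha> \<in> strategies \<Longrightarrow> prob_space \<alpha>"
  by (rule minor_strategies_prob[OF m0_prob])

definition moment :: real where "moment = Lp_norm p m0 (\<lambda>x. x)"

lemma moment_nonneg: "0 \<le> moment" by (simp add: moment_def Lp_norm_nonneg)

text \<open>The first marginal of every strategy is m0, so all of them have the same moment of the
  initial state; this makes the later bounds uniform over strategies.\<close>

lemma strategies_fst:
  assumes \<alpha>: "\<alpha> \<in> strategies"
  shows "Lp_fun p \<alpha> fst" "Lp_norm p \<alpha> fst = moment"
proof -
  have f: "fst \<in> measurable \<alpha> m0" unfolding strategies_measurable[OF \<alpha>] by (rule measurable_fst)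
  have fb: "fst \<in> borel_measurable \<alpha>" using f measurable_cong_sets[OF refl m0_sets] by blast
  have d: "distr \<alpha> m0 fst = m0" using \<alpha> by (simp add: minor_strategies_def Lambda_def)
  have L: "Lp_fun p m0 (\<lambda>x. x)" by (rule Pp_Lp_fun[OF p m0])
  have nm: "(\<lambda>x. norm x powr p) \<in> borel_measurable m0"
    using L unfolding Lp_fun_def by (intro borel_measurable_integrable) blast
  have i: "integrable (distr \<alpha> m0 fst) (\<lambda>x. norm x powr p)" using L d by (simp add: Lp_fun_def)
  show "Lp_fun p \<alpha> fst"
    using i fb unfolding integrable_distr_eq[OF f nm] by (simp add: Lp_fun_def)
  have "(LINT x|m0. norm x powr p) = (LINT \<omega>|\<alpha>. norm (fst \<omega>) powr p)"
    using integral_distr[OF f nm] d by simp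
  then show "Lp_norm p \<alpha> fst = moment" by (simp add: Lp_norm_def moment_def)
qed

lemma strategies_bound_Lp:
  assumes \<alpha>: "\<alpha> \<in> strategies"
  shows "Lp_fun p \<alpha> (\<lambda>\<omega>. a * norm (fst \<omega>) + b)"
proof -
  interpret prob_space \<alpha> by (rule strategies_prob[OF \<alpha>])
  note f = strategies_fst(1)[OF \<alpha>]
  have fm: "fst \<in> borel_measurable \<alpha>" by (rule Lp_fun_measurable[OF f])
  show ?thesis
  proof (rule Lp_fun_add_le(1)[OF p Lp_scaleR(1)[OF p f, of a] Lp_const(1)[OF p, of b]])
    show "(\<lambda>\<omega>. a * norm (fst \<omega>) + b) \<in> borel_measurable \<alpha>" using fm by measurable
    show "norm (a * norm (fst \<omega>) + b) \<le> norm (a *\<^sub>R fst \<omega>) + norm b" for \<omega> :: "'x \<times> (real \<times> 'u) measure"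
      using abs_triangle_ineq[of "a * norm (fst \<omega>)" b] by (simp add: abs_mult)
  qed
qed

text \<open>An affine function of the initial norm dominates the trajectory uniformly in time and
  control; it is p-integrable under every strategy. It is crude because \<open>b\<close> depends on
  the given flow.\<close>

lemma flow_crude_bound:
  assumes m: "flow m" and y: "continuous_on {0..T} y" and \<zeta>: "\<zeta> \<in> relaxed_controls T"
  obtains b where "0 \<le> b" "\<And>x0 \<xi> t. \<xi> \<in> relaxed_controls T \<Longrightarrow> t \<in> {0..T} \<Longrightarrow> norm (minor m y x0 \<xi> \<zeta> t) \<le> b * norm x0 + b"
proof -
  obtain c where c: "0 \<le> c" "\<And>t. t \<in> {0..T} \<Longrightarrow> varsigma p (m t) \<le> c" "\<And>t. t \<in> {0..T} \<Longrightarrow> norm (y t) \<le> c"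
    using flow_bounds[OF m y] by blast
  let ?l = "4 * A"
  let ?b = "(2 + (1 + 2 * c)) * exp (?l * T)"
  have "norm (minor m y x0 \<xi> \<zeta> t) \<le> ?b * norm x0 + ?b" if \<xi>: "\<xi> \<in> relaxed_controls T" and t: "t \<in> {0..T}" for x0 \<xi> t
  proof -
    have "norm (minor m y x0 \<xi> \<zeta> t) \<le> (2 * norm x0 + 4 * A * (1 + 2 * c) / ?l) * exp (?l * t)"
    proof (rule minor_growth[OF m y \<xi> \<zeta> order_refl _ _ t])
      show "0 \<le> 1 + 2 * c" using c by simp
      show "1 + varsigma p (m s) + norm (y s) \<le> (1 + 2 * c) * exp (?l * s)" if "s \<in> {0..T}" for s
      proof -
        have "(1 + 2 * c) * 1 \<le> (1 + 2 * c) * exp (?l * s)" using c A that by (intro mult_left_mono) auto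
        moreover have "1 + varsigma p (m s) + norm (y s) \<le> (1 + 2 * c) * 1" using c(2,3)[OF that] by simp
        ultimately show ?thesis by (rule order_trans[rotated])
      qed
    qed
    also have "\<dots> = (2 * norm x0 + (1 + 2 * c)) * exp (?l * t)" using A by simp
    also have "\<dots> \<le> (2 * norm x0 + (1 + 2 * c)) * exp (?l * T)"
      using t A c by (intro mult_left_mono) auto
    also have "\<dots> \<le> ((2 + (1 + 2 * c)) * norm x0 + (2 + (1 + 2 * c))) * exp (?l * T)"
      using c by (intro mult_right_mono) (auto simp: distrib_right)
    also have "\<dots> = ?b * norm x0 + ?b" by (simp add: algebra_simps)
    finally show ?thesis .
  qed
  then show ?thesis using that[of ?b] c by simp
qed

lemma minor_field:
  assumes m: "flow m" and y: "continuous_on {0..T} y" and \<zeta>: "\<zeta> \<in> relaxed_controls T" and \<alpha>: "\<alpha> \<in> strategies"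
  shows "\<And>t. t \<in> {0..T} \<Longrightarrow> (\<lambda>\<omega>. minor m y (fst \<omega>) (snd \<omega>) \<zeta> t) \<in> borel_measurable \<alpha>"
    and "\<And>t. t \<in> {0..T} \<Longrightarrow> Lp_fun p \<alpha> (\<lambda>\<omega>. minor m y (fst \<omega>) (snd \<omega>) \<zeta> t)"
    and "\<exists>c. \<forall>t\<in>{0..T}. Lp_norm p \<alpha> (\<lambda>\<omega>. minor m y (fst \<omega>) (snd \<omega>) \<zeta> t) \<le> c"
proof -
  obtain b where b: "0 \<le> b" "\<And>x0 \<xi> t. \<xi> \<in> relaxed_controls T \<Longrightarrow> t \<in> {0..T} \<Longrightarrow> norm (minor m y x0 \<xi> \<zeta> t) \<le> b * norm x0 + b"
    using flow_crude_bound[OF m y \<zeta>] by blast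
  show ms: "(\<lambda>\<omega>. minor m y (fst \<omega>) (snd \<omega>) \<zeta> t) \<in> borel_measurable \<alpha>" if "t \<in> {0..T}" for t
    unfolding strategies_measurable[OF \<alpha>] by (rule minor_eval_measurable[OF m y \<zeta> that])
  have le: "norm (minor m y (fst \<omega>) (snd \<omega>) \<zeta> t) \<le> norm (b * norm (fst \<omega>) + b)" if "t \<in> {0..T}" "\<omega> \<in> space \<alpha>" for t \<omega>
  proof -
    have "snd \<omega> \<in> relaxed_controls T" using that(2) strategies_space[OF \<alpha>] by (simp add: mem_Times_iff)
    then have "norm (minor m y (fst \<omega>) (snd \<omega>) \<zeta> t) \<le> b * norm (fst \<omega>) + b" using b(2) that(1) by blast
    then show ?thesis using abs_ge_self order_trans unfolding real_norm_def by blast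
  qed
  note L = Lp_fun_mono[OF p strategies_bound_Lp[OF \<alpha>] ms le]
  show "Lp_fun p \<alpha> (\<lambda>\<omega>. minor m y (fst \<omega>) (snd \<omega>) \<zeta> t)" if "t \<in> {0..T}" for t
    using L(1) that by blast
  show "\<exists>c. \<forall>t\<in>{0..T}. Lp_norm p \<alpha> (\<lambda>\<omega>. minor m y (fst \<omega>) (snd \<omega>) \<zeta> t) \<le> c"
    using L(2) by blast
qed

lemma Lp_norm_le_const:
  assumes \<alpha>: "prob_space \<alpha>" and h: "h \<in> borel_measurable \<alpha>" and le: "\<And>\<omega>. \<omega> \<in> space \<alpha> \<Longrightarrow> norm (h \<omega>) \<le> C"
  shows "Lp_fun p \<alpha> (h :: _ \<Rightarrow> 'x)" "Lp_norm p \<alpha> h \<le> C"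
proof -
  interpret prob_space \<alpha> by fact
  obtain \<omega> where "\<omega> \<in> space \<alpha>" using not_empty by blast
  then have C: "0 \<le> C" using le norm_ge_zero order_trans by blast
  note c = Lp_const[OF p, of C]
  show "Lp_fun p \<alpha> h" by (rule Lp_fun_mono(1)[OF p c(1) h]) (use le C in auto)
  have "Lp_norm p \<alpha> h \<le> Lp_norm p \<alpha> (\<lambda>_. C)" by (rule Lp_fun_mono(2)[OF p c(1) h]) (use le C in auto)
  then show "Lp_norm p \<alpha> h \<le> C" using c(2) C by simp
qed

text \<open>Eliminates the path law. There is no circle: a path law in \<open>Pp\<close> alone makes
  its marginals a \<open>flow\<close>, before anything is known about trajectories, and only then
  are the values of \<open>traj_minor\<close> genuine solutions. Conversely
  \<open>flow_crude_bound\<close> gives the path law a finite moment.\<close>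

lemma is_motion_iff:
  assumes \<alpha>: "\<alpha> \<in> strategies" and \<zeta>: "\<zeta> \<in> relaxed_controls T"
  shows "is_motion T p fI fII g y0 \<alpha> \<zeta> m y \<longleftrightarrow> m \<in> extensional {0..T} \<and> flow m \<and> y = major m \<zeta> \<and>
    (\<forall>t\<in>{0..T}. m t = distr \<alpha> borel (\<lambda>\<omega>. minor m y (fst \<omega>) (snd \<omega>) \<zeta> t))"
proof
  assume "is_motion T p fI fII g y0 \<alpha> \<zeta> m y"
  then obtain \<mu> where mE: "m \<in> {0..T} \<rightarrow>\<^sub>E state_law_space" and \<mu>: "\<mu> \<in> Pp p (path_space T)" and y: "y = major m \<zeta>"
    and mt: "\<And>t. t \<in> {0..T} \<Longrightarrow> m t = distr \<mu> borel (\<lambda>x. x t)"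
    and \<mu>d: "\<mu> = distr \<alpha> path_borel (\<lambda>\<omega>. minor m y (fst \<omega>) (snd \<omega>) \<zeta>)"
    unfolding is_motion_def case_prod_unfold by blast
  have \<mu>p: "prob_space \<mu>" and \<mu>s: "sets \<mu> = sets path_borel" using \<mu> by (auto simp: Pp_def)
  have \<mu>sp: "space \<mu> = mspace (path_space T)" using sets_eq_imp_space_eq[OF \<mu>s] by (simp add: space_borel_of)
  have \<mu>m: "measurable \<mu> M = measurable path_borel M" for M by (rule measurable_cong_sets[OF \<mu>s refl])
  obtain w0 where w0: "w0 \<in> mspace (path_space T)" and fin: "(\<integral>\<^sup>+x. ennreal (mdist (path_space T) x w0 powr p) \<partial>\<mu>) < \<infinity>"
    using \<mu> by (auto simp: Pp_def)
  obtain c0 where c0: "0 \<le> c0" "\<And>t. t \<in> {0..T} \<Longrightarrow> norm (w0 t) \<le> c0"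
    using continuous_on_Icc_bound[of T w0] w0 by (auto simp: mspace_path_space_iff)
  \<comment> \<open>Dominates the positions at all times at once: sup distance to the base path plus
    a bound of that path.\<close>
  let ?D = "\<lambda>w. mdist (path_space T) w w0 + c0"
  have dm: "(\<lambda>w. mdist (path_space T) w w0) \<in> borel_measurable \<mu>"
    unfolding \<mu>m by (rule borel_measurable_mdist[OF w0])
  interpret \<mu>: prob_space \<mu> by fact
  have "(\<lambda>w. mdist (path_space T) w w0 powr p) \<in> borel_measurable \<mu>" using dm by measurable
  then have "Lp_fun p \<mu> (\<lambda>w. mdist (path_space T) w w0)"
    using dm fin by (simp add: Lp_fun_def integrable_iff_bounded)
  then have D: "Lp_fun p \<mu> ?D"
  proof (rule Lp_fun_add_le(1)[OF p _ \<mu>.Lp_const(1)[OF p, of c0]])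
    show "?D \<in> borel_measurable \<mu>" using dm by measurable
  qed (rule norm_triangle_ineq)
  have le: "norm (w t) \<le> norm (?D w)" if t: "t \<in> {0..T}" and w: "w \<in> space \<mu>" for t w
  proof -
    have "norm (w t) \<le> norm (w0 t) + dist (w t) (w0 t)"
      using norm_triangle_sub[of "w t" "w0 t"] by (simp add: dist_norm)
    also have "\<dots> \<le> c0 + mdist (path_space T) w w0"
      using c0(2)[OF t] path_space_dist_le[of w T w0 t] w w0 t \<mu>sp by (intro add_mono) auto
    finally show ?thesis by simp
  qed
  have ev: "(\<lambda>w. w t) \<in> borel_measurable \<mu>" if "t \<in> {0..T}" for t
    unfolding \<mu>m by (rule borel_measurable_path_eval[OF that])
  have wc: "continuous_on {0..T} (\<lambda>t. w t)" if "w \<in> space \<mu>" for w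
    using that \<mu>sp by (simp add: mspace_path_space_iff)
  have mc: "continuous_map (top_of_set {0..T}) (Wp_topology p euclidean_metric) m"
    by (rule continuous_map_Wp_path_law[where x = "\<lambda>t w. w t", OF p \<mu>p ev wc D le mt]; assumption)
  have ms: "varsigma p (m t) = Lp_norm p \<mu> (\<lambda>w. w t)" if "t \<in> {0..T}" for t
    unfolding mt[OF that] by (rule varsigma_distr[OF ev[OF that]])
  have flow: "flow m"
    unfolding flow_def
  proof (intro conjI exI ballI)
    show "continuous_map (top_of_set {0..T}) (Wp_topology p euclidean_metric) m" by (rule mc)
    show "varsigma p (m t) \<le> Lp_norm p \<mu> ?D" if "t \<in> {0..T}" for t
      unfolding ms[OF that] by (rule Lp_fun_mono(2)[OF p D ev[OF that] le[OF that]])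
  qed
  have yc: "continuous_on {0..T} y" unfolding y by (rule major_continuous[OF flow \<zeta>])
  have Fm: "(\<lambda>\<omega>. minor m y (fst \<omega>) (snd \<omega>) \<zeta>) \<in> measurable \<alpha> path_borel"
    unfolding strategies_measurable[OF \<alpha>] by (rule minor_measurable[OF flow yc \<zeta>])
  have "m t = distr \<alpha> borel (\<lambda>\<omega>. minor m y (fst \<omega>) (snd \<omega>) \<zeta> t)" if t: "t \<in> {0..T}" for t
    using mt[OF t] distr_distr[OF borel_measurable_path_eval[OF t] Fm] unfolding \<mu>d[symmetric] by (simp add: comp_def)
  then show "m \<in> extensional {0..T} \<and> flow m \<and> y = major m \<zeta> \<and>
    (\<forall>t\<in>{0..T}. m t = distr \<alpha> borel (\<lambda>\<omega>. minor m y (fst \<omega>) (snd \<omega>) \<zeta> t))"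
    using mE flow y by (auto simp: PiE_def)
next
  assume "m \<in> extensional {0..T} \<and> flow m \<and> y = major m \<zeta> \<and>
    (\<forall>t\<in>{0..T}. m t = distr \<alpha> borel (\<lambda>\<omega>. minor m y (fst \<omega>) (snd \<omega>) \<zeta> t))"
  then have mE: "m \<in> extensional {0..T}" and flow: "flow m" and y: "y = major m \<zeta>"
    and mt: "\<And>t. t \<in> {0..T} \<Longrightarrow> m t = distr \<alpha> borel (\<lambda>\<omega>. minor m y (fst \<omega>) (snd \<omega>) \<zeta> t)" by auto
  have yc: "continuous_on {0..T} y" unfolding y by (rule major_continuous[OF flow \<zeta>])
  let ?F = "\<lambda>\<omega>. minor m y (fst \<omega>) (snd \<omega>) \<zeta>"
  have Fm: "?F \<in> measurable \<alpha> path_borel"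
    unfolding strategies_measurable[OF \<alpha>] by (rule minor_measurable[OF flow yc \<zeta>])
  interpret \<alpha>: prob_space \<alpha> by (rule strategies_prob[OF \<alpha>])
  define \<mu> where "\<mu> = distr \<alpha> path_borel ?F"
  obtain b where b: "0 \<le> b" "\<And>x0 \<xi> t. \<xi> \<in> relaxed_controls T \<Longrightarrow> t \<in> {0..T} \<Longrightarrow> norm (minor m y x0 \<xi> \<zeta> t) \<le> b * norm x0 + b"
    using flow_crude_bound[OF flow yc \<zeta>] by blast
  define w0 :: "real \<Rightarrow> 'x" where "w0 = restrict (\<lambda>_. 0) {0..T}"
  have w0: "w0 \<in> mspace (path_space T)"
    unfolding mspace_path_space_iff w0_def by (auto intro: continuous_on_eq[of _ "\<lambda>_. 0"])
  have "(\<integral>\<^sup>+w. ennreal (mdist (path_space T) w w0 powr p) \<partial>\<mu>) = (\<integral>\<^sup>+\<omega>. ennreal (mdist (path_space T) (?F \<omega>) w0 powr p) \<partial>\<alpha>)"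
    unfolding \<mu>_def using borel_measurable_mdist[OF w0] by (subst nn_integral_distr[OF Fm]) auto
  also have "\<dots> \<le> (\<integral>\<^sup>+\<omega>. ennreal (norm (b * norm (fst \<omega>) + b) powr p) \<partial>\<alpha>)"
  proof (rule nn_integral_mono, rule ennreal_leI, rule powr_mono2)
    fix \<omega> assume "\<omega> \<in> space \<alpha>"
    then have \<xi>: "snd \<omega> \<in> relaxed_controls T" using strategies_space[OF \<alpha>] by (simp add: mem_Times_iff)
    have "mdist (path_space T) (?F \<omega>) w0 \<le> b * norm (fst \<omega>) + b"
      using b(1) b(2)[OF \<xi>] by (intro path_space_mdist_le) (auto simp: w0_def)
    then show "mdist (path_space T) (?F \<omega>) w0 \<le> norm (b * norm (fst \<omega>) + b)" by simp
  qed (use p in auto)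
  also have "\<dots> < \<infinity>"
    using strategies_bound_Lp[OF \<alpha>, of b b] by (simp add: Lp_fun_def integrable_iff_bounded)
  finally have "\<mu> \<in> Pp p (path_space T)"
    using w0 \<alpha>.prob_space_distr[OF Fm] by (auto simp: Pp_def \<mu>_def)
  moreover have "m t = distr \<mu> borel (\<lambda>x. x t)" if t: "t \<in> {0..T}" for t
    unfolding \<mu>_def mt[OF t] using distr_distr[OF borel_measurable_path_eval[OF t] Fm] by (simp add: comp_def)
  moreover have "m \<in> {0..T} \<rightarrow>\<^sub>E state_law_space" using mE flow_in[OF flow] by (auto simp: PiE_def)
  moreover have "y \<in> {0..T} \<rightarrow>\<^sub>E UNIV" using major_curve(2)[OF flow \<zeta>] y by (auto simp: PiE_def)
  ultimately show "is_motion T p fI fII g y0 \<alpha> \<zeta> m y"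
    unfolding is_motion_def case_prod_unfold using y \<mu>_def by blast
qed

end


section \<open>Existence and uniqueness of motions\<close>

lemma Lp_norm_tendsto:
  fixes h :: "nat \<Rightarrow> 'a \<Rightarrow> 'b::euclidean_space" and D :: "'a \<Rightarrow> 'c::euclidean_space"
  assumes p: "p \<ge> 1" and D: "Lp_fun p M D" and [measurable]: "\<And>n. h n \<in> borel_measurable M" "k \<in> borel_measurable M"
    and le: "\<And>n x. x \<in> space M \<Longrightarrow> norm (h n x) \<le> norm (D x)"
    and lim: "\<And>x. x \<in> space M \<Longrightarrow> (\<lambda>n. h n x) \<longlonglongrightarrow> k x"
  shows "(\<lambda>n. Lp_norm p M (h n)) \<longlonglongrightarrow> Lp_norm p M k"
proof -
  have "(\<lambda>n. LINT x|M. norm (h n x) powr p) \<longlonglongrightarrow> (LINT x|M. norm (k x) powr p)"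
  proof (rule integral_dominated_convergence)
    show "integrable M (\<lambda>x. norm (D x) powr p)" using D by (simp add: Lp_fun_def)
    show "AE x in M. (\<lambda>n. norm (h n x) powr p) \<longlonglongrightarrow> norm (k x) powr p"
      using p lim by (intro AE_I2 tendsto_powr2 tendsto_norm tendsto_const) auto
    show "AE x in M. norm (norm (h n x) powr p) \<le> norm (D x) powr p" for n
      using le p by (intro AE_I2) (auto intro!: powr_mono2)
  qed auto
  then show ?thesis unfolding Lp_norm_def using p by (intro tendsto_powr2 tendsto_const) auto
qed

lemma uniform_limit_geometric:
  fixes f :: "nat \<Rightarrow> 'a \<Rightarrow> 'b::real_normed_vector"
  assumes "\<And>n x. x \<in> S \<Longrightarrow> norm (f n x - l x) \<le> C / 2 ^ n"
  shows "uniform_limit S f l sequentially"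
proof (rule uniform_limitI)
  fix e :: real assume "e > 0"
  have "(\<lambda>n. C / 2 ^ n) \<longlonglongrightarrow> 0" by (rule LIMSEQ_divide_realpow_zero) simp
  then have "eventually (\<lambda>n. C / 2 ^ n < e) sequentially" using \<open>e > 0\<close> by (rule order_tendstoD(2))
  then show "eventually (\<lambda>n. \<forall>x\<in>S. dist (f n x) (l x) < e) sequentially"
    by eventually_elim (use assms in \<open>auto simp: dist_norm intro: le_less_trans\<close>)
qed

context mean_field_game
begin

text \<open>With these constants \<open>varsigma p (m t) + norm (y t) \<le> radius * exp (rate * t)\<close> is preserved by
  one Picard iteration, which gives the a priori bound and the invariant of the fixed point.\<close>

definition rate :: real where "rate = 24 * A"

definition radius :: real where "radius = 8 * moment + 4 * norm y0 + 1"

lemma rate_pos: "0 < rate" using A by (simp add: rate_def)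

lemma radius_pos: "0 < radius"
  unfolding radius_def by (intro add_nonneg_pos add_nonneg_nonneg mult_nonneg_nonneg moment_nonneg norm_ge_zero) simp_all

lemma varsigma_nonneg: "0 \<le> varsigma p \<mu>" by (simp add: varsigma_def)

text \<open>At this rate the growth term 4 * A * (1 + k) / rate equals (1 + k) / 6. It occurs once
  for the major agent and twice for the minor agents, because of the factor 2 in the L^p inequality,
  in total (1 + k) / 2; the remaining terms 4 * moment + 2 * norm y0 + 1/2 are
  \<open>radius / 2\<close>.\<close>

lemma growth_step:
  assumes m: "flow m" and y: "continuous_on {0..T} y" and \<zeta>: "\<zeta> \<in> relaxed_controls T" and k: "0 \<le> k"
    and le: "\<And>t. t \<in> {0..T} \<Longrightarrow> varsigma p (m t) + norm (y t) \<le> k * exp (rate * t)" and t: "t \<in> {0..T}"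
  shows "\<xi> \<in> relaxed_controls T \<Longrightarrow> norm (minor m y x0 \<xi> \<zeta> t) \<le> (2 * norm x0 + (1 + k) / 6) * exp (rate * t)"
    and "\<alpha> \<in> strategies \<Longrightarrow> Lp_norm p \<alpha> (\<lambda>\<omega>. minor m y (fst \<omega>) (snd \<omega>) \<zeta> t) + norm (major m \<zeta> t)
      \<le> (radius / 2 + k / 2) * exp (rate * t)"
proof -
  have l: "4 * A \<le> rate" using A by (simp add: rate_def)
  have k1: "0 \<le> 1 + k" using k by simp
  have le1: "1 + varsigma p (m s) + norm (y s) \<le> (1 + k) * exp (rate * s)" if "s \<in> {0..T}" for s
  proof -
    have 1: "1 \<le> exp (rate * s)" using rate_pos that by simp
    show ?thesis unfolding distrib_right mult_1_left using 1 le[OF that] by linarith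
  qed
  have le2: "1 + varsigma p (m s) \<le> (1 + k) * exp (rate * s)" if "s \<in> {0..T}" for s
    using le1[OF that] norm_ge_zero[of "y s"] by linarith
  have e: "4 * A * (1 + k) / rate = (1 + k) / 6" using A by (simp add: rate_def)
  show mi: "norm (minor m y x0 \<xi> \<zeta> t) \<le> (2 * norm x0 + (1 + k) / 6) * exp (rate * t)" if \<xi>: "\<xi> \<in> relaxed_controls T" for x0 \<xi>
    using minor_growth[OF m y \<xi> \<zeta> l k1 le1 t] unfolding e .
  have ma: "norm (major m \<zeta> t) \<le> (2 * norm y0 + (1 + k) / 6) * exp (rate * t)"
    using major_growth[OF m \<zeta> l k1 le2 t] unfolding e .
  show "Lp_norm p \<alpha> (\<lambda>\<omega>. minor m y (fst \<omega>) (snd \<omega>) \<zeta> t) + norm (major m \<zeta> t)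
      \<le> (radius / 2 + k / 2) * exp (rate * t)" if \<alpha>: "\<alpha> \<in> strategies"
  proof -
    interpret prob_space \<alpha> by (rule strategies_prob[OF \<alpha>])
    let ?E = "exp (rate * t)"
    have "Lp_norm p \<alpha> (\<lambda>\<omega>. minor m y (fst \<omega>) (snd \<omega>) \<zeta> t)
        \<le> 2 * (Lp_norm p \<alpha> (\<lambda>\<omega>. (2 * ?E) *\<^sub>R fst \<omega>) + Lp_norm p \<alpha> (\<lambda>_. (1 + k) / 6 * ?E))"
    proof (rule Lp_fun_add_le(2)[OF p Lp_scaleR(1)[OF p strategies_fst(1)[OF \<alpha>]] Lp_const(1)[OF p] minor_field(1)[OF m y \<zeta> \<alpha> t]])
      fix \<omega> assume "\<omega> \<in> space \<alpha>"
      then have "snd \<omega> \<in> relaxed_controls T" using strategies_space[OF \<alpha>] by (simp add: mem_Times_iff)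
      from mi[OF this, of "fst \<omega>"]
      show "norm (minor m y (fst \<omega>) (snd \<omega>) \<zeta> t) \<le> norm ((2 * ?E) *\<^sub>R fst \<omega>) + norm ((1 + k) / 6 * ?E)"
        using k by (simp add: algebra_simps)
    qed
    also have "\<dots> = 2 * (2 * ?E * moment + (1 + k) / 6 * ?E)"
      unfolding Lp_scaleR(2)[OF p strategies_fst(1)[OF \<alpha>]] Lp_const(2)[OF p] strategies_fst(2)[OF \<alpha>]
      using k by simp
    finally have "Lp_norm p \<alpha> (\<lambda>\<omega>. minor m y (fst \<omega>) (snd \<omega>) \<zeta> t) + norm (major m \<zeta> t)
      \<le> 2 * (2 * ?E * moment + (1 + k) / 6 * ?E) + (2 * norm y0 + (1 + k) / 6) * ?E"
      using ma by linarith
    also have "\<dots> = (radius / 2 + k / 2) * ?E" by (simp add: radius_def field_simps)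
    finally show ?thesis .
  qed
qed

text \<open>Halving applied to \<open>growth_step\<close>. The bound of the individual flow is
  forgotten, so all motions obey one bound and one Lipschitz constant can be used for all of
  them.\<close>

lemma motion_bound:
  assumes \<alpha>: "\<alpha> \<in> strategies" and \<zeta>: "\<zeta> \<in> relaxed_controls T" and mot: "is_motion T p fI fII g y0 \<alpha> \<zeta> m y" and t: "t \<in> {0..T}"
  shows "varsigma p (m t) + norm (y t) \<le> radius * exp (rate * t)"
proof -
  have m: "flow m" and y: "y = major m \<zeta>"
    and mt: "\<And>t. t \<in> {0..T} \<Longrightarrow> m t = distr \<alpha> borel (\<lambda>\<omega>. minor m y (fst \<omega>) (snd \<omega>) \<zeta> t)"
    using mot unfolding is_motion_iff[OF \<alpha> \<zeta>] by auto
  have yc: "continuous_on {0..T} y" unfolding y by (rule major_continuous[OF m \<zeta>])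
  obtain c where c: "0 \<le> c" "\<And>t. t \<in> {0..T} \<Longrightarrow> varsigma p (m t) \<le> c" "\<And>t. t \<in> {0..T} \<Longrightarrow> norm (y t) \<le> c"
    using flow_bounds[OF m yc] by blast
  have "varsigma p (m t) + norm (y t) \<le> 2 * (radius / 2) * exp (rate * t)"
  proof (rule le_of_halving_step[where I = "{0..T}" and K = "2 * c" and F = "\<lambda>t. varsigma p (m t) + norm (y t)" and w = "\<lambda>t. exp (rate * t)"])
    show "varsigma p (m s) + norm (y s) \<le> 2 * c * exp (rate * s)" if "s \<in> {0..T}" for s
    proof -
      have "varsigma p (m s) + norm (y s) \<le> 2 * c * 1" using c(2,3)[OF that] by simp
      also have "\<dots> \<le> 2 * c * exp (rate * s)" using c(1) rate_pos that by (intro mult_left_mono) auto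
      finally show ?thesis .
    qed
    show "0 \<le> radius / 2" using radius_pos by simp
    show "varsigma p (m s) + norm (y s) \<le> (radius / 2 + k / 2) * exp (rate * s)"
      if k: "0 \<le> k" and ih: "\<And>j. j \<in> {0..T} \<Longrightarrow> varsigma p (m j) + norm (y j) \<le> k * exp (rate * j)" and s: "s \<in> {0..T}" for k s
    proof -
      have "varsigma p (m s) = Lp_norm p \<alpha> (\<lambda>\<omega>. minor m y (fst \<omega>) (snd \<omega>) \<zeta> s)"
        unfolding mt[OF s] by (rule varsigma_distr[OF minor_field(1)[OF m yc \<zeta> \<alpha> s]])
      then show ?thesis
        using growth_step(2)[OF m yc \<zeta> k ih s \<alpha>] y by simp
    qed
  qed (use t in auto)
  then show ?thesis by simp
qed

definition bound :: real where "bound = radius * exp (rate * T)"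

lemma bound_ge:
  assumes "v \<le> radius * exp (rate * t)" "t \<in> {0..T}"
  shows "v \<le> bound"
proof -
  have "radius * exp (rate * t) \<le> bound"
    unfolding bound_def using radius_pos rate_pos assms(2) by (intro mult_left_mono) auto
  then show ?thesis using assms(1) by simp
qed

lemma motion_bounds:
  assumes "\<alpha> \<in> strategies" "\<zeta> \<in> relaxed_controls T" "is_motion T p fI fII g y0 \<alpha> \<zeta> m y" "t \<in> {0..T}"
  shows "varsigma p (m t) \<le> bound" "norm (y t) \<le> bound"
  using bound_ge[OF motion_bound[OF assms] assms(4)] varsigma_nonneg[of "m t"] norm_ge_zero[of "y t"] by linarith+

text \<open>The L^p distance of the positions plus the distance of the major agents reproduces
  itself with the factor 1/2, so it vanishes by the halving lemma with r = 0.\<close>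

lemma motion_unique:
  assumes \<alpha>: "\<alpha> \<in> strategies" and \<zeta>: "\<zeta> \<in> relaxed_controls T"
    and mot: "is_motion T p fI fII g y0 \<alpha> \<zeta> m y" and mot': "is_motion T p fI fII g y0 \<alpha> \<zeta> m' y'"
  shows "m = m' \<and> y = y'"
proof -
  have m: "flow m" "m \<in> extensional {0..T}" and y: "y = major m \<zeta>"
    and mt: "\<And>t. t \<in> {0..T} \<Longrightarrow> m t = distr \<alpha> borel (\<lambda>\<omega>. minor m y (fst \<omega>) (snd \<omega>) \<zeta> t)"
    using mot unfolding is_motion_iff[OF \<alpha> \<zeta>] by auto
  have m': "flow m'" "m' \<in> extensional {0..T}" and y': "y' = major m' \<zeta>"
    and mt': "\<And>t. t \<in> {0..T} \<Longrightarrow> m' t = distr \<alpha> borel (\<lambda>\<omega>. minor m' y' (fst \<omega>) (snd \<omega>) \<zeta> t)"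
    using mot' unfolding is_motion_iff[OF \<alpha> \<zeta>] by auto
  have yc: "continuous_on {0..T} y" "continuous_on {0..T} y'"
    unfolding y y' using major_continuous \<zeta> m m' by auto
  note c = motion_bounds(1)[OF \<alpha> \<zeta> mot] motion_bounds(1)[OF \<alpha> \<zeta> mot'] motion_bounds(2)[OF \<alpha> \<zeta> mot] motion_bounds(2)[OF \<alpha> \<zeta> mot']
  obtain B where B: "lipschitz_const bound B" using lipschitz_const_exists by blast
  have B0: "0 \<le> B" using B by (simp add: lipschitz_const_def)
  \<comment> \<open>Each of the two comparisons, of minor and of major agents, then returns at most
    k / 4.\<close>
  define l where "l = 16 * B + 1"
  have l: "0 < l" "4 * B \<le> l" "16 * B \<le> l" using B0 by (auto simp: l_def)
  let ?x = "\<lambda>t \<omega>. minor m y (fst \<omega>) (snd \<omega>) \<zeta> t" and ?x' = "\<lambda>t \<omega>. minor m' y' (fst \<omega>) (snd \<omega>) \<zeta> t"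
  let ?d = "\<lambda>t. Lp_norm p \<alpha> (\<lambda>\<omega>. ?x t \<omega> - ?x' t \<omega>)"
  have dm: "(\<lambda>\<omega>. ?x t \<omega> - ?x' t \<omega>) \<in> borel_measurable \<alpha>" if "t \<in> {0..T}" for t
    using minor_field(1)[OF m(1) yc(1) \<zeta> \<alpha> that] minor_field(1)[OF m'(1) yc(2) \<zeta> \<alpha> that] by simp
  note add = Lp_fun_add_le[OF p minor_field(2)[OF m(1) yc(1) \<zeta> \<alpha>] minor_field(2)[OF m'(1) yc(2) \<zeta> \<alpha>] dm norm_triangle_ineq4]
  have Wd: "W (m t) (m' t) \<le> ?d t" if t: "t \<in> {0..T}" for t
    unfolding mt[OF t] mt'[OF t]
    by (rule Wp_distr_le[OF p minor_field(1)[OF m(1) yc(1) \<zeta> \<alpha> t] minor_field(1)[OF m'(1) yc(2) \<zeta> \<alpha> t] add(1)[OF t t t]])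
  obtain c1 where c1: "\<And>t. t \<in> {0..T} \<Longrightarrow> Lp_norm p \<alpha> (?x t) \<le> c1" using minor_field(3)[OF m(1) yc(1) \<zeta> \<alpha>] by blast
  obtain c2 where c2: "\<And>t. t \<in> {0..T} \<Longrightarrow> Lp_norm p \<alpha> (?x' t) \<le> c2" using minor_field(3)[OF m'(1) yc(2) \<zeta> \<alpha>] by blast
  let ?F = "\<lambda>t. ?d t + norm (y t - y' t)"
  have xcmp: "norm (?x t \<omega> - ?x' t \<omega>) \<le> (4 * B * k / l) * exp (l * t)"
    if k: "0 \<le> k" and ih: "\<And>j. j \<in> {0..T} \<Longrightarrow> ?F j \<le> k * exp (l * j)" and t: "t \<in> {0..T}" and \<omega>: "\<omega> \<in> space \<alpha>" for k t \<omega>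
  proof (rule minor_compare_same[OF m(1) m'(1) yc _ \<zeta> c B l(1,2) k _ t])
    show "snd \<omega> \<in> relaxed_controls T" using \<omega> strategies_space[OF \<alpha>] by (simp add: mem_Times_iff)
    show "W (m s) (m' s) + norm (y s - y' s) \<le> k * exp (l * s)" if "s \<in> {0..T}" for s
      using Wd[OF that] ih[OF that] by linarith
  qed
  have F0: "?F t \<le> 0" if t: "t \<in> {0..T}" for t
  proof -
    have "?F t \<le> 2 * 0 * exp (l * t)"
    proof (rule le_of_halving_step[where I = "{0..T}" and K = "2 * (c1 + c2) + 2 * bound" and F = ?F and w = "\<lambda>t. exp (l * t)"])
      show "?F s \<le> (2 * (c1 + c2) + 2 * bound) * exp (l * s)" if s: "s \<in> {0..T}" for s
      proof -
        have le: "?F s \<le> 2 * (c1 + c2) + 2 * bound"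
          using add(2)[OF s s s] c1[OF s] c2[OF s] norm_triangle_ineq4[of "y s" "y' s"] c(3,4)[OF s]
          unfolding distrib_left by linarith
        have "0 \<le> ?F s" using Lp_norm_nonneg by (rule add_nonneg_nonneg) (rule norm_ge_zero)
        then have "(2 * (c1 + c2) + 2 * bound) * 1 \<le> (2 * (c1 + c2) + 2 * bound) * exp (l * s)"
          using l s le by (intro mult_left_mono) auto
        then show ?thesis using le by simp
      qed
      show "?F s \<le> (0 + k / 2) * exp (l * s)"
        if k: "0 \<le> k" and ih: "\<And>j. j \<in> {0..T} \<Longrightarrow> ?F j \<le> k * exp (l * j)" and s: "s \<in> {0..T}" for k s
      proof -
        have 1: "?d s \<le> (4 * B * k / l) * exp (l * s)"
          by (rule Lp_norm_le_const(2)[OF strategies_prob[OF \<alpha>] dm[OF s] xcmp[OF k ih s]])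
        have 2: "norm (y s - y' s) \<le> (2 * 0 + 4 * B * k / l) * exp (l * s)"
          unfolding y y'
        proof (rule major_compare[OF m(1) m'(1) \<zeta> \<zeta> c(1,2) _ _ B l(1,2) k order_refl _ _ s])
          show "norm (major m \<zeta> t) \<le> bound" "norm (major m' \<zeta> t) \<le> bound" if "t \<in> {0..T}" for t
            using c(3,4)[OF that] y y' by simp_all
          show "W (m t) (m' t) \<le> k * exp (l * t)" if "t \<in> {0..T}" for t
            using Wd[OF that] ih[OF that] norm_ge_zero[of "y t - y' t"] by linarith
          show "norm (control_integral \<zeta> t (\<lambda>z. driftG m' (fst z) (major m' \<zeta> (fst z)) (snd z))
            - control_integral \<zeta> t (\<lambda>z. driftG m' (fst z) (major m' \<zeta> (fst z)) (snd z))) \<le> 0" for t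
            by (simp only: diff_self norm_zero order_refl)
        qed
        have "16 * B * k \<le> l * k" using l(3) k by (rule mult_right_mono)
        then have "4 * B * k / l \<le> k / 4" using l(1) by (simp add: field_simps)
        then have 3: "(4 * B * k / l) * exp (l * s) \<le> k / 4 * exp (l * s)" by (rule mult_right_mono) simp
        show ?thesis using add_mono[OF order_trans[OF 1 3] order_trans[OF 2[unfolded mult_zero_right add_0] 3]] by simp
      qed
    qed (use t in auto)
    then show ?thesis by simp
  qed
  have eqy: "y t = y' t" if "t \<in> {0..T}" for t
  proof -
    have "norm (y t - y' t) \<le> 0" using F0[OF that] Lp_norm_nonneg[of p \<alpha> "\<lambda>\<omega>. ?x t \<omega> - ?x' t \<omega>"] by linarith
    then show ?thesis by simp
  qed
  \<comment> \<open>Equality of the laws is read off from pathwise equality of the trajectories,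
    \<open>xcmp\<close> with k = 0.\<close>
  have eqm: "m t = m' t" if t: "t \<in> {0..T}" for t
  proof -
    have "?x t \<omega> = ?x' t \<omega>" if \<omega>: "\<omega> \<in> space \<alpha>" for \<omega>
    proof -
      have "norm (?x t \<omega> - ?x' t \<omega>) \<le> (4 * B * 0 / l) * exp (l * t)"
        by (rule xcmp[OF order_refl _ t \<omega>]) (use F0 in simp)
      then show ?thesis by simp
    qed
    then show ?thesis unfolding mt[OF t] mt'[OF t] by (intro distr_cong) auto
  qed
  have "m = m'" by (rule extensionalityI[OF m(2) m'(2) eqm])
  moreover have "y = y'"
  proof (rule extensionalityI[of _ "{0..T}"])
    show "y \<in> extensional {0..T}" unfolding y by (rule major_curve(2)[OF m(1) \<zeta>])
    show "y' \<in> extensional {0..T}" unfolding y' by (rule major_curve(2)[OF m'(1) \<zeta>])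
  qed (rule eqy)
  ultimately show ?thesis by blast
qed

text \<open>The unknown is a function of time and of the agent \<omega>, with the position of that
  agent and the state of the major agent as values in a Euclidean space, so completeness is
  immediate. The weight exp(l * t) * (1 + |x0|) allows positions to grow with the initial
  state.\<close>

lemma motion_exists:
  assumes \<alpha>: "\<alpha> \<in> strategies" and \<zeta>: "\<zeta> \<in> relaxed_controls T"
  shows "\<exists>m y. is_motion T p fI fII g y0 \<alpha> \<zeta> m y"
proof -
  interpret \<alpha>: prob_space \<alpha> by (rule strategies_prob[OF \<alpha>])
  obtain \<omega>0 where \<omega>0: "\<omega>0 \<in> space \<alpha>" using \<alpha>.not_empty by blast
  obtain B where B: "lipschitz_const bound B" using lipschitz_const_exists by blast
  have B0: "0 \<le> B" using B by (simp add: lipschitz_const_def)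
  let ?u = "\<lambda>\<omega> :: 'x \<times> (real \<times> 'u) measure. 1 * norm (fst \<omega>) + 1"
  have uL: "Lp_fun p \<alpha> ?u" by (rule strategies_bound_Lp[OF \<alpha>])
  have u1: "1 \<le> ?u \<omega>" for \<omega> by simp
  \<comment> \<open>The price of the weight when pointwise differences are converted: its L^p norm
    bounds the Wasserstein distance, and its value at \<omega>0 the distance of the y components,
    which are read off at \<omega>0.\<close>
  define Q where "Q = Lp_norm p \<alpha> ?u + ?u \<omega>0"
  have Q0: "0 \<le> Q" unfolding Q_def using Lp_norm_nonneg[of p \<alpha> ?u] by simp
  \<comment> \<open>As for uniqueness, with the perturbation now \<open>k * Q\<close>: each of the
    two comparisons returns at most k / 4.\<close>
  define l where "l = 16 * B * Q + 4 * B + 1"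
  have l: "0 < l" "4 * B \<le> l" "16 * B * Q \<le> l"
    using B0 mult_nonneg_nonneg[OF mult_nonneg_nonneg[OF _ B0, of 16] Q0] by (auto simp: l_def)
  \<comment> \<open>From the pathwise bound in \<open>growth_step\<close> with k =
    \<open>radius\<close>, written as a multiple of 1 + |x0|.\<close>
  define K where "K = (2 + (1 + radius) / 6) * exp (rate * T)"
  have K0: "0 \<le> K" unfolding K_def using radius_pos by simp
  define wt where "wt i = exp (l * fst i) * ?u (snd i)" for i :: "real \<times> ('x \<times> (real \<times> 'u) measure)"
  define mz where "mz z t = (if t \<in> {0..T} then distr \<alpha> borel (\<lambda>\<omega>. fst (z (t, \<omega>)) :: 'x) else undefined)"
    for z :: "real \<times> ('x \<times> (real \<times> 'u) measure) \<Rightarrow> 'x \<times> 'y" and t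
  define yz where "yz z t = (if t \<in> {0..T} then snd (z (t, \<omega>0)) else undefined)"
    for z :: "real \<times> ('x \<times> (real \<times> 'u) measure) \<Rightarrow> 'x \<times> 'y" and t
  \<comment> \<open>The y component is carried along by every agent and must not depend on it. The
    pathwise bound by \<open>K\<close> gives domination, through which the L^p bound in the last
    clause survives limits; the last clause keeps the iterates within the reach of the constant
    \<open>B\<close>.\<close>
  define P where "P z \<longleftrightarrow> (\<forall>t\<in>{0..T}. (\<lambda>\<omega>. fst (z (t, \<omega>))) \<in> borel_measurable \<alpha>) \<and>
      (\<forall>\<omega>\<in>space \<alpha>. continuous_on {0..T} (\<lambda>t. z (t, \<omega>))) \<and>
      (\<forall>t\<in>{0..T}. \<forall>\<omega>\<in>space \<alpha>. snd (z (t, \<omega>)) = snd (z (t, \<omega>0))) \<and>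
      (\<forall>t\<in>{0..T}. \<forall>\<omega>\<in>space \<alpha>. norm (fst (z (t, \<omega>))) \<le> K * ?u \<omega>) \<and>
      (\<forall>t\<in>{0..T}. Lp_norm p \<alpha> (\<lambda>\<omega>. fst (z (t, \<omega>))) + norm (snd (z (t, \<omega>0))) \<le> radius * exp (rate * t))"
    for z :: "real \<times> ('x \<times> (real \<times> 'u) measure) \<Rightarrow> 'x \<times> 'y"
  \<comment> \<open>The laws and the y path generated by \<open>z\<close> are frozen and every agent
    solves its equation exactly, so only the coupling through the laws is iterated.\<close>
  define \<Phi> where "\<Phi> z i = (minor (mz z) (yz z) (fst (snd i)) (snd (snd i)) \<zeta> (fst i), major (mz z) \<zeta> (fst i))"
    for z and i :: "real \<times> ('x \<times> (real \<times> 'u) measure)"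
  have KL: "Lp_fun p \<alpha> (\<lambda>\<omega>. K * ?u \<omega>)" using Lp_scaleR(1)[OF p uL, of K] by simp
  have Pm: "(\<lambda>\<omega>. fst (z (t, \<omega>))) \<in> borel_measurable \<alpha>" if "P z" "t \<in> {0..T}" for z t
    using that by (simp add: P_def)
  have Pc: "continuous_on {0..T} (\<lambda>t. z (t, \<omega>))" if "P z" "\<omega> \<in> space \<alpha>" for z \<omega>
    using that by (simp add: P_def)
  have Pk: "norm (fst (z (t, \<omega>))) \<le> norm (K * ?u \<omega>)" if "P z" "t \<in> {0..T}" "\<omega> \<in> space \<alpha>" for z t \<omega>
  proof -
    have "norm (fst (z (t, \<omega>))) \<le> K * ?u \<omega>" using that unfolding P_def by blast
    then show ?thesis using abs_ge_self order_trans unfolding real_norm_def by blast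
  qed
  have PL: "Lp_fun p \<alpha> (\<lambda>\<omega>. fst (z (t, \<omega>)))" if "P z" "t \<in> {0..T}" for z t
    by (rule Lp_fun_mono(1)[OF p KL Pm[OF that] Pk[OF that]])
  have Pyc: "continuous_on {0..T} (yz z)" if "P z" for z
    by (rule continuous_on_eq[OF continuous_on_snd[OF Pc[OF that \<omega>0]]]) (simp add: yz_def)
  have Pvs: "varsigma p (mz z t) = Lp_norm p \<alpha> (\<lambda>\<omega>. fst (z (t, \<omega>)))" if "P z" "t \<in> {0..T}" for z t
    using varsigma_distr[OF Pm[OF that]] that(2) by (simp add: mz_def)
  have Pb: "varsigma p (mz z t) + norm (yz z t) \<le> radius * exp (rate * t)" if "P z" "t \<in> {0..T}" for z t
    unfolding Pvs[OF that] using that by (simp add: P_def yz_def)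
  have Pb': "varsigma p (mz z t) \<le> bound" "norm (yz z t) \<le> bound" if "P z" "t \<in> {0..T}" for z t
    using bound_ge[OF Pb[OF that] that(2)] varsigma_nonneg[of "mz z t"] norm_ge_zero[of "yz z t"] by linarith+
  have Pf: "flow (mz z)" if z: "P z" for z
    unfolding flow_def
  proof (intro conjI exI ballI)
    show "continuous_map (top_of_set {0..T}) (Wp_topology p euclidean_metric) (mz z)"
    proof (rule continuous_map_Wp_path_law[where x = "\<lambda>t \<omega>. fst (z (t, \<omega>))" and D = "\<lambda>\<omega>. K * ?u \<omega>", OF p \<alpha>.prob_space_axioms])
      show "continuous_on {0..T} (\<lambda>t. fst (z (t, \<omega>)))" if "\<omega> \<in> space \<alpha>" for \<omega>
        by (rule continuous_on_fst[OF Pc[OF z that]])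
    qed (use Pm[OF z] KL Pk[OF z] in \<open>auto simp: mz_def\<close>)
    show "varsigma p (mz z t) \<le> bound" if "t \<in> {0..T}" for t by (rule Pb'(1)[OF z that])
  qed
  have inv: "P (\<Phi> z)" if z: "P z" for z
    unfolding P_def
  proof (intro conjI ballI)
    note f = Pf[OF z] and yc = Pyc[OF z]
    show "(\<lambda>\<omega>. fst (\<Phi> z (t, \<omega>))) \<in> borel_measurable \<alpha>" if "t \<in> {0..T}" for t
      unfolding \<Phi>_def using minor_field(1)[OF f yc \<zeta> \<alpha> that] by simp
    show "continuous_on {0..T} (\<lambda>t. \<Phi> z (t, \<omega>))" if "\<omega> \<in> space \<alpha>" for \<omega>
    proof -
      have "snd \<omega> \<in> relaxed_controls T" using that strategies_space[OF \<alpha>] by (simp add: mem_Times_iff)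
      then show ?thesis unfolding \<Phi>_def fst_conv snd_conv
        by (intro continuous_on_Pair minor_continuous[OF f yc _ \<zeta>] major_continuous[OF f \<zeta>])
    qed
    show "snd (\<Phi> z (t, \<omega>)) = snd (\<Phi> z (t, \<omega>0))" for t \<omega> by (simp add: \<Phi>_def)
    note gs = growth_step[OF f yc \<zeta> less_imp_le[OF radius_pos] Pb[OF z]]
    show "norm (fst (\<Phi> z (t, \<omega>))) \<le> K * ?u \<omega>" if t: "t \<in> {0..T}" and \<omega>: "\<omega> \<in> space \<alpha>" for t \<omega>
    proof -
      have "snd \<omega> \<in> relaxed_controls T" using \<omega> strategies_space[OF \<alpha>] by (simp add: mem_Times_iff)
      then have "norm (fst (\<Phi> z (t, \<omega>))) \<le> (2 * norm (fst \<omega>) + (1 + radius) / 6) * exp (rate * t)"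
        unfolding \<Phi>_def fst_conv snd_conv using gs(1) t by blast
      also have "\<dots> \<le> ((2 + (1 + radius) / 6) * ?u \<omega>) * exp (rate * T)"
      proof (rule mult_mono)
        have "0 \<le> (1 + radius) / 6 * norm (fst \<omega>)" using radius_pos by simp
        moreover have "(2 + (1 + radius) / 6) * ?u \<omega>
            = 2 * norm (fst \<omega>) + (1 + radius) / 6 + (2 + (1 + radius) / 6 * norm (fst \<omega>))"
          by (simp add: distrib_left distrib_right)
        ultimately show "2 * norm (fst \<omega>) + (1 + radius) / 6 \<le> (2 + (1 + radius) / 6) * ?u \<omega>" by linarith
      qed (use t rate_pos radius_pos in auto)
      also have "\<dots> = K * ?u \<omega>" by (simp add: K_def)
      finally show ?thesis .
    qed
    show "Lp_norm p \<alpha> (\<lambda>\<omega>. fst (\<Phi> z (t, \<omega>))) + norm (snd (\<Phi> z (t, \<omega>0))) \<le> radius * exp (rate * t)" if t: "t \<in> {0..T}" for t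
      unfolding \<Phi>_def fst_conv snd_conv using gs(2)[OF _ t \<alpha>] by simp
  qed
  have maj: "norm (major (mz z) \<zeta> t) \<le> bound" if z: "P z" and t: "t \<in> {0..T}" for z t
  proof -
    have "Lp_norm p \<alpha> (\<lambda>\<omega>. fst (\<Phi> z (t, \<omega>))) + norm (snd (\<Phi> z (t, \<omega>0))) \<le> radius * exp (rate * t)"
      using inv[OF z] t unfolding P_def by blast
    from bound_ge[OF this t] show ?thesis
      using Lp_norm_nonneg[of p \<alpha> "\<lambda>\<omega>. fst (\<Phi> z (t, \<omega>))"] unfolding \<Phi>_def fst_conv snd_conv by linarith
  qed
  let ?I = "{0..T} \<times> space \<alpha>"
  have pairn: "norm (a, b) \<le> norm a + norm b" for a :: 'x and b :: 'y
    unfolding norm_Pair by (rule sqrt_sum_squares_le_sum) auto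
  have wt0: "0 \<le> wt i" for i by (simp add: wt_def)
  have "\<exists>z. P z \<and> (\<forall>i\<in>?I. \<Phi> z i = z i)"
  proof (rule weighted_contraction_fixpoint[where ?z0.0 = "\<lambda>_. 0" and N = "K + bound" and w = wt
      and W = P and \<Phi> = \<Phi> and I = ?I, OF wt0 _ inv])
    show P0: "P (\<lambda>_. 0)"
      using K0 radius_pos p by (auto simp: P_def Lp_norm_def continuous_on_const)
    have b0: "0 \<le> bound" unfolding bound_def using radius_pos by simp
    then show "0 \<le> K + bound" using K0 by simp
    show "norm (\<Phi> (\<lambda>_. 0) i - 0) \<le> (K + bound) * wt i" if i: "i \<in> ?I" for i
    proof -
      obtain t \<omega> where [simp]: "i = (t, \<omega>)" and t: "t \<in> {0..T}" and \<omega>: "\<omega> \<in> space \<alpha>" using i by auto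
      have "norm (fst (\<Phi> (\<lambda>_. 0) i)) \<le> K * ?u \<omega>" using inv[OF P0] t \<omega> unfolding P_def by auto
      moreover have "norm (snd (\<Phi> (\<lambda>_. 0) i)) \<le> bound * ?u \<omega>"
      proof -
        have "norm (snd (\<Phi> (\<lambda>_. 0) i)) \<le> bound * 1" using maj[OF P0 t] by (simp add: \<Phi>_def)
        also have "\<dots> \<le> bound * ?u \<omega>" using b0 u1 by (rule mult_left_mono[rotated])
        finally show ?thesis .
      qed
      ultimately have "norm (\<Phi> (\<lambda>_. 0) i) \<le> K * ?u \<omega> + bound * ?u \<omega>"
        using pairn[of "fst (\<Phi> (\<lambda>_. 0) i)" "snd (\<Phi> (\<lambda>_. 0) i)"] by simp
      also have "\<dots> = (K + bound) * (1 * ?u \<omega>)" by (simp add: algebra_simps)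
      also have "\<dots> \<le> (K + bound) * wt i"
      proof (rule mult_left_mono)
        have "1 \<le> exp (l * t)" using l t by simp
        then have "1 * ?u \<omega> \<le> exp (l * t) * ?u \<omega>" by (rule mult_right_mono) simp
        then show "1 * ?u \<omega> \<le> wt i" by (simp add: wt_def)
      qed (use K0 b0 in simp)
      finally show ?thesis by simp
    qed
    show "norm (\<Phi> z i - \<Phi> z' i) \<le> k / 2 * wt i"
      if z: "P z" "P z'" and k: "0 \<le> k" and le: "\<And>j. j \<in> ?I \<Longrightarrow> norm (z j - z' j) \<le> k * wt j" and i: "i \<in> ?I" for z z' k i
    proof -
      obtain t \<omega> where [simp]: "i = (t, \<omega>)" and t: "t \<in> {0..T}" and \<omega>: "\<omega> \<in> space \<alpha>" using i by auto
      have Wle: "W (mz z s) (mz z' s) + norm (yz z s - yz z' s) \<le> (k * Q) * exp (l * s)" if s: "s \<in> {0..T}" for s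
      proof -
        let ?E = "exp (l * s)"
        have dm: "(\<lambda>\<omega>. fst (z (s, \<omega>)) - fst (z' (s, \<omega>))) \<in> borel_measurable \<alpha>"
          using Pm[OF z(1) s] Pm[OF z(2) s] by simp
        have sc: "Lp_fun p \<alpha> (\<lambda>\<omega>. (k * ?E) *\<^sub>R ?u \<omega>)" by (rule Lp_scaleR(1)[OF p uL])
        have dle: "norm (fst (z (s, \<omega>)) - fst (z' (s, \<omega>))) \<le> norm ((k * ?E) *\<^sub>R ?u \<omega>)" if "\<omega> \<in> space \<alpha>" for \<omega>
        proof -
          have "norm (fst (z (s, \<omega>)) - fst (z' (s, \<omega>))) \<le> norm (z (s, \<omega>) - z' (s, \<omega>))"
            using norm_fst_le[of "fst (z (s, \<omega>) - z' (s, \<omega>))" "snd (z (s, \<omega>) - z' (s, \<omega>))", unfolded prod.collapse, unfolded fst_diff] .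
          also have "\<dots> \<le> k * wt (s, \<omega>)" using le that s by auto
          also have "\<dots> = norm ((k * ?E) *\<^sub>R ?u \<omega>)" using k by (simp add: wt_def)
          finally show ?thesis .
        qed
        have "W (mz z s) (mz z' s) \<le> Lp_norm p \<alpha> (\<lambda>\<omega>. fst (z (s, \<omega>)) - fst (z' (s, \<omega>)))"
          using Wp_distr_le[OF p Pm[OF z(1) s] Pm[OF z(2) s] Lp_fun_mono(1)[OF p sc dm dle]] s by (simp add: mz_def)
        also have "\<dots> \<le> Lp_norm p \<alpha> (\<lambda>\<omega>. (k * ?E) *\<^sub>R ?u \<omega>)" by (rule Lp_fun_mono(2)[OF p sc dm dle])
        also have "\<dots> = k * ?E * Lp_norm p \<alpha> ?u" using Lp_scaleR(2)[OF p uL, of "k * ?E"] k by simp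
        finally have 1: "W (mz z s) (mz z' s) \<le> k * ?E * Lp_norm p \<alpha> ?u" .
        have "norm (yz z s - yz z' s) \<le> norm (z (s, \<omega>0) - z' (s, \<omega>0))"
          using norm_snd_le[of "snd (z (s, \<omega>0) - z' (s, \<omega>0))" "fst (z (s, \<omega>0) - z' (s, \<omega>0))", unfolded prod.collapse, unfolded snd_diff] s by (simp add: yz_def)
        also have "\<dots> \<le> k * ?E * ?u \<omega>0" using le[of "(s, \<omega>0)"] s \<omega>0 by (simp add: wt_def mult.assoc)
        finally have "W (mz z s) (mz z' s) + norm (yz z s - yz z' s) \<le> k * ?E * Lp_norm p \<alpha> ?u + k * ?E * ?u \<omega>0"
          using 1 by linarith
        also have "\<dots> = (k * Q) * ?E" unfolding Q_def by (simp add: algebra_simps)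
        finally show ?thesis .
      qed
      have kQ: "0 \<le> k * Q" using k Q0 by simp
      have \<xi>: "snd \<omega> \<in> relaxed_controls T" using \<omega> strategies_space[OF \<alpha>] by (simp add: mem_Times_iff)
      have 1: "norm (fst (\<Phi> z i) - fst (\<Phi> z' i)) \<le> (4 * B * (k * Q) / l) * exp (l * t)"
        unfolding \<Phi>_def using minor_compare_same[OF Pf[OF z(1)] Pf[OF z(2)] Pyc[OF z(1)] Pyc[OF z(2)] \<xi> \<zeta>
          Pb'(1)[OF z(1)] Pb'(1)[OF z(2)] Pb'(2)[OF z(1)] Pb'(2)[OF z(2)] B l(1,2) kQ Wle t] by simp
      have 2: "norm (snd (\<Phi> z i) - snd (\<Phi> z' i)) \<le> (2 * 0 + 4 * B * (k * Q) / l) * exp (l * t)"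
      proof -
        have "norm (major (mz z) \<zeta> t - major (mz z') \<zeta> t) \<le> (2 * 0 + 4 * B * (k * Q) / l) * exp (l * t)"
        proof (rule major_compare[OF Pf[OF z(1)] Pf[OF z(2)] \<zeta> \<zeta> Pb'(1)[OF z(1)] Pb'(1)[OF z(2)] maj[OF z(1)] maj[OF z(2)]
            B l(1,2) kQ order_refl _ _ t])
          show "W (mz z s) (mz z' s) \<le> k * Q * exp (l * s)" if "s \<in> {0..T}" for s
            using Wle[OF that] norm_ge_zero[of "yz z s - yz z' s"] by linarith
          show "norm (control_integral \<zeta> s (\<lambda>x. driftG (mz z') (fst x) (major (mz z') \<zeta> (fst x)) (snd x))
            - control_integral \<zeta> s (\<lambda>x. driftG (mz z') (fst x) (major (mz z') \<zeta> (fst x)) (snd x))) \<le> 0" for s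
            by (simp only: diff_self norm_zero order_refl)
        qed
        then show ?thesis by (simp add: \<Phi>_def)
      qed
      have "16 * B * Q * k \<le> l * k" using l(3) k by (rule mult_right_mono)
      then have "4 * B * (k * Q) / l \<le> k / 4" using l(1) by (simp add: field_simps)
      then have 3: "(4 * B * (k * Q) / l) * exp (l * t) \<le> k / 4 * exp (l * t)" by (rule mult_right_mono) simp
      have "norm (\<Phi> z i - \<Phi> z' i) \<le> norm (fst (\<Phi> z i) - fst (\<Phi> z' i)) + norm (snd (\<Phi> z i) - snd (\<Phi> z' i))"
        using pairn[of "fst (\<Phi> z i) - fst (\<Phi> z' i)" "snd (\<Phi> z i) - snd (\<Phi> z' i)"]
        by (metis fst_diff prod.collapse snd_diff)
      also have "\<dots> \<le> k / 2 * (exp (l * t) * 1)"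
        using add_mono[OF order_trans[OF 1 3] order_trans[OF 2[unfolded mult_zero_right add_0] 3]] by simp
      also have "\<dots> \<le> k / 2 * wt i" unfolding wt_def using k by (intro mult_left_mono) auto
      finally show ?thesis .
    qed
    show "P z" if Z: "\<And>n::nat. P (Z n)" and cl: "\<And>n i. i \<in> ?I \<Longrightarrow> norm (Z n i - z i) \<le> 2 * (K + bound) / 2 ^ n * wt i" for Z z
    proof -
      have ul: "uniform_limit {0..T} (\<lambda>n t. Z n (t, \<omega>)) (\<lambda>t. z (t, \<omega>)) sequentially" if \<omega>: "\<omega> \<in> space \<alpha>" for \<omega>
      proof (rule uniform_limit_geometric)
        fix n t assume t: "t \<in> {0..T}"
        have "norm (Z n (t, \<omega>) - z (t, \<omega>)) \<le> 2 * (K + bound) / 2 ^ n * wt (t, \<omega>)" using cl t \<omega> by auto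
        also have "\<dots> \<le> 2 * (K + bound) / 2 ^ n * (exp (l * T) * ?u \<omega>)"
          unfolding wt_def fst_conv snd_conv using t l K0 b0
          by (intro mult_left_mono mult_right_mono) auto
        finally show "norm (Z n (t, \<omega>) - z (t, \<omega>)) \<le> 2 * (K + bound) * (exp (l * T) * ?u \<omega>) / 2 ^ n" by simp
      qed
      have lim: "(\<lambda>n. Z n (t, \<omega>)) \<longlonglongrightarrow> z (t, \<omega>)" if "t \<in> {0..T}" "\<omega> \<in> space \<alpha>" for t \<omega>
        by (rule tendsto_uniform_limitI[OF ul[OF that(2)] that(1)])
      have zm: "(\<lambda>\<omega>. fst (z (t, \<omega>))) \<in> borel_measurable \<alpha>" if t: "t \<in> {0..T}" for t
        by (rule borel_measurable_LIMSEQ_metric[where f = "\<lambda>n \<omega>. fst (Z n (t, \<omega>))"])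
          (auto intro!: Pm[OF Z t] tendsto_fst lim[OF t])
      show ?thesis
        unfolding P_def
      proof (intro conjI ballI zm)
        show "continuous_on {0..T} (\<lambda>t. z (t, \<omega>))" if "\<omega> \<in> space \<alpha>" for \<omega>
          by (rule uniform_limit_theorem[OF _ ul[OF that]]) (use Pc[OF Z that] in auto)
        fix t assume t: "t \<in> {0..T}"
        show "snd (z (t, \<omega>)) = snd (z (t, \<omega>0))" if "\<omega> \<in> space \<alpha>" for \<omega>
        proof (rule LIMSEQ_unique)
          show "(\<lambda>n. snd (Z n (t, \<omega>))) \<longlonglongrightarrow> snd (z (t, \<omega>))" by (intro tendsto_snd lim t that)
          have "snd (Z n (t, \<omega>)) = snd (Z n (t, \<omega>0))" for n using Z[of n] t that unfolding P_def by blast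
          then show "(\<lambda>n. snd (Z n (t, \<omega>))) \<longlonglongrightarrow> snd (z (t, \<omega>0))"
            using tendsto_snd[OF lim[OF t \<omega>0]] by simp
        qed
        show "norm (fst (z (t, \<omega>))) \<le> K * ?u \<omega>" if \<omega>: "\<omega> \<in> space \<alpha>" for \<omega>
        proof (rule LIMSEQ_le_const2)
          show "(\<lambda>n. norm (fst (Z n (t, \<omega>)))) \<longlonglongrightarrow> norm (fst (z (t, \<omega>)))"
            by (intro tendsto_norm tendsto_fst lim t \<omega>)
          have "norm (fst (Z n (t, \<omega>))) \<le> K * ?u \<omega>" for n using Z[of n] t \<omega> unfolding P_def by blast
          then show "\<exists>N. \<forall>n\<ge>N. norm (fst (Z n (t, \<omega>))) \<le> K * ?u \<omega>" by blast
        qed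
        show "Lp_norm p \<alpha> (\<lambda>\<omega>. fst (z (t, \<omega>))) + norm (snd (z (t, \<omega>0))) \<le> radius * exp (rate * t)"
        proof (rule LIMSEQ_le_const2)
          have "(\<lambda>n. Lp_norm p \<alpha> (\<lambda>\<omega>. fst (Z n (t, \<omega>)))) \<longlonglongrightarrow> Lp_norm p \<alpha> (\<lambda>\<omega>. fst (z (t, \<omega>)))"
            by (rule Lp_norm_tendsto[where D = "\<lambda>\<omega>. K * ?u \<omega>"])
              (fact p KL Pm[OF Z t] zm[OF t] Pk[OF Z t] tendsto_fst[OF lim[OF t]])+
          then show "(\<lambda>n. Lp_norm p \<alpha> (\<lambda>\<omega>. fst (Z n (t, \<omega>))) + norm (snd (Z n (t, \<omega>0)))) \<longlonglongrightarrow>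
              Lp_norm p \<alpha> (\<lambda>\<omega>. fst (z (t, \<omega>))) + norm (snd (z (t, \<omega>0)))"
            by (intro tendsto_add tendsto_norm tendsto_snd lim t \<omega>0)
          have "Lp_norm p \<alpha> (\<lambda>\<omega>. fst (Z n (t, \<omega>))) + norm (snd (Z n (t, \<omega>0))) \<le> radius * exp (rate * t)" for n
            using Z[of n] t unfolding P_def by blast
          then show "\<exists>N. \<forall>n\<ge>N. Lp_norm p \<alpha> (\<lambda>\<omega>. fst (Z n (t, \<omega>))) + norm (snd (Z n (t, \<omega>0))) \<le> radius * exp (rate * t)" by blast
        qed
      qed
    qed
  qed
  then obtain z where z: "P z" and fp: "\<And>t \<omega>. t \<in> {0..T} \<Longrightarrow> \<omega> \<in> space \<alpha> \<Longrightarrow> \<Phi> z (t, \<omega>) = z (t, \<omega>)" by blast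
  have y: "yz z = major (mz z) \<zeta>"
  proof (rule extensionalityI[of _ "{0..T}"])
    show "yz z \<in> extensional {0..T}" by (simp add: yz_def extensional_def)
    show "major (mz z) \<zeta> \<in> extensional {0..T}" by (rule major_curve(2)[OF Pf[OF z] \<zeta>])
    show "yz z t = major (mz z) \<zeta> t" if "t \<in> {0..T}" for t
      using that arg_cong[OF fp[OF that \<omega>0], of snd] by (simp add: yz_def \<Phi>_def)
  qed
  have "is_motion T p fI fII g y0 \<alpha> \<zeta> (mz z) (yz z)"
    unfolding is_motion_iff[OF \<alpha> \<zeta>]
  proof (intro conjI ballI y Pf[OF z])
    show "mz z \<in> extensional {0..T}" by (simp add: mz_def extensional_def)
    fix t assume t: "t \<in> {0..T}"
    have "fst (z (t, \<omega>)) = minor (mz z) (yz z) (fst \<omega>) (snd \<omega>) \<zeta> t" if "\<omega> \<in> space \<alpha>" for \<omega>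
      using arg_cong[OF fp[OF t that], of fst] by (simp add: \<Phi>_def)
    then show "mz z t = distr \<alpha> borel (\<lambda>\<omega>. minor (mz z) (yz z) (fst \<omega>) (snd \<omega>) \<zeta> t)"
      using t by (auto simp: mz_def intro!: distr_cong)
  qed
  then show ?thesis by blast
qed

text \<open>Uniqueness resolves the \<open>THE\<close> in \<open>payoff\<close>.\<close>

lemma payoff_motion:
  assumes "\<alpha> \<in> strategies" "\<zeta> \<in> relaxed_controls T" and mot: "is_motion T p fI fII g y0 \<alpha> \<zeta> m y"
  shows "payoff T p fI fII g y0 \<sigma> \<alpha> \<zeta> = \<sigma> (m T, y T)"
proof -
  have "(THE (m, y). is_motion T p fI fII g y0 \<alpha> \<zeta> m y) = (m, y)"
  proof (rule the_equality)
    show "case (m, y) of (m, y) \<Rightarrow> is_motion T p fI fII g y0 \<alpha> \<zeta> m y" using mot by simp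
    fix z assume "case z of (m, y) \<Rightarrow> is_motion T p fI fII g y0 \<alpha> \<zeta> m y"
    then have "is_motion T p fI fII g y0 \<alpha> \<zeta> (fst z) (snd z)" by (simp add: case_prod_unfold)
    from motion_unique[OF assms(1,2) this mot] show "z = (m, y)" by (simp add: prod_eq_iff)
  qed
  then show ?thesis by (simp add: payoff_def)
qed

end


section \<open>Stability of motions\<close>

lemma Lp_fun_distr:
  fixes h :: "'a \<Rightarrow> 'b::euclidean_space"
  assumes X: "X \<in> measurable \<Omega> M" and h: "h \<in> borel_measurable M"
  shows "Lp_fun p (distr \<Omega> M X) h \<longleftrightarrow> Lp_fun p \<Omega> (\<lambda>\<omega>. h (X \<omega>))"
    and "Lp_norm p (distr \<Omega> M X) h = Lp_norm p \<Omega> (\<lambda>\<omega>. h (X \<omega>))"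
proof -
  have hm: "(\<lambda>x. norm (h x) powr p) \<in> borel_measurable M" using h by measurable
  have hX: "(\<lambda>\<omega>. h (X \<omega>)) \<in> borel_measurable \<Omega>" using measurable_compose[OF X h] .
  show "Lp_fun p (distr \<Omega> M X) h \<longleftrightarrow> Lp_fun p \<Omega> (\<lambda>\<omega>. h (X \<omega>))"
    unfolding Lp_fun_def using hX h integrable_distr_eq[OF X hm] by simp
  show "Lp_norm p (distr \<Omega> M X) h = Lp_norm p \<Omega> (\<lambda>\<omega>. h (X \<omega>))"
    unfolding Lp_norm_def by (subst integral_distr[OF X hm]) simp
qed

lemma integral_powr_eq_Lp_norm:
  assumes "p \<ge> 1"
  shows "(LINT x|M. norm (h x) powr p) = Lp_norm p M h powr p"
proof -
  have "0 \<le> (LINT x|M. norm (h x) powr p)" by simp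
  then show ?thesis using assms by (simp add: Lp_norm_def powr_powr)
qed

context mean_field_game
begin

text \<open>Two estimates for one pair of trajectories. The first bounds the control errors by the
  growth of f along the limit trajectory: it does not vanish, but yields a dominating function. In
  the second the errors vanish, at a speed depending on the agent. Together they feed dominated
  convergence.\<close>

lemma minor_stability:
  fixes mn :: "nat \<Rightarrow> real \<Rightarrow> 'x measure" and \<xi>n :: "nat \<Rightarrow> (real \<times> 'u) measure" and \<zeta>n :: "nat \<Rightarrow> (real \<times> 'v) measure"
  assumes m: "\<And>n. flow (mn n)" "flow m" and y: "\<And>n. continuous_on {0..T} (yn n)" "continuous_on {0..T} y"
    and \<xi>: "\<And>n. \<xi>n n \<in> relaxed_controls T" "\<xi> \<in> relaxed_controls T"
    and \<zeta>: "\<And>n. \<zeta>n n \<in> relaxed_controls T" "\<zeta> \<in> relaxed_controls T"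
    and c: "\<And>n t. t \<in> {0..T} \<Longrightarrow> varsigma p (mn n t) \<le> c" "\<And>t. t \<in> {0..T} \<Longrightarrow> varsigma p (m t) \<le> c"
      "\<And>n t. t \<in> {0..T} \<Longrightarrow> norm (yn n t) \<le> c" "\<And>t. t \<in> {0..T} \<Longrightarrow> norm (y t) \<le> c"
    and B: "lipschitz_const c B" and l: "0 < l" "4 * B \<le> l" and k: "\<And>n. 0 \<le> k n"
    and d: "\<And>n t. t \<in> {0..T} \<Longrightarrow> W (mn n t) (m t) + norm (yn n t - y t) \<le> k n * exp (l * t)"
    and b: "\<And>t. t \<in> {0..T} \<Longrightarrow> norm (minor m y x0 \<xi> \<zeta> t) \<le> b"
  shows "\<And>n t. t \<in> {0..T} \<Longrightarrow> norm (minor (mn n) (yn n) (xn n) (\<xi>n n) (\<zeta>n n) t - minor m y x0 \<xi> \<zeta> t)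
      \<le> (2 * (norm (xn n - x0) + 4 * (A * (b + (1 + 2 * c)) * T)) + 4 * B * k n / l) * exp (l * t)"
    and "control_conv T \<xi>n \<xi> \<Longrightarrow> control_conv T \<zeta>n \<zeta> \<Longrightarrow> \<exists>\<rho>. \<rho> \<longlonglongrightarrow> 0 \<and> (\<forall>n. \<forall>t\<in>{0..T}.
      norm (minor (mn n) (yn n) (xn n) (\<xi>n n) (\<zeta>n n) t - minor m y x0 \<xi> \<zeta> t)
      \<le> (2 * (norm (xn n - x0) + \<rho> n) + 4 * B * k n / l) * exp (l * t))"
proof -
  let ?x = "minor m y x0 \<xi> \<zeta>"
  let ?hI = "\<lambda>z. driftI m y (fst z) (?x (fst z)) (snd z)" and ?hII = "\<lambda>z. driftII m y (fst z) (?x (fst z)) (snd z)"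
  let ?C = "A * (b + (1 + 2 * c))"
  have xc: "continuous_on {0..T} ?x" by (rule minor_continuous[OF m(2) y(2) \<xi>(2) \<zeta>(2)])
  have hc: "continuous_on (control_domain T) ?hI" "continuous_on (control_domain T) ?hII"
    using drifts[OF m(2) y(2)] xc by (simp_all add: drift_def)
  have bd: "A * (norm (?x s) + (1 + varsigma p (m s) + norm (y s))) \<le> ?C" if "s \<in> {0..T}" for s
    using b[OF that] c(2,4)[OF that] A by (intro mult_left_mono) auto
  have C: "norm (?hI z) \<le> ?C" if "z \<in> control_domain T" for z
    using that order_trans[OF f_growth(1)[OF _ flow_in[OF m(2)]] bd] by (auto simp: mem_Times_iff)
  have C': "norm (?hII z) \<le> ?C" if "z \<in> control_domain T" for z
    using that order_trans[OF f_growth(2)[OF _ flow_in[OF m(2)]] bd] by (auto simp: mem_Times_iff)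
  have C0: "0 \<le> ?C" by (rule order_trans[OF norm_ge_zero C[of "(0, undefined)"]]) (use T in simp)
  note cmp = minor_compare[OF m(1) m(2) y(1) y(2) \<xi>(1) \<xi>(2) \<zeta>(1) \<zeta>(2) c(1) c(2) c(3) c(4) B l k _ d]
  show "norm (minor (mn n) (yn n) (xn n) (\<xi>n n) (\<zeta>n n) t - ?x t)
      \<le> (2 * (norm (xn n - x0) + 4 * (?C * T)) + 4 * B * k n / l) * exp (l * t)" if t: "t \<in> {0..T}" for n t
  proof (rule cmp)
    show "0 \<le> norm (xn n - x0) + 4 * (?C * T)" using C0 T0 by simp
    fix s assume s: "s \<in> {0..T}"
    then have s': "0 \<le> s" "s \<le> T" by auto
    have Cs: "?C * s \<le> ?C * T" using C0 s by (intro mult_left_mono) auto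
    have 1: "norm (control_integral (\<xi>n n) s ?hI - control_integral \<xi> s ?hI) \<le> 2 * (?C * T)"
      using norm_triangle_ineq4[of "control_integral (\<xi>n n) s ?hI" "control_integral \<xi> s ?hI"]
        norm_control_integral_le_const[OF \<xi>(1)[of n] hc(1) s' C] norm_control_integral_le_const[OF \<xi>(2) hc(1) s' C] Cs by linarith
    have 2: "norm (control_integral (\<zeta>n n) s ?hII - control_integral \<zeta> s ?hII) \<le> 2 * (?C * T)"
      using norm_triangle_ineq4[of "control_integral (\<zeta>n n) s ?hII" "control_integral \<zeta> s ?hII"]
        norm_control_integral_le_const[OF \<zeta>(1)[of n] hc(2) s' C'] norm_control_integral_le_const[OF \<zeta>(2) hc(2) s' C'] Cs by linarith
    show "norm (xn n - x0) + norm (control_integral (\<xi>n n) s ?hI - control_integral \<xi> s ?hI)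
      + norm (control_integral (\<zeta>n n) s ?hII - control_integral \<zeta> s ?hII) \<le> norm (xn n - x0) + 4 * (?C * T)"
      using 1 2 by linarith
  qed (use t in auto)
  show "\<exists>\<rho>. \<rho> \<longlonglongrightarrow> 0 \<and> (\<forall>n. \<forall>t\<in>{0..T}.
      norm (minor (mn n) (yn n) (xn n) (\<xi>n n) (\<zeta>n n) t - ?x t)
      \<le> (2 * (norm (xn n - x0) + \<rho> n) + 4 * B * k n / l) * exp (l * t))"
    if conv: "control_conv T \<xi>n \<xi>" "control_conv T \<zeta>n \<zeta>"
  proof -
    obtain \<rho>1 where \<rho>1: "\<rho>1 \<longlonglongrightarrow> 0" "\<And>n. 0 \<le> \<rho>1 n"
      "\<And>n t. t \<in> {0..T} \<Longrightarrow> norm (control_integral (\<xi>n n) t ?hI - control_integral \<xi> t ?hI) \<le> \<rho>1 n"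
      using control_conv_uniform[OF conv(1) \<xi> T0 hc(1) C] by blast
    obtain \<rho>2 where \<rho>2: "\<rho>2 \<longlonglongrightarrow> 0" "\<And>n. 0 \<le> \<rho>2 n"
      "\<And>n t. t \<in> {0..T} \<Longrightarrow> norm (control_integral (\<zeta>n n) t ?hII - control_integral \<zeta> t ?hII) \<le> \<rho>2 n"
      using control_conv_uniform[OF conv(2) \<zeta> T0 hc(2) C'] by blast
    show ?thesis
    proof (intro exI[of _ "\<lambda>n. \<rho>1 n + \<rho>2 n"] conjI allI ballI)
      show "(\<lambda>n. \<rho>1 n + \<rho>2 n) \<longlonglongrightarrow> 0" using tendsto_add[OF \<rho>1(1) \<rho>2(1)] by simp
      fix n t assume t: "t \<in> {0..T}"
      show "norm (minor (mn n) (yn n) (xn n) (\<xi>n n) (\<zeta>n n) t - ?x t)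
        \<le> (2 * (norm (xn n - x0) + (\<rho>1 n + \<rho>2 n)) + 4 * B * k n / l) * exp (l * t)"
      proof (rule cmp)
        show "0 \<le> norm (xn n - x0) + (\<rho>1 n + \<rho>2 n)" using \<rho>1(2)[of n] \<rho>2(2)[of n] by simp
        show "norm (xn n - x0) + norm (control_integral (\<xi>n n) s ?hI - control_integral \<xi> s ?hI)
          + norm (control_integral (\<zeta>n n) s ?hII - control_integral \<zeta> s ?hII) \<le> norm (xn n - x0) + (\<rho>1 n + \<rho>2 n)"
          if "s \<in> {0..T}" for s
          using \<rho>1(3)[OF that, of n] \<rho>2(3)[OF that, of n] by linarith
      qed (use t in auto)
    qed
  qed
qed

text \<open>There is a single major agent, so the vanishing error needs no domination.\<close>

lemma major_stability:
  fixes mn :: "nat \<Rightarrow> real \<Rightarrow> 'x measure" and \<zeta>n :: "nat \<Rightarrow> (real \<times> 'v) measure"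
  assumes m: "\<And>n. flow (mn n)" "flow m"
    and \<zeta>: "\<And>n. \<zeta>n n \<in> relaxed_controls T" "\<zeta> \<in> relaxed_controls T"
    and c: "\<And>n t. t \<in> {0..T} \<Longrightarrow> varsigma p (mn n t) \<le> c" "\<And>t. t \<in> {0..T} \<Longrightarrow> varsigma p (m t) \<le> c"
      "\<And>n t. t \<in> {0..T} \<Longrightarrow> norm (major (mn n) (\<zeta>n n) t) \<le> c" "\<And>t. t \<in> {0..T} \<Longrightarrow> norm (major m \<zeta> t) \<le> c"
    and B: "lipschitz_const c B" and l: "0 < l" "4 * B \<le> l" and k: "\<And>n. 0 \<le> k n"
    and d: "\<And>n t. t \<in> {0..T} \<Longrightarrow> W (mn n t) (m t) \<le> k n * exp (l * t)"
    and conv: "control_conv T \<zeta>n \<zeta>"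
  shows "\<exists>\<rho>. \<rho> \<longlonglongrightarrow> 0 \<and> (\<forall>n. \<forall>t\<in>{0..T}. norm (major (mn n) (\<zeta>n n) t - major m \<zeta> t) \<le> (2 * \<rho> n + 4 * B * k n / l) * exp (l * t))"
proof -
  let ?y = "major m \<zeta>"
  let ?h = "\<lambda>z. driftG m (fst z) (?y (fst z)) (snd z)"
  have hc: "continuous_on (control_domain T) ?h"
    using drift_g[OF m(2)] major_continuous[OF m(2) \<zeta>(2)] by (simp add: drift_def)
  obtain C where C: "\<And>z. z \<in> control_domain T \<Longrightarrow> norm (?h z) \<le> C"
    using continuous_on_control_domain_bound[OF hc] by blast
  obtain \<rho> where \<rho>: "\<rho> \<longlonglongrightarrow> 0" "\<And>n. 0 \<le> \<rho> n"
    "\<And>n t. t \<in> {0..T} \<Longrightarrow> norm (control_integral (\<zeta>n n) t ?h - control_integral \<zeta> t ?h) \<le> \<rho> n"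
    using control_conv_uniform[OF conv \<zeta> T0 hc C] by blast
  show ?thesis
  proof (intro exI[of _ \<rho>] conjI allI ballI \<rho>(1))
    fix n t assume t: "t \<in> {0..T}"
    show "norm (major (mn n) (\<zeta>n n) t - major m \<zeta> t) \<le> (2 * \<rho> n + 4 * B * k n / l) * exp (l * t)"
      by (rule major_compare[OF m(1) m(2) \<zeta>(1) \<zeta>(2) c(1) c(2) c(3) c(4) B l k \<rho>(2) d \<rho>(3)]) (rule t | assumption)+
  qed
qed

text \<open>The distance \<open>k n\<close> of the motions is also the perturbation in the equations
  of the agents. The pathwise comparison returns it with the small factor 4 * B / l; after
  integration it is absorbed, and only vanishing errors remain.\<close>

lemma motion_stable:
  fixes \<Omega> :: "'w measure" and Xn :: "nat \<Rightarrow> 'w \<Rightarrow> 'x \<times> (real \<times> 'u) measure"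
  assumes \<Omega>: "prob_space \<Omega>"
    and Xn: "\<And>n. Xn n \<in> measurable \<Omega> input_space" "\<And>n. distr \<Omega> input_space (Xn n) \<in> strategies"
    and X: "X \<in> measurable \<Omega> input_space" "distr \<Omega> input_space X \<in> strategies"
    and conv: "AE \<omega> in \<Omega>. (\<lambda>n. fst (Xn n \<omega>)) \<longlonglongrightarrow> fst (X \<omega>) \<and> control_conv T (\<lambda>n. snd (Xn n \<omega>)) (snd (X \<omega>))"
    and \<zeta>: "\<And>n. \<zeta>n n \<in> relaxed_controls T" "\<zeta> \<in> relaxed_controls T" and conv\<zeta>: "control_conv T \<zeta>n \<zeta>"
    and motn: "\<And>n. is_motion T p fI fII g y0 (distr \<Omega> input_space (Xn n)) (\<zeta>n n) (mn n) (yn n)"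
    and mot: "is_motion T p fI fII g y0 (distr \<Omega> input_space X) \<zeta> m y"
  shows "(\<lambda>n. W (m T) (mn n T)) \<longlonglongrightarrow> 0" "(\<lambda>n. yn n T) \<longlonglongrightarrow> y T"
proof -
  interpret \<Omega>: prob_space \<Omega> by fact
  have mn: "flow (mn n)" "yn n = major (mn n) (\<zeta>n n)" and mnt: "t \<in> {0..T} \<Longrightarrow> mn n t =
    distr (distr \<Omega> input_space (Xn n)) borel (\<lambda>\<omega>. minor (mn n) (yn n) (fst \<omega>) (snd \<omega>) (\<zeta>n n) t)" for n t
    using motn[of n] unfolding is_motion_iff[OF Xn(2) \<zeta>(1)] by auto
  have m: "flow m" "y = major m \<zeta>" and mt: "t \<in> {0..T} \<Longrightarrow> m t =
    distr (distr \<Omega> input_space X) borel (\<lambda>\<omega>. minor m y (fst \<omega>) (snd \<omega>) \<zeta> t)" for t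
    using mot unfolding is_motion_iff[OF X(2) \<zeta>(2)] by auto
  have yc: "continuous_on {0..T} (yn n)" "continuous_on {0..T} y" for n
    unfolding mn(2) m(2) by (intro major_continuous mn(1) m(1) \<zeta>)+
  note cn = motion_bounds[OF Xn(2) \<zeta>(1) motn] and c = motion_bounds[OF X(2) \<zeta>(2) mot]
  obtain B where B: "lipschitz_const bound B" using lipschitz_const_exists by blast
  have B0: "0 \<le> B" using B by (simp add: lipschitz_const_def)
  \<comment> \<open>In the final estimate 4 * B * k n / l occurs five times; with this rate the five
    terms together are at most \<open>k n / 2\<close>.\<close>
  define l where "l = 40 * B + 1"
  have l: "0 < l" "4 * B \<le> l" "40 * B \<le> l" using B0 by (auto simp: l_def)
  define x where "x n t \<omega> = minor (mn n) (yn n) (fst (Xn n \<omega>)) (snd (Xn n \<omega>)) (\<zeta>n n) t" for n t \<omega>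
  define x' where "x' t \<omega> = minor m y (fst (X \<omega>)) (snd (X \<omega>)) \<zeta> t" for t \<omega>
  have evn: "(\<lambda>\<omega>. minor (mn n) (yn n) (fst \<omega>) (snd \<omega>) (\<zeta>n n) t) \<in> borel_measurable input_space" if "t \<in> {0..T}" for n t
    by (rule minor_eval_measurable[OF mn(1) yc(1) \<zeta>(1) that])
  have ev: "(\<lambda>\<omega>. minor m y (fst \<omega>) (snd \<omega>) \<zeta> t) \<in> borel_measurable input_space" if "t \<in> {0..T}" for t
    by (rule minor_eval_measurable[OF m(1) yc(2) \<zeta>(2) that])
  have xm: "x n t \<in> borel_measurable \<Omega>" if "t \<in> {0..T}" for n t
    unfolding x_def by (rule measurable_compose[OF Xn(1) evn[OF that]])
  have x'm: "x' t \<in> borel_measurable \<Omega>" if "t \<in> {0..T}" for t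
    unfolding x'_def by (rule measurable_compose[OF X(1) ev[OF that]])
  have xlaw: "mn n t = distr \<Omega> borel (x n t)" if t: "t \<in> {0..T}" for n t
    unfolding mnt[OF t] distr_distr[OF evn[OF t] Xn(1)] comp_def x_def ..
  have x'law: "m t = distr \<Omega> borel (x' t)" if t: "t \<in> {0..T}" for t
    unfolding mt[OF t] distr_distr[OF ev[OF t] X(1)] comp_def x'_def ..
  have xL: "Lp_fun p \<Omega> (x n t)" if t: "t \<in> {0..T}" for n t
    unfolding x_def using minor_field(2)[OF mn(1)[of n] yc(1)[of n] \<zeta>(1)[of n] Xn(2)[of n] t] unfolding Lp_fun_distr(1)[OF Xn(1) evn[OF t]] .
  have x'L: "Lp_fun p \<Omega> (x' t)" if t: "t \<in> {0..T}" for t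
    unfolding x'_def using minor_field(2)[OF m(1) yc(2) \<zeta>(2) X(2) t] unfolding Lp_fun_distr(1)[OF X(1) ev[OF t]] .
  have dm: "(\<lambda>\<omega>. x n t \<omega> - x' t \<omega>) \<in> borel_measurable \<Omega>" if "t \<in> {0..T}" for n t
    using xm[OF that] x'm[OF that] by simp
  have ee: "exp (- (l * t)) * (exp (l * t) * z) = z" "exp (l * t) * (exp (- (l * t)) * z) = z" for t z :: real
    by (simp_all add: exp_minus)
  define D where "D n t = Lp_norm p \<Omega> (\<lambda>\<omega>. x n t \<omega> - x' t \<omega>)" for n t
  define F where "F n t = D n t + norm (yn n t - y t)" for n t
  have D0: "0 \<le> D n t" for n t unfolding D_def by (rule Lp_norm_nonneg)
  have F0: "0 \<le> F n t" for n t using D0[of n t] by (simp add: F_def)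
  note dL = Lp_fun_add_le[OF p xL x'L dm norm_triangle_ineq4]
  have Wn: "W (mn n t) (m t) \<le> D n t" if t: "t \<in> {0..T}" for n t
    unfolding xlaw[OF t] x'law[OF t] D_def by (rule Wp_distr_le[OF p xm[OF t] x'm[OF t] dL(1)[OF t t t]])
  \<comment> \<open>\<open>Wp\<close> is bounded in both orders: the Lipschitz conditions use the
    other one, while balls of \<open>Wp_topology\<close> have the limit as first argument.\<close>
  have Wn': "W (m t) (mn n t) \<le> D n t" if t: "t \<in> {0..T}" for n t
  proof -
    have "Lp_fun p \<Omega> (\<lambda>\<omega>. x' t \<omega> - x n t \<omega>)"
      by (rule Lp_fun_add_le(1)[OF p x'L[OF t] xL[OF t] _ norm_triangle_ineq4]) (use xm[OF t] x'm[OF t] in simp)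
    then have "W (m t) (mn n t) \<le> Lp_norm p \<Omega> (\<lambda>\<omega>. x' t \<omega> - x n t \<omega>)"
      unfolding xlaw[OF t] x'law[OF t] by (rule Wp_distr_le[OF p x'm[OF t] xm[OF t]])
    also have "\<dots> = D n t" unfolding D_def Lp_norm_def by (simp only: norm_minus_commute)
    finally show ?thesis .
  qed
  have FK: "F n t \<le> 6 * bound" if t: "t \<in> {0..T}" for n t
  proof -
    have "Lp_norm p \<Omega> (x n t) \<le> bound" "Lp_norm p \<Omega> (x' t) \<le> bound"
      using cn(1)[OF t, of n] c(1)[OF t] unfolding xlaw[OF t] x'law[OF t] varsigma_distr[OF xm[OF t]] varsigma_distr[OF x'm[OF t]] .
    then have "D n t \<le> 4 * bound" using dL(2)[OF t t t, of n] unfolding D_def distrib_left by linarith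
    then show ?thesis
      using norm_triangle_ineq4[of "yn n t" "y t"] cn(2)[OF t, of n] c(2)[OF t] unfolding F_def by linarith
  qed
  \<comment> \<open>One number per n for the distance of the whole motions, in the form in which the
    comparison lemmas take their perturbation. It is finite by the common a priori bound.\<close>
  define k where "k n = (SUP t\<in>{0..T}. exp (- (l * t)) * F n t)" for n
  have eK: "exp (- (l * t)) * F n t \<le> 6 * bound" if t: "t \<in> {0..T}" for n t
  proof -
    have "exp (- (l * t)) * F n t \<le> 1 * F n t" using l t F0 by (intro mult_right_mono) auto
    then show ?thesis using FK[OF t, of n] by simp
  qed
  have bdd: "bdd_above ((\<lambda>t. exp (- (l * t)) * F n t) ` {0..T})" for n
    by (rule bdd_aboveI2[where M = "6 * bound"]) (rule eK)
  have up: "exp (- (l * t)) * F n t \<le> k n" if "t \<in> {0..T}" for n t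
    unfolding k_def by (rule cSUP_upper[OF that bdd])
  have k0: "0 \<le> k n" for n
    by (rule order_trans[OF _ up[of 0]]) (use F0 T0 in auto)
  have Fk: "F n t \<le> k n * exp (l * t)" if "t \<in> {0..T}" for n t
  proof -
    have "exp (l * t) * (exp (- (l * t)) * F n t) \<le> exp (l * t) * k n" by (rule mult_left_mono[OF up[OF that]]) simp
    then show ?thesis unfolding ee(2) by (simp only: mult.commute)
  qed
  have d: "W (mn n t) (m t) + norm (yn n t - y t) \<le> k n * exp (l * t)" if "t \<in> {0..T}" for n t
    using Fk[OF that, of n] Wn[OF that, of n] by (simp add: F_def)
  have Wk: "W (mn n t) (m t) \<le> k n * exp (l * t)" if "t \<in> {0..T}" for n t
    using d[OF that, of n] norm_ge_zero[of "yn n t - y t"] by linarith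
  obtain P where P: "P \<longlonglongrightarrow> 0" "\<And>n t. t \<in> {0..T} \<Longrightarrow> norm (yn n t - y t) \<le> (2 * P n + 4 * B * k n / l) * exp (l * t)"
    using major_stability[OF mn(1) m(1) \<zeta>(1) \<zeta>(2) cn(1) c(1) cn(2)[unfolded mn(2)] c(2)[unfolded m(2)] B l(1,2) k0 Wk conv\<zeta>]
    unfolding mn(2)[symmetric] m(2)[symmetric] by blast
  obtain b where b: "0 \<le> b" "\<And>x0 \<xi> t. \<xi> \<in> relaxed_controls T \<Longrightarrow> t \<in> {0..T} \<Longrightarrow> norm (minor m y x0 \<xi> \<zeta> t) \<le> b * norm x0 + b"
    using flow_crude_bound[OF m(1) yc(2) \<zeta>(2)] by blast
  have X\<xi>: "snd (Xn n \<omega>) \<in> relaxed_controls T" "snd (X \<omega>) \<in> relaxed_controls T" if "\<omega> \<in> space \<Omega>" for n \<omega>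
    using measurable_space[OF Xn(1) that, of n] measurable_space[OF X(1) that] by (auto simp: space_input mem_Times_iff)
  have stab1: "norm (x n t \<omega> - x' t \<omega>) \<le> (2 * (norm (fst (Xn n \<omega>) - fst (X \<omega>))
      + 4 * (A * (b * norm (fst (X \<omega>)) + b + (1 + 2 * bound)) * T)) + 4 * B * k n / l) * exp (l * t)"
    if \<omega>: "\<omega> \<in> space \<Omega>" and t: "t \<in> {0..T}" for n t \<omega>
    unfolding x_def x'_def
    by (rule minor_stability(1)[where mn = mn and m = m and yn = yn and y = y and \<xi>n = "\<lambda>n. snd (Xn n \<omega>)" and \<xi> = "snd (X \<omega>)"
      and \<zeta>n = \<zeta>n and \<zeta> = \<zeta> and xn = "\<lambda>n. fst (Xn n \<omega>)" and ?x0.0 = "fst (X \<omega>)" and k = k and B = B and l = l and c = bound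
      and b = "b * norm (fst (X \<omega>)) + b"])
        (fact mn(1) m(1) yc X\<xi>[OF \<omega>] \<zeta> cn c B l k0 d b(2)[OF X\<xi>(2)[OF \<omega>]] t)+
  have stab2: "\<exists>\<rho>. \<rho> \<longlonglongrightarrow> 0 \<and> (\<forall>n. \<forall>t\<in>{0..T}. norm (x n t \<omega> - x' t \<omega>)
      \<le> (2 * (norm (fst (Xn n \<omega>) - fst (X \<omega>)) + \<rho> n) + 4 * B * k n / l) * exp (l * t))"
    if \<omega>: "\<omega> \<in> space \<Omega>" and cv: "control_conv T (\<lambda>n. snd (Xn n \<omega>)) (snd (X \<omega>))" for \<omega>
    unfolding x_def x'_def
    by (rule minor_stability(2)[where mn = mn and m = m and yn = yn and y = y and \<xi>n = "\<lambda>n. snd (Xn n \<omega>)" and \<xi> = "snd (X \<omega>)"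
      and \<zeta>n = \<zeta>n and \<zeta> = \<zeta> and xn = "\<lambda>n. fst (Xn n \<omega>)" and ?x0.0 = "fst (X \<omega>)" and k = k and B = B and l = l and c = bound
      and b = "b * norm (fst (X \<omega>)) + b"])
        (fact mn(1) m(1) yc X\<xi>[OF \<omega>] \<zeta> cn c B l k0 d b(2)[OF X\<xi>(2)[OF \<omega>]] cv conv\<zeta>)+
  have ne: "{0..T} \<noteq> {}" using T by simp
  \<comment> \<open>The supremum need not be attained; a time attaining it up to 1 / (n + 1) reduces
    the L^p estimate to one time for each n.\<close>
  have "\<exists>t\<in>{0..T}. k n - 1 / real (Suc n) \<le> exp (- (l * t)) * F n t" for n
  proof -
    have "k n - 1 / real (Suc n) < (SUP t\<in>{0..T}. exp (- (l * t)) * F n t)" unfolding k_def[symmetric] by simp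
    then show ?thesis unfolding less_cSUP_iff[OF ne bdd] by (auto intro: less_imp_le)
  qed
  then obtain s where s: "\<And>n. s n \<in> {0..T}" "\<And>n. k n - 1 / real (Suc n) \<le> exp (- (l * s n)) * F n (s n)" by metis
  have fm: "(\<lambda>\<omega>. fst (Xn n \<omega>)) \<in> borel_measurable \<Omega>" "(\<lambda>\<omega>. fst (X \<omega>)) \<in> borel_measurable \<Omega>" for n
    using measurable_compose[OF Xn(1) measurable_fst, of n] measurable_compose[OF X(1) measurable_fst]
      measurable_cong_sets[OF refl m0_sets] by blast+
  have fi: "fst \<in> borel_measurable input_space"
    using measurable_fst measurable_cong_sets[OF refl m0_sets] by blast
  have fL: "Lp_fun p \<Omega> (\<lambda>\<omega>. fst (Xn n \<omega>))" "Lp_fun p \<Omega> (\<lambda>\<omega>. fst (X \<omega>))" for n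
    using strategies_fst(1)[OF Xn(2), of n] strategies_fst(1)[OF X(2)]
    unfolding Lp_fun_distr(1)[OF Xn(1) fi] Lp_fun_distr(1)[OF X(1) fi] .
  have fN: "Lp_norm p \<Omega> (\<lambda>\<omega>. fst (Xn n \<omega>)) = moment" "Lp_norm p \<Omega> (\<lambda>\<omega>. fst (X \<omega>)) = moment" for n
    using strategies_fst(2)[OF Xn(2), of n] strategies_fst(2)[OF X(2)]
    unfolding Lp_fun_distr(2)[OF Xn(1) fi] Lp_fun_distr(2)[OF X(1) fi] .
  define \<delta> where "\<delta> n = Lp_norm p \<Omega> (\<lambda>\<omega>. fst (Xn n \<omega>) - fst (X \<omega>))" for n
  have \<delta>: "\<delta> \<longlonglongrightarrow> 0"
    unfolding \<delta>_def
  proof (rule Lp_norm_tendsto_0_of_norms[OF p fL(1) fL(2)])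
    show "(LINT \<omega>|\<Omega>. norm (fst (Xn n \<omega>)) powr p) = (LINT \<omega>|\<Omega>. norm (fst (X \<omega>)) powr p)" for n
      unfolding integral_powr_eq_Lp_norm[OF p] fN ..
    show "AE \<omega> in \<Omega>. (\<lambda>n. fst (Xn n \<omega>)) \<longlonglongrightarrow> fst (X \<omega>)" using conv by eventually_elim blast
  qed
  \<comment> \<open>The bounds \<open>\<rho>\<close> on the control errors need not be measurable in \<open>\<omega>\<close>; \<open>H n\<close> is a measurable substitute
    at the time \<open>s n\<close>, which almost attains the supremum \<open>k n\<close>.\<close>
  define H where "H n \<omega> = max 0 (exp (- (l * s n)) * norm (x n (s n) \<omega> - x' (s n) \<omega>) - 2 * norm (fst (Xn n \<omega>) - fst (X \<omega>)) - 4 * B * k n / l)" for n \<omega>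
  have Hm: "H n \<in> borel_measurable \<Omega>" for n
    unfolding H_def using dm[OF s(1)] fm by measurable
  have H0: "0 \<le> H n \<omega>" for n \<omega> by (simp add: H_def)
  have Hle: "H n \<omega> \<le> 2 * \<rho>"
    if "norm (x n (s n) \<omega> - x' (s n) \<omega>) \<le> (2 * (norm (fst (Xn n \<omega>) - fst (X \<omega>)) + \<rho>) + 4 * B * k n / l) * exp (l * s n)" "0 \<le> \<rho>" for n \<omega> \<rho>
  proof -
    have "exp (- (l * s n)) * norm (x n (s n) \<omega> - x' (s n) \<omega>)
      \<le> exp (- (l * s n)) * (exp (l * s n) * (2 * (norm (fst (Xn n \<omega>) - fst (X \<omega>)) + \<rho>) + 4 * B * k n / l))"
      using that(1) by (intro mult_left_mono) (simp_all only: mult.commute exp_ge_zero)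
    also have "\<dots> = 2 * (norm (fst (Xn n \<omega>) - fst (X \<omega>)) + \<rho>) + 4 * B * k n / l" by (rule ee(1))
    finally show ?thesis using that(2) by (simp add: H_def)
  qed
  \<comment> \<open>\<open>Hle\<close> doubles the control error 4 * A * T times the growth factor
    in \<open>stab1\<close>.\<close>
  define a where "a = 8 * A * T"
  let ?D = "\<lambda>\<omega>. (a * b) * norm (fst (X \<omega>)) + a * (b + (1 + 2 * bound))"
  have DL: "Lp_fun p \<Omega> ?D"
  proof -
    have "(\<lambda>\<omega>. (a * b) * norm (fst \<omega>) + a * (b + (1 + 2 * bound))) \<in> borel_measurable input_space" using fi by measurable
    from Lp_fun_distr(1)[OF X(1) this, of p] show ?thesis using strategies_bound_Lp[OF X(2)] by blast
  qed
  have b0: "0 \<le> bound" unfolding bound_def using radius_pos by simp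
  have Hdom: "norm (H n \<omega>) \<le> norm (?D \<omega>)" if \<omega>: "\<omega> \<in> space \<Omega>" for n \<omega>
  proof -
    let ?C = "4 * (A * (b * norm (fst (X \<omega>)) + b + (1 + 2 * bound)) * T)"
    have C0: "0 \<le> ?C" using A T0 b(1) b0 by simp
    have "H n \<omega> \<le> 2 * ?C" by (rule Hle[OF stab1[OF \<omega> s(1)] C0])
    also have "\<dots> = ?D \<omega>" by (simp add: a_def algebra_simps)
    finally show ?thesis using H0[of n \<omega>] by simp
  qed
  have Hlim: "AE \<omega> in \<Omega>. (\<lambda>n. H n \<omega>) \<longlonglongrightarrow> 0"
    using conv AE_space
  proof eventually_elim
    case (elim \<omega>)
    then obtain \<rho> where \<rho>: "\<rho> \<longlonglongrightarrow> 0" "\<And>n t. t \<in> {0..T} \<Longrightarrow> norm (x n t \<omega> - x' t \<omega>)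
      \<le> (2 * (norm (fst (Xn n \<omega>) - fst (X \<omega>)) + \<rho> n) + 4 * B * k n / l) * exp (l * t)"
      using stab2[of \<omega>] by blast
    have "H n \<omega> \<le> 2 * \<bar>\<rho> n\<bar>" for n
    proof (rule Hle)
      have "(2 * (norm (fst (Xn n \<omega>) - fst (X \<omega>)) + \<rho> n) + 4 * B * k n / l) * exp (l * s n)
        \<le> (2 * (norm (fst (Xn n \<omega>) - fst (X \<omega>)) + \<bar>\<rho> n\<bar>) + 4 * B * k n / l) * exp (l * s n)"
        by (intro mult_right_mono add_right_mono) auto
      then show "norm (x n (s n) \<omega> - x' (s n) \<omega>)
        \<le> (2 * (norm (fst (Xn n \<omega>) - fst (X \<omega>)) + \<bar>\<rho> n\<bar>) + 4 * B * k n / l) * exp (l * s n)"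
        by (rule order_trans[OF \<rho>(2)[OF s(1)]])
    qed simp
    moreover have "(\<lambda>n. 2 * \<bar>\<rho> n\<bar>) \<longlonglongrightarrow> 0" using tendsto_mult_right_zero[OF tendsto_rabs_zero[OF \<rho>(1)]] .
    ultimately show ?case using H0 by (intro tendsto_sandwich[of "\<lambda>_. 0" "\<lambda>n. H n \<omega>" _ "\<lambda>n. 2 * \<bar>\<rho> n\<bar>"]) auto
  qed
  have HL: "(\<lambda>n. Lp_norm p \<Omega> (H n)) \<longlonglongrightarrow> 0"
    by (rule Lp_norm_dominated_tendsto_0[OF p DL Hm Hdom Hlim])
  have HLp: "Lp_fun p \<Omega> (H n)" for n by (rule Lp_fun_mono(1)[OF p DL Hm Hdom])
  \<comment> \<open>Two uses of the L^p inequality give four copies of \<open>?e\<close> from the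
    minor agents, and the major agent adds one. Absorbing the five copies into the left-hand side
    costs the outer factor 2.\<close>
  have kle: "k n \<le> 2 * (1 / real (Suc n) + 4 * Lp_norm p \<Omega> (H n) + 4 * \<delta> n + 2 * P n)" for n
  proof -
    let ?E = "exp (l * s n)" and ?e = "4 * B * k n / l"
    have e0: "0 \<le> ?e" using B0 k0 l by simp
    let ?h = "\<lambda>\<omega>. H n \<omega> + ?e"
    have hm: "?h \<in> borel_measurable \<Omega>" using Hm by simp
    note h = Lp_fun_add_le[OF p HLp \<Omega>.Lp_const(1)[OF p] hm norm_triangle_ineq]
    have hn: "Lp_norm p \<Omega> ?h \<le> 2 * (Lp_norm p \<Omega> (H n) + ?e)"
      using h(2) e0 unfolding \<Omega>.Lp_const(2)[OF p] by simp
    have xdL: "Lp_fun p \<Omega> (\<lambda>\<omega>. fst (Xn n \<omega>) - fst (X \<omega>))"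
      by (rule Lp_fun_add_le(1)[OF p fL(1) fL(2) _ norm_triangle_ineq4]) (use fm in simp)
    have "D n (s n) \<le> 2 * (Lp_norm p \<Omega> (\<lambda>\<omega>. ?E *\<^sub>R ?h \<omega>) + Lp_norm p \<Omega> (\<lambda>\<omega>. (2 * ?E) *\<^sub>R (fst (Xn n \<omega>) - fst (X \<omega>))))"
      unfolding D_def
    proof (rule Lp_fun_add_le(2)[OF p Lp_scaleR(1)[OF p h(1)] Lp_scaleR(1)[OF p xdL] dm[OF s(1)]])
      fix \<omega>
      let ?d = "norm (x n (s n) \<omega> - x' (s n) \<omega>)"
      have "exp (- (l * s n)) * ?d \<le> H n \<omega> + 2 * norm (fst (Xn n \<omega>) - fst (X \<omega>)) + ?e" by (simp add: H_def)
      then have "?E * (exp (- (l * s n)) * ?d) \<le> ?E * (H n \<omega> + 2 * norm (fst (Xn n \<omega>) - fst (X \<omega>)) + ?e)"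
        by (rule mult_left_mono) simp
      then have "?d \<le> ?E * ?h \<omega> + (2 * ?E) * norm (fst (Xn n \<omega>) - fst (X \<omega>))"
        unfolding ee(2) by (simp add: algebra_simps)
      also have "\<dots> = norm (?E *\<^sub>R ?h \<omega>) + norm ((2 * ?E) *\<^sub>R (fst (Xn n \<omega>) - fst (X \<omega>)))"
        using H0[of n \<omega>] e0 by (simp add: abs_mult)
      finally show "?d \<le> norm (?E *\<^sub>R ?h \<omega>) + norm ((2 * ?E) *\<^sub>R (fst (Xn n \<omega>) - fst (X \<omega>)))" .
    qed
    also have "\<dots> = 2 * (?E * Lp_norm p \<Omega> ?h + 2 * ?E * \<delta> n)"
      unfolding Lp_scaleR(2)[OF p h(1)] Lp_scaleR(2)[OF p xdL] \<delta>_def by simp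
    also have "\<dots> \<le> 2 * (?E * (2 * (Lp_norm p \<Omega> (H n) + ?e)) + 2 * ?E * \<delta> n)"
      using hn by simp
    finally have "F n (s n) \<le> 2 * (?E * (2 * (Lp_norm p \<Omega> (H n) + ?e)) + 2 * ?E * \<delta> n) + (2 * P n + ?e) * ?E"
      using P(2)[OF s(1)[of n], of n] unfolding F_def by linarith
    also have "\<dots> = ?E * (4 * Lp_norm p \<Omega> (H n) + 4 * \<delta> n + 2 * P n + 5 * ?e)" by (simp add: algebra_simps)
    finally have "exp (- (l * s n)) * F n (s n) \<le> exp (- (l * s n)) * (?E * (4 * Lp_norm p \<Omega> (H n) + 4 * \<delta> n + 2 * P n + 5 * ?e))"
      by (rule mult_left_mono) simp
    also have "\<dots> = 4 * Lp_norm p \<Omega> (H n) + 4 * \<delta> n + 2 * P n + 5 * ?e" by (rule ee(1))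
    finally have 1: "k n - 1 / real (Suc n) \<le> 4 * Lp_norm p \<Omega> (H n) + 4 * \<delta> n + 2 * P n + 5 * ?e"
      using s(2)[of n] by linarith
    have "40 * B * k n \<le> l * k n" by (rule mult_right_mono[OF l(3) k0])
    then have 2: "?e \<le> k n / 10" using l(1) by (simp add: field_simps)
    have "K \<le> 2 * (r + 4 * h + 4 * d + 2 * q)" if "K - r \<le> 4 * h + 4 * d + 2 * q + 5 * e" "e \<le> K / 10" for K r h d q e :: real
      using that unfolding distrib_left by linarith
    from this[OF 1 2] show ?thesis .
  qed
  have "(\<lambda>n. 2 * (1 / real (Suc n) + 4 * Lp_norm p \<Omega> (H n) + 4 * \<delta> n + 2 * P n)) \<longlonglongrightarrow> 2 * (0 + 4 * 0 + 4 * 0 + 2 * 0)"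
    by (intro tendsto_intros HL \<delta> P(1) LIMSEQ_inverse_real_of_nat[unfolded inverse_eq_divide])
  then have klim: "k \<longlonglongrightarrow> 0"
    using k0 kle by (intro tendsto_sandwich[of "\<lambda>_. 0" k]) auto
  have TT: "T \<in> {0..T}" using T0 by simp
  have Flim: "(\<lambda>n. F n T) \<longlonglongrightarrow> 0"
    using F0 Fk[OF TT] by (intro tendsto_sandwich[OF _ _ tendsto_const tendsto_mult_left_zero[OF klim, of "exp (l * T)"]]) auto
  have "W (m T) (mn n T) \<le> F n T" for n unfolding F_def using Wn'[OF TT, of n] norm_ge_zero by (rule add_increasing2[rotated])
  then show "(\<lambda>n. W (m T) (mn n T)) \<longlonglongrightarrow> 0"
    using W_nonneg by (intro tendsto_sandwich[OF _ _ tendsto_const Flim]) auto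
  have "norm (yn n T - y T) \<le> F n T" for n using D0[of n T] by (simp add: F_def)
  then have "(\<lambda>n. norm (yn n T - y T)) \<longlonglongrightarrow> 0"
    by (intro tendsto_sandwich[OF _ _ tendsto_const Flim]) auto
  then show "(\<lambda>n. yn n T) \<longlonglongrightarrow> y T"
    by (simp add: LIM_zero_iff tendsto_norm_zero_iff)
qed

end


section \<open>Stackelberg solutions\<close>

text \<open>Compactness is used for the set of values in the reals, so \<open>Q\<close> itself
  carries no topology.\<close>

lemma attains_Max:
  fixes V :: "'q \<Rightarrow> real"
  assumes ne: "Q \<noteq> {}"
    and cpt: "\<And>q. (\<And>n::nat. q n \<in> Q) \<Longrightarrow> \<exists>r. strict_mono (r :: nat \<Rightarrow> nat) \<and> (\<exists>q'\<in>Q. (\<lambda>n. V (q (r n))) \<longlonglongrightarrow> V q')"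
  shows "\<exists>q\<in>Q. \<forall>q'\<in>Q. V q' \<le> V q"
proof -
  have "seq_compact (V ` Q)"
    unfolding seq_compact_def
  proof (intro allI impI)
    fix f :: "nat \<Rightarrow> real" assume "\<forall>n. f n \<in> V ` Q"
    then have "\<forall>n. \<exists>q. q \<in> Q \<and> f n = V q" by blast
    then obtain q where q: "\<And>n. q n \<in> Q" "\<And>n. f n = V (q n)" by metis
    then show "\<exists>l\<in>V ` Q. \<exists>r. strict_mono r \<and> (f \<circ> r) \<longlonglongrightarrow> l"
      using cpt[of q, OF q(1)] by (auto simp: comp_def)
  qed
  then have "compact (V ` Q)" by (simp add: compact_eq_seq_compact_metric)
  then show ?thesis using compact_attains_sup[of "V ` Q"] ne by auto
qed

text \<open>The relation \<open>conv\<close> is an abstract convergence of the leader's actions. The point is that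
  the graph of the best response correspondence is sequentially compact.\<close>

lemma Stackelberg_solution_exists:
  fixes F L :: "'s \<Rightarrow> 'z \<Rightarrow> real" and conv :: "(nat \<Rightarrow> 'z) \<Rightarrow> 'z \<Rightarrow> bool"
  assumes ne: "S \<noteq> {}" "Z \<noteq> {}"
    and leader: "\<And>\<zeta>n. (\<And>n. \<zeta>n n \<in> Z) \<Longrightarrow> \<exists>r \<zeta>. strict_mono (r :: nat \<Rightarrow> nat) \<and> \<zeta> \<in> Z \<and> conv (\<lambda>n. \<zeta>n (r n)) \<zeta>"
    and follower: "\<And>\<alpha>n \<zeta>n \<zeta>. (\<And>n. \<alpha>n n \<in> S) \<Longrightarrow> (\<And>n. \<zeta>n n \<in> Z) \<Longrightarrow> \<zeta> \<in> Z \<Longrightarrow> conv \<zeta>n \<zeta> \<Longrightarrow>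
      \<exists>r \<alpha>. strict_mono (r :: nat \<Rightarrow> nat) \<and> \<alpha> \<in> S \<and> (\<lambda>n. F (\<alpha>n (r n)) (\<zeta>n (r n))) \<longlonglongrightarrow> F \<alpha> \<zeta> \<and>
        (\<lambda>n. L (\<alpha>n (r n)) (\<zeta>n (r n))) \<longlonglongrightarrow> L \<alpha> \<zeta>"
    and cont: "\<And>\<alpha> \<zeta>n \<zeta>. \<alpha> \<in> S \<Longrightarrow> (\<And>n. \<zeta>n n \<in> Z) \<Longrightarrow> \<zeta> \<in> Z \<Longrightarrow> conv \<zeta>n \<zeta> \<Longrightarrow> (\<lambda>n. F \<alpha> (\<zeta>n n)) \<longlonglongrightarrow> F \<alpha> \<zeta>"
    and const: "\<And>\<zeta>. conv (\<lambda>_. \<zeta>) \<zeta>"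
  defines "R \<equiv> \<lambda>\<zeta>. {\<alpha>. is_arg_max (\<lambda>\<alpha>. F \<alpha> \<zeta>) (\<lambda>\<alpha>. \<alpha> \<in> S) \<alpha>}"
  shows "\<exists>\<zeta>s\<in>Z. \<exists>\<alpha>s\<in>S. \<alpha>s \<in> R \<zeta>s \<and>
    (\<forall>\<zeta>\<in>Z. \<exists>\<alpha>max. is_arg_max (\<lambda>\<alpha>. L \<alpha> \<zeta>) (\<lambda>\<alpha>. \<alpha> \<in> R \<zeta>) \<alpha>max \<and> L \<alpha>s \<zeta>s \<ge> L \<alpha>max \<zeta>)"
proof -
  have R: "\<alpha> \<in> R \<zeta> \<longleftrightarrow> \<alpha> \<in> S \<and> (\<forall>\<alpha>'\<in>S. F \<alpha>' \<zeta> \<le> F \<alpha> \<zeta>)" for \<alpha> \<zeta>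
    unfolding R_def is_arg_max_linorder by auto
  \<comment> \<open>The constant sequence of leader's actions turns \<open>follower\<close> into
    compactness for a fixed action.\<close>
  have Rne: "R \<zeta> \<noteq> {}" if \<zeta>: "\<zeta> \<in> Z" for \<zeta>
  proof -
    have "\<exists>\<alpha>\<in>S. \<forall>\<alpha>'\<in>S. F \<alpha>' \<zeta> \<le> F \<alpha> \<zeta>"
    proof (rule attains_Max[OF ne(1)])
      fix \<alpha>n assume "\<And>n::nat. \<alpha>n n \<in> S"
      from follower[of \<alpha>n "\<lambda>_. \<zeta>" \<zeta>, OF this \<zeta> \<zeta> const]
      show "\<exists>r. strict_mono (r :: nat \<Rightarrow> nat) \<and> (\<exists>\<alpha>\<in>S. (\<lambda>n. F (\<alpha>n (r n)) \<zeta>) \<longlonglongrightarrow> F \<alpha> \<zeta>)" by blast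
    qed
    then show ?thesis using R by blast
  qed
  \<comment> \<open>Optimality against a fixed competitor passes to the limit: \<open>cont\<close>
    gives convergence on the side of the competitor, \<open>follower\<close> on the side of the
    optimal responses.\<close>
  have closed: "\<exists>r \<alpha>. strict_mono (r :: nat \<Rightarrow> nat) \<and> \<alpha> \<in> R \<zeta> \<and> (\<lambda>n. L (\<alpha>n (r n)) (\<zeta>n (r n))) \<longlonglongrightarrow> L \<alpha> \<zeta>"
    if \<alpha>n: "\<And>n. \<alpha>n n \<in> R (\<zeta>n n)" and \<zeta>: "\<And>n. \<zeta>n n \<in> Z" "\<zeta> \<in> Z" and conv: "conv \<zeta>n \<zeta>" for \<alpha>n \<zeta>n \<zeta>
  proof -
    have "\<alpha>n n \<in> S" for n using \<alpha>n R by blast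
    from follower[of \<alpha>n \<zeta>n, OF this \<zeta> conv] obtain r \<alpha> where r: "strict_mono r" "\<alpha> \<in> S"
      "(\<lambda>n. F (\<alpha>n (r n)) (\<zeta>n (r n))) \<longlonglongrightarrow> F \<alpha> \<zeta>" "(\<lambda>n. L (\<alpha>n (r n)) (\<zeta>n (r n))) \<longlonglongrightarrow> L \<alpha> \<zeta>" by blast
    have "F \<alpha>' \<zeta> \<le> F \<alpha> \<zeta>" if \<alpha>': "\<alpha>' \<in> S" for \<alpha>'
    proof (rule LIMSEQ_le[OF _ r(3)])
      show "(\<lambda>n. F \<alpha>' (\<zeta>n (r n))) \<longlonglongrightarrow> F \<alpha>' \<zeta>"
        using LIMSEQ_subseq_LIMSEQ[OF cont[OF \<alpha>' \<zeta> conv] r(1)] by (simp add: comp_def)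
      show "\<exists>N. \<forall>n\<ge>N. F \<alpha>' (\<zeta>n (r n)) \<le> F (\<alpha>n (r n)) (\<zeta>n (r n))"
        using \<alpha>n R \<alpha>' by blast
    qed
    then show ?thesis using r R by blast
  qed
  \<comment> \<open>The maximum is taken jointly over leader's actions and best responses: ties
    among the best responses are resolved in favour of the leader.\<close>
  have "\<exists>q\<in>{q. snd q \<in> Z \<and> fst q \<in> R (snd q)}. \<forall>q'\<in>{q. snd q \<in> Z \<and> fst q \<in> R (snd q)}. L (fst q') (snd q') \<le> L (fst q) (snd q)"
  proof (rule attains_Max)
    show "{q. snd q \<in> Z \<and> fst q \<in> R (snd q)} \<noteq> {}" using ne(2) Rne by fastforce
    fix q :: "nat \<Rightarrow> 's \<times> 'z" assume q: "\<And>n. q n \<in> {q. snd q \<in> Z \<and> fst q \<in> R (snd q)}"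
    have "snd (q n) \<in> Z" for n using q[of n] by simp
    from leader[of "\<lambda>n. snd (q n)", OF this] obtain r \<zeta> where r: "strict_mono r" "\<zeta> \<in> Z" "conv (\<lambda>n. snd (q (r n))) \<zeta>" by blast
    have "fst (q (r n)) \<in> R (snd (q (r n)))" "snd (q (r n)) \<in> Z" for n using q[of "r n"] by auto
    from closed[of "\<lambda>n. fst (q (r n))" "\<lambda>n. snd (q (r n))", OF this r(2,3)] obtain r' \<alpha> where r': "strict_mono r'" "\<alpha> \<in> R \<zeta>"
      "(\<lambda>n. L (fst (q (r (r' n)))) (snd (q (r (r' n))))) \<longlonglongrightarrow> L \<alpha> \<zeta>" by blast
    show "\<exists>r. strict_mono (r :: nat \<Rightarrow> nat) \<and> (\<exists>q'\<in>{q. snd q \<in> Z \<and> fst q \<in> R (snd q)}.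
        (\<lambda>n. L (fst (q (r n))) (snd (q (r n)))) \<longlonglongrightarrow> L (fst q') (snd q'))"
      using strict_mono_compose[OF r(1) r'(1)] r(2) r'(2,3)
      by (intro exI[of _ "\<lambda>n. r (r' n)"] conjI bexI[of _ "(\<alpha>, \<zeta>)"]) (auto simp: comp_def)
  qed
  then obtain \<alpha>s \<zeta>s where s: "\<zeta>s \<in> Z" "\<alpha>s \<in> R \<zeta>s" "\<And>\<alpha> \<zeta>. \<zeta> \<in> Z \<Longrightarrow> \<alpha> \<in> R \<zeta> \<Longrightarrow> L \<alpha> \<zeta> \<le> L \<alpha>s \<zeta>s" by fastforce
  \<comment> \<open>The inner maximum is attained as well, by the same closedness along a constant
    leader's action.\<close>
  have "\<exists>\<alpha>max. is_arg_max (\<lambda>\<alpha>. L \<alpha> \<zeta>) (\<lambda>\<alpha>. \<alpha> \<in> R \<zeta>) \<alpha>max \<and> L \<alpha>s \<zeta>s \<ge> L \<alpha>max \<zeta>" if \<zeta>: "\<zeta> \<in> Z" for \<zeta>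
  proof -
    have "\<exists>\<alpha>\<in>R \<zeta>. \<forall>\<alpha>'\<in>R \<zeta>. L \<alpha>' \<zeta> \<le> L \<alpha> \<zeta>"
    proof (rule attains_Max[OF Rne[OF \<zeta>]])
      fix \<alpha>n assume "\<And>n::nat. \<alpha>n n \<in> R \<zeta>"
      from closed[of \<alpha>n "\<lambda>_. \<zeta>", OF this \<zeta> \<zeta> const]
      show "\<exists>r. strict_mono (r :: nat \<Rightarrow> nat) \<and> (\<exists>\<alpha>\<in>R \<zeta>. (\<lambda>n. L (\<alpha>n (r n)) \<zeta>) \<longlonglongrightarrow> L \<alpha> \<zeta>)" by blast
    qed
    then obtain \<alpha> where "\<alpha> \<in> R \<zeta>" "\<And>\<alpha>'. \<alpha>' \<in> R \<zeta> \<Longrightarrow> L \<alpha>' \<zeta> \<le> L \<alpha> \<zeta>" by blast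
    then show ?thesis using s(3)[OF \<zeta>] unfolding is_arg_max_linorder by blast
  qed
  then show ?thesis using s(1,2) R by blast
qed

context mean_field_game
begin

abbreviation "outcome \<sigma> \<alpha> \<zeta> \<equiv> payoff T p fI fII g y0 \<sigma> \<alpha> \<zeta>"

abbreviation "continuous_payoff \<sigma> \<equiv>
  continuous_map (prod_topology (Wp_topology p (euclidean_metric :: 'x metric)) (euclidean :: 'y topology)) (euclidean :: real topology) \<sigma>"

lemma payoff_stable:
  fixes \<Omega> :: "'w measure" and Xn :: "nat \<Rightarrow> 'w \<Rightarrow> 'x \<times> (real \<times> 'u) measure"
  assumes \<sigma>: "continuous_payoff \<sigma>" and \<Omega>: "prob_space \<Omega>"
    and Xn: "\<And>n. Xn n \<in> measurable \<Omega> input_space" "\<And>n. distr \<Omega> input_space (Xn n) \<in> strategies"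
    and X: "X \<in> measurable \<Omega> input_space" "distr \<Omega> input_space X \<in> strategies"
    and conv: "AE \<omega> in \<Omega>. (\<lambda>n. fst (Xn n \<omega>)) \<longlonglongrightarrow> fst (X \<omega>) \<and> control_conv T (\<lambda>n. snd (Xn n \<omega>)) (snd (X \<omega>))"
    and \<zeta>: "\<And>n. \<zeta>n n \<in> relaxed_controls T" "\<zeta> \<in> relaxed_controls T" and conv\<zeta>: "control_conv T \<zeta>n \<zeta>"
  shows "(\<lambda>n. outcome \<sigma> (distr \<Omega> input_space (Xn n)) (\<zeta>n n)) \<longlonglongrightarrow> outcome \<sigma> (distr \<Omega> input_space X) \<zeta>"
proof -
  have "\<forall>n. \<exists>m y. is_motion T p fI fII g y0 (distr \<Omega> input_space (Xn n)) (\<zeta>n n) m y"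
    using motion_exists[OF Xn(2) \<zeta>(1)] by blast
  then obtain mn yn where mn: "\<And>n. is_motion T p fI fII g y0 (distr \<Omega> input_space (Xn n)) (\<zeta>n n) (mn n) (yn n)"
    by metis
  obtain m y where m: "is_motion T p fI fII g y0 (distr \<Omega> input_space X) \<zeta> m y"
    using motion_exists[OF X(2) \<zeta>(2)] by blast
  note st = motion_stable[OF \<Omega> Xn(1) Xn(2) X conv \<zeta>(1) \<zeta>(2) conv\<zeta> mn m]
  have "m T \<in> state_law_space" "mn n T \<in> state_law_space" for n
    using m mn[of n] T0 unfolding is_motion_def by (auto simp: PiE_iff)
  from tendsto_payoff[OF \<sigma> this st] show ?thesis
    unfolding payoff_motion[OF Xn(2) \<zeta>(1) mn] payoff_motion[OF X(2) \<zeta>(2) m] .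
qed

text \<open>The subsequence and the limit strategy come from the coding of strategies alone, so they
  serve both payoffs simultaneously.\<close>

lemma payoff_subsequence:
  assumes \<sigma>: "continuous_payoff \<sigma>F" "continuous_payoff \<sigma>L" and \<alpha>n: "\<And>n. \<alpha>n n \<in> strategies"
    and \<zeta>: "\<And>n. \<zeta>n n \<in> relaxed_controls T" "\<zeta> \<in> relaxed_controls T" and conv: "control_conv T \<zeta>n \<zeta>"
  shows "\<exists>r \<alpha>. strict_mono (r :: nat \<Rightarrow> nat) \<and> \<alpha> \<in> strategies \<and>
    (\<lambda>n. outcome \<sigma>F (\<alpha>n (r n)) (\<zeta>n (r n))) \<longlonglongrightarrow> outcome \<sigma>F \<alpha> \<zeta> \<and>
    (\<lambda>n. outcome \<sigma>L (\<alpha>n (r n)) (\<zeta>n (r n))) \<longlonglongrightarrow> outcome \<sigma>L \<alpha> \<zeta>"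
proof -
  obtain r and \<Omega> :: "real measure" and Xn X \<alpha> where r: "strict_mono (r :: nat \<Rightarrow> nat)" and \<Omega>: "prob_space \<Omega>"
    and Xn: "\<And>n. Xn n \<in> measurable \<Omega> input_space" "\<And>n. distr \<Omega> input_space (Xn n) = \<alpha>n (r n)"
    and X: "X \<in> measurable \<Omega> input_space" "distr \<Omega> input_space X = \<alpha>" and \<alpha>: "\<alpha> \<in> strategies"
    and ae: "AE \<omega> in \<Omega>. (\<lambda>n. fst (Xn n \<omega>)) \<longlonglongrightarrow> fst (X \<omega>) \<and> control_conv T (\<lambda>n. snd (Xn n \<omega>)) (snd (X \<omega>))"
    using minor_strategies_Skorohod[where \<alpha>n = \<alpha>n, OF T m0_prob m0_sets \<alpha>n] by blast
  have cv: "control_conv T (\<lambda>n. \<zeta>n (r n)) \<zeta>"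
    using conv LIMSEQ_subseq_LIMSEQ[OF _ r] unfolding control_conv_def by (fastforce simp: comp_def)
  have "distr \<Omega> input_space (Xn n) \<in> strategies" "distr \<Omega> input_space X \<in> strategies" for n
    using \<alpha>n \<alpha> unfolding Xn(2) X(2) by auto
  note lim = payoff_stable[OF _ \<Omega> Xn(1) this(1) X(1) this(2) ae \<zeta>(1) \<zeta>(2) cv, unfolded Xn(2) X(2)]
  show ?thesis using r \<alpha> lim[OF \<sigma>(1)] lim[OF \<sigma>(2)] by blast
qed

text \<open>The strategy itself is taken as the probability space, with the identity as every random
  input; the convergence of inputs is then trivial and only the leader's control varies.\<close>

lemma payoff_leader_continuous:
  assumes \<sigma>: "continuous_payoff \<sigma>" and \<alpha>: "\<alpha> \<in> strategies"
    and \<zeta>: "\<And>n. \<zeta>n n \<in> relaxed_controls T" "\<zeta> \<in> relaxed_controls T" and conv: "control_conv T \<zeta>n \<zeta>"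
  shows "(\<lambda>n. outcome \<sigma> \<alpha> (\<zeta>n n)) \<longlonglongrightarrow> outcome \<sigma> \<alpha> \<zeta>"
proof -
  have s: "sets input_space = sets \<alpha>" by (rule minor_strategies_sets[OF \<alpha>, symmetric])
  have id: "(\<lambda>\<omega>. \<omega>) \<in> measurable \<alpha> input_space" by (rule measurable_ident_sets[OF s[symmetric]])
  have d: "distr \<alpha> input_space (\<lambda>\<omega>. \<omega>) = \<alpha>" by (rule distr_id2[OF s])
  note st = payoff_stable[where Xn = "\<lambda>_ \<omega>. \<omega>" and X = "\<lambda>\<omega>. \<omega>", OF \<sigma> strategies_prob[OF \<alpha>] id _ id _ _ \<zeta>(1) \<zeta>(2) conv, unfolded d]
  show ?thesis by (rule st) (simp_all add: \<alpha> control_conv_const)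
qed

theorem Stackelberg:
  assumes \<sigma>F: "continuous_payoff \<sigma>F" and \<sigma>L: "continuous_payoff \<sigma>L"
  shows "\<exists>\<zeta>s\<in>relaxed_controls T. \<exists>\<alpha>s\<in>strategies. \<alpha>s \<in> best_responses T p fI fII g m0 y0 \<sigma>F \<zeta>s \<and>
    (\<forall>\<zeta>\<in>relaxed_controls T. \<exists>\<alpha>max.
       is_arg_max (\<lambda>\<alpha>. outcome \<sigma>L \<alpha> \<zeta>) (\<lambda>\<alpha>. \<alpha> \<in> best_responses T p fI fII g m0 y0 \<sigma>F \<zeta>) \<alpha>max \<and>
       outcome \<sigma>L \<alpha>s \<zeta>s \<ge> outcome \<sigma>L \<alpha>max \<zeta>)"
  unfolding best_responses_def
  by (rule Stackelberg_solution_exists[where conv = "control_conv T",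
        OF minor_strategies_nonempty relaxed_controls_nonempty relaxed_controls_seq_compact[OF T]
          payoff_subsequence[OF \<sigma>F \<sigma>L] payoff_leader_continuous[OF \<sigma>F] control_conv_const])

end

text \<open>The maximum over best responses is expressed by a maximiser, so that its attainment for
  every leader's control is part of the claim.\<close>

theorem mainTheorem3:
  fixes T p A :: real
    and fI :: "real \<Rightarrow> real^'d \<Rightarrow> (real^'d) measure \<Rightarrow> real^'e \<Rightarrow> 'u::compact_metric_space \<Rightarrow> real^'d"
    and fII :: "real \<Rightarrow> real^'d \<Rightarrow> (real^'d) measure \<Rightarrow> real^'e \<Rightarrow> 'v::compact_metric_space \<Rightarrow> real^'d"
    and g :: "real \<Rightarrow> real^'e \<Rightarrow> (real^'d) measure \<Rightarrow> 'v \<Rightarrow> real^'e"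
    and m0 :: "(real^'d) measure"
    and y0 :: "real^'e"
    and \<sigma>F \<sigma>L :: "(real^'d) measure \<times> (real^'e) \<Rightarrow> real"
  assumes "T > 0" and "p \<ge> 1" and "A > 0"
    and "(fI, fII) \<in> SLLL_sub0 T p A"
    and "g \<in> SLLL_sup0 T p A"
    and "m0 \<in> Pp p euclidean_metric"
    and "continuous_map (prod_topology (Wp_topology p euclidean_metric) euclidean) euclidean \<sigma>F"
    and "continuous_map (prod_topology (Wp_topology p euclidean_metric) euclidean) euclidean \<sigma>L"
  shows "\<exists>\<zeta>s\<in>relaxed_controls T. \<exists>\<alpha>s\<in>minor_strategies T m0.
           \<alpha>s \<in> best_responses T p fI fII g m0 y0 \<sigma>F \<zeta>s \<and>
           (\<forall>\<zeta>\<in>relaxed_controls T.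
              \<exists>\<alpha>max. is_arg_max (\<lambda>\<alpha>. payoff T p fI fII g y0 \<sigma>L \<alpha> \<zeta>)
                       (\<lambda>\<alpha>. \<alpha> \<in> best_responses T p fI fII g m0 y0 \<sigma>F \<zeta>) \<alpha>max \<and>
                payoff T p fI fII g y0 \<sigma>L \<alpha>s \<zeta>s \<ge> payoff T p fI fII g y0 \<sigma>L \<alpha>max \<zeta>)"
proof -
  interpret mean_field_game T p A fI fII g m0 y0
    using assms(1-6) by unfold_locales
  show ?thesis by (rule Stackelberg[OF assms(7,8)])
qed

end
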